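(* In the vector Gaussian setting described in the context, the rate-distortion function satisfies $R^{MSE}(\mathbf{D})\le R^G_{ach}(\mathbf{D})=\min_{v\in\mathcal{V}}\inf_{p\in C^G_{ach,v}(\mathbf{D})}\inf_{C^{LP}_{ach}(p)}\sum_{j=1}^{2^m-1}R_{\mathcal{S}_j}$, where $C^G_{ach,v}(\mathbf{D})$ is the set of joint distributions $p$ of $(\mathbf{U}_{\mathcal{S}_1},\dots,\mathbf{U}_{\mathcal{S}_{2^m-1}},\mathbf{X},\mathbf{Y_1},\dots,\mathbf{Y_m})$ such that: (1) the marginal of $(\mathbf{X},\mathbf{Y_1},\dots,\mathbf{Y_m})$ is the given Gaussian distribution; (2) there is a random variable $T$ taking values in $[\tau]$ for some positive integer $\tau$, with $T$ independent of $(\mathbf{X},\mathbf{Y_1},\dots,\mathbf{Y_m})$; (3) $\mathcal{U}\leftrightarrow\mathbf{X}\leftrightarrow(\mathbf{Y_1},\dots,\mathbf{Y_m})$; (4) for each $i\in[m]$ the vector of diagonal entries of the conditional (MMSE error) covariance matrix $K_{\mathbf{X}|\mathbf{U}_{\mathcal{D}_i},\mathbf{Y_i}}$ is componentwise at most $\mathbf{D_i}$; (5) each $\mathbf{U}_{\mathcal{S}_j}=(\mathbf{U}_{\mathcal{S}_j,T},T)$, where for each $t$ the vectors $\mathbf{U}_{\mathcal{S}_j,t}$ are jointly Gaussian with $(\mathbf{X},\mathbf{Y_1},\dots,\mathbf{Y_m})$, and $I(\mathbf{U}_{\mathcal{S}_j};\mathbf{U}_{\mathcal{S}_i},\mathbf{X})<\infty$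 for all $i\ne j$. Here $C^{LP}_{ach}(p)$ is the set of nonnegative $R_{\mathcal{S}_j},R'_{\mathcal{S}_j}$ with $R_{\mathcal{S}_j}\ge I(\mathbf{X},\mathbf{U}^-_{\mathcal{S}_j};\mathbf{U}_{\mathcal{S}_j})-R'_{\mathcal{S}_j}$ for all $j$ and, for every $l\in[m]$ and every nonempty $\mathcal{D}'_l\subseteq\mathcal{D}_l$, $$\sum_{\mathcal{S}_j\in\mathcal{D}'_l}R'_{\mathcal{S}_j}\le\sum_{\mathcal{S}_j\in\mathcal{D}'_l}I\big(\mathbf{U}_{\mathcal{S}_j};\mathbf{U}^-_{\mathcal{S}_j,\mathcal{D}'_l},\mathbf{U}_{\mathcal{D}_l\setminus\mathcal{D}'_l},\mathbf{Y_l}\big).$$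
   Context: Setting: $(\mathbf{X},\mathbf{Y_1},\dots,\mathbf{Y_m})$ are zero-mean jointly Gaussian vectors ($\mathbf{X}\in\mathbb{R}^k$, $\mathbf{Y_i}\in\mathbb{R}^{k_i}$) with a given joint distribution; the blocks are i.i.d. over time. An $(n,M,\mathbf{D})$ code (with $\mathbf{D}=(\mathbf{D_1},\dots,\mathbf{D_m})$, each $\mathbf{D_i}\in(0,\infty)^k$) is an encoder $f:(\mathbb{R}^k)^n\to\{1,\dots,M\}$ and decoders $g_i$ mapping $(f(\mathbf{X}^n),\mathbf{Y_i}^n)$ to reconstructions $\widehat{\mathbf{X}}_{i1},\dots,\widehat{\mathbf{X}}_{in}\in\mathbb{R}^k$ such that the diagonal of $\frac1n\sum_{k=1}^nE[(\mathbf{X}_k-\widehat{\mathbf{X}}_{ik})(\mathbf{X}_k-\widehat{\mathbf{X}}_{ik})^T]$ is componentwise $\le\mathbf{D_i}$ for each $i$. A rate $R$ is $\mathbf{D}$-achievable if for every $\epsilon>0$ and all large $n$ there is an $(n,M,\mathbf{D}+\epsilon\mathbf{1})$ code with $\frac1n\log M\le R+\epsilon$; $R^{MSE}(\mathbf{D})$ is the infimum of achievable rates. Notation: $\mathcal{V}$ is the set of orderings $v=(\mathcal{S}_1,\dots,\mathcal{S}_{2^m-1})$ of the nonempty subsets of $[m]$; $\mathcal{U}=\{\mathbf{U}_{\mathcal{S}_1},\dots,\mathbf{U}_{\mathcal{S}_{2^m-1}}\}$; $\mathcal{D}_l=\{\mathcal{S}_i:l\in\mathcal{S}_i\}$; $\mathbf{U}_{\mathcal{D}'}=\{\mathbf{U}_{\mathcal{S}_i}:\mathcal{S}_i\in\mathcal{D}'\}$;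 $\mathbf{U}^-_{\mathcal{S}_j}=\{\mathbf{U}_{\mathcal{S}_i}:i<j\}$; $\mathbf{U}^-_{\mathcal{S}_j,\mathcal{D}'_l}=\{\mathbf{U}_{\mathcal{S}_i}: i<j,\ \mathcal{S}_i\in\mathcal{D}'_l\}$. *)

theory Defs
  imports "HOL-Probability.Probability"
begin

text \<open>A vector in R^d is represented as an extensional function on the
index set {..<d}; its measurable space is the finite product of Borel sets.\<close>

definition vecM :: "nat \<Rightarrow> (nat \<Rightarrow> real) measure" where
  "vecM d = PiM {..<d} (\<lambda>_. borel)"

text \<open>(Y_1,...,Y_m), indexed 0..m-1, Y_i in R^(kY i).\<close>
definition YM :: "nat \<Rightarrow> (nat \<Rightarrow> nat) \<Rightarrow> (nat \<Rightarrow> nat \<Rightarrow> real) measure" where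
  "YM m kY = PiM {..<m} (\<lambda>i. vecM (kY i))"

definition XYM :: "nat \<Rightarrow> nat \<Rightarrow> (nat \<Rightarrow> nat) \<Rightarrow> ((nat \<Rightarrow> real) \<times> (nat \<Rightarrow> nat \<Rightarrow> real)) measure" where
  "XYM m k kY = vecM k \<Otimes>\<^sub>M YM m kY"

definition gauss_rv :: "'a measure \<Rightarrow> ('a \<Rightarrow> real) \<Rightarrow> bool" where
  "gauss_rv M W \<longleftrightarrow> W \<in> borel_measurable M \<and>
     (\<exists>\<mu>. (AE \<omega> in M. W \<omega> = \<mu>) \<or>
          (\<exists>\<sigma>>0. distributed M lborel W (normal_density \<mu> \<sigma>)))"

definition jgauss :: "'a measure \<Rightarrow> 'i set \<Rightarrow> ('i \<Rightarrow> 'a \<Rightarrow> real) \<Rightarrow> bool" where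
  "jgauss M I Z \<longleftrightarrow> finite I \<and> (\<forall>i\<in>I. Z i \<in> borel_measurable M) \<and>
     (\<forall>c :: 'i \<Rightarrow> real. gauss_rv M (\<lambda>\<omega>. \<Sum>i\<in>I. c i * Z i \<omega>))"

text \<open>Scalar coordinates: of U_{S,t}, of X, of Y_i.\<close>
datatype coord = UC "nat set" nat | XC nat | YC nat nat

definition source_coords :: "nat \<Rightarrow> nat \<Rightarrow> (nat \<Rightarrow> nat) \<Rightarrow> coord set" where
  "source_coords m k kY = XC ` {..<k} \<union> (\<Union>i<m. YC i ` {..<kY i})"

fun source_val :: "coord \<Rightarrow> (nat \<Rightarrow> real) \<times> (nat \<Rightarrow> nat \<Rightarrow> real) \<Rightarrow> real" where
  "source_val (XC c) z = fst z c"
| "source_val (YC i c) z = snd z i c"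
| "source_val (UC S c) z = 0"

definition gaussian_source :: "nat \<Rightarrow> nat \<Rightarrow> (nat \<Rightarrow> nat) \<Rightarrow>
    ((nat \<Rightarrow> real) \<times> (nat \<Rightarrow> nat \<Rightarrow> real)) measure \<Rightarrow> bool" where
  "gaussian_source m k kY P \<longleftrightarrow> prob_space P \<and> sets P = sets (XYM m k kY) \<and>
     jgauss P (source_coords m k kY) source_val \<and>
     (\<forall>j\<in>source_coords m k kY. integral\<^sup>L P (source_val j) = 0)"

text \<open>An (n,M,D) code. The n-block source is the product of n copies of P
(i.i.d. blocks). f encodes the X-block into {1..M}; g i decodes from the index
and the Y_i-block, producing g i w ys t c = c-th component of hat X_{i,t}.
Distortion: (1/n) sum_t E[(X_t c - hat X_{i t} c)^2] <= D i c.\<close>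
definition is_code :: "nat \<Rightarrow> nat \<Rightarrow> (nat \<Rightarrow> nat) \<Rightarrow>
    ((nat \<Rightarrow> real) \<times> (nat \<Rightarrow> nat \<Rightarrow> real)) measure \<Rightarrow> nat \<Rightarrow> nat \<Rightarrow>
    (nat \<Rightarrow> nat \<Rightarrow> real) \<Rightarrow> ((nat \<Rightarrow> nat \<Rightarrow> real) \<Rightarrow> nat) \<Rightarrow>
    (nat \<Rightarrow> nat \<Rightarrow> (nat \<Rightarrow> nat \<Rightarrow> real) \<Rightarrow> nat \<Rightarrow> nat \<Rightarrow> real) \<Rightarrow> bool" where
  "is_code m k kY P n M D f g \<longleftrightarrow>
     f \<in> measurable (PiM {..<n} (\<lambda>_. vecM k)) (count_space UNIV) \<and>
     (\<forall>xs\<in>space (PiM {..<n} (\<lambda>_. vecM k)). f xs \<in> {1..M}) \<and>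
     (\<forall>i<m. \<forall>t<n. \<forall>c<k. (\<lambda>p. g i (fst p) (snd p) t c) \<in>
        borel_measurable (count_space UNIV \<Otimes>\<^sub>M PiM {..<n} (\<lambda>_. vecM (kY i)))) \<and>
     (\<forall>i<m. \<forall>c<k.
        ennreal (1 / real n) *
          (\<Sum>t<n. \<integral>\<^sup>+\<omega>. ennreal ((fst (\<omega> t) c -
              g i (f (\<lambda>s\<in>{..<n}. fst (\<omega> s))) (\<lambda>s\<in>{..<n}. snd (\<omega> s) i) t c)\<^sup>2)
            \<partial>(PiM {..<n} (\<lambda>_. P)))
        \<le> ennreal (D i c))"

definition mse_achievable :: "nat \<Rightarrow> nat \<Rightarrow> (nat \<Rightarrow> nat) \<Rightarrow>
    ((nat \<Rightarrow> real) \<times> (nat \<Rightarrow> nat \<Rightarrow> real)) measure \<Rightarrow> (nat \<Rightarrow> nat \<Rightarrow> real) \<Rightarrow> real \<Rightarrow> bool" where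
  "mse_achievable m k kY P D R \<longleftrightarrow>
     (\<forall>\<epsilon>>0. \<exists>N. \<forall>n\<ge>N. \<exists>M f g. n > 0 \<and>
        is_code m k kY P n M (\<lambda>i c. D i c + \<epsilon>) f g \<and> ln (real M) / real n \<le> R + \<epsilon>)"

definition R_MSE :: "nat \<Rightarrow> nat \<Rightarrow> (nat \<Rightarrow> nat) \<Rightarrow>
    ((nat \<Rightarrow> real) \<times> (nat \<Rightarrow> nat \<Rightarrow> real)) measure \<Rightarrow> (nat \<Rightarrow> nat \<Rightarrow> real) \<Rightarrow> ereal" where
  "R_MSE m k kY P D = Inf {ereal R | R. mse_achievable m k kY P D R}"

text \<open>Mutual information (in nats) as the KL divergence of the joint law from
the product of the marginals, with value infinity if the joint law is not
absolutely continuous. Uses D(J||Q) = int (f ln f - f + 1) dQ, f = dJ/dQ.\<close>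
definition mutual_info :: "'a measure \<Rightarrow> 'b measure \<Rightarrow> 'c measure \<Rightarrow>
    ('a \<Rightarrow> 'b) \<Rightarrow> ('a \<Rightarrow> 'c) \<Rightarrow> ereal" where
  "mutual_info M SA SB A B =
     (let J = distr M (SA \<Otimes>\<^sub>M SB) (\<lambda>\<omega>. (A \<omega>, B \<omega>));
          Q = distr M SA A \<Otimes>\<^sub>M distr M SB B
      in if absolutely_continuous Q J
         then enn2ereal (\<integral>\<^sup>+z. ennreal (let f = enn2real (RN_deriv Q J z) in f * ln f - f + 1) \<partial>Q)
         else \<infinity>)"

definition markov_chain :: "'a measure \<Rightarrow> 'u measure \<Rightarrow> ('a \<Rightarrow> 'u) \<Rightarrow>
    'x measure \<Rightarrow> ('a \<Rightarrow> 'x) \<Rightarrow> 'y measure \<Rightarrow> ('a \<Rightarrow> 'y) \<Rightarrow> bool" where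
  "markov_chain M SU U SX X SY Y \<longleftrightarrow>
     (\<forall>A\<in>sets SU. \<forall>B\<in>sets SY. AE \<omega> in M.
        real_cond_exp M (vimage_algebra (space M) X SX)
          (indicator {\<omega>\<in>space M. U \<omega> \<in> A \<and> Y \<omega> \<in> B}) \<omega> =
        real_cond_exp M (vimage_algebra (space M) X SX) (indicator {\<omega>\<in>space M. U \<omega> \<in> A}) \<omega> *
        real_cond_exp M (vimage_algebra (space M) X SX) (indicator {\<omega>\<in>space M. Y \<omega> \<in> B}) \<omega>)"

text \<open>Canonical sample space carrying the family U_{S,t}, the time-sharing
variable T, X and (Y_1,...,Y_m).\<close>
type_synonym omega = "(nat set \<Rightarrow> nat \<Rightarrow> nat \<Rightarrow> real) \<times> nat \<times> (nat \<Rightarrow> real) \<times> (nat \<Rightarrow> nat \<Rightarrow> real)"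

definition subsets :: "nat \<Rightarrow> nat set set" where
  "subsets m = {S. S \<subseteq> {..<m} \<and> S \<noteq> {}}"

definition orderings :: "nat \<Rightarrow> nat set list set" where
  "orderings m = {vs. distinct vs \<and> set vs = subsets m}"

definition Dl :: "nat \<Rightarrow> nat \<Rightarrow> nat set set" where
  "Dl m l = {S\<in>subsets m. l \<in> S}"

definition before :: "nat set list \<Rightarrow> nat set \<Rightarrow> nat set set" where
  "before vs S = {S'. \<exists>i j. i < j \<and> j < length vs \<and> vs ! i = S' \<and> vs ! j = S}"

text \<open>Value space of U_S = (U_{S,T}, T) when U_{S,t} is in R^d.\<close>
definition UM :: "nat \<Rightarrow> ((nat \<Rightarrow> real) \<times> nat) measure" where
  "UM d = vecM d \<Otimes>\<^sub>M count_space UNIV"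

definition Uval :: "(nat set \<Rightarrow> nat \<Rightarrow> 'a \<Rightarrow> nat \<Rightarrow> real) \<Rightarrow> ('a \<Rightarrow> nat) \<Rightarrow> nat set \<Rightarrow>
    'a \<Rightarrow> (nat \<Rightarrow> real) \<times> nat" where
  "Uval Uf T S \<omega> = (Uf S (T \<omega>) \<omega>, T \<omega>)"

definition Ucoll :: "(nat set \<Rightarrow> nat \<Rightarrow> 'a \<Rightarrow> nat \<Rightarrow> real) \<Rightarrow> ('a \<Rightarrow> nat) \<Rightarrow> nat set set \<Rightarrow>
    'a \<Rightarrow> nat set \<Rightarrow> (nat \<Rightarrow> real) \<times> nat" where
  "Ucoll Uf T A \<omega> = (\<lambda>S\<in>A. Uval Uf T S \<omega>)"

definition UcollM :: "(nat set \<Rightarrow> nat) \<Rightarrow> nat set set \<Rightarrow> (nat set \<Rightarrow> (nat \<Rightarrow> real) \<times> nat) measure" where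
  "UcollM dU A = PiM A (\<lambda>S. UM (dU S))"

text \<open>Membership of the joint distribution of (U, X, Y) in C^G_{ach}(D),
given by a realization on the canonical sample space. dU S is the dimension
of U_{S,t}.\<close>
definition CG :: "nat \<Rightarrow> nat \<Rightarrow> (nat \<Rightarrow> nat) \<Rightarrow>
    ((nat \<Rightarrow> real) \<times> (nat \<Rightarrow> nat \<Rightarrow> real)) measure \<Rightarrow> (nat \<Rightarrow> nat \<Rightarrow> real) \<Rightarrow>
    omega measure \<Rightarrow> (omega \<Rightarrow> nat \<Rightarrow> real) \<Rightarrow> (omega \<Rightarrow> nat \<Rightarrow> nat \<Rightarrow> real) \<Rightarrow>
    (omega \<Rightarrow> nat) \<Rightarrow> nat \<Rightarrow> (nat set \<Rightarrow> nat) \<Rightarrow> (nat set \<Rightarrow> nat \<Rightarrow> omega \<Rightarrow> nat \<Rightarrow> real) \<Rightarrow> bool" where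
  "CG m k kY P D M X Y T \<tau> dU Uf \<longleftrightarrow>
     prob_space M \<and>
     X \<in> measurable M (vecM k) \<and> Y \<in> measurable M (YM m kY) \<and>
     \<comment> \<open>(1) marginal of (X,Y) is the given Gaussian law\<close>
     distr M (XYM m k kY) (\<lambda>\<omega>. (X \<omega>, Y \<omega>)) = P \<and>
     \<comment> \<open>(2) time sharing variable T in [tau], independent of (X,Y)\<close>
     \<tau> > 0 \<and> T \<in> measurable M (count_space UNIV) \<and> (\<forall>\<omega>\<in>space M. T \<omega> \<in> {1..\<tau>}) \<and>
     (\<forall>A B. B \<in> sets (XYM m k kY) \<longrightarrow>
        measure M {\<omega>\<in>space M. T \<omega> \<in> A \<and> (X \<omega>, Y \<omega>) \<in> B} =
        measure M {\<omega>\<in>space M. T \<omega> \<in> A} * measure M {\<omega>\<in>space M. (X \<omega>, Y \<omega>) \<in> B}) \<and>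
     (\<forall>S\<in>subsets m. \<forall>t\<in>{1..\<tau>}. Uf S t \<in> measurable M (vecM (dU S))) \<and>
     \<comment> \<open>(3) Markov chain U -- X -- (Y_1,...,Y_m)\<close>
     markov_chain M (UcollM dU (subsets m)) (Ucoll Uf T (subsets m)) (vecM k) X (YM m kY) Y \<and>
     \<comment> \<open>(4) diagonal of the MMSE error covariance of X given (U_{D_i}, Y_i)\<close>
     (\<forall>i<m. \<forall>c<k.
        (\<integral>\<^sup>+\<omega>. ennreal ((X \<omega> c -
            real_cond_exp M
              (vimage_algebra (space M) (\<lambda>\<omega>. (Ucoll Uf T (Dl m i) \<omega>, Y \<omega> i))
                 (UcollM dU (Dl m i) \<Otimes>\<^sub>M vecM (kY i)))
              (\<lambda>\<omega>. X \<omega> c) \<omega>)\<^sup>2) \<partial>M)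
        \<le> ennreal (D i c)) \<and>
     \<comment> \<open>(5) for each t, the U_{S,t} are jointly Gaussian with (X,Y)\<close>
     (\<forall>t\<in>{1..\<tau>}. jgauss M ((\<Union>S\<in>subsets m. UC S ` {..<dU S}) \<union> source_coords m k kY)
        (\<lambda>j \<omega>. case j of UC S c \<Rightarrow> Uf S t \<omega> c | XC c \<Rightarrow> X \<omega> c | YC i c \<Rightarrow> Y \<omega> i c)) \<and>
     (\<forall>S\<in>subsets m. \<forall>S'\<in>subsets m. S \<noteq> S' \<longrightarrow>
        mutual_info M (UM (dU S)) (UM (dU S') \<Otimes>\<^sub>M vecM k)
          (Uval Uf T S) (\<lambda>\<omega>. (Uval Uf T S' \<omega>, X \<omega>)) < \<infinity>)"

definition LP :: "nat \<Rightarrow> nat \<Rightarrow> (nat \<Rightarrow> nat) \<Rightarrow> nat set list \<Rightarrow>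
    omega measure \<Rightarrow> (omega \<Rightarrow> nat \<Rightarrow> real) \<Rightarrow> (omega \<Rightarrow> nat \<Rightarrow> nat \<Rightarrow> real) \<Rightarrow>
    (omega \<Rightarrow> nat) \<Rightarrow> (nat set \<Rightarrow> nat) \<Rightarrow> (nat set \<Rightarrow> nat \<Rightarrow> omega \<Rightarrow> nat \<Rightarrow> real) \<Rightarrow>
    (nat set \<Rightarrow> real) \<Rightarrow> (nat set \<Rightarrow> real) \<Rightarrow> bool" where
  "LP m k kY vs M X Y T dU Uf R R' \<longleftrightarrow>
     (\<forall>S\<in>subsets m. R S \<ge> 0 \<and> R' S \<ge> 0) \<and>
     (\<forall>S\<in>subsets m. ereal (R S) \<ge>
        mutual_info M (vecM k \<Otimes>\<^sub>M UcollM dU (before vs S)) (UM (dU S))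
          (\<lambda>\<omega>. (X \<omega>, Ucoll Uf T (before vs S) \<omega>)) (Uval Uf T S) - ereal (R' S)) \<and>
     (\<forall>l<m. \<forall>D'. D' \<subseteq> Dl m l \<and> D' \<noteq> {} \<longrightarrow>
        ereal (\<Sum>S\<in>D'. R' S) \<le>
        (\<Sum>S\<in>D'. mutual_info M (UM (dU S))
            (UcollM dU (before vs S \<inter> D') \<Otimes>\<^sub>M UcollM dU (Dl m l - D') \<Otimes>\<^sub>M vecM (kY l))
            (Uval Uf T S)
            (\<lambda>\<omega>. (Ucoll Uf T (before vs S \<inter> D') \<omega>, Ucoll Uf T (Dl m l - D') \<omega>, Y \<omega> l))))"

definition R_G_ach :: "nat \<Rightarrow> nat \<Rightarrow> (nat \<Rightarrow> nat) \<Rightarrow>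
    ((nat \<Rightarrow> real) \<times> (nat \<Rightarrow> nat \<Rightarrow> real)) measure \<Rightarrow> (nat \<Rightarrow> nat \<Rightarrow> real) \<Rightarrow> ereal" where
  "R_G_ach m k kY P D =
     (INF vs\<in>orderings m.
        \<Sqinter> {\<Sqinter> {ereal (\<Sum>S\<in>subsets m. R S) | R R'. LP m k kY vs M X Y T dU Uf R R'}
           | M X Y T \<tau> dU Uf. CG m k kY P D M X Y T \<tau> dU Uf})"

end

theory Submission
  imports Defs "HOL-Real_Asymp.Real_Asymp"
begin

text \<open>
  For each subset \<open>S\<close> a codebook of \<open>exp (n (R S + R' S))\<close> words is drawn i.i.d. from the law of
  \<open>U\<^sub>S\<close> and split into \<open>exp (n R S)\<close> bins; the encoder picks one word per codebook and sends the
  bin indices, and decoder \<open>l\<close> looks for the unique jointly typical tuple of words in the bins of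
  the sets containing \<open>l\<close>.

  Encoding. Let \<open>\<rho> S\<close> be the density of \<open>((X, U before S), U\<^sub>S)\<close> with respect to the product of its marginals;
  the product \<open>w\<close> of all \<open>\<rho> S\<close> is the density of \<open>((X, Y), U)\<close> with respect to the product of
  the source law and the laws of the \<open>U\<^sub>S\<close> (chain rule and Markov property). A second moment
  computation shows that the average of \<open>w\<close> over all tuples of codewords, restricted to tuples
  where each \<open>\<rho> S\<close> is not too large, concentrates at 1. Hence the randomized encoder
  choosing a tuple with probability proportional to its weight behaves, up to a factor 2, as if the
  chosen codewords and the source were drawn from the true joint law, and minimizing the conditional
  failure probability makes the encoder deterministic.

  Decoding. Typicality is a lower bound on products of densities, so the probability that a wrong
  tuple is typical is bounded by Markov's inequality; the required integral factorizes over time and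
  is at most 1 by integrating out one codeword at a time.

  Distortion. The conditional expectations are clipped, the average distortion is made part of
  typicality, and the failure event is handled by uniform integrability of \<open>X\<close> squared.
\<close>

section \<open>Product measures, a law of large numbers and conditional estimators\<close>

text \<open>The alphabets are uncountable, so type counting and a Markov lemma for strong typicality
  are out of reach. Choosing codewords by likelihood takes their place: the weight depends on
  \<open>X\<close> alone, yet it yields the correct joint law with the side information, because by
  the Markov property the density of \<open>((X, Y), U)\<close> against the independent law is a
  function of \<open>(X, U)\<close>.

  Everything is set up letter by letter: one letter of the experiment is a source letter plus one
  letter of every codeword of every codebook, and \<open>n\<close> independent copies form a block.
  The second moment bound and the decoding bound thus reduce to one-letter integrals that are at
  most 1.

  The encoder inequalities force finite mutual informations, since rates are finite; the decoder
  inequalities may involve infinite ones. So typicality is one-sided, and for the decoders the law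
  of large numbers is applied to truncated logarithms, whose means approach the mutual information
  from below. Joint Gaussianity supplies the finite second moment of \<open>X\<close>.\<close>

lemma distr_pair_PiM:
  fixes K :: "'k set"
  assumes M: "prob_space M" and N: "prob_space N" and K: "finite K"
  shows "distr (PiM K (\<lambda>_. M) \<Otimes>\<^sub>M PiM K (\<lambda>_. N)) (PiM K (\<lambda>_. M \<Otimes>\<^sub>M N)) (\<lambda>z. \<lambda>i\<in>K. (fst z i, snd z i))
    = PiM K (\<lambda>_. M \<Otimes>\<^sub>M N)"
proof -
  interpret M: prob_space M by fact
  interpret N: prob_space N by fact
  interpret MN: pair_prob_space M N ..
  interpret PM: product_prob_space "\<lambda>_::'k. M" by (rule product_prob_spaceI) (rule M)
  interpret PN: product_prob_space "\<lambda>_::'k. N" by (rule product_prob_spaceI) (rule N)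
  interpret PMN: product_prob_space "\<lambda>_::'k. M \<Otimes>\<^sub>M N"
    by (rule product_prob_spaceI) (rule MN.prob_space_axioms)
  interpret A: prob_space "PiM K (\<lambda>_. M)" by (rule prob_space_PiM) (rule M)
  interpret B: prob_space "PiM K (\<lambda>_. N)" by (rule prob_space_PiM) (rule N)
  interpret AB: pair_prob_space "PiM K (\<lambda>_. M)" "PiM K (\<lambda>_. N)" ..
  show ?thesis
  proof (rule PMN.PiM_eqI[OF K])
    fix A assume A: "\<And>i. i \<in> K \<Longrightarrow> A i \<in> sets (M \<Otimes>\<^sub>M N)"
    note A[measurable]
    have S[measurable]: "Pi\<^sub>E K A \<in> sets (PiM K (\<lambda>_. M \<Otimes>\<^sub>M N))"
      by (intro sets_PiM_I_finite K A)
    let ?f = "\<lambda>z. \<lambda>i\<in>K. (fst z i, snd z i)"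
    have f[measurable]: "?f \<in> measurable (PiM K (\<lambda>_. M) \<Otimes>\<^sub>M PiM K (\<lambda>_. N)) (PiM K (\<lambda>_. M \<Otimes>\<^sub>M N))"
      by measurable
    have ind: "indicator (Pi\<^sub>E K A) (?f (a, c)) = (\<Prod>i\<in>K. indicator (A i) (a i, c i) :: ennreal)" for a c
    proof (cases "\<forall>i\<in>K. (a i, c i) \<in> A i")
      case True then show ?thesis by (auto simp: indicator_def)
    next
      case False
      then obtain i where "i \<in> K" "(a i, c i) \<notin> A i" by auto
      then have "(\<Prod>i\<in>K. indicator (A i) (a i, c i) :: ennreal) = 0"
        using K by (intro prod_zero bexI[of _ i]) auto
      moreover have "?f (a, c) \<notin> Pi\<^sub>E K A" using \<open>i \<in> K\<close> \<open>(a i, c i) \<notin> A i\<close> by (auto simp: PiE_iff)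
      ultimately show ?thesis by simp
    qed
    have "emeasure (distr (PiM K (\<lambda>_. M) \<Otimes>\<^sub>M PiM K (\<lambda>_. N)) (PiM K (\<lambda>_. M \<Otimes>\<^sub>M N)) ?f) (Pi\<^sub>E K A)
       = (\<integral>\<^sup>+z. indicator (Pi\<^sub>E K A) z \<partial>distr (PiM K (\<lambda>_. M) \<Otimes>\<^sub>M PiM K (\<lambda>_. N)) (PiM K (\<lambda>_. M \<Otimes>\<^sub>M N)) ?f)"
      by simp
    also have "\<dots> = (\<integral>\<^sup>+z. indicator (Pi\<^sub>E K A) (?f z) \<partial>(PiM K (\<lambda>_. M) \<Otimes>\<^sub>M PiM K (\<lambda>_. N)))"
      by (subst nn_integral_distr) simp_all
    also have "\<dots> = (\<integral>\<^sup>+c. \<integral>\<^sup>+a. indicator (Pi\<^sub>E K A) (?f (a, c)) \<partial>PiM K (\<lambda>_. M) \<partial>PiM K (\<lambda>_. N))"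
      by (rule AB.nn_integral_snd[symmetric]) simp
    also have "\<dots> = (\<integral>\<^sup>+c. (\<Prod>i\<in>K. \<integral>\<^sup>+a. indicator (A i) (a, c i) \<partial>M) \<partial>PiM K (\<lambda>_. N))"
    proof (rule nn_integral_cong)
      fix c assume c: "c \<in> space (PiM K (\<lambda>_. N))"
      show "(\<integral>\<^sup>+a. indicator (Pi\<^sub>E K A) (?f (a, c)) \<partial>PiM K (\<lambda>_. M)) = (\<Prod>i\<in>K. \<integral>\<^sup>+a. indicator (A i) (a, c i) \<partial>M)"
        unfolding ind
      proof (rule PM.product_nn_integral_prod[OF K])
        fix i assume "i \<in> K"
        then have "c i \<in> space N" using c by (auto simp: space_PiM)
        then show "(\<lambda>a. indicator (A i) (a, c i) :: ennreal) \<in> borel_measurable M"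
          using A[OF \<open>i \<in> K\<close>] by measurable
      qed
    qed
    also have "\<dots> = (\<Prod>i\<in>K. \<integral>\<^sup>+c. \<integral>\<^sup>+a. indicator (A i) (a, c) \<partial>M \<partial>N)"
    proof (rule PN.product_nn_integral_prod[OF K])
      fix i assume "i \<in> K"
      then show "(\<lambda>c. \<integral>\<^sup>+a. indicator (A i) (a, c) \<partial>M) \<in> borel_measurable N"
        using A[OF \<open>i \<in> K\<close>] by measurable
    qed
    also have "\<dots> = (\<Prod>i\<in>K. emeasure (M \<Otimes>\<^sub>M N) (A i))"
    proof (rule prod.cong[OF refl])
      fix i assume i: "i \<in> K"
      have "(\<integral>\<^sup>+c. \<integral>\<^sup>+a. indicator (A i) (a, c) \<partial>M \<partial>N) = (\<integral>\<^sup>+z. indicator (A i) z \<partial>(M \<Otimes>\<^sub>M N))"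
        by (rule MN.nn_integral_snd) (use A[OF i] in measurable)
      then show "(\<integral>\<^sup>+c. \<integral>\<^sup>+a. indicator (A i) (a, c) \<partial>M \<partial>N) = emeasure (M \<Otimes>\<^sub>M N) (A i)"
        using A[OF i] by simp
    qed
    finally show "emeasure (distr (PiM K (\<lambda>_. M) \<Otimes>\<^sub>M PiM K (\<lambda>_. N)) (PiM K (\<lambda>_. M \<Otimes>\<^sub>M N)) ?f) (Pi\<^sub>E K A)
       = (\<Prod>i\<in>K. emeasure (M \<Otimes>\<^sub>M N) (A i))" .
  qed simp
qed

lemma PiM_density:
  fixes K :: "'k set"
  assumes M: "prob_space M" and K: "finite K" and [measurable]: "w \<in> borel_measurable M"
    and D: "prob_space (density M w)"
  shows "PiM K (\<lambda>_. density M w) = density (PiM K (\<lambda>_. M)) (\<lambda>z. \<Prod>i\<in>K. w (z i))"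
proof -
  interpret M: prob_space M by fact
  interpret PM: product_prob_space "\<lambda>_::'k. M" by (rule product_prob_spaceI) (rule M)
  interpret PD: product_prob_space "\<lambda>_::'k. density M w" by (rule product_prob_spaceI) (rule D)
  show ?thesis
  proof (rule PD.PiM_eqI[OF K, symmetric])
    show "sets (density (PiM K (\<lambda>_. M)) (\<lambda>z. \<Prod>i\<in>K. w (z i))) = sets (PiM K (\<lambda>_. density M w))"
      by (auto intro!: sets_PiM_cong)
    fix A assume "\<And>i. i \<in> K \<Longrightarrow> A i \<in> sets (density M w)"
    then have A[measurable]: "\<And>i. i \<in> K \<Longrightarrow> A i \<in> sets M" by simp
    have S[measurable]: "Pi\<^sub>E K A \<in> sets (PiM K (\<lambda>_. M))"
      by (intro sets_PiM_I_finite K A)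
    have "emeasure (density (PiM K (\<lambda>_. M)) (\<lambda>z. \<Prod>i\<in>K. w (z i))) (Pi\<^sub>E K A)
      = (\<integral>\<^sup>+z. (\<Prod>i\<in>K. w (z i)) * indicator (Pi\<^sub>E K A) z \<partial>PiM K (\<lambda>_. M))"
      by (rule emeasure_density) measurable
    also have "\<dots> = (\<integral>\<^sup>+z. (\<Prod>i\<in>K. w (z i) * indicator (A i) (z i)) \<partial>PiM K (\<lambda>_. M))"
    proof (rule nn_integral_cong)
      fix z assume z: "z \<in> space (PiM K (\<lambda>_. M))"
      have "(indicator (Pi\<^sub>E K A) z :: ennreal) = (\<Prod>i\<in>K. indicator (A i) (z i))"
      proof (cases "\<forall>i\<in>K. z i \<in> A i")
        case True then show ?thesis using z by (auto simp: indicator_def space_PiM PiE_iff)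
      next
        case False
        then obtain i where "i \<in> K" "z i \<notin> A i" by auto
        then have "(\<Prod>i\<in>K. indicator (A i) (z i) :: ennreal) = 0" "z \<notin> Pi\<^sub>E K A"
          using K by (auto simp: PiE_iff intro!: prod_zero bexI[of _ i])
        then show ?thesis by simp
      qed
      then show "(\<Prod>i\<in>K. w (z i)) * indicator (Pi\<^sub>E K A) z = (\<Prod>i\<in>K. w (z i) * indicator (A i) (z i))"
        by (simp add: prod.distrib)
    qed
    also have "\<dots> = (\<Prod>i\<in>K. \<integral>\<^sup>+z. w z * indicator (A i) z \<partial>M)"
      by (rule PM.product_nn_integral_prod[OF K]) measurable
    also have "\<dots> = (\<Prod>i\<in>K. emeasure (density M w) (A i))"
      by (intro prod.cong refl emeasure_density[symmetric] A) auto
    finally show "emeasure (density (PiM K (\<lambda>_. M)) (\<lambda>z. \<Prod>i\<in>K. w (z i))) (Pi\<^sub>E K A)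
       = (\<Prod>i\<in>K. emeasure (density M w) (A i))" .
  qed
qed

text \<open>Splitting off coordinate \<open>k\<close> by Fubini, the old value is overwritten and
  integrates to 1. Functional update over the full index set, in place of a smaller product, allows
  coordinates to be integrated out one after another without reindexing.\<close>

lemma nn_integral_PiM_resample:
  assumes q: "\<And>i. prob_space (q i)" and K: "finite K" "k \<in> K"
    and F[measurable]: "F \<in> borel_measurable (PiM K q)"
  shows "(\<integral>\<^sup>+c. F c \<partial>PiM K q) = (\<integral>\<^sup>+c. \<integral>\<^sup>+v. F (c(k := v)) \<partial>q k \<partial>PiM K q)"
proof -
  interpret q: product_prob_space q by (rule product_prob_spaceI) (rule q)
  define K' where "K' = K - {k}"
  have K': "finite K'" "k \<notin> K'" "K = insert k K'" using K by (auto simp: K'_def)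
  have upd[measurable]: "(\<lambda>z. (fst z)(k := snd z)) \<in> measurable (PiM K q \<Otimes>\<^sub>M q k) (PiM K q)"
  proof (rule measurable_PiM_single')
    show "(\<lambda>z. \<lambda>i. ((fst z)(k := snd z)) i) \<in> space (PiM K q \<Otimes>\<^sub>M q k) \<rightarrow> (\<Pi>\<^sub>E i\<in>K. space (q i))"
      using K by (auto simp: space_pair_measure space_PiM PiE_iff extensional_def)
    fix i assume "i \<in> K"
    then show "(\<lambda>z. ((fst z)(k := snd z)) i) \<in> measurable (PiM K q \<Otimes>\<^sub>M q k) (q i)"
      by (cases "i = k") auto
  qed
  have m: "(\<lambda>c. \<integral>\<^sup>+v. F (c(k := v)) \<partial>q k) \<in> borel_measurable (PiM K q)"
    by measurable
  have "(\<integral>\<^sup>+c. \<integral>\<^sup>+v. F (c(k := v)) \<partial>q k \<partial>PiM K q)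
    = (\<integral>\<^sup>+c. \<integral>\<^sup>+y. \<integral>\<^sup>+v. F ((c(k := y))(k := v)) \<partial>q k \<partial>q k \<partial>PiM K' q)"
    unfolding K'(3) by (rule q.product_nn_integral_insert[OF K'(1,2)]) (use m K'(3) in simp)
  also have "\<dots> = (\<integral>\<^sup>+c. \<integral>\<^sup>+v. F (c(k := v)) \<partial>q k \<partial>PiM K' q)"
    by (simp add: prob_space.emeasure_space_1[OF q])
  also have "\<dots> = (\<integral>\<^sup>+c. F c \<partial>PiM K q)"
    unfolding K'(3) by (rule q.product_nn_integral_insert[symmetric, OF K'(1,2)]) (use F K'(3) in simp)
  finally show ?thesis ..
qed

text \<open>Integrating the coordinates in reverse order peels off one factor at a time.\<close>
lemma nn_integral_PiM_chain_le_1: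
  assumes q: "\<And>i. prob_space (q i)" and K: "finite K"
    and ks: "distinct ks" "set ks \<subseteq> K"
    and h: "\<And>k. k \<in> set ks \<Longrightarrow> h k \<in> borel_measurable (PiM K q)"
    and dep: "sorted_wrt (\<lambda>k k'. \<forall>c v. h k (c(k' := v)) = h k c) ks"
    and le: "\<And>k c. k \<in> set ks \<Longrightarrow> c \<in> space (PiM K q) \<Longrightarrow> (\<integral>\<^sup>+v. h k (c(k := v)) \<partial>q k) \<le> (1::ennreal)"
  shows "(\<integral>\<^sup>+c. (\<Prod>k\<in>set ks. h k c) \<partial>PiM K q) \<le> 1"
  using ks h dep le
proof (induction ks rule: rev_induct)
  case Nil
  interpret prob_space "PiM K q" by (rule prob_space_PiM) (rule q)
  show ?case by (simp add: emeasure_space_1)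
next
  case (snoc k ks)
  have kK: "k \<in> K" and kn: "k \<notin> set ks" using snoc.prems by auto
  note snoc.prems(3)[measurable]
  have dep': "h i (c(k := v)) = h i c" if "i \<in> set ks" for i c v
    using snoc.prems(4) that unfolding sorted_wrt_append by auto
  have hm: "(\<lambda>v. h k (c(k := v))) \<in> borel_measurable (q k)" if c: "c \<in> space (PiM K q)" for c
  proof -
    have "(\<lambda>v. c(k := v)) \<in> measurable (q k) (PiM K q)"
    proof (rule measurable_PiM_single')
      show "(\<lambda>v. \<lambda>i. (c(k := v)) i) \<in> space (q k) \<rightarrow> (\<Pi>\<^sub>E i\<in>K. space (q i))"
        using c kK by (auto simp: space_PiM PiE_iff extensional_def)
      fix i assume "i \<in> K"
      then show "(\<lambda>v. (c(k := v)) i) \<in> measurable (q k) (q i)"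
        using c by (cases "i = k") (auto simp: space_PiM PiE_iff)
    qed
    then show ?thesis using snoc.prems(3)[of k] by (auto intro: measurable_compose)
  qed
  have "(\<integral>\<^sup>+c. (\<Prod>i\<in>set (ks @ [k]). h i c) \<partial>PiM K q)
     = (\<integral>\<^sup>+c. \<integral>\<^sup>+v. (\<Prod>i\<in>set (ks @ [k]). h i (c(k := v))) \<partial>q k \<partial>PiM K q)"
    by (rule nn_integral_PiM_resample[OF q K kK]) (auto intro!: borel_measurable_prod_ennreal snoc.prems(3))
  also have "\<dots> = (\<integral>\<^sup>+c. (\<Prod>i\<in>set ks. h i c) * (\<integral>\<^sup>+v. h k (c(k := v)) \<partial>q k) \<partial>PiM K q)"
  proof (rule nn_integral_cong)
    fix c assume c: "c \<in> space (PiM K q)"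
    have "(\<Prod>i\<in>set (ks @ [k]). h i (c(k := v))) = (\<Prod>i\<in>set ks. h i c) * h k (c(k := v))" for v
      using kn dep' by (simp add: mult.commute)
    then show "(\<integral>\<^sup>+v. (\<Prod>i\<in>set (ks @ [k]). h i (c(k := v))) \<partial>q k)
      = (\<Prod>i\<in>set ks. h i c) * (\<integral>\<^sup>+v. h k (c(k := v)) \<partial>q k)"
      using hm[OF c] by (simp add: nn_integral_cmult)
  qed
  also have "\<dots> \<le> (\<integral>\<^sup>+c. (\<Prod>i\<in>set ks. h i c) * 1 \<partial>PiM K q)"
    by (intro nn_integral_mono mult_left_mono snoc.prems(5)) auto
  also have "\<dots> \<le> 1"
  proof -
    have "(\<integral>\<^sup>+c. (\<Prod>i\<in>set ks. h i c) \<partial>PiM K q) \<le> 1"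
      by (rule snoc.IH) (use snoc.prems in \<open>simp_all add: sorted_wrt_append del: fun_upd_apply\<close>)
    then show ?thesis by simp
  qed
  finally show ?case .
qed

section \<open>Weak law of large numbers by truncation\<close>

lemma measure_PiM_sum_Hoeffding:
  fixes g :: "'a \<Rightarrow> real"
  assumes M: "prob_space M" and g[measurable]: "g \<in> borel_measurable M"
    and B: "\<And>x. x \<in> space M \<Longrightarrow> g x \<in> {-B..B}" "B > 0" and e: "e > 0" and n: "n > 0"
  shows "measure (PiM {..<n} (\<lambda>_. M)) {z \<in> space (PiM {..<n} (\<lambda>_. M)). (\<Sum>t<n. g (z t)) \<ge> real n * (integral\<^sup>L M g + e)}
    \<le> exp (- (e\<^sup>2 / (2 * B\<^sup>2)) * real n)"
proof -
  let ?P = "PiM {..<n} (\<lambda>_. M)"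
  interpret M: prob_space M by fact
  interpret P: prob_space ?P by (rule prob_space_PiM) (rule M)
  have "P.indep_vars (\<lambda>_. M) (\<lambda>t z. z t) {..<n}"
  proof (subst P.indep_vars_iff_distr_eq_PiM')
    show "{..<n} \<noteq> {}" using n by auto
    show "P.random_variable M (\<lambda>z. z t)" if "t \<in> {..<n}" for t
      using that by measurable
    have "distr ?P ?P (\<lambda>x. restrict x {..<n}) = distr ?P ?P (\<lambda>x. x)"
      by (rule distr_cong) (auto simp: space_PiM PiE_iff extensional_restrict)
    also have "\<dots> = ?P" by (rule distr_id)
    also have "\<dots> = PiM {..<n} (\<lambda>t. distr ?P M (\<lambda>z. z t))"
      by (rule PiM_cong[OF refl], subst distr_PiM_component) (auto intro: M)
    finally show "distr ?P (PiM {..<n} (\<lambda>i. M)) (\<lambda>x. \<lambda>i\<in>{..<n}. x i) = PiM {..<n} (\<lambda>t. distr ?P M (\<lambda>z. z t))" .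
  qed
  then have indep: "P.indep_vars (\<lambda>_. borel) (\<lambda>t z. g (z t)) {..<n}"
    by (rule P.indep_vars_compose2) auto
  have exp: "P.expectation (\<lambda>z. g (z t)) = integral\<^sup>L M g" if "t < n" for t
  proof -
    have "integral\<^sup>L M g = integral\<^sup>L (distr ?P M (\<lambda>z. z t)) g"
      using that by (subst distr_PiM_component) (auto intro: M)
    also have "\<dots> = P.expectation (\<lambda>z. g (z t))"
      using that by (intro integral_distr) auto
    finally show ?thesis by simp
  qed
  interpret H: Hoeffding_ineq ?P "{..<n}" "\<lambda>t z. g (z t)" "\<lambda>_. -B" "\<lambda>_. B" "real n * integral\<^sup>L M g"
  proof unfold_locales
    show "real n * integral\<^sup>L M g \<equiv> \<Sum>i<n. P.expectation (\<lambda>z. g (z i))"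
      by (simp add: exp)
    show "AE x in ?P. g (x i) \<in> {-B..B}" if "i \<in> {..<n}" for i
      using that B by (intro AE_I2) (auto simp: space_PiM PiE_iff)
  qed (use indep in auto)
  have "P.prob {x\<in>space ?P. (\<Sum>i<n. g (x i)) \<ge> real n * integral\<^sup>L M g + real n * e}
     \<le> exp (-2 * (real n * e)\<^sup>2 / (\<Sum>i<n. (B - -B)\<^sup>2))"
    by (rule H.Hoeffding_ineq_ge) (use n B e in auto)
  also have "-2 * (real n * e)\<^sup>2 / (\<Sum>i<n. (B - -B)\<^sup>2) = - (e\<^sup>2 / (2 * B\<^sup>2)) * real n"
    using n B by (simp add: field_simps power2_eq_square)
  finally show ?thesis by (simp add: distrib_left)
qed

text \<open>Truncation at a level \<open>B\<close>: the truncated sum obeys Hoeffding's inequality,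
  and the sum of the truncation errors is controlled by Markov's inequality. This asks for a first
  moment only, which is all that is known of log-densities. The upper tail suffices, as every
  typicality condition is one-sided.\<close>

lemma weak_law_upper:
  fixes f :: "'a \<Rightarrow> real"
  assumes M: "prob_space M" and f: "integrable M f" and e: "e > 0"
  shows "(\<lambda>n. measure (PiM {..<n} (\<lambda>_. M))
     {z \<in> space (PiM {..<n} (\<lambda>_. M)). \<not> (\<Sum>t<n. f (z t)) \<le> real n * (integral\<^sup>L M f + e)}) \<longlonglongrightarrow> 0"
proof (rule LIMSEQ_I)
  fix r :: real assume r: "r > 0"
  interpret M: prob_space M by fact
  have [measurable]: "f \<in> borel_measurable M" using f by auto
  define g where "g B x = max (- real B) (min (real B) (f x))" for B :: nat and x
  have gm[measurable]: "g B \<in> borel_measurable M" for B unfolding g_def by measurable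
  have "(\<lambda>B. \<integral>x. \<bar>f x - g B x\<bar> \<partial>M) \<longlonglongrightarrow> (\<integral>x. 0 \<partial>M)"
  proof (rule integral_dominated_convergence[where w="\<lambda>x. \<bar>f x\<bar>"])
    show "AE x in M. (\<lambda>B. \<bar>f x - g B x\<bar>) \<longlonglongrightarrow> 0"
    proof (rule AE_I2)
      fix x
      obtain N :: nat where N: "\<bar>f x\<bar> \<le> real N" using real_arch_simple by blast
      have "eventually (\<lambda>B. \<bar>f x - g B x\<bar> = 0) sequentially"
        using eventually_ge_at_top[of N] by eventually_elim (use N in \<open>auto simp: g_def\<close>)
      then show "(\<lambda>B. \<bar>f x - g B x\<bar>) \<longlonglongrightarrow> 0" by (rule tendsto_eventually)
    qed
    show "AE x in M. norm \<bar>f x - g B x\<bar> \<le> \<bar>f x\<bar>" for B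
      by (intro AE_I2) (auto simp: g_def)
  qed (use f in auto)
  then have "(\<lambda>B. \<integral>x. \<bar>f x - g B x\<bar> \<partial>M) \<longlonglongrightarrow> 0" by simp
  \<comment> \<open>The bound \<open>e/4\<close> limits the shift of the mean;
    \<open>r * e / 8\<close> makes Markov's inequality at threshold \<open>e/2\<close> give
    \<open>r/4\<close>. The total deviation is then \<open>e/4\<close> (mean) plus
    \<open>e/4\<close> (Hoeffding) plus \<open>e/2\<close> (truncation error).\<close>
  moreover have "0 < min (e/4) (r * e / 8)" using e r by simp
  ultimately have "eventually (\<lambda>B. (\<integral>x. \<bar>f x - g B x\<bar> \<partial>M) < min (e/4) (r * e / 8)) sequentially"
    by (rule order_tendstoD(2))
  then obtain B0 where "\<And>B. B \<ge> B0 \<Longrightarrow> (\<integral>x. \<bar>f x - g B x\<bar> \<partial>M) < min (e/4) (r * e / 8)"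
    by (auto simp: eventually_sequentially)
  then obtain B :: nat where B: "B > 0" and small: "(\<integral>x. \<bar>f x - g B x\<bar> \<partial>M) < min (e/4) (r * e / 8)"
    by (metis le_add1 zero_less_Suc add_Suc_right)
  have gi: "integrable M (g B)"
    by (rule M.integrable_const_bound[where B="real B"]) (auto simp: g_def)
  have hi: "integrable M (\<lambda>x. \<bar>f x - g B x\<bar>)" using f gi by auto
  have "\<bar>integral\<^sup>L M f - integral\<^sup>L M (g B)\<bar> \<le> (\<integral>x. \<bar>f x - g B x\<bar> \<partial>M)"
    using integral_abs_bound[of M "\<lambda>x. f x - g B x"] f gi by simp
  then have Egf: "integral\<^sup>L M (g B) \<le> integral\<^sup>L M f + e/4" using small by auto
  have "(\<lambda>n. exp (- ((e/4)\<^sup>2 / (2 * (real B)\<^sup>2)) * real n)) \<longlonglongrightarrow> 0"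
  proof -
    have "(e/4)\<^sup>2 / (2 * (real B)\<^sup>2) > 0" using e B by simp
    moreover have "(\<lambda>n. exp (- c * real n)) \<longlonglongrightarrow> 0" if "c > 0" for c :: real
      using that by real_asymp
    ultimately show ?thesis by blast
  qed
  then have "eventually (\<lambda>n. exp (- ((e/4)\<^sup>2 / (2 * (real B)\<^sup>2)) * real n) < r/4) sequentially"
    using r by (intro order_tendstoD(2)) auto
  then obtain N where N: "\<And>n. n \<ge> N \<Longrightarrow> exp (- ((e/4)\<^sup>2 / (2 * (real B)\<^sup>2)) * real n) < r/4"
    by (auto simp: eventually_sequentially)
  show "\<exists>N. \<forall>n\<ge>N. norm (measure (PiM {..<n} (\<lambda>_. M))
     {z \<in> space (PiM {..<n} (\<lambda>_. M)). \<not> (\<Sum>t<n. f (z t)) \<le> real n * (integral\<^sup>L M f + e)} - 0) < r"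
  proof (intro exI[of _ "Suc N"] allI impI)
    fix n assume n: "n \<ge> Suc N"
    let ?P = "PiM {..<n} (\<lambda>_. M)"
    interpret P: prob_space ?P by (rule prob_space_PiM) (rule M)
    have [measurable]: "(\<lambda>z. z t) \<in> measurable ?P M" if "t \<in> {..<n}" for t
      using that by (rule measurable_component_singleton)
    let ?A = "{z \<in> space ?P. (\<Sum>t<n. g B (z t)) \<ge> real n * (integral\<^sup>L M (g B) + e/4)}"
    let ?B = "{z \<in> space ?P. (\<Sum>t<n. \<bar>f (z t) - g B (z t)\<bar>) \<ge> real n * (e/2)}"
    have hint: "integrable ?P (\<lambda>z. \<bar>f (z t) - g B (z t)\<bar>)" "(\<integral>z. \<bar>f (z t) - g B (z t)\<bar> \<partial>?P) = (\<integral>x. \<bar>f x - g B x\<bar> \<partial>M)" if "t < n" for t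
    proof -
      have D: "distr ?P M (\<lambda>z. z t) = M" using that by (subst distr_PiM_component) (auto intro: M)
      show "integrable ?P (\<lambda>z. \<bar>f (z t) - g B (z t)\<bar>)"
        using that hi by (subst integrable_distr_eq[symmetric, of "\<lambda>z. z t" _ M]) (auto simp: D)
      show "(\<integral>z. \<bar>f (z t) - g B (z t)\<bar> \<partial>?P) = (\<integral>x. \<bar>f x - g B x\<bar> \<partial>M)"
        using that by (subst integral_distr[symmetric, of "\<lambda>z. z t" _ M]) (auto simp: D)
    qed
    have "P.prob ?A \<le> exp (- ((e/4)\<^sup>2 / (2 * (real B)\<^sup>2)) * real n)"
      by (rule measure_PiM_sum_Hoeffding[OF M]) (use B e n in \<open>auto simp: g_def\<close>)
    also have "\<dots> < r/4" using N n by simp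
    finally have A: "P.prob ?A < r/4" .
    have "P.prob ?B \<le> (\<integral>z. (\<Sum>t<n. \<bar>f (z t) - g B (z t)\<bar>) \<partial>?P) / (real n * (e/2))"
    proof (rule integral_Markov_inequality_measure[where A="{}"])
      show "integrable ?P (\<lambda>z. \<Sum>t<n. \<bar>f (z t) - g B (z t)\<bar>)"
        by (rule Bochner_Integration.integrable_sum) (rule hint, simp)
    qed (use n e in \<open>auto intro!: sum_nonneg\<close>)
    also have "(\<integral>z. (\<Sum>t<n. \<bar>f (z t) - g B (z t)\<bar>) \<partial>?P) = real n * (\<integral>x. \<bar>f x - g B x\<bar> \<partial>M)"
      using hint by (subst Bochner_Integration.integral_sum) auto
    also have "\<dots> / (real n * (e/2)) = (\<integral>x. \<bar>f x - g B x\<bar> \<partial>M) * (2/e)"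
      using n by simp
    also have "\<dots> < (r * e / 8) * (2/e)"
      using small e by (intro mult_strict_right_mono) auto
    also have "\<dots> = r/4" using e by simp
    finally have B': "P.prob ?B < r/4" .
    have sub: "{z \<in> space ?P. \<not> (\<Sum>t<n. f (z t)) \<le> real n * (integral\<^sup>L M f + e)} \<subseteq> ?A \<union> ?B"
    proof (safe, rule ccontr)
      fix z assume z: "z \<in> space ?P" and nle: "\<not> (\<Sum>t<n. f (z t)) \<le> real n * (integral\<^sup>L M f + e)"
        and nB: "\<not> real n * (e/2) \<le> (\<Sum>t<n. \<bar>f (z t) - g B (z t)\<bar>)"
        and nA: "\<not> real n * (integral\<^sup>L M (g B) + e/4) \<le> (\<Sum>t<n. g B (z t))"
      have "(\<Sum>t<n. f (z t)) \<le> (\<Sum>t<n. g B (z t) + \<bar>f (z t) - g B (z t)\<bar>)"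
        by (rule sum_mono) auto
      also have "\<dots> = (\<Sum>t<n. g B (z t)) + (\<Sum>t<n. \<bar>f (z t) - g B (z t)\<bar>)" by (rule sum.distrib)
      also have "\<dots> \<le> real n * (integral\<^sup>L M (g B) + e/4) + real n * (e/2)" using nA nB by simp
      also have "\<dots> = real n * (integral\<^sup>L M (g B) + e/4 + e/2)" by (simp add: algebra_simps)
      also have "\<dots> \<le> real n * (integral\<^sup>L M f + e)"
        using Egf by (intro mult_left_mono) auto
      finally show False using nle by simp
    qed
    have "P.prob {z \<in> space ?P. \<not> (\<Sum>t<n. f (z t)) \<le> real n * (integral\<^sup>L M f + e)} \<le> P.prob (?A \<union> ?B)"
      by (rule P.finite_measure_mono[OF sub]) measurable
    also have "\<dots> \<le> P.prob ?A + P.prob ?B"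
      by (rule measure_Un_le) measurable
    also have "\<dots> < r" using A B' r by simp
    finally show "norm (P.prob {z \<in> space ?P. \<not> (\<Sum>t<n. f (z t)) \<le> real n * (integral\<^sup>L M f + e)} - 0) < r"
      by simp
  qed
qed

section \<open>Functions of an observation and deterministic encoders\<close>

lemma doob_dynkin_ennreal:
  fixes f :: "'a \<Rightarrow> ennreal"
  assumes f: "f \<in> borel_measurable (vimage_algebra X B N)" and B: "B \<in> X \<rightarrow> space N"
  shows "\<exists>h\<in>borel_measurable N. \<forall>x\<in>X. f x = h (B x)"
  using f
proof (induction rule: borel_measurable_induct)
  case (cong f g)
  then show ?case by auto
next
  case (set A)
  then obtain C where "C \<in> sets N" "A = B -` C \<inter> X" using B by (auto simp: sets_vimage_algebra2)
  then show ?case by (intro bexI[of _ "indicator C"]) (auto simp: indicator_def)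
next
  case (mult u v)
  then obtain h where "h \<in> borel_measurable N" "\<forall>x\<in>X. u x = h (B x)" by blast
  then show ?case using mult by (intro bexI[of _ "\<lambda>y. v * h y"]) auto
next
  case (add u v)
  then obtain h k where "h \<in> borel_measurable N" "\<forall>x\<in>X. u x = h (B x)"
    "k \<in> borel_measurable N" "\<forall>x\<in>X. v x = k (B x)" by blast
  then show ?case by (intro bexI[of _ "\<lambda>y. k y + h y"]) auto
next
  case (seq U)
  then have "\<forall>i. \<exists>h\<in>borel_measurable N. \<forall>x\<in>X. U i x = h (B x)" by blast
  then obtain h where "\<And>i. h i \<in> borel_measurable N" "\<And>i x. x \<in> X \<Longrightarrow> U i x = h i (B x)" by metis
  then show ?case
  proof (intro bexI[of _ "\<lambda>y. SUP i. h i y"] ballI)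
    fix x assume "x \<in> X"
    then show "(SUP i. U i) x = (SUP i. h i (B x))"
      using \<open>\<And>i x. x \<in> X \<Longrightarrow> U i x = h i (B x)\<close> by (simp add: image_image)
  qed simp
qed

text \<open>Positive and negative parts reduce this to the \<open>ennreal\<close> version. It turns
  a conditional expectation, a function on the sample space, into a function of the observed values,
  which a decoder can evaluate on codewords and side information.\<close>

lemma doob_dynkin:
  fixes f :: "'a \<Rightarrow> real"
  assumes f[measurable]: "f \<in> borel_measurable (vimage_algebra X B N)" and B: "B \<in> X \<rightarrow> space N"
  shows "\<exists>h\<in>borel_measurable N. \<forall>x\<in>X. f x = h (B x)"
proof -
  obtain h where h: "h \<in> borel_measurable N" "\<And>x. x \<in> X \<Longrightarrow> ennreal (f x) = h (B x)"
    using doob_dynkin_ennreal[OF _ B, of "\<lambda>x. ennreal (f x)"] by auto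
  obtain k where k: "k \<in> borel_measurable N" "\<And>x. x \<in> X \<Longrightarrow> ennreal (- f x) = k (B x)"
    using doob_dynkin_ennreal[OF _ B, of "\<lambda>x. ennreal (- f x)"] by auto
  have "f x = enn2real (h (B x)) - enn2real (k (B x))" if "x \<in> X" for x
    using that by (cases "f x \<ge> 0") (auto simp: h(2)[symmetric] k(2)[symmetric] ennreal_neg)
  then show ?thesis using h(1) k(1)
    by (intro bexI[of _ "\<lambda>y. enn2real (h y) - enn2real (k y)"]) auto
qed

text \<open>A randomized encoder with weights \<open>p\<close> can be replaced by the deterministic encoder that
  minimizes the conditional failure probability, which is a Radon--Nikodym derivative.\<close>
lemma argmin_encoder_exists:
  fixes Q :: "'a measure" and p :: "nat \<Rightarrow> 'x \<Rightarrow> real"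
  assumes Q: "prob_space Q" and x[measurable]: "x \<in> measurable Q SX" and J: "J > 0"
    and fail[measurable]: "\<And>j. j < J \<Longrightarrow> fail j \<in> sets Q"
    and p[measurable]: "\<And>j. j < J \<Longrightarrow> p j \<in> borel_measurable SX"
    and p0: "\<And>j v. p j v \<ge> 0"
  shows "\<exists>f\<in>measurable SX (count_space UNIV). (\<forall>v. f v < J) \<and>
    {a\<in>space Q. a \<in> fail (f (x a))} \<in> sets Q \<and>
    emeasure Q {a\<in>space Q. a \<in> fail (f (x a))} \<le> emeasure Q {a\<in>space Q. (\<Sum>j<J. p j (x a)) < 1/2}
      + 2 * (\<Sum>j<J. \<integral>\<^sup>+a. ennreal (p j (x a)) * indicator (fail j) a \<partial>Q)"
proof -
  interpret Q: prob_space Q by fact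
  define PX where "PX = distr Q SX x"
  have [measurable_cong]: "sets PX = sets SX" by (simp add: PX_def)
  interpret PX: prob_space PX unfolding PX_def by (rule Q.prob_space_distr) (rule x)
  define F where "F j = RN_deriv PX (distr (density Q (indicator (fail j))) SX x)" for j
  have F[measurable]: "F j \<in> borel_measurable SX" for j
    unfolding F_def using borel_measurable_RN_deriv[of PX] by (metis \<open>sets PX = sets SX\<close> measurable_cong_sets)
  \<comment> \<open>In other words, \<open>F j\<close> at \<open>x a\<close> is the conditional
    probability of \<open>fail j\<close> given \<open>x\<close>. Testing against arbitrary
    \<open>h\<close> allows both the chosen index and the weights \<open>p j\<close> to be
    inserted.\<close>
  have Fint: "(\<integral>\<^sup>+v. F j v * h v \<partial>PX) = (\<integral>\<^sup>+a. indicator (fail j) a * h (x a) \<partial>Q)"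
    if j: "j < J" and h[measurable]: "h \<in> borel_measurable SX" for j h
  proof -
    have [measurable]: "fail j \<in> sets Q" using fail j by auto
    have "absolutely_continuous PX (distr (density Q (indicator (fail j))) SX x)"
    proof (unfold absolutely_continuous_def, safe)
      fix N assume N: "N \<in> null_sets PX"
      then have [measurable]: "N \<in> sets SX" by (auto simp: PX_def null_sets_def)
      have "AE a in Q. x a \<notin> N"
        using AE_distrD[OF x, of "\<lambda>v. v \<notin> N"] AE_not_in[OF N] unfolding PX_def by auto
      then have "emeasure (density Q (indicator (fail j))) (x -` N \<inter> space Q) = 0"
        by (subst emeasure_density) (auto simp: nn_integral_0_iff_AE indicator_def elim: AE_mp)
      then show "N \<in> null_sets (distr (density Q (indicator (fail j))) SX x)"
        by (auto simp: null_sets_def emeasure_distr)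
    qed
    then have "(\<integral>\<^sup>+v. F j v * h v \<partial>PX) = integral\<^sup>N (distr (density Q (indicator (fail j))) SX x) h"
      unfolding F_def by (subst PX.RN_deriv_nn_integral) (auto simp: PX_def)
    also have "\<dots> = (\<integral>\<^sup>+a. indicator (fail j) a * h (x a) \<partial>Q)"
      by (subst nn_integral_distr) (auto simp: nn_integral_density)
    finally show ?thesis .
  qed
  \<comment> \<open>Ties go to the least index, which keeps the minimizer measurable.\<close>
  define f where "f v = (LEAST j. j < J \<and> (\<forall>i<J. F j v \<le> F i v))" for v
  have fm[measurable]: "f \<in> measurable SX (count_space UNIV)" unfolding f_def by measurable
  have f: "f v < J \<and> (\<forall>i<J. F (f v) v \<le> F i v)" for v
  proof -
    have "finite ((\<lambda>i. F i v) ` {..<J})" "(\<lambda>i. F i v) ` {..<J} \<noteq> {}" using J by auto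
    then have "Min ((\<lambda>i. F i v) ` {..<J}) \<in> (\<lambda>i. F i v) ` {..<J}" by (rule Min_in)
    then obtain j where "j < J" "F j v = Min ((\<lambda>i. F i v) ` {..<J})" by auto
    then have "j < J \<and> (\<forall>i<J. F j v \<le> F i v)" by auto
    then show ?thesis unfolding f_def by (rule LeastI)
  qed
  let ?E = "{a\<in>space Q. a \<in> fail (f (x a))}"
  have E_eq: "?E = (\<Union>j<J. {a\<in>space Q. f (x a) = j} \<inter> fail j)"
    using f fail[THEN sets.sets_into_space] by auto
  have E[measurable]: "?E \<in> sets Q" unfolding E_eq by measurable
  let ?N = "\<lambda>v. \<Sum>j<J. p j v"
  have [measurable]: "?N \<in> borel_measurable SX" by (auto intro!: borel_measurable_sum)
  let ?B = "{a\<in>space Q. ?N (x a) < 1/2}"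
  have "emeasure Q ?E \<le> emeasure Q (?B \<union> (?E - ?B))"
    by (rule emeasure_mono) (auto, measurable)
  also have "\<dots> \<le> emeasure Q ?B + emeasure Q (?E - ?B)"
    by (rule emeasure_subadditive) measurable
  also have "emeasure Q (?E - ?B) \<le> 2 * (\<Sum>j<J. \<integral>\<^sup>+a. ennreal (p j (x a)) * indicator (fail j) a \<partial>Q)"
  proof -
    have "emeasure Q (?E - ?B) = (\<integral>\<^sup>+a. indicator (?E - ?B) a \<partial>Q)" by simp
    also have "\<dots> = (\<integral>\<^sup>+a. (\<Sum>j<J. indicator (fail j) a * (indicator {v. f v = j \<and> \<not> ?N v < 1/2} (x a))) \<partial>Q)"
    proof (rule nn_integral_cong)
      fix a assume a: "a \<in> space Q"
      have "(\<Sum>j<J. indicator (fail j) a * (indicator {v. f v = j \<and> \<not> ?N v < 1/2} (x a)))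
        = (\<Sum>j<J. if j = f (x a) then indicator (?E - ?B) a else (0::ennreal))"
        using a by (intro sum.cong) (auto simp: indicator_def)
      also have "\<dots> = indicator (?E - ?B) a" using f by (simp add: sum.delta)
      finally show "indicator (?E - ?B) a = (\<Sum>j<J. indicator (fail j) a * (indicator {v. f v = j \<and> \<not> ?N v < 1/2} (x a) :: ennreal))" ..
    qed
    also have "\<dots> = (\<Sum>j<J. \<integral>\<^sup>+a. indicator (fail j) a * (indicator {v. f v = j \<and> \<not> ?N v < 1/2} (x a)) \<partial>Q)"
      by (rule nn_integral_sum) measurable
    also have "\<dots> = (\<Sum>j<J. \<integral>\<^sup>+v. F j v * indicator {v. f v = j \<and> \<not> ?N v < 1/2} v \<partial>PX)"
      by (intro sum.cong refl Fint[symmetric]) (auto, measurable)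
    also have "\<dots> = (\<integral>\<^sup>+v. (\<Sum>j<J. F j v * indicator {v. f v = j \<and> \<not> ?N v < 1/2} v) \<partial>PX)"
      by (rule nn_integral_sum[symmetric]) measurable
    also have "\<dots> \<le> (\<integral>\<^sup>+v. 2 * (\<Sum>j<J. F j v * ennreal (p j v)) \<partial>PX)"
    proof (rule nn_integral_mono)
      fix v
      have "(\<Sum>j<J. F j v * indicator {v. f v = j \<and> \<not> ?N v < 1/2} v)
        = (\<Sum>j<J. if j = f v then F (f v) v * indicator {v. \<not> ?N v < 1/2} v else 0)"
        by (intro sum.cong) (auto simp: indicator_def)
      also have "\<dots> = F (f v) v * indicator {v. \<not> ?N v < 1/2} v" using f by (simp add: sum.delta)
      \<comment> \<open>Where the total weight is at least 1/2, the factor \<open>2 * ?N v\<close>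
        is at least 1; so the minimum is bounded by twice the weighted sum without normalizing the
        weights.\<close>
      also have "\<dots> \<le> F (f v) v * ennreal (2 * ?N v)"
        by (intro mult_left_mono) (auto simp: indicator_def)
      also have "\<dots> = 2 * (\<Sum>j<J. F (f v) v * ennreal (p j v))"
        using p0 by (simp add: ennreal_mult' sum_ennreal[symmetric] sum_distrib_left mult_ac sum_nonneg)
      also have "\<dots> \<le> 2 * (\<Sum>j<J. F j v * ennreal (p j v))"
        using f by (intro mult_left_mono sum_mono mult_right_mono) auto
      finally show "(\<Sum>j<J. F j v * indicator {v. f v = j \<and> \<not> ?N v < 1/2} v) \<le> 2 * (\<Sum>j<J. F j v * ennreal (p j v))" .
    qed
    also have "\<dots> = 2 * (\<Sum>j<J. \<integral>\<^sup>+v. F j v * ennreal (p j v) \<partial>PX)"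
      by (subst nn_integral_cmult) (auto intro!: arg_cong[where f="\<lambda>x. 2 * x"] nn_integral_sum borel_measurable_sum)
    also have "\<dots> = 2 * (\<Sum>j<J. \<integral>\<^sup>+a. indicator (fail j) a * ennreal (p j (x a)) \<partial>Q)"
      using Fint by (intro arg_cong[where f="\<lambda>x. 2 * x"] sum.cong) auto
    finally show ?thesis by (simp add: mult.commute)
  qed
  finally show ?thesis using fm f E by (intro bexI[of _ f]) (auto intro: add_left_mono)
qed

section \<open>Random codebooks\<close>

text \<open>
  \<open>\<rho> S x u\<close> stands for the density of \<open>((X, U before S), U\<^sub>S)\<close>, and \<open>g l D S y u\<close> for that of
  \<open>(U\<^sub>S, (U before S within D, U outside D, Y\<^sub>l))\<close>, relative to the product of the marginals. They are
  normalized so that the integral over the \<open>S\<close>-coordinate is at most 1 everywhere, not only almost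
  everywhere. \<open>RM\<close> makes the codewords independent of the source, \<open>JM\<close> is the true joint law.
\<close>
locale multi_codebook =
  fixes P :: "'a measure" and SX :: "'x measure" and px :: "'a \<Rightarrow> 'x"
    and q :: "'s \<Rightarrow> 'u measure" and vs :: "'s list"
    and \<rho> :: "'s \<Rightarrow> 'x \<Rightarrow> ('s \<Rightarrow> 'u) \<Rightarrow> real"
    and m :: nat and DS :: "nat \<Rightarrow> 's set"
    and SY :: "nat \<Rightarrow> 'y measure" and py :: "nat \<Rightarrow> 'a \<Rightarrow> 'y"
    and g :: "nat \<Rightarrow> 's set \<Rightarrow> 's \<Rightarrow> 'y \<Rightarrow> ('s \<Rightarrow> 'u) \<Rightarrow> real"
    and R R' :: "'s \<Rightarrow> real"
  assumes P: "prob_space P" and px[measurable]: "px \<in> measurable P SX"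
    and py[measurable]: "\<And>l. l < m \<Longrightarrow> py l \<in> measurable P (SY l)"
    and q: "\<And>S. prob_space (q S)" and vs: "distinct vs"
    and rho_meas: "\<And>S. S \<in> set vs \<Longrightarrow> (\<lambda>z. \<rho> S (fst z) (snd z)) \<in> borel_measurable (SX \<Otimes>\<^sub>M PiM (set vs) q)"
    and rho_nonneg: "\<And>S x u. \<rho> S x u \<ge> 0"
    and rho_dep: "sorted_wrt (\<lambda>S S'. \<forall>x u v. \<rho> S x (u(S' := v)) = \<rho> S x u) vs"
    and rho_int: "\<And>S x u. S \<in> set vs \<Longrightarrow> x \<in> space SX \<Longrightarrow> u \<in> space (PiM (set vs) q) \<Longrightarrow>
        (\<integral>\<^sup>+v. ennreal (\<rho> S x (u(S := v))) \<partial>q S) \<le> 1"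
    and DS: "\<And>l. l < m \<Longrightarrow> DS l \<subseteq> set vs"
    and g_meas: "\<And>l D S. l < m \<Longrightarrow> D \<subseteq> DS l \<Longrightarrow> S \<in> D \<Longrightarrow>
        (\<lambda>z. g l D S (fst z) (snd z)) \<in> borel_measurable (SY l \<Otimes>\<^sub>M PiM (DS l) q)"
    and g_nonneg: "\<And>l D S y u. g l D S y u \<ge> 0"
    and g_dep: "\<And>l D. l < m \<Longrightarrow> D \<subseteq> DS l \<Longrightarrow>
        sorted_wrt (\<lambda>S S'. \<forall>y u v. g l D S y (u(S' := v)) = g l D S y u) (filter (\<lambda>S. S \<in> D) vs)"
    and g_int: "\<And>l D S y u. l < m \<Longrightarrow> D \<subseteq> DS l \<Longrightarrow> S \<in> D \<Longrightarrow> y \<in> space (SY l) \<Longrightarrow>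
        u \<in> space (PiM (DS l) q) \<Longrightarrow> (\<integral>\<^sup>+v. ennreal (g l D S y (u(S := v))) \<partial>q S) \<le> 1"
begin

definition RM :: "('a \<times> ('s \<Rightarrow> 'u)) measure" where
  "RM = P \<Otimes>\<^sub>M PiM (set vs) q"

definition w :: "'a \<times> ('s \<Rightarrow> 'u) \<Rightarrow> real" where
  "w z = (\<Prod>S\<in>set vs. \<rho> S (px (fst z)) (snd z))"

definition JM :: "('a \<times> ('s \<Rightarrow> 'u)) measure" where
  "JM = density RM (\<lambda>z. ennreal (w z))"

text \<open>A cap from above on each density, with \<open>R S + R' S\<close> the nominal rate of the
  codebook of \<open>S\<close>. It acts as a truncation: beyond the cap, two tuples sharing a
  codeword could contribute too much to the second moment.\<close>

definition cov :: "nat \<Rightarrow> real \<Rightarrow> (nat \<Rightarrow> 'x) \<Rightarrow> (nat \<Rightarrow> 's \<Rightarrow> 'u) \<Rightarrow> bool" where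
  "cov n \<theta> xs us \<longleftrightarrow> (\<forall>S\<in>set vs. (\<Prod>t<n. \<rho> S (xs t) (us t)) \<le> exp (real n * (R S + R' S + \<theta>)))"

text \<open>There is one test for each set \<open>D\<close> of codewords that might be wrong. By the
  chain rule the product of \<open>g l D S\<close> over \<open>D\<close> is the density of all words
  and \<open>Y l\<close> against independent words in \<open>D\<close>, with the words outside
  \<open>D\<close> and \<open>Y l\<close> kept jointly distributed.\<close>

definition jtyp :: "nat \<Rightarrow> real \<Rightarrow> nat \<Rightarrow> (nat \<Rightarrow> 'y) \<Rightarrow> (nat \<Rightarrow> 's \<Rightarrow> 'u) \<Rightarrow> bool" where
  "jtyp n \<theta> l ys us \<longleftrightarrow> (\<forall>D\<in>Pow (DS l) - {{}}.
     exp (real n * ((\<Sum>S\<in>D. R' S) - \<theta>)) \<le> (\<Prod>t<n. \<Prod>S\<in>D. g l D S (ys t) (us t)))"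

lemma prob_space_RM: "prob_space RM"
proof -
  interpret PP: prob_space P by (rule P)
  interpret Q: prob_space "PiM (set vs) q" by (rule prob_space_PiM) (rule q)
  interpret pair_prob_space P "PiM (set vs) q" ..
  show ?thesis unfolding RM_def by (rule prob_space_axioms)
qed

lemma rho_meas_RM[measurable]: "S \<in> set vs \<Longrightarrow> (\<lambda>z. \<rho> S (px (fst z)) (snd z)) \<in> borel_measurable RM"
proof -
  assume S: "S \<in> set vs"
  have "(\<lambda>z. (px (fst z), snd z)) \<in> measurable RM (SX \<Otimes>\<^sub>M PiM (set vs) q)"
    unfolding RM_def by measurable
  from measurable_compose[OF this rho_meas[OF S]] show ?thesis by simp
qed

lemma w_meas[measurable]: "w \<in> borel_measurable RM"
  unfolding w_def by measurable

lemma w_nonneg: "w z \<ge> 0"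
  unfolding w_def by (intro prod_nonneg rho_nonneg ballI)

lemma finite_DS: "l < m \<Longrightarrow> finite (DS l)"
  using DS by (rule finite_subset) auto

end

text \<open>\<open>A S\<close> counts the bins of a codebook and \<open>B S\<close> the words in a
  bin. \<open>G\<close> is an abstract success condition, so that random coding can be done without
  mentioning distortion; it is later instantiated by the bound on the average distortion.\<close>

locale multi_codebook_n = multi_codebook P SX px q vs \<rho> m DS SY py g R R'
  for P :: "'a measure" and SX :: "'x measure" and px :: "'a \<Rightarrow> 'x"
    and q :: "'s \<Rightarrow> 'u measure" and vs :: "'s list"
    and \<rho> :: "'s \<Rightarrow> 'x \<Rightarrow> ('s \<Rightarrow> 'u) \<Rightarrow> real"
    and m :: nat and DS :: "nat \<Rightarrow> 's set"
    and SY :: "nat \<Rightarrow> 'y measure" and py :: "nat \<Rightarrow> 'a \<Rightarrow> 'y"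
    and g :: "nat \<Rightarrow> 's set \<Rightarrow> 's \<Rightarrow> 'y \<Rightarrow> ('s \<Rightarrow> 'u) \<Rightarrow> real"
    and R R' :: "'s \<Rightarrow> real" +
  fixes n :: nat and A B :: "'s \<Rightarrow> nat" and \<theta> :: real
    and G :: "(nat \<Rightarrow> 'a \<times> ('s \<Rightarrow> 'u)) \<Rightarrow> bool"
  assumes JM: "prob_space JM"
    and A: "\<And>S. A S > 0" and B: "\<And>S. B S > 0"
    and G[measurable]: "Measurable.pred (PiM {..<n} (\<lambda>_. RM)) G"
begin

text \<open>In a codeword index \<open>(a, b)\<close>, \<open>a\<close> is the transmitted bin and \<open>b\<close> the position inside the bin.\<close>
definition idx :: "'s \<Rightarrow> (nat \<times> nat) set" where "idx S = {..<A S} \<times> {..<B S}"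

definition keys :: "('s \<times> nat \<times> nat) set" where "keys = Sigma (set vs) idx"

definition QC :: "('s \<times> nat \<times> nat \<Rightarrow> 'u) measure" where "QC = PiM keys (\<lambda>k. q (fst k))"

definition tuples :: "('s \<Rightarrow> nat \<times> nat) set" where "tuples = PiE (set vs) idx"

definition pick :: "('s \<Rightarrow> nat \<times> nat) \<Rightarrow> ('s \<times> nat \<times> nat \<Rightarrow> 'u) \<Rightarrow> 's \<Rightarrow> 'u" where
  "pick j c = (\<lambda>S\<in>set vs. c (S, j S))"

definition dpick :: "nat \<Rightarrow> ('s \<Rightarrow> nat) \<Rightarrow> ('s \<Rightarrow> nat) \<Rightarrow> ('s \<times> nat \<times> nat \<Rightarrow> 'u) \<Rightarrow> 's \<Rightarrow> 'u" where
  "dpick l a b c = (\<lambda>S\<in>DS l. c (S, a S, b S))"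

text \<open>One letter of the whole experiment: a source letter and, independently, one letter of
  every codeword. Since codewords have i.i.d. letters, \<open>n\<close> independent copies of
  \<open>OM\<close> describe a source block together with all codebooks.\<close>

definition OM :: "('a \<times> ('s \<times> nat \<times> nat \<Rightarrow> 'u)) measure" where "OM = P \<Otimes>\<^sub>M QC"

definition zmap :: "('s \<Rightarrow> nat \<times> nat) \<Rightarrow> (nat \<Rightarrow> 'a \<times> ('s \<times> nat \<times> nat \<Rightarrow> 'u)) \<Rightarrow> nat \<Rightarrow> 'a \<times> ('s \<Rightarrow> 'u)" where
  "zmap j = compose {..<n} (\<lambda>z. (fst z, pick j (snd z)))"

definition covZ :: "(nat \<Rightarrow> 'a \<times> ('s \<Rightarrow> 'u)) \<Rightarrow> bool" where
  "covZ z \<longleftrightarrow> cov n \<theta> (\<lambda>t. px (fst (z t))) (\<lambda>t. snd (z t))"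

definition okZ :: "(nat \<Rightarrow> 'a \<times> ('s \<Rightarrow> 'u)) \<Rightarrow> bool" where
  "okZ z \<longleftrightarrow> G z \<and> (\<forall>l<m. jtyp n \<theta> l (\<lambda>t. py l (fst (z t))) (\<lambda>t. restrict (snd (z t)) (DS l)))"

text \<open>The transmitted bins \<open>fst (j S)\<close> are known to the decoders, so a competitor
  \<open>b\<close> differs from the true tuple in positions inside those bins.\<close>

definition bad :: "('s \<Rightarrow> nat \<times> nat) \<Rightarrow> (nat \<Rightarrow> 'a \<times> ('s \<times> nat \<times> nat \<Rightarrow> 'u)) \<Rightarrow> bool" where
  "bad j z \<longleftrightarrow> \<not> okZ (zmap j z) \<or> (\<exists>l<m. \<exists>b\<in>PiE (DS l) (\<lambda>S. {..<B S}).
     b \<noteq> (\<lambda>S\<in>DS l. snd (j S)) \<and> jtyp n \<theta> l (\<lambda>t. py l (fst (z t))) (\<lambda>t. dpick l (\<lambda>S. fst (j S)) b (snd (z t))))"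

lemma finite_keys: "finite keys" by (auto simp: keys_def idx_def)

lemma finite_tuples: "finite tuples" by (auto simp: tuples_def idx_def intro!: finite_PiE)

lemma card_tuples: "real (card tuples) = (\<Prod>S\<in>set vs. real (A S * B S))"
  unfolding tuples_def idx_def by (subst card_PiE) (auto simp: card_cartesian_product)

lemma card_tuples_pos: "card tuples > 0"
proof -
  have "(\<Prod>S\<in>set vs. real (A S * B S)) > 0" using A B by (intro prod_pos) auto
  then show ?thesis using card_tuples by simp
qed

lemma prob_space_QC: "prob_space QC"
  unfolding QC_def by (rule prob_space_PiM) (rule q)

lemma prob_space_OM: "prob_space OM"
proof -
  interpret PP: prob_space P by (rule P)
  interpret Q: prob_space QC by (rule prob_space_QC)
  interpret pair_prob_space P QC ..
  show ?thesis unfolding OM_def by (rule prob_space_axioms)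
qed

lemma pick_meas[measurable]:
  assumes "j \<in> tuples" shows "pick j \<in> measurable QC (PiM (set vs) q)"
  unfolding pick_def QC_def
proof (rule measurable_restrict)
  fix S assume "S \<in> set vs"
  then have "(S, j S) \<in> keys" using assms by (auto simp: keys_def tuples_def)
  then show "(\<lambda>c. c (S, j S)) \<in> measurable (PiM keys (\<lambda>k. q (fst k))) (q S)"
    using measurable_component_singleton[of "(S, j S)" keys "\<lambda>k. q (fst k)"] by simp
qed

lemma dpick_meas[measurable]:
  assumes "j \<in> tuples" "l < m" "b \<in> PiE (DS l) (\<lambda>S. {..<B S})"
  shows "dpick l (\<lambda>S. fst (j S)) b \<in> measurable QC (PiM (DS l) q)"
  unfolding dpick_def QC_def
proof (rule measurable_restrict)
  fix S assume S: "S \<in> DS l"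
  then have "j S \<in> idx S" "b S < B S" using assms DS by (auto simp: tuples_def PiE_iff)
  then have "(S, fst (j S), b S) \<in> keys" using S assms DS by (auto simp: keys_def idx_def)
  then show "(\<lambda>c. c (S, fst (j S), b S)) \<in> measurable (PiM keys (\<lambda>k. q (fst k))) (q S)"
    using measurable_component_singleton[of "(S, fst (j S), b S)" keys "\<lambda>k. q (fst k)"] by simp
qed

lemma distr_pick:
  assumes j: "j \<in> tuples"
  shows "distr QC (PiM (set vs) q) (pick j) = PiM (set vs) q"
proof -
  have "distr (PiM keys (\<lambda>k. q (fst k))) (\<Pi>\<^sub>M S\<in>set vs. q (fst (S, j S))) (\<lambda>c. \<lambda>S\<in>set vs. c (S, j S))
     = (\<Pi>\<^sub>M S\<in>set vs. q (fst (S, j S)))"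
    by (rule distr_PiM_reindex) (use j q in \<open>auto simp: inj_on_def keys_def tuples_def\<close>)
  then show ?thesis by (simp add: QC_def pick_def[abs_def])
qed

lemma letter_meas[measurable]:
  "j \<in> tuples \<Longrightarrow> (\<lambda>z. (fst z, pick j (snd z))) \<in> measurable OM RM"
  unfolding OM_def RM_def by measurable

lemma distr_letter:
  assumes j: "j \<in> tuples"
  shows "distr OM RM (\<lambda>z. (fst z, pick j (snd z))) = RM"
proof -
  note [measurable] = pick_meas[OF j]
  interpret PP: prob_space P by (rule P)
  interpret Q: prob_space "PiM (set vs) q" by (rule prob_space_PiM) (rule q)
  have "distr P P (\<lambda>x. x) \<Otimes>\<^sub>M distr QC (PiM (set vs) q) (pick j) = distr (P \<Otimes>\<^sub>M QC) (P \<Otimes>\<^sub>M PiM (set vs) q) (\<lambda>(x, y). (x, pick j y))"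
    by (rule pair_measure_distr) (auto simp: distr_pick[OF j] intro: Q.sigma_finite_measure_axioms j)
  then show ?thesis by (simp add: distr_pick[OF j] OM_def RM_def case_prod_beta' distr_id)
qed

lemma zmap_meas[measurable]:
  "j \<in> tuples \<Longrightarrow> zmap j \<in> measurable (PiM {..<n} (\<lambda>_. OM)) (PiM {..<n} (\<lambda>_. RM))"
  unfolding zmap_def compose_def by measurable

lemma distr_zmap:
  assumes j: "j \<in> tuples"
  shows "distr (PiM {..<n} (\<lambda>_. OM)) (PiM {..<n} (\<lambda>_. RM)) (zmap j) = PiM {..<n} (\<lambda>_. RM)"
  unfolding zmap_def
  by (subst distr_PiM_finite_prob_space') (auto simp: distr_letter[OF j] intro: prob_space_OM prob_space_RM letter_meas j)

lemma component_meas: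
  "t \<in> {..<n} \<Longrightarrow> (\<lambda>z. z t) \<in> measurable (PiM {..<n} (\<lambda>_. M)) M"
  by (rule measurable_component_singleton)

definition wZ :: "(nat \<Rightarrow> 'a \<times> ('s \<Rightarrow> 'u)) \<Rightarrow> real" where
  "wZ z = (\<Prod>t<n. w (z t))"

lemma wZ_meas[measurable]: "wZ \<in> borel_measurable (PiM {..<n} (\<lambda>_. RM))"
  unfolding wZ_def by (intro borel_measurable_prod measurable_compose[OF _ w_meas]) simp

lemma wZ_nonneg: "wZ z \<ge> 0" unfolding wZ_def by (intro prod_nonneg w_nonneg ballI)

text \<open>Seen through a fixed tuple \<open>j\<close>, the experiment is \<open>n\<close> copies
  of \<open>RM\<close>, where \<open>JM\<close> has density \<open>w\<close>. Weighting by
  \<open>wZ\<close> thus makes codewords drawn without looking at the source behave as if drawn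
  jointly with it.\<close>

lemma nn_integral_zmap:
  assumes j: "j \<in> tuples" and F[measurable]: "F \<in> borel_measurable (PiM {..<n} (\<lambda>_. RM))"
  shows "(\<integral>\<^sup>+z. ennreal (wZ (zmap j z)) * F (zmap j z) \<partial>PiM {..<n} (\<lambda>_. OM)) = (\<integral>\<^sup>+z. F z \<partial>PiM {..<n} (\<lambda>_. JM))"
proof -
  note [measurable] = zmap_meas[OF j]
  have "(\<integral>\<^sup>+z. ennreal (wZ (zmap j z)) * F (zmap j z) \<partial>PiM {..<n} (\<lambda>_. OM))
    = (\<integral>\<^sup>+z. ennreal (wZ z) * F z \<partial>distr (PiM {..<n} (\<lambda>_. OM)) (PiM {..<n} (\<lambda>_. RM)) (zmap j))"
    by (subst nn_integral_distr) auto
  also have "\<dots> = (\<integral>\<^sup>+z. ennreal (wZ z) * F z \<partial>PiM {..<n} (\<lambda>_. RM))"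
    by (simp add: distr_zmap[OF j])
  also have "\<dots> = (\<integral>\<^sup>+z. F z \<partial>density (PiM {..<n} (\<lambda>_. RM)) (\<lambda>z. \<Prod>t\<in>{..<n}. ennreal (w (z t))))"
    by (subst nn_integral_density) (auto simp: wZ_def prod_ennreal w_nonneg)
  also have "\<dots> = (\<integral>\<^sup>+z. F z \<partial>PiM {..<n} (\<lambda>_. JM))"
    unfolding JM_def by (subst PiM_density) (use prob_space_RM JM in \<open>auto simp: JM_def\<close>)
  finally show ?thesis .
qed

section \<open>One-letter integrals for two codeword tuples\<close>

text \<open>The keys of the second layer are listed last and so are integrated first. The factors
  \<open>h2\<close> may read words of the first layer, but \<open>h1\<close> never reads the second.
  Both the second moment (two encoder tuples) and decoding (true tuple and competitor) have this
  shape.\<close>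

lemma two_layer_le_1:
  assumes i: "\<And>S. S \<in> set vs \<Longrightarrow> (S, i S) \<in> keys" and i': "\<And>S. S \<in> set ws \<Longrightarrow> (S, i' S) \<in> keys"
    and ws: "distinct ws" and ne: "\<And>S. S \<in> set ws \<Longrightarrow> i S \<noteq> i' S"
    and h1: "\<And>S. S \<in> set vs \<Longrightarrow> h1 S \<in> borel_measurable QC"
    and h2: "\<And>S. S \<in> set ws \<Longrightarrow> h2 S \<in> borel_measurable QC"
    and d1: "sorted_wrt (\<lambda>S S'. \<forall>c v. h1 S (c((S', i S') := v)) = h1 S c) vs"
    and d12: "\<And>S S' c v. S \<in> set vs \<Longrightarrow> S' \<in> set ws \<Longrightarrow> h1 S (c((S', i' S') := v)) = h1 S c"
    and d2: "sorted_wrt (\<lambda>S S'. \<forall>c v. h2 S (c((S', i' S') := v)) = h2 S c) ws"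
    and int1: "\<And>S c. S \<in> set vs \<Longrightarrow> c \<in> space QC \<Longrightarrow> (\<integral>\<^sup>+v. h1 S (c((S, i S) := v)) \<partial>q S) \<le> 1"
    and int2: "\<And>S c. S \<in> set ws \<Longrightarrow> c \<in> space QC \<Longrightarrow> (\<integral>\<^sup>+v. h2 S (c((S, i' S) := v)) \<partial>q S) \<le> (1::ennreal)"
  shows "(\<integral>\<^sup>+c. (\<Prod>S\<in>set vs. h1 S c) * (\<Prod>S\<in>set ws. h2 S c) \<partial>QC) \<le> 1"
proof -
  \<comment> \<open>A single family of factors indexed by keys is needed; \<open>ne\<close> makes it
    unambiguous to which layer a key belongs.\<close>
  define h where "h = (\<lambda>(S, r). if r = i S then h1 S else h2 S)"
  let ?k1 = "map (\<lambda>S. (S, i S)) vs" and ?k2 = "map (\<lambda>S. (S, i' S)) ws"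
  have hh1: "h (S, i S) = h1 S" for S by (simp add: h_def)
  have hh2: "h (S, i' S) = h2 S" if "S \<in> set ws" for S using ne[OF that] by (auto simp: h_def)
  have disj: "set ?k1 \<inter> set ?k2 = {}" using ne by (fastforce simp: eq_commute)
  have "(\<integral>\<^sup>+c. (\<Prod>k\<in>set (?k1 @ ?k2). h k c) \<partial>PiM keys (\<lambda>k. q (fst k))) \<le> 1"
  proof (rule nn_integral_PiM_chain_le_1[OF q finite_keys])
    show "distinct (?k1 @ ?k2)" using disj vs ws by (auto simp: distinct_map inj_on_def)
    show "set (?k1 @ ?k2) \<subseteq> keys" using i i' by auto
    show "h k \<in> borel_measurable (PiM keys (\<lambda>k. q (fst k)))" if "k \<in> set (?k1 @ ?k2)" for k
      using that h1 h2 hh1 hh2 by (auto simp: QC_def)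
    have "sorted_wrt (\<lambda>S S'. \<forall>c v. h (S, i' S) (c((S', i' S') := v)) = h (S, i' S) c) ws"
      by (rule sorted_wrt_mono_rel[OF _ d2]) (simp add: hh2)
    then show "sorted_wrt (\<lambda>k k'. \<forall>c v. h k (c(k' := v)) = h k c) (?k1 @ ?k2)"
      using d1 d12 unfolding sorted_wrt_append sorted_wrt_map by (auto simp: hh1 simp del: fun_upd_apply)
    show "(\<integral>\<^sup>+v. h k (c(k := v)) \<partial>q (fst k)) \<le> 1"
      if "k \<in> set (?k1 @ ?k2)" "c \<in> space (PiM keys (\<lambda>k. q (fst k)))" for k c
      using that int1[of _ c] int2[of _ c] hh1 hh2 by (auto simp: QC_def simp del: fun_upd_apply)
  qed
  also have "(\<lambda>c. \<Prod>k\<in>set (?k1 @ ?k2). h k c) = (\<lambda>c. (\<Prod>S\<in>set vs. h1 S c) * (\<Prod>S\<in>set ws. h2 S c))"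
  proof
    fix c
    have "(\<Prod>k\<in>set (?k1 @ ?k2). h k c) = (\<Prod>k\<in>set ?k1. h k c) * (\<Prod>k\<in>set ?k2. h k c)"
      using disj by (simp only: set_append) (rule prod.union_disjoint, auto)
    also have "(\<Prod>k\<in>set ?k1. h k c) = (\<Prod>S\<in>set vs. h1 S c)"
      by (simp, subst prod.reindex) (auto simp: inj_on_def hh1)
    also have "(\<Prod>k\<in>set ?k2. h k c) = (\<Prod>S\<in>set ws. h2 S c)"
      by (simp, subst prod.reindex) (auto simp: inj_on_def hh2)
    finally show "(\<Prod>k\<in>set (?k1 @ ?k2). h k c) = (\<Prod>S\<in>set vs. h1 S c) * (\<Prod>S\<in>set ws. h2 S c)" .
  qed
  finally show ?thesis by (simp add: QC_def)
qed

lemma tuples_keys: "j \<in> tuples \<Longrightarrow> S \<in> set vs \<Longrightarrow> (S, j S) \<in> keys"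
  by (auto simp: tuples_def keys_def)

lemma pick_upd_other:
  "i \<noteq> j S \<Longrightarrow> pick j (c((S, i) := v)) = pick j c"
  by (auto simp: pick_def fun_eq_iff)

lemma pick_upd_same:
  "S \<in> set vs \<Longrightarrow> pick j (c((S, j S) := v)) = (pick j c)(S := v)"
  by (auto simp: pick_def fun_eq_iff)

lemma rho_pick_meas:
  assumes "j \<in> tuples" "S \<in> set vs" "x \<in> space SX"
  shows "(\<lambda>c. \<rho> S x (pick j c)) \<in> borel_measurable QC"
proof -
  note [measurable] = pick_meas[OF assms(1)]
  have "(\<lambda>c. (x, pick j c)) \<in> measurable QC (SX \<Otimes>\<^sub>M PiM (set vs) q)"
    using assms(3) by measurable
  from measurable_compose[OF this rho_meas[OF assms(2)]] show ?thesis by simp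
qed

lemma rho_pick_dep:
  "sorted_wrt (\<lambda>S S'. \<forall>c v. ennreal (\<rho> S x (pick j (c((S', j S') := v)))) = ennreal (\<rho> S x (pick j c))) vs"
proof (rule sorted_wrt_mono_rel[OF _ rho_dep])
  fix S S' assume "S \<in> set vs" "S' \<in> set vs" "\<forall>x u v. \<rho> S x (u(S' := v)) = \<rho> S x u"
  then show "\<forall>c v. ennreal (\<rho> S x (pick j (c((S', j S') := v)))) = ennreal (\<rho> S x (pick j c))"
    by (simp add: pick_upd_same del: fun_upd_apply)
qed

lemma rho_pick_int:
  assumes "j \<in> tuples" "S \<in> set vs" "x \<in> space SX" "c \<in> space QC"
  shows "(\<integral>\<^sup>+v. ennreal (\<rho> S x (pick j (c((S, j S) := v)))) \<partial>q S) \<le> 1"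
  unfolding pick_upd_same[OF assms(2)]
  by (rule rho_int[OF assms(2,3)]) (use measurable_space[OF pick_meas[OF assms(1)] assms(4)] in simp)

text \<open>Words shared by \<open>j\<close> and \<open>j'\<close> keep the factor of
  \<open>j'\<close> alone. The other words of \<open>j\<close> are fresh and form the second layer;
  that \<open>pick j\<close> also reads shared words is harmless, since these are fixed while the
  fresh ones are integrated.\<close>

lemma pair_overlap_le_1:
  assumes j: "j \<in> tuples" and j': "j' \<in> tuples" and x: "x \<in> space SX"
  shows "(\<integral>\<^sup>+c. (\<Prod>S\<in>set vs. ennreal (\<rho> S x (pick j' c))) *
      (\<Prod>S\<in>{S\<in>set vs. j S \<noteq> j' S}. ennreal (\<rho> S x (pick j c))) \<partial>QC) \<le> 1"
proof -
  let ?ws = "filter (\<lambda>S. j S \<noteq> j' S) vs"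
  have "(\<integral>\<^sup>+c. (\<Prod>S\<in>set vs. ennreal (\<rho> S x (pick j' c))) *
      (\<Prod>S\<in>set ?ws. ennreal (\<rho> S x (pick j c))) \<partial>QC) \<le> 1"
  proof (rule two_layer_le_1[where i=j' and i'=j])
    show "sorted_wrt (\<lambda>S S'. \<forall>c v. ennreal (\<rho> S x (pick j (c((S', j S') := v)))) = ennreal (\<rho> S x (pick j c))) ?ws"
      by (rule sorted_wrt_filter) (rule rho_pick_dep)
    show "sorted_wrt (\<lambda>S S'. \<forall>c v. ennreal (\<rho> S x (pick j' (c((S', j' S') := v)))) = ennreal (\<rho> S x (pick j' c))) vs"
      by (rule rho_pick_dep)
    show "ennreal (\<rho> S x (pick j' (c((S', j S') := v)))) = ennreal (\<rho> S x (pick j' c))"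
      if "S \<in> set vs" "S' \<in> set ?ws" for S S' c v
      using that by (simp add: pick_upd_other del: fun_upd_apply)
  qed (use assms vs in \<open>auto simp: tuples_keys intro!: measurable_compose[OF _ measurable_ennreal] rho_pick_meas rho_pick_int simp del: fun_upd_apply\<close>)
  then show ?thesis by simp
qed

text \<open>The competitor differs from the true tuple exactly on \<open>D\<close>, where its words
  are fresh. Integrating those removes the factors \<open>g\<close>, and integrating the true words
  afterwards removes the factors \<open>\<rho>\<close>.\<close>

lemma packing_le_1:
  assumes j: "j \<in> tuples" and l: "l < m" and b: "b \<in> PiE (DS l) (\<lambda>S. {..<B S})"
    and D: "D = {S\<in>DS l. b S \<noteq> snd (j S)}"
    and x: "x \<in> space SX" and y: "y \<in> space (SY l)"
  shows "(\<integral>\<^sup>+c. (\<Prod>S\<in>set vs. ennreal (\<rho> S x (pick j c))) *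
      (\<Prod>S\<in>D. ennreal (g l D S y (dpick l (\<lambda>S. fst (j S)) b c))) \<partial>QC) \<le> 1"
proof -
  let ?ws = "filter (\<lambda>S. S \<in> D) vs"
  have Dsub: "D \<subseteq> DS l" using D by auto
  have Dset: "set ?ws = D" using Dsub DS[OF l] by auto
  let ?i' = "\<lambda>S. (fst (j S), b S)"
  have upd: "dpick l (\<lambda>S. fst (j S)) b (c((S, ?i' S) := v)) = (dpick l (\<lambda>S. fst (j S)) b c)(S := v)"
    if "S \<in> DS l" for S c v using that by (auto simp: dpick_def fun_eq_iff)
  have ne: "j S \<noteq> ?i' S" if "S \<in> D" for S
  proof
    assume "j S = ?i' S" then have "snd (j S) = b S" by (metis snd_conv)
    then show False using that D by auto
  qed
  have gm: "(\<lambda>c. g l D S y (dpick l (\<lambda>S. fst (j S)) b c)) \<in> borel_measurable QC" if "S \<in> D" for S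
  proof -
    note [measurable] = dpick_meas[OF j l b]
    have "(\<lambda>c. (y, dpick l (\<lambda>S. fst (j S)) b c)) \<in> measurable QC (SY l \<Otimes>\<^sub>M PiM (DS l) q)"
      using y by measurable
    from measurable_compose[OF this g_meas[OF l Dsub that]] show ?thesis by simp
  qed
  have "(\<integral>\<^sup>+c. (\<Prod>S\<in>set vs. ennreal (\<rho> S x (pick j c))) *
      (\<Prod>S\<in>set ?ws. ennreal (g l D S y (dpick l (\<lambda>S. fst (j S)) b c))) \<partial>QC) \<le> 1"
  proof (rule two_layer_le_1[where i=j and i'="?i'"])
    show "(S, ?i' S) \<in> keys" if "S \<in> set ?ws" for S
    proof -
      have "S \<in> DS l" "S \<in> set vs" using that Dsub by auto
      then have "j S \<in> idx S" "b S < B S" using j b by (auto simp: tuples_def PiE_iff)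
      then show ?thesis using \<open>S \<in> set vs\<close> by (auto simp: keys_def idx_def)
    qed
    show "sorted_wrt (\<lambda>S S'. \<forall>c v. ennreal (\<rho> S x (pick j (c((S', j S') := v)))) = ennreal (\<rho> S x (pick j c))) vs"
      by (rule rho_pick_dep)
    show "ennreal (\<rho> S x (pick j (c((S', ?i' S') := v)))) = ennreal (\<rho> S x (pick j c))"
      if "S \<in> set vs" "S' \<in> set ?ws" for S S' c v
      using ne[of S'] that by (subst pick_upd_other) auto
    show "sorted_wrt (\<lambda>S S'. \<forall>c v. ennreal (g l D S y (dpick l (\<lambda>S. fst (j S)) b (c((S', ?i' S') := v))))
        = ennreal (g l D S y (dpick l (\<lambda>S. fst (j S)) b c))) ?ws"
    proof (rule sorted_wrt_mono_rel[OF _ g_dep[OF l Dsub]])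
      fix S S' assume S: "S \<in> set ?ws" "S' \<in> set ?ws" and d: "\<forall>y u v. g l D S y (u(S' := v)) = g l D S y u"
      then have "S' \<in> DS l" using Dsub by auto
      then show "\<forall>c v. ennreal (g l D S y (dpick l (\<lambda>S. fst (j S)) b (c((S', ?i' S') := v))))
        = ennreal (g l D S y (dpick l (\<lambda>S. fst (j S)) b c))"
        using d by (simp only: upd) simp
    qed
    show "(\<integral>\<^sup>+v. ennreal (g l D S y (dpick l (\<lambda>S. fst (j S)) b (c((S, ?i' S) := v)))) \<partial>q S) \<le> 1"
      if "S \<in> set ?ws" "c \<in> space QC" for S c
    proof -
      have S: "S \<in> D" "S \<in> DS l" using that Dsub by auto
      show ?thesis unfolding upd[OF S(2)]
        by (rule g_int[OF l Dsub S(1) y]) (use measurable_space[OF dpick_meas[OF j l b] that(2)] in simp)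
    qed
    show "j S \<noteq> ?i' S" if "S \<in> set ?ws" for S using ne that by auto
    show "(\<lambda>c. ennreal (g l D S y (dpick l (\<lambda>S. fst (j S)) b c))) \<in> borel_measurable QC" if "S \<in> set ?ws" for S
      using gm[of S] that by auto
  qed (use assms vs in \<open>auto simp: tuples_keys intro!: measurable_compose[OF _ measurable_ennreal] rho_pick_meas rho_pick_int simp del: fun_upd_apply\<close>)
  then show ?thesis by (simp only: Dset)
qed

text \<open>A bound valid for every fixed source letter survives averaging over the source, and the
  letters are independent, so the bounds multiply.\<close>

lemma nn_integral_prod_OM_le_1:
  assumes f[measurable]: "f \<in> borel_measurable OM"
    and le: "\<And>a. a \<in> space P \<Longrightarrow> (\<integral>\<^sup>+c. f (a, c) \<partial>QC) \<le> (1::ennreal)"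
  shows "(\<integral>\<^sup>+z. (\<Prod>t<n. f (z t)) \<partial>PiM {..<n} (\<lambda>_. OM)) \<le> 1"
proof -
  interpret PP: prob_space P by (rule P)
  interpret QC: prob_space QC by (rule prob_space_QC)
  interpret PO: product_prob_space "\<lambda>_::nat. OM" by (rule product_prob_spaceI) (rule prob_space_OM)
  have "(\<integral>\<^sup>+z. f z \<partial>OM) = (\<integral>\<^sup>+a. \<integral>\<^sup>+c. f (a, c) \<partial>QC \<partial>P)"
    using f unfolding OM_def by (rule QC.nn_integral_fst[symmetric])
  also have "\<dots> \<le> (\<integral>\<^sup>+a. 1 \<partial>P)" by (rule nn_integral_mono) (rule le)
  also have "\<dots> = 1" by (simp add: PP.emeasure_space_1)
  finally have 1: "(\<integral>\<^sup>+z. f z \<partial>OM) \<le> 1" .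
  have "(\<integral>\<^sup>+z. (\<Prod>t<n. f (z t)) \<partial>PiM {..<n} (\<lambda>_. OM)) = (\<Prod>t<n. \<integral>\<^sup>+z. f z \<partial>OM)"
    by (rule PO.product_nn_integral_prod[of "{..<n}" "\<lambda>_. f", OF finite_lessThan f])
  also have "\<dots> \<le> 1" using power_mono[OF 1, of n] by simp
  finally show ?thesis .
qed

end

section \<open>Measurability of the covering and typicality events\<close>

context multi_codebook
begin

lemma cov_pred:
  assumes X: "\<And>t. t < n \<Longrightarrow> X t \<in> measurable M SX" and U: "\<And>t. t < n \<Longrightarrow> U t \<in> measurable M (PiM (set vs) q)"
  shows "Measurable.pred M (\<lambda>z. cov n \<theta> (\<lambda>t. X t z) (\<lambda>t. U t z))"
proof -
  have [measurable]: "(\<lambda>z. \<Prod>t<n. \<rho> S (X t z) (U t z)) \<in> borel_measurable M" if "S \<in> set vs" for S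
  proof (rule borel_measurable_prod)
    fix t assume "t \<in> {..<n}"
    then have "(\<lambda>z. (X t z, U t z)) \<in> measurable M (SX \<Otimes>\<^sub>M PiM (set vs) q)"
      using X[of t] U[of t] by (intro measurable_Pair) auto
    from measurable_compose[OF this rho_meas[OF that]] show "(\<lambda>z. \<rho> S (X t z) (U t z)) \<in> borel_measurable M"
      by simp
  qed
  show ?thesis unfolding cov_def by measurable
qed

lemma jtyp_pred:
  assumes l: "l < m"
    and Y: "\<And>t. t < n \<Longrightarrow> Y t \<in> measurable M (SY l)" and U: "\<And>t. t < n \<Longrightarrow> U t \<in> measurable M (PiM (DS l) q)"
  shows "Measurable.pred M (\<lambda>z. jtyp n \<theta> l (\<lambda>t. Y t z) (\<lambda>t. U t z))"
proof -
  have [measurable]: "(\<lambda>z. \<Prod>t<n. \<Prod>S\<in>D. g l D S (Y t z) (U t z)) \<in> borel_measurable M" if "D \<in> Pow (DS l) - {{}}" for D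
  proof (intro borel_measurable_prod)
    fix t S assume "t \<in> {..<n}" and S: "S \<in> D"
    then have "(\<lambda>z. (Y t z, U t z)) \<in> measurable M (SY l \<Otimes>\<^sub>M PiM (DS l) q)"
      using Y[of t] U[of t] by (intro measurable_Pair) auto
    from measurable_compose[OF this g_meas[OF l _ S]] that
    show "(\<lambda>z. g l D S (Y t z) (U t z)) \<in> borel_measurable M" by simp
  qed
  have "finite (Pow (DS l) - {{}})" using finite_DS[OF l] by auto
  then show ?thesis unfolding jtyp_def by measurable
qed

lemma cov_cong: "(\<And>t. t < n \<Longrightarrow> xs t = xs' t) \<Longrightarrow> (\<And>t. t < n \<Longrightarrow> us t = us' t) \<Longrightarrow>
    cov n \<theta> xs us = cov n \<theta> xs' us'"
  unfolding cov_def by simp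

lemma jtyp_cong: "(\<And>t. t < n \<Longrightarrow> xs t = xs' t) \<Longrightarrow> (\<And>t. t < n \<Longrightarrow> us t = us' t) \<Longrightarrow>
    jtyp n \<theta> l xs us = jtyp n \<theta> l xs' us'"
  unfolding jtyp_def by simp

end

context multi_codebook_n
begin

lemma covZ_meas[measurable]: "Measurable.pred (PiM {..<n} (\<lambda>_. RM)) covZ"
  unfolding covZ_def
proof (rule cov_pred)
  fix t assume "t < n"
  then have [measurable]: "(\<lambda>z. z t) \<in> measurable (PiM {..<n} (\<lambda>_. RM)) (P \<Otimes>\<^sub>M PiM (set vs) q)"
    using component_meas[of t RM] by (simp add: RM_def)
  show "(\<lambda>z. px (fst (z t))) \<in> measurable (PiM {..<n} (\<lambda>_. RM)) SX" by measurable
  show "(\<lambda>z. snd (z t)) \<in> measurable (PiM {..<n} (\<lambda>_. RM)) (PiM (set vs) q)" by measurable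
qed

lemma okZ_meas[measurable]: "Measurable.pred (PiM {..<n} (\<lambda>_. RM)) okZ"
proof -
  have [measurable]: "Measurable.pred (PiM {..<n} (\<lambda>_. RM)) (\<lambda>z. jtyp n \<theta> l (\<lambda>t. py l (fst (z t))) (\<lambda>t. restrict (snd (z t)) (DS l)))"
    if l: "l < m" for l
  proof (rule jtyp_pred[OF l])
    fix t assume "t < n"
    then have [measurable]: "(\<lambda>z. z t) \<in> measurable (PiM {..<n} (\<lambda>_. RM)) (P \<Otimes>\<^sub>M PiM (set vs) q)"
      using component_meas[of t RM] by (simp add: RM_def)
    note [measurable] = py[OF l] measurable_restrict_subset[OF DS[OF l], of q]
    show "(\<lambda>z. py l (fst (z t))) \<in> measurable (PiM {..<n} (\<lambda>_. RM)) (SY l)" by measurable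
    show "(\<lambda>z. restrict (snd (z t)) (DS l)) \<in> measurable (PiM {..<n} (\<lambda>_. RM)) (PiM (DS l) q)"
      by (rule measurable_compose[OF _ measurable_restrict_subset[OF DS[OF l]]]) measurable
  qed
  show ?thesis unfolding okZ_def by measurable
qed

lemma dec_meas[measurable]:
  assumes "j \<in> tuples" "l < m" "b \<in> PiE (DS l) (\<lambda>S. {..<B S})"
  shows "Measurable.pred (PiM {..<n} (\<lambda>_. OM))
    (\<lambda>z. jtyp n \<theta> l (\<lambda>t. py l (fst (z t))) (\<lambda>t. dpick l (\<lambda>S. fst (j S)) b (snd (z t))))"
proof (rule jtyp_pred[OF assms(2)])
  fix t assume "t < n"
  then have [measurable]: "(\<lambda>z. z t) \<in> measurable (PiM {..<n} (\<lambda>_. OM)) (P \<Otimes>\<^sub>M QC)"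
    using component_meas[of t OM] by (simp add: OM_def)
  note [measurable] = py[OF assms(2)] dpick_meas[OF assms]
  show "(\<lambda>z. py l (fst (z t))) \<in> measurable (PiM {..<n} (\<lambda>_. OM)) (SY l)" by measurable
  show "(\<lambda>z. dpick l (\<lambda>S. fst (j S)) b (snd (z t))) \<in> measurable (PiM {..<n} (\<lambda>_. OM)) (PiM (DS l) q)"
    by measurable
qed

lemma bad_meas[measurable]:
  assumes j: "j \<in> tuples" shows "Measurable.pred (PiM {..<n} (\<lambda>_. OM)) (bad j)"
proof -
  note [measurable] = zmap_meas[OF j] dec_meas[OF j]
  have [simp]: "finite (PiE (DS l) (\<lambda>S. {..<B S}))" if "l < m" for l
    using finite_DS[OF that] by (intro finite_PiE) auto
  show ?thesis unfolding bad_def by measurable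
qed

section \<open>Moments of the encoder weights\<close>

definition E :: "'s \<Rightarrow> real" where "E S = exp (real n * (R S + R' S + \<theta>))"

text \<open>Unnormalized weight of the tuple \<open>j\<close>: the likelihood ratio of the joint law
  against the independent one, set to zero where a cap in \<open>cov\<close> is violated.\<close>

definition yZ :: "('s \<Rightarrow> nat \<times> nat) \<Rightarrow> (nat \<Rightarrow> 'a \<times> ('s \<times> nat \<times> nat \<Rightarrow> 'u)) \<Rightarrow> real" where
  "yZ j z = wZ (zmap j z) * of_bool (covZ (zmap j z))"

lemma zmap_nth: "t < n \<Longrightarrow> zmap j z t = (fst (z t), pick j (snd (z t)))"
  by (simp add: zmap_def compose_def)

lemma yZ_nonneg: "yZ j z \<ge> 0" by (simp add: yZ_def wZ_nonneg)

lemma yZ_meas[measurable]: "j \<in> tuples \<Longrightarrow> yZ j \<in> borel_measurable (PiM {..<n} (\<lambda>_. OM))"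
proof -
  assume j: "j \<in> tuples"
  note [measurable] = zmap_meas[OF j]
  show ?thesis unfolding yZ_def by measurable
qed

lemma rho_letter_meas:
  "j \<in> tuples \<Longrightarrow> S \<in> set vs \<Longrightarrow> (\<lambda>z. \<rho> S (px (fst z)) (pick j (snd z))) \<in> borel_measurable OM"
  using measurable_compose[OF letter_meas rho_meas_RM, of j S] by simp

text \<open>A codeword shared by \<open>j\<close> and \<open>j'\<close> would contribute the square
  of a density; there one of the two factors is replaced by its cap \<open>E S\<close>, granted by
  \<open>covZ\<close> for \<open>j\<close>. What remains factorizes over time into the integrand of
  \<open>pair_overlap_le_1\<close>. The cap for \<open>j'\<close> is dropped.\<close>

lemma second_moment_pair:
  assumes j: "j \<in> tuples" and j': "j' \<in> tuples"
  shows "(\<integral>\<^sup>+z. ennreal (yZ j z * yZ j' z) \<partial>PiM {..<n} (\<lambda>_. OM))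
    \<le> ennreal (\<Prod>S\<in>set vs. if j S = j' S then E S else 1)"
proof -
  define C where "C = (\<Prod>S\<in>set vs. if j S = j' S then E S else 1)"
  have C0: "C \<ge> 0" unfolding C_def by (intro prod_nonneg) (auto simp: E_def)
  let ?D = "{S\<in>set vs. j S \<noteq> j' S}" and ?A = "{S\<in>set vs. j S = j' S}"
  define f where "f z = (\<Prod>S\<in>set vs. ennreal (\<rho> S (px (fst z)) (pick j' (snd z)))) *
      (\<Prod>S\<in>?D. ennreal (\<rho> S (px (fst z)) (pick j (snd z))))" for z
  have fm[measurable]: "f \<in> borel_measurable OM"
    unfolding f_def
    by (intro borel_measurable_times_ennreal borel_measurable_prod_ennreal measurable_compose[OF _ measurable_ennreal] rho_letter_meas j j') auto
  have "ennreal (yZ j z * yZ j' z) \<le> ennreal C * (\<Prod>t<n. f (z t))" for z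
  proof -
    define r where "r i S t = \<rho> S (px (fst (z t))) (pick i (snd (z t)))" for i S t
    have r0: "r i S t \<ge> 0" for i S t unfolding r_def by (rule rho_nonneg)
    have wr: "wZ (zmap i z) = (\<Prod>t<n. \<Prod>S\<in>set vs. r i S t)" for i
      unfolding wZ_def w_def r_def by (intro prod.cong refl) (simp add: zmap_nth)
    have "yZ j z \<le> C * (\<Prod>t<n. \<Prod>S\<in>?D. r j S t)"
    proof (cases "covZ (zmap j z)")
      case False
      then show ?thesis using C0 r0 by (auto simp: yZ_def intro!: mult_nonneg_nonneg prod_nonneg)
    next
      case True
      have le: "(\<Prod>t<n. r j S t) \<le> E S" if "S \<in> set vs" for S
      proof -
        have "(\<Prod>t<n. r j S t) = (\<Prod>t<n. \<rho> S (px (fst (zmap j z t))) (snd (zmap j z t)))"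
          unfolding r_def by (intro prod.cong refl) (simp add: zmap_nth)
        also have "\<dots> \<le> E S" using True that unfolding covZ_def cov_def E_def by auto
        finally show ?thesis .
      qed
      have "yZ j z = (\<Prod>S\<in>set vs. \<Prod>t<n. r j S t)"
        using True by (simp add: yZ_def wr) (rule prod.swap)
      also have "\<dots> = (\<Prod>S\<in>?A. \<Prod>t<n. r j S t) * (\<Prod>S\<in>?D. \<Prod>t<n. r j S t)"
        by (subst prod.union_disjoint[symmetric]) (auto intro!: prod.cong)
      also have "\<dots> \<le> (\<Prod>S\<in>?A. E S) * (\<Prod>S\<in>?D. \<Prod>t<n. r j S t)"
        using le r0 by (intro mult_right_mono prod_mono prod_nonneg ballI conjI) auto
      also have "(\<Prod>S\<in>?A. E S) = C"
        unfolding C_def by (simp add: prod.If_cases Int_def)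
      also have "(\<Prod>S\<in>?D. \<Prod>t<n. r j S t) = (\<Prod>t<n. \<Prod>S\<in>?D. r j S t)" by (rule prod.swap)
      finally show ?thesis .
    qed
    moreover have "yZ j' z \<le> (\<Prod>t<n. \<Prod>S\<in>set vs. r j' S t)"
      using wZ_nonneg[of "zmap j' z"] by (auto simp: yZ_def wr)
    ultimately have "yZ j z * yZ j' z \<le> (C * (\<Prod>t<n. \<Prod>S\<in>?D. r j S t)) * (\<Prod>t<n. \<Prod>S\<in>set vs. r j' S t)"
      using C0 r0 by (intro mult_mono yZ_nonneg) (auto intro!: mult_nonneg_nonneg prod_nonneg)
    also have "\<dots> = C * (\<Prod>t<n. (\<Prod>S\<in>set vs. r j' S t) * (\<Prod>S\<in>?D. r j S t))"
      by (simp add: prod.distrib mult_ac)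
    finally have "ennreal (yZ j z * yZ j' z) \<le> ennreal (C * (\<Prod>t<n. (\<Prod>S\<in>set vs. r j' S t) * (\<Prod>S\<in>?D. r j S t)))"
      by (rule ennreal_leI)
    also have "\<dots> = ennreal C * (\<Prod>t<n. f (z t))"
    proof -
      have "f (z t) = ennreal ((\<Prod>S\<in>set vs. r j' S t) * (\<Prod>S\<in>?D. r j S t))" for t
        unfolding f_def r_def[symmetric] using r0 by (simp add: prod_ennreal ennreal_mult prod_nonneg)
      then have "(\<Prod>t<n. f (z t)) = (\<Prod>t<n. ennreal ((\<Prod>S\<in>set vs. r j' S t) * (\<Prod>S\<in>?D. r j S t)))"
        by (simp only:)
      also have "\<dots> = ennreal (\<Prod>t<n. (\<Prod>S\<in>set vs. r j' S t) * (\<Prod>S\<in>?D. r j S t))"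
        by (rule prod_ennreal) (use r0 in \<open>auto intro!: mult_nonneg_nonneg prod_nonneg\<close>)
      finally show ?thesis using C0 by (simp only: ennreal_mult')
    qed
    finally show ?thesis .
  qed
  then have "(\<integral>\<^sup>+z. ennreal (yZ j z * yZ j' z) \<partial>PiM {..<n} (\<lambda>_. OM))
     \<le> (\<integral>\<^sup>+z. ennreal C * (\<Prod>t<n. f (z t)) \<partial>PiM {..<n} (\<lambda>_. OM))"
    by (intro nn_integral_mono)
  also have "\<dots> = ennreal C * (\<integral>\<^sup>+z. (\<Prod>t<n. f (z t)) \<partial>PiM {..<n} (\<lambda>_. OM))"
    by (rule nn_integral_cmult) (auto intro!: borel_measurable_prod_ennreal measurable_compose[OF component_meas fm])
  also have "\<dots> \<le> ennreal C * 1"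
  proof (intro mult_left_mono nn_integral_prod_OM_le_1 fm)
    fix a assume "a \<in> space P"
    then have "px a \<in> space SX" by (rule measurable_space[OF px])
    from pair_overlap_le_1[OF j j' this] show "(\<integral>\<^sup>+c. f (a, c) \<partial>QC) \<le> 1" by (simp add: f_def)
  qed simp
  finally show ?thesis by (simp add: C_def)
qed

lemma first_moment:
  assumes j: "j \<in> tuples"
  shows "(\<integral>\<^sup>+z. ennreal (yZ j z) \<partial>PiM {..<n} (\<lambda>_. OM))
    = emeasure (PiM {..<n} (\<lambda>_. JM)) {z\<in>space (PiM {..<n} (\<lambda>_. RM)). covZ z}"
proof -
  note [measurable] = zmap_meas[OF j]
  have s: "sets (PiM {..<n} (\<lambda>_. JM)) = sets (PiM {..<n} (\<lambda>_. RM))"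
    by (intro sets_PiM_cong) (auto simp: JM_def)
  have "(\<integral>\<^sup>+z. ennreal (yZ j z) \<partial>PiM {..<n} (\<lambda>_. OM)) =
    (\<integral>\<^sup>+z. ennreal (wZ (zmap j z)) * indicator {z\<in>space (PiM {..<n} (\<lambda>_. RM)). covZ z} (zmap j z) \<partial>PiM {..<n} (\<lambda>_. OM))"
  proof (rule nn_integral_cong)
    fix z assume "z \<in> space (PiM {..<n} (\<lambda>_. OM))"
    then have "zmap j z \<in> space (PiM {..<n} (\<lambda>_. RM))" by (rule measurable_space[OF zmap_meas[OF j]])
    then show "ennreal (yZ j z) = ennreal (wZ (zmap j z)) * indicator {z\<in>space (PiM {..<n} (\<lambda>_. RM)). covZ z} (zmap j z)"
      by (auto simp: yZ_def indicator_def)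
  qed
  also have "\<dots> = (\<integral>\<^sup>+z. indicator {z\<in>space (PiM {..<n} (\<lambda>_. RM)). covZ z} z \<partial>PiM {..<n} (\<lambda>_. JM))"
    by (rule nn_integral_zmap[OF j]) measurable
  also have "\<dots> = emeasure (PiM {..<n} (\<lambda>_. JM)) {z\<in>space (PiM {..<n} (\<lambda>_. RM)). covZ z}"
    by (rule nn_integral_indicator) (simp add: s)
  finally show ?thesis .
qed

definition NZ :: "(nat \<Rightarrow> 'a \<times> ('s \<times> nat \<times> nat \<Rightarrow> 'u)) \<Rightarrow> real" where
  "NZ z = (\<Sum>j\<in>tuples. yZ j z / real (card tuples))"

lemma NZ_meas[measurable]: "NZ \<in> borel_measurable (PiM {..<n} (\<lambda>_. OM))"
  unfolding NZ_def by (intro borel_measurable_sum borel_measurable_divide yZ_meas) auto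

lemma NZ_nonneg: "NZ z \<ge> 0" unfolding NZ_def by (intro sum_nonneg divide_nonneg_nonneg yZ_nonneg) auto

text \<open>Summing over tuples of indices is multiplying sums over single indices. For each
  \<open>S\<close> one index agrees with \<open>j S\<close> and contributes \<open>E S\<close>; the
  others contribute 1 each.\<close>

lemma sum_overlap:
  assumes j: "j \<in> tuples"
  shows "(\<Sum>j'\<in>tuples. \<Prod>S\<in>set vs. if j S = j' S then E S else 1) = (\<Prod>S\<in>set vs. E S + (real (A S * B S) - 1))"
proof -
  have "(\<Sum>j'\<in>tuples. \<Prod>S\<in>set vs. if j S = j' S then E S else 1) = (\<Prod>S\<in>set vs. \<Sum>i\<in>idx S. if j S = i then E S else 1)"
    unfolding tuples_def by (rule prod_sum_PiE[symmetric]) (auto simp: idx_def)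
  also have "\<dots> = (\<Prod>S\<in>set vs. E S + (real (A S * B S) - 1))"
  proof (rule prod.cong[OF refl])
    fix S assume "S \<in> set vs"
    then have jS: "j S \<in> idx S" using j by (auto simp: tuples_def)
    have fin: "finite (idx S)" by (simp add: idx_def)
    have "(\<Sum>i\<in>idx S. if j S = i then E S else 1) = E S + (\<Sum>i\<in>idx S - {j S}. if j S = i then E S else 1)"
      using sum.remove[OF fin jS, of "\<lambda>i. if j S = i then E S else 1"] by simp
    also have "(\<Sum>i\<in>idx S - {j S}. if j S = i then E S else 1) = (\<Sum>i\<in>idx S - {j S}. 1)"
      by (intro sum.cong) auto
    also have "\<dots> = real (card (idx S)) - 1"
    proof -
      have "card (idx S) > 0" using fin jS by (auto simp: card_gt_0_iff)
      then show ?thesis using jS by (simp add: of_nat_diff)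
    qed
    also have "real (card (idx S)) = real (A S * B S)" by (simp add: idx_def card_cartesian_product)
    finally show "(\<Sum>i\<in>idx S. if j S = i then E S else 1) = E S + (real (A S * B S) - 1)" .
  qed
  finally show ?thesis .
qed

text \<open>After \<open>sum_overlap\<close> the inner sum no longer depends on \<open>j\<close>.
  The bound tends to 1 once every codebook is exponentially larger than the cap
  \<open>E S\<close>.\<close>

lemma NZ_second_moment:
  "(\<integral>\<^sup>+z. ennreal ((NZ z)\<^sup>2) \<partial>PiM {..<n} (\<lambda>_. OM)) \<le> ennreal (\<Prod>S\<in>set vs. 1 + E S / real (A S * B S))"
proof -
  let ?O = "PiM {..<n} (\<lambda>_. OM)" and ?K = "real (card tuples)"
  have K: "?K > 0" using card_tuples_pos by simp
  have "(\<integral>\<^sup>+z. ennreal ((NZ z)\<^sup>2) \<partial>?O) = (\<integral>\<^sup>+z. (\<Sum>j\<in>tuples. \<Sum>j'\<in>tuples. ennreal (1 / ?K\<^sup>2) * ennreal (yZ j z * yZ j' z)) \<partial>?O)"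
  proof (rule nn_integral_cong)
    fix z
    have "(NZ z)\<^sup>2 = (\<Sum>j\<in>tuples. \<Sum>j'\<in>tuples. (yZ j z / ?K) * (yZ j' z / ?K))"
      unfolding NZ_def power2_eq_square by (rule sum_product)
    also have "\<dots> = (\<Sum>j\<in>tuples. \<Sum>j'\<in>tuples. 1 / ?K\<^sup>2 * (yZ j z * yZ j' z))"
      by (intro sum.cong refl) (simp add: power2_eq_square)
    finally show "ennreal ((NZ z)\<^sup>2) = (\<Sum>j\<in>tuples. \<Sum>j'\<in>tuples. ennreal (1 / ?K\<^sup>2) * ennreal (yZ j z * yZ j' z))"
      by (simp add: sum_ennreal[symmetric] sum_nonneg yZ_nonneg ennreal_mult'[symmetric] del: sum_ennreal)
  qed
  also have "\<dots> = (\<Sum>j\<in>tuples. \<Sum>j'\<in>tuples. ennreal (1 / ?K\<^sup>2) * (\<integral>\<^sup>+z. ennreal (yZ j z * yZ j' z) \<partial>?O))"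
  proof -
    have m: "(\<lambda>z. ennreal (yZ j z * yZ j' z)) \<in> borel_measurable ?O" if "j \<in> tuples" "j' \<in> tuples" for j j'
      using yZ_meas[OF that(1)] yZ_meas[OF that(2)] by measurable
    show ?thesis
      by (subst nn_integral_sum, intro borel_measurable_sum borel_measurable_times_ennreal borel_measurable_const m, simp, simp)
         (intro sum.cong refl, subst nn_integral_sum,
          auto intro!: borel_measurable_times_ennreal borel_measurable_const m sum.cong nn_integral_cmult)
  qed
  also have "\<dots> \<le> (\<Sum>j\<in>tuples. \<Sum>j'\<in>tuples. ennreal (1 / ?K\<^sup>2) * ennreal (\<Prod>S\<in>set vs. if j S = j' S then E S else 1))"
    by (intro sum_mono mult_left_mono second_moment_pair) auto
  also have "\<dots> = ennreal (\<Sum>j\<in>tuples. \<Sum>j'\<in>tuples. 1 / ?K\<^sup>2 * (\<Prod>S\<in>set vs. if j S = j' S then E S else 1))"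
  proof -
    have "(\<Prod>S\<in>set vs. if j S = j' S then E S else 1) \<ge> 0" for j j' :: "'s \<Rightarrow> nat \<times> nat"
      by (intro prod_nonneg) (auto simp: E_def)
    then show ?thesis
      by (simp add: sum_ennreal[symmetric] sum_nonneg ennreal_mult'[symmetric] del: sum_ennreal)
  qed
  also have "(\<Sum>j\<in>tuples. \<Sum>j'\<in>tuples. 1 / ?K\<^sup>2 * (\<Prod>S\<in>set vs. if j S = j' S then E S else 1))
      = (\<Sum>j\<in>tuples. 1 / ?K\<^sup>2 * (\<Prod>S\<in>set vs. E S + (real (A S * B S) - 1)))"
    by (intro sum.cong refl) (simp add: sum_distrib_left[symmetric] sum_overlap del: times_divide_eq_left)
  also have "\<dots> = (\<Prod>S\<in>set vs. E S + (real (A S * B S) - 1)) / ?K"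
    using K by (simp add: power2_eq_square)
  also have "\<dots> = (\<Prod>S\<in>set vs. (E S + (real (A S * B S) - 1)) / real (A S * B S))"
    by (simp add: card_tuples prod_dividef)
  also have "\<dots> \<le> (\<Prod>S\<in>set vs. 1 + E S / real (A S * B S))"
  proof (intro prod_mono conjI)
    fix S
    have AB: "real (A S * B S) \<ge> 1" using A[of S] B[of S]
      by (metis Suc_leI One_nat_def mult_pos_pos of_nat_1 of_nat_le_iff)
    then show "0 \<le> (E S + (real (A S * B S) - 1)) / real (A S * B S)"
      by (intro divide_nonneg_nonneg add_nonneg_nonneg) (auto simp: E_def)
    show "(E S + (real (A S * B S) - 1)) / real (A S * B S) \<le> 1 + E S / real (A S * B S)"
      using AB A[of S] B[of S] by (simp add: field_simps)
  qed
  finally show ?thesis by (simp add: ennreal_leI)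
qed

text \<open>Chebyshev's inequality around 1: the indicator of \<open>NZ < 1/2\<close> is at most 4
  (1 - NZ)^2. With \<open>p\<close> the probability of \<open>covZ\<close> (the mean of
  \<open>NZ\<close>) and \<open>c\<close> the second moment bound, the mean of the right side is at
  most 4 (c - 1) + 8 (1 - p).\<close>

lemma prob_NZ_small:
  "measure (PiM {..<n} (\<lambda>_. OM)) {z\<in>space (PiM {..<n} (\<lambda>_. OM)). NZ z < 1/2}
    \<le> 8 * measure (PiM {..<n} (\<lambda>_. JM)) {z\<in>space (PiM {..<n} (\<lambda>_. JM)). \<not> covZ z}
      + 4 * ((\<Prod>S\<in>set vs. 1 + E S / real (A S * B S)) - 1)"
proof -
  let ?O = "PiM {..<n} (\<lambda>_. OM)" and ?J = "PiM {..<n} (\<lambda>_. JM)" and ?K = "real (card tuples)"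
  interpret O: prob_space ?O by (rule prob_space_PiM) (rule prob_space_OM)
  interpret JJ: prob_space ?J by (rule prob_space_PiM) (rule JM)
  have K: "?K > 0" using card_tuples_pos by simp
  have s[measurable_cong]: "sets ?J = sets (PiM {..<n} (\<lambda>_. RM))"
    by (intro sets_PiM_cong) (auto simp: JM_def)
  have sp: "space ?J = space (PiM {..<n} (\<lambda>_. RM))" using s by (rule sets_eq_imp_space_eq)
  let ?p = "measure ?J {z\<in>space ?J. covZ z}"
  let ?c = "\<Prod>S\<in>set vs. 1 + E S / real (A S * B S)"
  have c0: "?c \<ge> 0" by (intro prod_nonneg) (auto simp: E_def)
  have EN: "(\<integral>\<^sup>+z. ennreal (NZ z) \<partial>?O) = ennreal ?p"
  proof -
    have "(\<integral>\<^sup>+z. ennreal (NZ z) \<partial>?O) = (\<integral>\<^sup>+z. (\<Sum>j\<in>tuples. ennreal (1/?K) * ennreal (yZ j z)) \<partial>?O)"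
      by (intro nn_integral_cong)
         (simp add: NZ_def sum_ennreal[symmetric] yZ_nonneg ennreal_mult'[symmetric] del: sum_ennreal)
    also have "\<dots> = (\<Sum>j\<in>tuples. ennreal (1/?K) * (\<integral>\<^sup>+z. ennreal (yZ j z) \<partial>?O))"
      by (subst nn_integral_sum)
         (auto intro!: borel_measurable_times_ennreal measurable_compose[OF yZ_meas measurable_ennreal] sum.cong nn_integral_cmult)
    also have "\<dots> = (\<Sum>j\<in>tuples. ennreal (1/?K) * ennreal ?p)"
      by (intro sum.cong refl) (simp add: first_moment JJ.emeasure_eq_measure sp)
    also have "\<dots> = ennreal (\<Sum>j\<in>tuples. 1/?K * ?p)"
      by (simp add: sum_ennreal[symmetric] ennreal_mult'[symmetric] del: sum_ennreal sum_constant)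
    also have "(\<Sum>j\<in>tuples. 1/?K * ?p) = ?p" using K by simp
    finally show ?thesis .
  qed
  have "ennreal (measure ?O {z\<in>space ?O. NZ z < 1/2} + 8 * ?p)
     = emeasure ?O {z\<in>space ?O. NZ z < 1/2} + 8 * (\<integral>\<^sup>+z. ennreal (NZ z) \<partial>?O)"
    by (simp add: EN O.emeasure_eq_measure ennreal_mult')
  also have "\<dots> = (\<integral>\<^sup>+z. indicator {z\<in>space ?O. NZ z < 1/2} z + 8 * ennreal (NZ z) \<partial>?O)"
    by (subst nn_integral_add) (auto simp: nn_integral_cmult)
  also have "\<dots> \<le> (\<integral>\<^sup>+z. 4 * ennreal ((NZ z)\<^sup>2) + 4 \<partial>?O)"
  proof (rule nn_integral_mono)
    fix z
    \<comment> \<open>The mixed term of 4 (1 - NZ)^2 stands on the left, so that no subtraction of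
      \<open>ennreal\<close> integrals occurs.\<close>
    have "of_bool (NZ z < 1/2) + 8 * NZ z \<le> 4 * (NZ z)\<^sup>2 + 4"
    proof (cases "NZ z < 1/2")
      case True
      then have "(1 - NZ z)\<^sup>2 \<ge> (1/2)\<^sup>2" by (intro power_mono) auto
      then show ?thesis using True by (simp add: power2_eq_square algebra_simps)
    next
      case False
      have "(1 - NZ z)\<^sup>2 \<ge> 0" by simp
      then show ?thesis using False by (simp add: power2_eq_square algebra_simps)
    qed
    then have "ennreal (of_bool (NZ z < 1/2) + 8 * NZ z) \<le> ennreal (4 * (NZ z)\<^sup>2 + 4)" by (rule ennreal_leI)
    moreover have "indicator {z\<in>space ?O. NZ z < 1/2} z \<le> ennreal (of_bool (NZ z < 1/2))"
      by (auto simp: indicator_def)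
    ultimately show "indicator {z\<in>space ?O. NZ z < 1/2} z + 8 * ennreal (NZ z) \<le> 4 * ennreal ((NZ z)\<^sup>2) + 4"
      using NZ_nonneg[of z] by (simp add: ennreal_plus ennreal_mult' del: ennreal_plus[symmetric]) (auto intro: order_trans[OF add_right_mono])
  qed
  also have "\<dots> = 4 * (\<integral>\<^sup>+z. ennreal ((NZ z)\<^sup>2) \<partial>?O) + 4"
    by (subst nn_integral_add) (auto simp: nn_integral_cmult O.emeasure_space_1)
  also have "\<dots> \<le> 4 * ennreal ?c + 4"
    by (intro add_right_mono mult_left_mono NZ_second_moment) auto
  also have "\<dots> = ennreal (4 * ?c + 4)" using c0 by (simp add: ennreal_mult')
  finally have "measure ?O {z\<in>space ?O. NZ z < 1/2} + 8 * ?p \<le> 4 * ?c + 4"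
    using c0 by (subst (asm) ennreal_le_iff) auto
  moreover have "measure ?J {z\<in>space ?J. \<not> covZ z} = 1 - ?p"
  proof -
    have "{z\<in>space ?J. covZ z} \<in> sets ?J" by measurable
    then have "JJ.prob (space ?J - {z\<in>space ?J. covZ z}) = 1 - ?p" by (rule JJ.prob_compl)
    moreover have "space ?J - {z\<in>space ?J. covZ z} = {z\<in>space ?J. \<not> covZ z}" by auto
    ultimately show ?thesis by simp
  qed
  ultimately show ?thesis by simp
qed

end

section \<open>Decoding errors and the choice of a good codebook\<close>

lemma prob_space_nn_integral_less:
  assumes "prob_space M" "(\<integral>\<^sup>+x. f x \<partial>M) < e"
  shows "\<exists>x\<in>space M. f x < e"
proof (rule ccontr)
  interpret prob_space M by fact
  assume "\<not> ?thesis"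
  then have "(\<integral>\<^sup>+x. e \<partial>M) \<le> (\<integral>\<^sup>+x. f x \<partial>M)" by (intro nn_integral_mono) (auto simp: not_less)
  then show False using assms(2) by (simp add: emeasure_space_1)
qed

context multi_codebook_n
begin

lemma wZ_zmap: "wZ (zmap j z) = (\<Prod>t<n. \<Prod>S\<in>set vs. \<rho> S (px (fst (z t))) (pick j (snd (z t))))"
  unfolding wZ_def w_def by (intro prod.cong refl) (simp add: zmap_nth)

text \<open>Typicality for the set \<open>D\<close> of wrong positions makes \<open>C\<close> times
  the product of the \<open>g\<close> at least 1, and this product replaces the indicator. The bound
  depends on \<open>b\<close> through a product over \<open>S\<close>, so its sum over all
  \<open>b\<close> factorizes.\<close>

lemma packing:
  assumes j: "j \<in> tuples" and l: "l < m" and b: "b \<in> PiE (DS l) (\<lambda>S. {..<B S})"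
    and ne: "b \<noteq> (\<lambda>S\<in>DS l. snd (j S))"
  shows "(\<integral>\<^sup>+z. ennreal (wZ (zmap j z)) * indicator {z\<in>space (PiM {..<n} (\<lambda>_. OM)).
      jtyp n \<theta> l (\<lambda>t. py l (fst (z t))) (\<lambda>t. dpick l (\<lambda>S. fst (j S)) b (snd (z t)))} z \<partial>PiM {..<n} (\<lambda>_. OM))
    \<le> ennreal (exp (real n * \<theta>) * (\<Prod>S\<in>DS l. if b S = snd (j S) then 1 else exp (- real n * R' S)))"
proof -
  let ?O = "PiM {..<n} (\<lambda>_. OM)"
  define D where "D = {S\<in>DS l. b S \<noteq> snd (j S)}"
  have Dsub: "D \<subseteq> DS l" by (auto simp: D_def)
  have finD: "finite D" using Dsub finite_DS[OF l] by (rule finite_subset)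
  \<comment> \<open>\<open>jtyp\<close> tests nonempty sets, so a competitor must differ somewhere
    for its own test to exist.\<close>
  have Dne: "D \<noteq> {}"
  proof
    assume "D = {}"
    then have "b = (\<lambda>S\<in>DS l. snd (j S))" using b by (intro ext) (auto simp: D_def PiE_iff extensional_def restrict_def)
    then show False using ne by simp
  qed
  define C where "C = exp (- real n * ((\<Sum>S\<in>D. R' S) - \<theta>))"
  have C_eq: "C = exp (real n * \<theta>) * (\<Prod>S\<in>DS l. if b S = snd (j S) then 1 else exp (- real n * R' S))"
  proof -
    have "C = exp (real n * \<theta>) * exp (\<Sum>S\<in>D. - real n * R' S)"
      unfolding C_def exp_add[symmetric] by (simp add: sum_distrib_left[symmetric] algebra_simps sum_negf)
    also have "exp (\<Sum>S\<in>D. - real n * R' S) = (\<Prod>S\<in>D. exp (- real n * R' S))" using finD by (rule exp_sum)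
    also have "\<dots> = (\<Prod>S\<in>DS l. if b S = snd (j S) then 1 else exp (- real n * R' S))"
      unfolding D_def using finite_DS[OF l] by (intro prod.mono_neutral_cong_left) auto
    finally show ?thesis .
  qed
  define f where "f z = (\<Prod>S\<in>set vs. ennreal (\<rho> S (px (fst z)) (pick j (snd z)))) *
     (\<Prod>S\<in>D. ennreal (g l D S (py l (fst z)) (dpick l (\<lambda>S. fst (j S)) b (snd z))))" for z
  have gm: "(\<lambda>z. g l D S (py l (fst z)) (dpick l (\<lambda>S. fst (j S)) b (snd z))) \<in> borel_measurable OM" if "S \<in> D" for S
  proof -
    note [measurable] = dpick_meas[OF j l b] py[OF l]
    have "(\<lambda>z. (py l (fst z), dpick l (\<lambda>S. fst (j S)) b (snd z))) \<in> measurable OM (SY l \<Otimes>\<^sub>M PiM (DS l) q)"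
      unfolding OM_def by measurable
    from measurable_compose[OF this g_meas[OF l Dsub that]] show ?thesis by simp
  qed
  have fm[measurable]: "f \<in> borel_measurable OM"
    unfolding f_def
    by (intro borel_measurable_times_ennreal borel_measurable_prod_ennreal measurable_compose[OF _ measurable_ennreal] rho_letter_meas j gm) auto
  have "ennreal (wZ (zmap j z)) * indicator {z\<in>space ?O.
      jtyp n \<theta> l (\<lambda>t. py l (fst (z t))) (\<lambda>t. dpick l (\<lambda>S. fst (j S)) b (snd (z t)))} z \<le> ennreal C * (\<Prod>t<n. f (z t))" for z
  proof (cases "jtyp n \<theta> l (\<lambda>t. py l (fst (z t))) (\<lambda>t. dpick l (\<lambda>S. fst (j S)) b (snd (z t)))")
    case False then show ?thesis by simp
  next
    case True
    define r where "r S t = \<rho> S (px (fst (z t))) (pick j (snd (z t)))" for S t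
    define k where "k S t = g l D S (py l (fst (z t))) (dpick l (\<lambda>S. fst (j S)) b (snd (z t)))" for S t
    have r0: "r S t \<ge> 0" "k S t \<ge> 0" for S t unfolding r_def k_def by (rule rho_nonneg g_nonneg)+
    have "exp (real n * ((\<Sum>S\<in>D. R' S) - \<theta>)) \<le> (\<Prod>t<n. \<Prod>S\<in>D. k S t)"
      using True Dsub Dne unfolding jtyp_def k_def by auto
    then have "C * exp (real n * ((\<Sum>S\<in>D. R' S) - \<theta>)) \<le> C * (\<Prod>t<n. \<Prod>S\<in>D. k S t)"
      by (intro mult_left_mono) (auto simp: C_def)
    moreover have "C * exp (real n * ((\<Sum>S\<in>D. R' S) - \<theta>)) = 1" unfolding C_def exp_add[symmetric] by simp
    ultimately have ge1: "1 \<le> C * (\<Prod>t<n. \<Prod>S\<in>D. k S t)" by simp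
    have "wZ (zmap j z) * 1 \<le> wZ (zmap j z) * (C * (\<Prod>t<n. \<Prod>S\<in>D. k S t))"
      using ge1 by (intro mult_left_mono wZ_nonneg)
    also have "\<dots> = C * (\<Prod>t<n. (\<Prod>S\<in>set vs. r S t) * (\<Prod>S\<in>D. k S t))"
      by (simp add: wZ_zmap r_def prod.distrib mult_ac)
    finally have "ennreal (wZ (zmap j z)) \<le> ennreal (C * (\<Prod>t<n. (\<Prod>S\<in>set vs. r S t) * (\<Prod>S\<in>D. k S t)))"
      by (intro ennreal_leI) simp
    also have "\<dots> = ennreal C * (\<Prod>t<n. f (z t))"
    proof -
      have "f (z t) = ennreal ((\<Prod>S\<in>set vs. r S t) * (\<Prod>S\<in>D. k S t))" for t
        unfolding f_def r_def[symmetric] k_def[symmetric] using r0 by (simp add: prod_ennreal ennreal_mult prod_nonneg)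
      then have "(\<Prod>t<n. f (z t)) = (\<Prod>t<n. ennreal ((\<Prod>S\<in>set vs. r S t) * (\<Prod>S\<in>D. k S t)))"
        by (simp only:)
      also have "\<dots> = ennreal (\<Prod>t<n. (\<Prod>S\<in>set vs. r S t) * (\<Prod>S\<in>D. k S t))"
        by (rule prod_ennreal) (use r0 in \<open>auto intro!: mult_nonneg_nonneg prod_nonneg\<close>)
      finally show ?thesis by (simp only: ennreal_mult' C_def exp_ge_zero)
    qed
    finally show ?thesis by (auto simp: indicator_def)
  qed
  then have "(\<integral>\<^sup>+z. ennreal (wZ (zmap j z)) * indicator {z\<in>space ?O.
      jtyp n \<theta> l (\<lambda>t. py l (fst (z t))) (\<lambda>t. dpick l (\<lambda>S. fst (j S)) b (snd (z t)))} z \<partial>?O)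
     \<le> (\<integral>\<^sup>+z. ennreal C * (\<Prod>t<n. f (z t)) \<partial>?O)"
    by (intro nn_integral_mono)
  also have "\<dots> = ennreal C * (\<integral>\<^sup>+z. (\<Prod>t<n. f (z t)) \<partial>?O)"
    by (rule nn_integral_cmult) (auto intro!: borel_measurable_prod_ennreal measurable_compose[OF component_meas fm])
  also have "\<dots> \<le> ennreal C * 1"
  proof (intro mult_left_mono nn_integral_prod_OM_le_1 fm)
    fix a assume a: "a \<in> space P"
    then have x: "px a \<in> space SX" by (rule measurable_space[OF px])
    have y: "py l a \<in> space (SY l)" using a by (rule measurable_space[OF py[OF l]])
    from packing_le_1[OF j l b D_def x y] show "(\<integral>\<^sup>+c. f (a, c) \<partial>QC) \<le> 1" by (simp add: f_def)
  qed simp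
  finally show ?thesis by (simp only: C_eq mult_1_right)
qed

text \<open>A union bound over decoders and competitors. Expanding the product enumerates the sets
  of wrong positions; the 1 subtracted belongs to the true tuple, and
  \<open>exp (real n * \<theta>)\<close> is the slack allowed in \<open>jtyp\<close>.\<close>

definition dE :: real where
  "dE = (\<Sum>l<m. exp (real n * \<theta>) * ((\<Prod>S\<in>DS l. 1 + real (B S - 1) * exp (- real n * R' S)) - 1))"

lemma sum_packing:
  assumes j: "j \<in> tuples" and l: "l < m"
  shows "(\<Sum>b\<in>PiE (DS l) (\<lambda>S. {..<B S}) - {\<lambda>S\<in>DS l. snd (j S)}.
      \<Prod>S\<in>DS l. if b S = snd (j S) then 1 else exp (- real n * R' S))
    = (\<Prod>S\<in>DS l. 1 + real (B S - 1) * exp (- real n * R' S)) - 1"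
proof -
  let ?b = "\<lambda>S\<in>DS l. snd (j S)" and ?h = "\<lambda>b. \<Prod>S\<in>DS l. if b S = snd (j S) then 1 else exp (- real n * R' S)"
  have jS: "snd (j S) \<in> {..<B S}" if "S \<in> DS l" for S
    using that j DS[OF l] by (auto simp: tuples_def idx_def PiE_iff mem_Times_iff)
  have fin: "finite (PiE (DS l) (\<lambda>S. {..<B S}))" using finite_DS[OF l] by (intro finite_PiE) auto
  have "?b \<in> PiE (DS l) (\<lambda>S. {..<B S})" using jS by auto
  then have "(\<Sum>b\<in>PiE (DS l) (\<lambda>S. {..<B S}). ?h b) = ?h ?b + (\<Sum>b\<in>PiE (DS l) (\<lambda>S. {..<B S}) - {?b}. ?h b)"
    by (rule sum.remove[OF fin])
  moreover have "?h ?b = 1" by (intro prod.neutral) auto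
  moreover have "(\<Sum>b\<in>PiE (DS l) (\<lambda>S. {..<B S}). ?h b)
     = (\<Prod>S\<in>DS l. \<Sum>i\<in>{..<B S}. if i = snd (j S) then 1 else exp (- real n * R' S))"
    by (rule prod_sum_PiE[symmetric]) (auto intro: finite_DS[OF l])
  moreover have "(\<Prod>S\<in>DS l. \<Sum>i\<in>{..<B S}. if i = snd (j S) then 1 else exp (- real n * R' S))
     = (\<Prod>S\<in>DS l. 1 + real (B S - 1) * exp (- real n * R' S))"
  proof (rule prod.cong[OF refl])
    fix S assume S: "S \<in> DS l"
    have "(\<Sum>i\<in>{..<B S}. if i = snd (j S) then 1 else exp (- real n * R' S))
      = 1 + (\<Sum>i\<in>{..<B S} - {snd (j S)}. if i = snd (j S) then 1 else exp (- real n * R' S))"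
      using sum.remove[OF finite_lessThan jS[OF S], of "\<lambda>i. if i = snd (j S) then 1 else exp (- real n * R' S)"] by simp
    also have "(\<Sum>i\<in>{..<B S} - {snd (j S)}. if i = snd (j S) then 1 else exp (- real n * R' S))
      = (\<Sum>i\<in>{..<B S} - {snd (j S)}. exp (- real n * R' S))" by (intro sum.cong) auto
    also have "\<dots> = real (B S - 1) * exp (- real n * R' S)" using jS[OF S] by simp
    finally show "(\<Sum>i\<in>{..<B S}. if i = snd (j S) then 1 else exp (- real n * R' S))
      = 1 + real (B S - 1) * exp (- real n * R' S)" .
  qed
  ultimately show ?thesis by simp
qed

text \<open>Under the weight \<open>wZ\<close> the tuple \<open>j\<close> follows the true joint
  law, so its own failure has the probability given by \<open>JM\<close>; competitors are summed by
  \<open>packing\<close>. The bound is the same for all \<open>j\<close> and hence survives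
  averaging over tuples.\<close>

lemma bad_bound:
  assumes j: "j \<in> tuples"
  shows "(\<integral>\<^sup>+z. ennreal (wZ (zmap j z)) * indicator {z\<in>space (PiM {..<n} (\<lambda>_. OM)). bad j z} z \<partial>PiM {..<n} (\<lambda>_. OM))
    \<le> ennreal (measure (PiM {..<n} (\<lambda>_. JM)) {z\<in>space (PiM {..<n} (\<lambda>_. JM)). \<not> okZ z} + dE)"
proof -
  let ?O = "PiM {..<n} (\<lambda>_. OM)" and ?J = "PiM {..<n} (\<lambda>_. JM)" and ?RR = "PiM {..<n} (\<lambda>_. RM)"
  note [measurable] = zmap_meas[OF j] dec_meas[OF j]
  interpret JJ: prob_space ?J by (rule prob_space_PiM) (rule JM)
  have s[measurable_cong]: "sets ?J = sets ?RR"
    by (intro sets_PiM_cong) (auto simp: JM_def)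
  have sp: "space ?J = space ?RR" using s by (rule sets_eq_imp_space_eq)
  define Bs where "Bs l = PiE (DS l) (\<lambda>S. {..<B S}) - {\<lambda>S\<in>DS l. snd (j S)}" for l
  have finB: "finite (Bs l)" if "l < m" for l unfolding Bs_def using finite_DS[OF that] by (auto intro!: finite_PiE)
  define T where "T l b = {z\<in>space ?O. jtyp n \<theta> l (\<lambda>t. py l (fst (z t))) (\<lambda>t. dpick l (\<lambda>S. fst (j S)) b (snd (z t)))}" for l b
  have Tm[measurable]: "T l b \<in> sets ?O" if "l < m" "b \<in> Bs l" for l b
    using dec_meas[OF j that(1), of b] that unfolding T_def Bs_def by auto
  let ?K = "{z\<in>space ?RR. \<not> okZ z}"
  have point: "ennreal (wZ (zmap j z)) * indicator {z\<in>space ?O. bad j z} z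
    \<le> ennreal (wZ (zmap j z)) * indicator ?K (zmap j z) + (\<Sum>l<m. \<Sum>b\<in>Bs l. ennreal (wZ (zmap j z)) * indicator (T l b) z)"
    if z: "z \<in> space ?O" for z
  proof -
    have zz: "zmap j z \<in> space ?RR" using z by (rule measurable_space[OF zmap_meas[OF j]])
    have "indicator {z\<in>space ?O. bad j z} z \<le> (indicator ?K (zmap j z) + (\<Sum>l<m. \<Sum>b\<in>Bs l. indicator (T l b) z) :: ennreal)"
    proof (cases "bad j z")
      case True
      then consider "\<not> okZ (zmap j z)" | l b where "l < m" "b \<in> Bs l" "z \<in> T l b"
        using z unfolding bad_def Bs_def T_def by auto
      then show ?thesis
      proof cases
        case 1 then show ?thesis using zz by (auto simp: indicator_def intro: order_trans[OF _ le_add_same_cancel1[THEN iffD2]])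
      next
        case 2
        have "(1::ennreal) = indicator (T l b) z" using 2 by simp
        also have "\<dots> \<le> (\<Sum>b\<in>Bs l. indicator (T l b) z)" using 2 finB by (intro member_le_sum) auto
        also have "\<dots> \<le> (\<Sum>l<m. \<Sum>b\<in>Bs l. indicator (T l b) z)"
          using 2 by (intro member_le_sum[where f="\<lambda>l. \<Sum>b\<in>Bs l. indicator (T l b) z"]) auto
        finally have "(1::ennreal) \<le> (\<Sum>l<m. \<Sum>b\<in>Bs l. indicator (T l b) z)" .
        then show ?thesis by (auto simp: indicator_def intro: add_increasing)
      qed
    qed simp
    then have "ennreal (wZ (zmap j z)) * indicator {z\<in>space ?O. bad j z} z \<le> ennreal (wZ (zmap j z)) *
       (indicator ?K (zmap j z) + (\<Sum>l<m. \<Sum>b\<in>Bs l. indicator (T l b) z))" by (rule mult_left_mono) simp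
    then show ?thesis by (simp add: distrib_left sum_distrib_left)
  qed
  have m1: "(\<lambda>z. ennreal (wZ (zmap j z)) * indicator ?K (zmap j z)) \<in> borel_measurable ?O" by measurable
  have m2: "(\<lambda>z. ennreal (wZ (zmap j z)) * indicator (T l b) z) \<in> borel_measurable ?O" if "l < m" "b \<in> Bs l" for l b
    using Tm[OF that] by measurable
  have "(\<integral>\<^sup>+z. ennreal (wZ (zmap j z)) * indicator {z\<in>space ?O. bad j z} z \<partial>?O)
    \<le> (\<integral>\<^sup>+z. ennreal (wZ (zmap j z)) * indicator ?K (zmap j z) + (\<Sum>l<m. \<Sum>b\<in>Bs l. ennreal (wZ (zmap j z)) * indicator (T l b) z) \<partial>?O)"
    by (rule nn_integral_mono) (rule point)
  also have "\<dots> = (\<integral>\<^sup>+z. ennreal (wZ (zmap j z)) * indicator ?K (zmap j z) \<partial>?O)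
      + (\<Sum>l<m. \<Sum>b\<in>Bs l. \<integral>\<^sup>+z. ennreal (wZ (zmap j z)) * indicator (T l b) z \<partial>?O)"
    by (subst nn_integral_add) (auto intro!: m1 m2 borel_measurable_sum nn_integral_sum[THEN trans] sum.cong)
  also have "(\<integral>\<^sup>+z. ennreal (wZ (zmap j z)) * indicator ?K (zmap j z) \<partial>?O) = (\<integral>\<^sup>+z. indicator ?K z \<partial>?J)"
    by (rule nn_integral_zmap[OF j]) measurable
  also have "\<dots> = ennreal (measure ?J {z\<in>space ?J. \<not> okZ z})"
  proof -
    have "?K \<in> sets ?J" unfolding s by measurable
    then show ?thesis by (simp add: JJ.emeasure_eq_measure sp)
  qed
  also have "(\<Sum>l<m. \<Sum>b\<in>Bs l. \<integral>\<^sup>+z. ennreal (wZ (zmap j z)) * indicator (T l b) z \<partial>?O)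
    \<le> (\<Sum>l<m. \<Sum>b\<in>Bs l. ennreal (exp (real n * \<theta>) * (\<Prod>S\<in>DS l. if b S = snd (j S) then 1 else exp (- real n * R' S))))"
    unfolding T_def by (intro sum_mono packing[OF j]) (auto simp: Bs_def)
  also have "\<dots> = ennreal (\<Sum>l<m. \<Sum>b\<in>Bs l. exp (real n * \<theta>) * (\<Prod>S\<in>DS l. if b S = snd (j S) then 1 else exp (- real n * R' S)))"
  proof -
    have "exp (real n * \<theta>) * (\<Prod>S\<in>DS l. if b S = snd (j S) then 1 else exp (- real n * R' S)) \<ge> 0" for l b
      by (intro mult_nonneg_nonneg prod_nonneg) auto
    then show ?thesis by (simp add: sum_ennreal sum_nonneg)
  qed
  also have "(\<Sum>l<m. \<Sum>b\<in>Bs l. exp (real n * \<theta>) * (\<Prod>S\<in>DS l. if b S = snd (j S) then 1 else exp (- real n * R' S))) = dE"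
    unfolding dE_def
    by (intro sum.cong refl) (simp add: Bs_def sum_distrib_left[symmetric] sum_packing[OF j])
  finally have le: "(\<integral>\<^sup>+z. ennreal (wZ (zmap j z)) * indicator {z\<in>space ?O. bad j z} z \<partial>?O)
    \<le> ennreal (measure ?J {z\<in>space ?J. \<not> okZ z}) + ennreal dE" by (simp add: add_left_mono)
  have "dE \<ge> 0" unfolding dE_def
    by (intro sum_nonneg mult_nonneg_nonneg) (auto intro!: prod_ge_1)
  then show ?thesis using le by simp
qed

text \<open>The average over source and codebooks is below \<open>\<eta>\<close>, so some codebook
  has a source average below \<open>\<eta>\<close>; for that codebook
  \<open>argmin_encoder_exists\<close> supplies the encoder.\<close>

lemma codebook_exists:
  assumes err: "8 * measure (PiM {..<n} (\<lambda>_. JM)) {z\<in>space (PiM {..<n} (\<lambda>_. JM)). \<not> covZ z}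
      + 4 * ((\<Prod>S\<in>set vs. 1 + E S / real (A S * B S)) - 1)
      + 2 * (measure (PiM {..<n} (\<lambda>_. JM)) {z\<in>space (PiM {..<n} (\<lambda>_. JM)). \<not> okZ z} + dE) < \<eta>"
  shows "\<exists>c\<in>space (PiM {..<n} (\<lambda>_. QC)). \<exists>f\<in>measurable (PiM {..<n} (\<lambda>_. SX)) (count_space UNIV).
    (\<forall>xs. f xs \<in> tuples) \<and>
    {a\<in>space (PiM {..<n} (\<lambda>_. P)). bad (f (\<lambda>t\<in>{..<n}. px (a t))) (\<lambda>t\<in>{..<n}. (a t, c t))} \<in> sets (PiM {..<n} (\<lambda>_. P)) \<and>
    measure (PiM {..<n} (\<lambda>_. P)) {a\<in>space (PiM {..<n} (\<lambda>_. P)). bad (f (\<lambda>t\<in>{..<n}. px (a t))) (\<lambda>t\<in>{..<n}. (a t, c t))} < \<eta>"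
proof -
  let ?O = "PiM {..<n} (\<lambda>_. OM)" and ?J = "PiM {..<n} (\<lambda>_. JM)" and ?PP = "PiM {..<n} (\<lambda>_. P)"
    and ?QQ = "PiM {..<n} (\<lambda>_. QC)" and ?XX = "PiM {..<n} (\<lambda>_. SX)" and ?K = "card tuples"
  interpret PP: prob_space P by (rule P)
  interpret O: prob_space ?O by (rule prob_space_PiM) (rule prob_space_OM)
  interpret Pn: prob_space ?PP by (rule prob_space_PiM) (rule P)
  interpret Qn: prob_space ?QQ by (rule prob_space_PiM) (rule prob_space_QC)
  interpret PQ: pair_prob_space ?PP ?QQ ..
  have K: "?K > 0" by (rule card_tuples_pos)
  define pb where "pb a c = (\<lambda>t\<in>{..<n}. (a t, c t))" for a :: "nat \<Rightarrow> 'a" and c :: "nat \<Rightarrow> 's \<times> nat \<times> nat \<Rightarrow> 'u"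
  define wb where "wb j z = ennreal (wZ (zmap j z)) * indicator {z\<in>space ?O. bad j z} z" for j z
  have wbm[measurable]: "wb j \<in> borel_measurable ?O" if j: "j \<in> tuples" for j
  proof -
    note [measurable] = zmap_meas[OF j] bad_meas[OF j]
    show ?thesis unfolding wb_def by measurable
  qed
  have iN: "{z\<in>space ?O. NZ z < 1/2} \<in> sets ?O" by measurable
  \<comment> \<open>Chosen so that, with the codebook fixed, its source average dominates the bound
    of \<open>argmin_encoder_exists\<close>.\<close>
  define \<Phi> where "\<Phi> z = indicator {z\<in>space ?O. NZ z < 1/2} z + 2 * (\<Sum>j\<in>tuples. ennreal (1/?K) * wb j z)" for z
  have \<Phi>m[measurable]: "\<Phi> \<in> borel_measurable ?O"
    unfolding \<Phi>_def by (intro borel_measurable_add borel_measurable_times_ennreal borel_measurable_sum wbm) measurable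
  let ?po = "measure ?J {z\<in>space ?J. \<not> okZ z} + dE"
  have po0: "?po \<ge> 0"
    unfolding dE_def by (intro add_nonneg_nonneg sum_nonneg mult_nonneg_nonneg) (auto intro!: prod_ge_1)
  have "(\<integral>\<^sup>+z. \<Phi> z \<partial>?O) = emeasure ?O {z\<in>space ?O. NZ z < 1/2} + 2 * (\<Sum>j\<in>tuples. ennreal (1/?K) * (\<integral>\<^sup>+z. wb j z \<partial>?O))"
  proof -
    have "(\<integral>\<^sup>+z. \<Phi> z \<partial>?O) = (\<integral>\<^sup>+z. indicator {z\<in>space ?O. NZ z < 1/2} z \<partial>?O) + (\<integral>\<^sup>+z. 2 * (\<Sum>j\<in>tuples. ennreal (1/?K) * wb j z) \<partial>?O)"
      unfolding \<Phi>_def by (rule nn_integral_add) (auto intro!: borel_measurable_indicator iN borel_measurable_times_ennreal borel_measurable_sum wbm)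
    also have "(\<integral>\<^sup>+z. 2 * (\<Sum>j\<in>tuples. ennreal (1/?K) * wb j z) \<partial>?O) = 2 * (\<integral>\<^sup>+z. (\<Sum>j\<in>tuples. ennreal (1/?K) * wb j z) \<partial>?O)"
      by (rule nn_integral_cmult) (auto intro!: borel_measurable_times_ennreal borel_measurable_sum wbm)
    also have "(\<integral>\<^sup>+z. (\<Sum>j\<in>tuples. ennreal (1/?K) * wb j z) \<partial>?O) = (\<Sum>j\<in>tuples. \<integral>\<^sup>+z. ennreal (1/?K) * wb j z \<partial>?O)"
      by (rule nn_integral_sum) (auto intro!: borel_measurable_times_ennreal wbm)
    also have "\<dots> = (\<Sum>j\<in>tuples. ennreal (1/?K) * (\<integral>\<^sup>+z. wb j z \<partial>?O))"
      by (intro sum.cong refl nn_integral_cmult wbm)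
    finally show ?thesis by simp
  qed
  also have "\<dots> \<le> ennreal (measure ?O {z\<in>space ?O. NZ z < 1/2}) + 2 * (\<Sum>j\<in>tuples. ennreal (1/?K) * ennreal ?po)"
    unfolding O.emeasure_eq_measure wb_def by (intro add_mono mult_left_mono sum_mono bad_bound) auto
  also have "(\<Sum>j\<in>tuples. ennreal (1/?K) * ennreal ?po) = ennreal (\<Sum>j\<in>tuples. 1/?K * ?po)"
    using po0 by (subst sum_ennreal[symmetric])
      (auto intro!: sum.cong simp: ennreal_mult[symmetric] simp del: sum_constant)
  also have "(\<Sum>j\<in>tuples. 1/?K * ?po) = ?po" using K by simp
  also have "ennreal (measure ?O {z\<in>space ?O. NZ z < 1/2}) + 2 * ennreal ?po
    = ennreal (measure ?O {z\<in>space ?O. NZ z < 1/2} + 2 * ?po)"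
  proof -
    have "2 * ennreal x = ennreal (2 * x)" if "x \<ge> 0" for x :: real
      using that by (simp add: ennreal_mult')
    then show ?thesis using po0 by (subst ennreal_plus) auto
  qed
  also have "\<dots> < ennreal \<eta>"
  proof -
    have "measure ?O {z\<in>space ?O. NZ z < 1/2} + 2 * ?po < \<eta>" using prob_NZ_small err by linarith
    moreover have "0 \<le> measure ?O {z\<in>space ?O. NZ z < 1/2} + 2 * ?po"
      using po0 by (intro add_nonneg_nonneg measure_nonneg) simp
    ultimately show ?thesis by (intro ennreal_lessI) linarith+
  qed
  finally have \<Phi>lt: "(\<integral>\<^sup>+z. \<Phi> z \<partial>?O) < ennreal \<eta>" .
  \<comment> \<open>\<open>pb\<close> zips a source block with a codebook. By
    \<open>distr_pair_PiM\<close> this carries the product of the block laws to \<open>n\<close>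
    copies of \<open>OM\<close>, after which Fubini isolates the codebook.\<close>
  have pbm: "(\<lambda>z. pb (fst z) (snd z)) \<in> measurable (?PP \<Otimes>\<^sub>M ?QQ) ?O"
    unfolding pb_def OM_def by measurable
  have "(\<integral>\<^sup>+z. \<Phi> z \<partial>?O) = (\<integral>\<^sup>+z. \<Phi> z \<partial>distr (?PP \<Otimes>\<^sub>M ?QQ) ?O (\<lambda>z. pb (fst z) (snd z)))"
    unfolding pb_def OM_def by (subst distr_pair_PiM[OF P prob_space_QC]) auto
  also have "\<dots> = (\<integral>\<^sup>+z. \<Phi> (pb (fst z) (snd z)) \<partial>(?PP \<Otimes>\<^sub>M ?QQ))"
    by (rule nn_integral_distr[OF pbm]) simp
  also have "\<dots> = (\<integral>\<^sup>+c. \<integral>\<^sup>+a. \<Phi> (pb a c) \<partial>?PP \<partial>?QQ)"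
    using PQ.nn_integral_snd[of "\<lambda>z. \<Phi> (pb (fst z) (snd z))"] measurable_compose[OF pbm \<Phi>m] by simp
  finally have "(\<integral>\<^sup>+c. \<integral>\<^sup>+a. \<Phi> (pb a c) \<partial>?PP \<partial>?QQ) < ennreal \<eta>" using \<Phi>lt by simp
  from prob_space_nn_integral_less[OF Qn.prob_space_axioms this]
  obtain c where c: "c \<in> space ?QQ" and clt: "(\<integral>\<^sup>+a. \<Phi> (pb a c) \<partial>?PP) < ennreal \<eta>" by auto
  have ct: "c t \<in> space QC" if "t < n" for t using c that by (auto simp: space_PiM PiE_iff)
  have pbc[measurable]: "(\<lambda>a. pb a c) \<in> measurable ?PP ?O"
    using measurable_compose[OF measurable_Pair2'[OF c, of ?PP] pbm] by simp
  obtain h where h: "bij_betw h {0..<?K} tuples" using ex_bij_betw_nat_finite[OF finite_tuples] by auto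
  then have ht: "h i \<in> tuples" if "i < ?K" for i using that by (auto simp: bij_betw_def)
  \<comment> \<open>With the codebook \<open>c\<close> fixed, the weights are functions of the
    source block \<open>xs\<close> alone, as an encoder requires.\<close>
  define p where "p i xs = (\<Prod>t<n. \<Prod>S\<in>set vs. \<rho> S (xs t) (pick (h i) (c t))) *
      of_bool (cov n \<theta> xs (\<lambda>t. pick (h i) (c t))) / ?K" for i xs
  let ?x = "\<lambda>a. \<lambda>t\<in>{..<n}. px (a t)"
  have xm: "?x \<in> measurable ?PP ?XX" by measurable
  have p0: "p i xs \<ge> 0" for i xs
    unfolding p_def by (intro divide_nonneg_nonneg mult_nonneg_nonneg prod_nonneg ballI rho_nonneg) auto
  have p_eq: "p i (?x a) = yZ (h i) (pb a c) / ?K" for i a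
  proof -
    have "wZ (zmap (h i) (pb a c)) = (\<Prod>t<n. \<Prod>S\<in>set vs. \<rho> S (?x a t) (pick (h i) (c t)))"
      unfolding wZ_zmap by (intro prod.cong refl) (simp add: pb_def)
    moreover have "covZ (zmap (h i) (pb a c)) = cov n \<theta> (?x a) (\<lambda>t. pick (h i) (c t))"
      unfolding covZ_def by (rule cov_cong) (simp_all add: zmap_nth pb_def)
    ultimately show ?thesis by (simp add: p_def yZ_def)
  qed
  have p_meas: "p i \<in> borel_measurable ?XX" if "i < ?K" for i
  proof -
    have X: "(\<lambda>xs. xs t) \<in> measurable ?XX SX" if "t < n" for t using that by simp
    have U: "(\<lambda>xs. pick (h i) (c t)) \<in> measurable ?XX (PiM (set vs) q)" if "t < n" for t
      using measurable_space[OF pick_meas[OF ht[OF \<open>i < ?K\<close>]] ct[OF that]] by simp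
    have [measurable]: "Measurable.pred ?XX (\<lambda>xs. cov n \<theta> xs (\<lambda>t. pick (h i) (c t)))"
      using cov_pred[of n "\<lambda>t xs. xs t" ?XX "\<lambda>t xs. pick (h i) (c t)" \<theta>, OF X U] by simp
    have [measurable]: "(\<lambda>xs. \<Prod>t<n. \<Prod>S\<in>set vs. \<rho> S (xs t) (pick (h i) (c t))) \<in> borel_measurable ?XX"
    proof (intro borel_measurable_prod)
      fix t S assume t: "t \<in> {..<n}" and S: "S \<in> set vs"
      then have "(\<lambda>xs. (xs t, pick (h i) (c t))) \<in> measurable ?XX (SX \<Otimes>\<^sub>M PiM (set vs) q)"
        using X[of t] U[of t] by (intro measurable_Pair) auto
      from measurable_compose[OF this rho_meas[OF S]]
      show "(\<lambda>xs. \<rho> S (xs t) (pick (h i) (c t))) \<in> borel_measurable ?XX" by simp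
    qed
    show ?thesis unfolding p_def by measurable
  qed
  define fail where "fail i = {a\<in>space ?PP. bad (h i) (pb a c)}" for i
  have failm: "fail i \<in> sets ?PP" if "i < ?K" for i
  proof -
    note [measurable] = bad_meas[OF ht[OF that]]
    show ?thesis unfolding fail_def by measurable
  qed
  obtain f where f: "f \<in> measurable ?XX (count_space UNIV)" "\<And>v. f v < ?K"
    "{a\<in>space ?PP. a \<in> fail (f (?x a))} \<in> sets ?PP"
    and fle: "emeasure ?PP {a\<in>space ?PP. a \<in> fail (f (?x a))} \<le> emeasure ?PP {a\<in>space ?PP. (\<Sum>i<?K. p i (?x a)) < 1/2}
      + 2 * (\<Sum>i<?K. \<integral>\<^sup>+a. ennreal (p i (?x a)) * indicator (fail i) a \<partial>?PP)"
    using argmin_encoder_exists[where fail=fail and p=p, OF Pn.prob_space_axioms xm K failm p_meas p0] by blast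
  have sumN: "(\<Sum>i<?K. p i (?x a)) = NZ (pb a c)" for a
    unfolding p_eq NZ_def using sum.reindex_bij_betw[OF h, of "\<lambda>j. yZ j (pb a c) / ?K"] by (simp add: lessThan_atLeast0)
  have pbs: "pb a c \<in> space ?O" if "a \<in> space ?PP" for a using measurable_space[OF pbc that] .
  have "emeasure ?PP {a\<in>space ?PP. (\<Sum>i<?K. p i (?x a)) < 1/2}
      + 2 * (\<Sum>i<?K. \<integral>\<^sup>+a. ennreal (p i (?x a)) * indicator (fail i) a \<partial>?PP) \<le> (\<integral>\<^sup>+a. \<Phi> (pb a c) \<partial>?PP)"
  proof -
    have 1: "emeasure ?PP {a\<in>space ?PP. (\<Sum>i<?K. p i (?x a)) < 1/2} = (\<integral>\<^sup>+a. indicator {z\<in>space ?O. NZ z < 1/2} (pb a c) \<partial>?PP)"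
    proof -
      have "{a\<in>space ?PP. NZ (pb a c) < 1/2} \<in> sets ?PP" by measurable
      then have "emeasure ?PP {a\<in>space ?PP. NZ (pb a c) < 1/2} = (\<integral>\<^sup>+a. indicator {a\<in>space ?PP. NZ (pb a c) < 1/2} a \<partial>?PP)" by simp
      also have "\<dots> = (\<integral>\<^sup>+a. indicator {z\<in>space ?O. NZ z < 1/2} (pb a c) \<partial>?PP)"
        by (intro nn_integral_cong) (auto simp: indicator_def pbs)
      finally show ?thesis by (simp add: sumN)
    qed
    have wbm': "(\<lambda>a. wb (h i) (pb a c)) \<in> borel_measurable ?PP" if "i < ?K" for i
      by (rule measurable_compose[OF pbc wbm[OF ht[OF that]]])
    have 2: "(\<integral>\<^sup>+a. ennreal (p i (?x a)) * indicator (fail i) a \<partial>?PP) \<le> (\<integral>\<^sup>+a. ennreal (1/?K) * wb (h i) (pb a c) \<partial>?PP)" for i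
    proof (rule nn_integral_mono)
      fix a assume a: "a \<in> space ?PP"
      have "yZ (h i) (pb a c) \<le> wZ (zmap (h i) (pb a c))" using wZ_nonneg by (auto simp: yZ_def)
      then have "p i (?x a) \<le> 1/?K * wZ (zmap (h i) (pb a c))" unfolding p_eq by (simp add: divide_right_mono)
      then have "ennreal (p i (?x a)) \<le> ennreal (1/?K) * ennreal (wZ (zmap (h i) (pb a c)))"
        using wZ_nonneg by (subst ennreal_mult'[symmetric]) (auto intro: ennreal_leI)
      moreover have "indicator (fail i) a = (indicator {z\<in>space ?O. bad (h i) z} (pb a c) :: ennreal)"
        using a pbs by (auto simp: fail_def indicator_def)
      ultimately show "ennreal (p i (?x a)) * indicator (fail i) a \<le> ennreal (1/?K) * wb (h i) (pb a c)"
        unfolding wb_def by (simp add: mult_right_mono flip: mult.assoc)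
    qed
    have "(\<integral>\<^sup>+a. \<Phi> (pb a c) \<partial>?PP) = (\<integral>\<^sup>+a. indicator {z\<in>space ?O. NZ z < 1/2} (pb a c) + 2 * (\<Sum>i<?K. ennreal (1/?K) * wb (h i) (pb a c)) \<partial>?PP)"
      unfolding \<Phi>_def by (simp add: sum.reindex_bij_betw[OF h, symmetric] lessThan_atLeast0)
    also have "\<dots> = (\<integral>\<^sup>+a. indicator {z\<in>space ?O. NZ z < 1/2} (pb a c) \<partial>?PP) + (\<integral>\<^sup>+a. 2 * (\<Sum>i<?K. ennreal (1/?K) * wb (h i) (pb a c)) \<partial>?PP)"
      by (rule nn_integral_add) (auto intro!: measurable_compose[OF pbc borel_measurable_indicator[OF iN]] borel_measurable_times_ennreal borel_measurable_sum wbm')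
    also have "(\<integral>\<^sup>+a. 2 * (\<Sum>i<?K. ennreal (1/?K) * wb (h i) (pb a c)) \<partial>?PP) = 2 * (\<integral>\<^sup>+a. (\<Sum>i<?K. ennreal (1/?K) * wb (h i) (pb a c)) \<partial>?PP)"
      by (rule nn_integral_cmult) (auto intro!: borel_measurable_times_ennreal borel_measurable_sum wbm')
    also have "(\<integral>\<^sup>+a. (\<Sum>i<?K. ennreal (1/?K) * wb (h i) (pb a c)) \<partial>?PP) = (\<Sum>i<?K. \<integral>\<^sup>+a. ennreal (1/?K) * wb (h i) (pb a c) \<partial>?PP)"
      by (rule nn_integral_sum) (auto intro!: borel_measurable_times_ennreal wbm')
    finally show ?thesis unfolding 1 using 2 by (auto intro!: add_left_mono mult_left_mono sum_mono)
  qed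
  then have "emeasure ?PP {a\<in>space ?PP. a \<in> fail (f (?x a))} < ennreal \<eta>" using fle clt by simp
  then have lt: "measure ?PP {a\<in>space ?PP. a \<in> fail (f (?x a))} < \<eta>"
    by (simp add: Pn.emeasure_eq_measure ennreal_less_iff)
  have set_eq: "{a\<in>space ?PP. a \<in> fail (f (?x a))} = {a\<in>space ?PP. bad ((h \<circ> f) (?x a)) (\<lambda>t\<in>{..<n}. (a t, c t))}"
    by (auto simp: fail_def pb_def)
  have "h \<circ> f \<in> measurable ?XX (count_space UNIV)" by (rule measurable_comp[OF f(1)]) simp
  then show ?thesis using c f lt ht unfolding set_eq by (intro bexI[of _ c] bexI[of _ "h \<circ> f"]) auto
qed

end

section \<open>Vanishing error probability\<close>

lemma nat_ceiling_bounds: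
  fixes x :: real assumes "x \<ge> 0"
  shows "x \<le> real (nat \<lceil>x\<rceil>)" "real (nat \<lceil>x\<rceil>) \<le> x + 1" "real (nat \<lceil>x\<rceil> - 1) \<le> x"
proof -
  show "x \<le> real (nat \<lceil>x\<rceil>)" "real (nat \<lceil>x\<rceil>) \<le> x + 1" using assms by linarith+
  then show "real (nat \<lceil>x\<rceil> - 1) \<le> x" using assms by (cases "nat \<lceil>x\<rceil>") auto
qed

lemma ln_nat_ceiling_exp:
  assumes "x \<ge> 0" shows "ln (real (nat \<lceil>exp x\<rceil>)) \<le> x + ln 2"
proof -
  have "real (nat \<lceil>exp x\<rceil>) \<le> exp x + 1" by (rule nat_ceiling_bounds) simp
  also have "\<dots> \<le> exp x * 2" using assms by simp
  finally have "ln (real (nat \<lceil>exp x\<rceil>)) \<le> ln (exp x * 2)"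
    by (intro ln_mono) (auto simp: less_eq_real_def)
  then show ?thesis by (simp add: ln_mult)
qed

context multi_codebook
begin

lemma PiM_JM_sets: "sets (PiM {..<n} (\<lambda>_. JM)) = sets (PiM {..<n} (\<lambda>_. RM))"
  by (intro sets_PiM_cong) (auto simp: JM_def)

lemma cov_fail_tendsto_0:
  assumes JM: "prob_space JM" and \<theta>: "\<theta> > 0"
    and int: "\<And>S. S \<in> set vs \<Longrightarrow> integrable JM (\<lambda>z. ln (\<rho> S (px (fst z)) (snd z)))"
    and le: "\<And>S. S \<in> set vs \<Longrightarrow> (\<integral>z. ln (\<rho> S (px (fst z)) (snd z)) \<partial>JM) \<le> R S + R' S"
  shows "(\<lambda>n. measure (PiM {..<n} (\<lambda>_. JM)) {z\<in>space (PiM {..<n} (\<lambda>_. JM)).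
      \<not> cov n \<theta> (\<lambda>t. px (fst (z t))) (\<lambda>t. snd (z t))}) \<longlonglongrightarrow> 0"
proof -
  let ?J = "\<lambda>n. PiM {..<n::nat} (\<lambda>_. JM)"
  define T where "T S n = {z\<in>space (?J n). \<not> (\<Sum>t<n. ln (\<rho> S (px (fst (z t))) (snd (z t)))) \<le>
     real n * ((\<integral>z. ln (\<rho> S (px (fst z)) (snd z)) \<partial>JM) + \<theta>)}" for S n
  have lim: "(\<lambda>n. measure (?J n) (T S n)) \<longlonglongrightarrow> 0" if "S \<in> set vs" for S
    unfolding T_def by (rule weak_law_upper[OF JM int[OF that] \<theta>])
  have lim': "(\<lambda>n. \<Sum>S\<in>set vs. measure (?J n) (T S n)) \<longlonglongrightarrow> 0"
    using tendsto_sum[of "set vs" "\<lambda>S n. measure (?J n) (T S n)" "\<lambda>_. 0" sequentially] lim by simp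
  show ?thesis
  proof (rule tendsto_sandwich[OF _ _ tendsto_const lim'])
    show "\<forall>\<^sub>F n in sequentially. measure (?J n) {z\<in>space (?J n). \<not> cov n \<theta> (\<lambda>t. px (fst (z t))) (\<lambda>t. snd (z t))}
      \<le> (\<Sum>S\<in>set vs. measure (?J n) (T S n))"
    proof (intro always_eventually allI)
      fix n
      interpret prob_space "?J n" by (rule prob_space_PiM) (rule JM)
      have Tm: "T S n \<in> sets (?J n)" if "S \<in> set vs" for S
      proof -
        have [measurable]: "(\<lambda>z. ln (\<rho> S (px (fst z)) (snd z))) \<in> borel_measurable JM" using int[OF that] by auto
        show ?thesis unfolding T_def by measurable
      qed
      have "{z\<in>space (?J n). \<not> cov n \<theta> (\<lambda>t. px (fst (z t))) (\<lambda>t. snd (z t))} \<subseteq> (\<Union>S\<in>set vs. T S n)"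
      proof
        fix z assume "z \<in> {z\<in>space (?J n). \<not> cov n \<theta> (\<lambda>t. px (fst (z t))) (\<lambda>t. snd (z t))}"
        then obtain S where z: "z \<in> space (?J n)" and S: "S \<in> set vs"
          and gt: "(\<Prod>t<n. \<rho> S (px (fst (z t))) (snd (z t))) > exp (real n * (R S + R' S + \<theta>))"
          unfolding cov_def by (auto simp: not_le)
        let ?r = "\<lambda>t. \<rho> S (px (fst (z t))) (snd (z t))"
        \<comment> \<open>Logarithms may be summed here because a product exceeding a positive
          number has no vanishing factor.\<close>
        have pos: "?r t > 0" if "t < n" for t
        proof (rule ccontr)
          assume "\<not> ?r t > 0"
          then have "?r t = 0" using rho_nonneg[of S "px (fst (z t))" "snd (z t)"] by simp
          then have "(\<Prod>t<n. ?r t) = 0" using that by (intro prod_zero) auto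
          then show False using gt exp_gt_zero[of "real n * (R S + R' S + \<theta>)"] by linarith
        qed
        have "(\<Prod>t<n. ?r t) = exp (\<Sum>t<n. ln (?r t))" using pos by (subst exp_sum) auto
        then have "(\<Sum>t<n. ln (?r t)) > real n * (R S + R' S + \<theta>)" using gt by simp
        moreover have "real n * ((\<integral>z. ln (\<rho> S (px (fst z)) (snd z)) \<partial>JM) + \<theta>) \<le> real n * (R S + R' S + \<theta>)"
          using le[OF S] by (intro mult_left_mono) auto
        ultimately have "z \<in> T S n" using z unfolding T_def by auto
        then show "z \<in> (\<Union>S\<in>set vs. T S n)" using S by auto
      qed
      then have "prob {z\<in>space (?J n). \<not> cov n \<theta> (\<lambda>t. px (fst (z t))) (\<lambda>t. snd (z t))} \<le> prob (\<Union>S\<in>set vs. T S n)"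
        by (rule finite_measure_mono) (use Tm in auto)
      also have "\<dots> \<le> (\<Sum>S\<in>set vs. prob (T S n))"
        by (rule finite_measure_subadditive_finite) (use Tm in auto)
      finally show "prob {z\<in>space (?J n). \<not> cov n \<theta> (\<lambda>t. px (fst (z t))) (\<lambda>t. snd (z t))} \<le> (\<Sum>S\<in>set vs. prob (T S n))" .
    qed
  qed simp
qed

text \<open>The mutual information of a decoder may be infinite, so the logarithms of
  \<open>g\<close> need not be integrable; an integrable minorant \<open>h\<close> stands in for
  their sum. Half of \<open>\<theta>\<close> covers the gap between the mean of \<open>h\<close> and
  the sum of the \<open>R' S\<close>, the other half the deviation in \<open>weak_law_upper\<close>,
  which is applied to \<open>- h\<close>.\<close>

lemma typ_fail_tendsto_0:
  assumes JM: "prob_space JM" and \<theta>: "\<theta> > 0"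
    and gln: "\<And>l D e. l < m \<Longrightarrow> D \<subseteq> DS l \<Longrightarrow> D \<noteq> {} \<Longrightarrow> e > 0 \<Longrightarrow> \<exists>h. integrable JM h \<and>
      (AE z in JM. (\<forall>S\<in>D. g l D S (py l (fst z)) (restrict (snd z) (DS l)) > 0) \<and>
         h z \<le> (\<Sum>S\<in>D. ln (g l D S (py l (fst z)) (restrict (snd z) (DS l))))) \<and>
      (\<Sum>S\<in>D. R' S) - e \<le> integral\<^sup>L JM h"
  shows "(\<lambda>n. measure (PiM {..<n} (\<lambda>_. JM)) {z\<in>space (PiM {..<n} (\<lambda>_. JM)).
      \<not> (\<forall>l<m. jtyp n \<theta> l (\<lambda>t. py l (fst (z t))) (\<lambda>t. restrict (snd (z t)) (DS l)))}) \<longlonglongrightarrow> 0"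
proof -
  let ?J = "\<lambda>n. PiM {..<n::nat} (\<lambda>_. JM)"
  define k where "k l D S z = g l D S (py l (fst z)) (restrict (snd z) (DS l))" for l D S and z :: "'a \<times> ('s \<Rightarrow> 'u)"
  define Q where "Q = Sigma {..<m} (\<lambda>l. Pow (DS l) - {{}})"
  have finQ: "finite Q" unfolding Q_def using finite_DS by auto
  have "\<forall>p\<in>Q. \<exists>h. integrable JM h \<and>
      (AE z in JM. (\<forall>S\<in>snd p. k (fst p) (snd p) S z > 0) \<and> h z \<le> (\<Sum>S\<in>snd p. ln (k (fst p) (snd p) S z))) \<and>
      (\<Sum>S\<in>snd p. R' S) - \<theta>/2 \<le> integral\<^sup>L JM h"
    using gln[of _ _ "\<theta>/2"] \<theta> unfolding k_def Q_def by auto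
  from bchoice[OF this] obtain h where hint: "\<And>p. p \<in> Q \<Longrightarrow> integrable JM (h p)"
    and hAE: "\<And>p. p \<in> Q \<Longrightarrow> AE z in JM. (\<forall>S\<in>snd p. k (fst p) (snd p) S z > 0) \<and> h p z \<le> (\<Sum>S\<in>snd p. ln (k (fst p) (snd p) S z))"
    and hle: "\<And>p. p \<in> Q \<Longrightarrow> (\<Sum>S\<in>snd p. R' S) - \<theta>/2 \<le> integral\<^sup>L JM (h p)"
    by blast
  define T where "T p n = {z\<in>space (?J n). \<not> (\<Sum>t<n. - h p (z t)) \<le> real n * ((\<integral>z. - h p z \<partial>JM) + \<theta>/2)}" for p n
  have lim: "(\<lambda>n. measure (?J n) (T p n)) \<longlonglongrightarrow> 0" if "p \<in> Q" for p
    unfolding T_def by (rule weak_law_upper[OF JM]) (use hint[OF that] \<theta> in auto)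
  have lim': "(\<lambda>n. \<Sum>p\<in>Q. measure (?J n) (T p n)) \<longlonglongrightarrow> 0"
    using tendsto_sum[of Q "\<lambda>p n. measure (?J n) (T p n)" "\<lambda>_. 0" sequentially] lim by simp
  show ?thesis
  proof (rule tendsto_sandwich[OF _ _ tendsto_const lim'])
    show "\<forall>\<^sub>F n in sequentially. measure (?J n) {z\<in>space (?J n).
      \<not> (\<forall>l<m. jtyp n \<theta> l (\<lambda>t. py l (fst (z t))) (\<lambda>t. restrict (snd (z t)) (DS l)))} \<le> (\<Sum>p\<in>Q. measure (?J n) (T p n))"
    proof (intro always_eventually allI)
      fix n
      interpret prob_space "?J n" by (rule prob_space_PiM) (rule JM)
      have Tm: "T p n \<in> sets (?J n)" if "p \<in> Q" for p
      proof -
        have [measurable]: "h p \<in> borel_measurable JM" using hint[OF that] by auto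
        show ?thesis unfolding T_def by measurable
      qed
      have "AE z in ?J n. (\<forall>S\<in>snd p. k (fst p) (snd p) S (z t) > 0) \<and> h p (z t) \<le> (\<Sum>S\<in>snd p. ln (k (fst p) (snd p) S (z t)))"
        if "p \<in> Q" "t \<in> {..<n}" for p t
        by (rule AE_PiM_component[OF _ that(2) hAE[OF that(1)]]) (rule JM)
      then have "AE z in ?J n. \<forall>p\<in>Q. \<forall>t\<in>{..<n}. (\<forall>S\<in>snd p. k (fst p) (snd p) S (z t) > 0) \<and> h p (z t) \<le> (\<Sum>S\<in>snd p. ln (k (fst p) (snd p) S (z t)))"
        using finQ by (simp add: AE_finite_all)
      then have "AE z in ?J n. z \<in> {z\<in>space (?J n).
          \<not> (\<forall>l<m. jtyp n \<theta> l (\<lambda>t. py l (fst (z t))) (\<lambda>t. restrict (snd (z t)) (DS l)))} \<longrightarrow> z \<in> (\<Union>p\<in>Q. T p n)"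
      proof (eventually_elim, intro impI)
        fix z
        assume ok: "\<forall>p\<in>Q. \<forall>t\<in>{..<n}. (\<forall>S\<in>snd p. k (fst p) (snd p) S (z t) > 0) \<and> h p (z t) \<le> (\<Sum>S\<in>snd p. ln (k (fst p) (snd p) S (z t)))"
          and "z \<in> {z\<in>space (?J n). \<not> (\<forall>l<m. jtyp n \<theta> l (\<lambda>t. py l (fst (z t))) (\<lambda>t. restrict (snd (z t)) (DS l)))}"
        then obtain l where z: "z \<in> space (?J n)" and l: "l < m"
          and nj: "\<not> jtyp n \<theta> l (\<lambda>t. py l (fst (z t))) (\<lambda>t. restrict (snd (z t)) (DS l))" by auto
        from nj obtain D where D: "D \<in> Pow (DS l) - {{}}"
          and lt: "(\<Prod>t<n. \<Prod>S\<in>D. k l D S (z t)) < exp (real n * ((\<Sum>S\<in>D. R' S) - \<theta>))"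
          unfolding jtyp_def k_def by (auto simp: not_le)
        have p: "(l, D) \<in> Q" using l D by (auto simp: Q_def)
        have finD: "finite D" using D finite_DS[OF l] by (auto intro: finite_subset)
        have pos: "k l D S (z t) > 0" if "t < n" "S \<in> D" for t S using ok p that by force
        have "(\<Prod>t<n. \<Prod>S\<in>D. k l D S (z t)) = exp (\<Sum>t<n. \<Sum>S\<in>D. ln (k l D S (z t)))"
          using pos finD by (simp add: exp_sum)
        then have "(\<Sum>t<n. \<Sum>S\<in>D. ln (k l D S (z t))) < real n * ((\<Sum>S\<in>D. R' S) - \<theta>)" using lt by simp
        moreover have "(\<Sum>t<n. h (l, D) (z t)) \<le> (\<Sum>t<n. \<Sum>S\<in>D. ln (k l D S (z t)))"
          using ok p by (intro sum_mono) force
        moreover have "real n * ((\<Sum>S\<in>D. R' S) - \<theta>) \<le> real n * (integral\<^sup>L JM (h (l, D)) - \<theta>/2)"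
          using hle[OF p] by (intro mult_left_mono) auto
        ultimately have "(\<Sum>t<n. h (l, D) (z t)) < real n * (integral\<^sup>L JM (h (l, D)) - \<theta>/2)" by linarith
        then have "z \<in> T (l, D) n" using z unfolding T_def
          by (simp add: sum_negf algebra_simps)
        then show "z \<in> (\<Union>p\<in>Q. T p n)" using p by blast
      qed
      then have "prob {z\<in>space (?J n). \<not> (\<forall>l<m. jtyp n \<theta> l (\<lambda>t. py l (fst (z t))) (\<lambda>t. restrict (snd (z t)) (DS l)))} \<le> prob (\<Union>p\<in>Q. T p n)"
        by (rule finite_measure_mono_AE) (use Tm finQ in auto)
      also have "\<dots> \<le> (\<Sum>p\<in>Q. prob (T p n))"
        by (rule finite_measure_subadditive_finite) (use Tm finQ in auto)
      finally show "prob {z\<in>space (?J n). \<not> (\<forall>l<m. jtyp n \<theta> l (\<lambda>t. py l (fst (z t))) (\<lambda>t. restrict (snd (z t)) (DS l)))} \<le> (\<Sum>p\<in>Q. prob (T p n))" .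
    qed
  qed simp
qed

text \<open>Up to rounding, a codebook has rate \<open>R S + R' S + 2 * \<theta>\<close>, which
  beats the exponent of the cap in \<open>cov\<close> by \<open>\<theta>\<close>. A bin has rate
  \<open>R' S - 2 * \<theta>\<close>, which pays for the slack \<open>\<theta>\<close> in
  \<open>jtyp\<close> and leaves \<open>\<theta>\<close> to spare.\<close>

definition Abin :: "real \<Rightarrow> nat \<Rightarrow> 's \<Rightarrow> nat" where
  "Abin \<theta> n S = nat \<lceil>exp (real n * (R S + 4 * \<theta>))\<rceil>"

definition Bbin :: "real \<Rightarrow> nat \<Rightarrow> 's \<Rightarrow> nat" where
  "Bbin \<theta> n S = nat \<lceil>exp (real n * (R' S - 2 * \<theta>))\<rceil>"

lemma Abin_pos: "Abin \<theta> n S > 0" and Bbin_pos: "Bbin \<theta> n S > 0"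
  by (simp_all add: Abin_def Bbin_def)

lemma covering_error_tendsto_0:
  assumes \<theta>: "\<theta> > 0"
  shows "(\<lambda>n. (\<Prod>S\<in>set vs. 1 + exp (real n * (R S + R' S + \<theta>)) / real (Abin \<theta> n S * Bbin \<theta> n S)) - 1) \<longlonglongrightarrow> 0"
proof -
  have "(\<lambda>n. 1 + exp (real n * (R S + R' S + \<theta>)) / real (Abin \<theta> n S * Bbin \<theta> n S)) \<longlonglongrightarrow> 1 + 0" for S
  proof (rule tendsto_add[OF tendsto_const], rule tendsto_sandwich[OF _ _ tendsto_const])
    show "(\<lambda>n. exp (- \<theta> * real n)) \<longlonglongrightarrow> 0" using \<theta> by real_asymp
    show "\<forall>\<^sub>F n in sequentially. exp (real n * (R S + R' S + \<theta>)) / real (Abin \<theta> n S * Bbin \<theta> n S) \<le> exp (- \<theta> * real n)"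
    proof (intro always_eventually allI)
      fix n
      have "exp (real n * (R S + 4 * \<theta>)) * exp (real n * (R' S - 2 * \<theta>)) \<le> real (Abin \<theta> n S) * real (Bbin \<theta> n S)"
        unfolding Abin_def Bbin_def by (intro mult_mono nat_ceiling_bounds(1)) (auto intro: less_le_trans[OF _ exp_ge_zero])
      then have "exp (real n * (R S + R' S + \<theta>)) / real (Abin \<theta> n S * Bbin \<theta> n S)
        \<le> exp (real n * (R S + R' S + \<theta>)) / (exp (real n * (R S + 4 * \<theta>)) * exp (real n * (R' S - 2 * \<theta>)))"
        by (intro divide_left_mono mult_pos_pos) (simp_all add: Abin_pos Bbin_pos)
      also have "\<dots> = exp (- \<theta> * real n)"
        unfolding exp_add[symmetric] exp_diff[symmetric] by (simp add: algebra_simps)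
      finally show "exp (real n * (R S + R' S + \<theta>)) / real (Abin \<theta> n S * Bbin \<theta> n S) \<le> exp (- \<theta> * real n)" .
    qed
  qed simp
  then have "(\<lambda>n. \<Prod>S\<in>set vs. 1 + exp (real n * (R S + R' S + \<theta>)) / real (Abin \<theta> n S * Bbin \<theta> n S)) \<longlonglongrightarrow> (\<Prod>S\<in>set vs. 1)"
    by (intro tendsto_prod) simp
  from tendsto_diff[OF this tendsto_const[of 1]] show ?thesis by simp
qed

lemma packing_error_tendsto_0:
  assumes \<theta>: "\<theta> > 0"
  shows "(\<lambda>n. \<Sum>l<m. exp (real n * \<theta>) * ((\<Prod>S\<in>DS l. 1 + real (Bbin \<theta> n S - 1) * exp (- real n * R' S)) - 1)) \<longlonglongrightarrow> 0"
proof -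
  have "(\<lambda>n. exp (real n * \<theta>) * ((\<Prod>S\<in>DS l. 1 + real (Bbin \<theta> n S - 1) * exp (- real n * R' S)) - 1)) \<longlonglongrightarrow> 0" for l
  proof (rule tendsto_sandwich[OF _ _ tendsto_const])
    \<comment> \<open>By \<open>1 + x <= exp x\<close> the product is at most
      \<open>exp (d * exp (- 2 * \<theta> * real n))\<close>. It exceeds 1 by an amount of order
      \<open>exp (- 2 * \<theta> * real n)\<close>, which beats the prefactor
      \<open>exp (real n * \<theta>)\<close>.\<close>
    define d where "d = real (card (DS l))"
    show "(\<lambda>n. exp (real n * \<theta>) * (exp (d * exp (- 2 * \<theta> * real n)) - 1)) \<longlonglongrightarrow> 0"
      using \<theta> by real_asymp
    have le: "real (Bbin \<theta> n S - 1) * exp (- real n * R' S) \<le> exp (- 2 * \<theta> * real n)" for n S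
    proof -
      \<comment> \<open>Competitors are counted, not words: rounding up and subtracting 1 adds
        nothing. If \<open>R' S\<close> is below \<open>2 * \<theta>\<close>, the bin holds a single
        word and there is no competitor.\<close>
      have "real (Bbin \<theta> n S - 1) \<le> exp (real n * (R' S - 2 * \<theta>))" unfolding Bbin_def by (rule nat_ceiling_bounds(3)) simp
      then have "real (Bbin \<theta> n S - 1) * exp (- real n * R' S) \<le> exp (real n * (R' S - 2 * \<theta>)) * exp (- real n * R' S)"
        by (intro mult_right_mono) auto
      also have "\<dots> = exp (- 2 * \<theta> * real n)" unfolding exp_add[symmetric] by (simp add: algebra_simps)
      finally show ?thesis .
    qed
    show "\<forall>\<^sub>F n in sequentially. exp (real n * \<theta>) * ((\<Prod>S\<in>DS l. 1 + real (Bbin \<theta> n S - 1) * exp (- real n * R' S)) - 1)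
       \<le> exp (real n * \<theta>) * (exp (d * exp (- 2 * \<theta> * real n)) - 1)"
    proof (intro always_eventually allI mult_left_mono diff_right_mono)
      fix n
      have "(\<Prod>S\<in>DS l. 1 + real (Bbin \<theta> n S - 1) * exp (- real n * R' S)) \<le> (\<Prod>S\<in>DS l. exp (exp (- 2 * \<theta> * real n)))"
      proof (intro prod_mono conjI)
        fix S
        show "0 \<le> 1 + real (Bbin \<theta> n S - 1) * exp (- real n * R' S)" by simp
        have "1 + real (Bbin \<theta> n S - 1) * exp (- real n * R' S) \<le> 1 + exp (- 2 * \<theta> * real n)" using le by simp
        also have "\<dots> \<le> exp (exp (- 2 * \<theta> * real n))" by (rule exp_ge_add_one_self)
        finally show "1 + real (Bbin \<theta> n S - 1) * exp (- real n * R' S) \<le> exp (exp (- 2 * \<theta> * real n))" .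
      qed
      also have "\<dots> = exp (d * exp (- 2 * \<theta> * real n))"
        by (simp add: d_def exp_of_nat_mult)
      finally show "(\<Prod>S\<in>DS l. 1 + real (Bbin \<theta> n S - 1) * exp (- real n * R' S)) \<le> exp (d * exp (- 2 * \<theta> * real n))" .
    qed simp
    show "\<forall>\<^sub>F n in sequentially. 0 \<le> exp (real n * \<theta>) * ((\<Prod>S\<in>DS l. 1 + real (Bbin \<theta> n S - 1) * exp (- real n * R' S)) - 1)"
      by (intro always_eventually allI mult_nonneg_nonneg) (auto intro!: prod_ge_1)
  qed
  then show ?thesis
    using tendsto_sum[of "{..<m}" "\<lambda>l n. exp (real n * \<theta>) * ((\<Prod>S\<in>DS l. 1 + real (Bbin \<theta> n S - 1) * exp (- real n * R' S)) - 1)" "\<lambda>_. 0" sequentially]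
    by simp
qed

lemma rate_bound:
  assumes \<theta>: "\<theta> > 0" and R0: "\<And>S. S \<in> set vs \<Longrightarrow> R S \<ge> 0" and n: "n > 0"
  shows "ln (real (card (PiE (set vs) (\<lambda>S. {..<Abin \<theta> n S})))) / real n
    \<le> (\<Sum>S\<in>set vs. R S) + real (card (set vs)) * (4 * \<theta> + ln 2 / real n)"
proof -
  have "ln (real (card (PiE (set vs) (\<lambda>S. {..<Abin \<theta> n S})))) = ln (\<Prod>S\<in>set vs. real (Abin \<theta> n S))"
    by (simp add: card_PiE)
  also have "\<dots> = (\<Sum>S\<in>set vs. ln (real (Abin \<theta> n S)))" by (rule ln_prod) (auto simp: Abin_pos)
  also have "\<dots> \<le> (\<Sum>S\<in>set vs. real n * (R S + 4 * \<theta>) + ln 2)"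
    unfolding Abin_def using R0 \<theta> by (intro sum_mono ln_nat_ceiling_exp mult_nonneg_nonneg) auto
  also have "\<dots> = real n * ((\<Sum>S\<in>set vs. R S) + real (card (set vs)) * (4 * \<theta> + ln 2 / real n))"
    using n by (simp add: sum.distrib sum_distrib_left[symmetric] field_simps)
  finally show ?thesis using n by (simp add: divide_le_eq mult.commute)
qed

end

section \<open>Densities and mutual information\<close>

lemma measure_eqI_rectangles:
  assumes "sets M = sets (S \<Otimes>\<^sub>M T)" "sets N = sets (S \<Otimes>\<^sub>M T)" and fin: "finite_measure M"
    and eq: "\<And>A B. A \<in> sets S \<Longrightarrow> B \<in> sets T \<Longrightarrow> emeasure M (A \<times> B) = emeasure N (A \<times> B)"
  shows "M = N"
proof (rule measure_eqI_generator_eq[OF Int_stable_pair_measure_generator[of S T]])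
  let ?A = "\<lambda>_::nat. space S \<times> space T"
  show "range ?A \<subseteq> {a \<times> b |a b. a \<in> sets S \<and> b \<in> sets T}" by auto
  show "(\<Union>i. ?A i) = space S \<times> space T" by auto
  show "emeasure M (?A i) \<noteq> \<infinity>" for i using finite_measure.emeasure_finite[OF fin] by auto
  show "{a \<times> b |a b. a \<in> sets S \<and> b \<in> sets T} \<subseteq> Pow (space S \<times> space T)"
    by (auto dest: sets.sets_into_space)
qed (use assms in \<open>auto simp: sets_pair_measure\<close>)

text \<open>If the joint law has a density \<open>h\<close> against some product, its marginals have
  densities \<open>hA\<close> and \<open>hB\<close>, both positive almost surely under the joint
  law. Where both are positive, a null set for the product of the marginals is null for the
  reference product, hence for the joint law. Absolute continuity is obtained in this way without
  finite mutual information.\<close>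

lemma absolutely_continuous_marginals:
  assumes \<alpha>: "prob_space \<alpha>" and \<beta>: "prob_space \<beta>" and s: "sets \<alpha> = sets SA" "sets \<beta> = sets SB"
    and M: "prob_space M" and A: "A \<in> measurable M SA" and B: "B \<in> measurable M SB"
    and ac: "absolutely_continuous (\<alpha> \<Otimes>\<^sub>M \<beta>) (distr M (SA \<Otimes>\<^sub>M SB) (\<lambda>\<omega>. (A \<omega>, B \<omega>)))"
  shows "absolutely_continuous (distr M SA A \<Otimes>\<^sub>M distr M SB B) (distr M (SA \<Otimes>\<^sub>M SB) (\<lambda>\<omega>. (A \<omega>, B \<omega>)))"
proof -
  interpret M: prob_space M by fact
  interpret a: prob_space \<alpha> by fact
  interpret b: prob_space \<beta> by fact
  interpret ab: pair_prob_space \<alpha> \<beta> ..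
  note [measurable_cong] = s and [measurable] = A B
  let ?J = "distr M (SA \<Otimes>\<^sub>M SB) (\<lambda>\<omega>. (A \<omega>, B \<omega>))"
  have sJ: "sets ?J = sets (\<alpha> \<Otimes>\<^sub>M \<beta>)" using s by (simp cong: sets_pair_measure_cong)
  define h where "h = RN_deriv (\<alpha> \<Otimes>\<^sub>M \<beta>) ?J"
  have hm[measurable]: "h \<in> borel_measurable (\<alpha> \<Otimes>\<^sub>M \<beta>)" by (simp add: h_def)
  have J: "?J = density (\<alpha> \<Otimes>\<^sub>M \<beta>) h"
    unfolding h_def using ab.density_RN_deriv[OF ac sJ] by simp
  define hA where "hA x = (\<integral>\<^sup>+y. h (x, y) \<partial>\<beta>)" for x
  define hB where "hB y = (\<integral>\<^sup>+x. h (x, y) \<partial>\<alpha>)" for y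
  have [measurable]: "hA \<in> borel_measurable \<alpha>" "hB \<in> borel_measurable \<beta>"
    unfolding hA_def hB_def by measurable
  have dA: "distr M SA A = density \<alpha> hA"
  proof (rule measure_eqI)
    fix C assume "C \<in> sets (distr M SA A)"
    then have [measurable]: "C \<in> sets SA" by simp
    have "emeasure (distr M SA A) C = emeasure ?J (C \<times> space SB)"
      using measurable_space[OF B] by (subst (1 2) emeasure_distr) (auto intro!: arg_cong[where f="emeasure M"])
    also have "\<dots> = (\<integral>\<^sup>+z. h z * indicator (C \<times> space SB) z \<partial>(\<alpha> \<Otimes>\<^sub>M \<beta>))"
      unfolding J by (rule emeasure_density) measurable
    also have "\<dots> = (\<integral>\<^sup>+x. \<integral>\<^sup>+y. h (x, y) * indicator (C \<times> space SB) (x, y) \<partial>\<beta> \<partial>\<alpha>)"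
      by (rule b.nn_integral_fst[symmetric]) measurable
    also have "\<dots> = (\<integral>\<^sup>+x. hA x * indicator C x \<partial>\<alpha>)"
      unfolding hA_def
    proof (rule nn_integral_cong)
      fix x assume x: "x \<in> space \<alpha>"
      have "(\<integral>\<^sup>+y. h (x, y) * indicator (C \<times> space SB) (x, y) \<partial>\<beta>) = (\<integral>\<^sup>+y. h (x, y) * indicator C x \<partial>\<beta>)"
        using sets_eq_imp_space_eq[OF s(2)] by (intro nn_integral_cong) (auto simp: indicator_def)
      then show "(\<integral>\<^sup>+y. h (x, y) * indicator (C \<times> space SB) (x, y) \<partial>\<beta>) = (\<integral>\<^sup>+y. h (x, y) \<partial>\<beta>) * indicator C x"
        using x by (simp add: nn_integral_multc)
    qed
    finally show "emeasure (distr M SA A) C = emeasure (density \<alpha> hA) C" by (simp add: emeasure_density)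
  qed (simp add: s)
  have dB: "distr M SB B = density \<beta> hB"
  proof (rule measure_eqI)
    fix C assume "C \<in> sets (distr M SB B)"
    then have [measurable]: "C \<in> sets SB" by simp
    have "emeasure (distr M SB B) C = emeasure ?J (space SA \<times> C)"
      using measurable_space[OF A] by (subst (1 2) emeasure_distr) (auto intro!: arg_cong[where f="emeasure M"])
    also have "\<dots> = (\<integral>\<^sup>+z. h z * indicator (space SA \<times> C) z \<partial>(\<alpha> \<Otimes>\<^sub>M \<beta>))"
      unfolding J by (rule emeasure_density) measurable
    also have "\<dots> = (\<integral>\<^sup>+y. \<integral>\<^sup>+x. h (x, y) * indicator (space SA \<times> C) (x, y) \<partial>\<alpha> \<partial>\<beta>)"
      by (rule ab.nn_integral_snd[symmetric]) measurable
    also have "\<dots> = (\<integral>\<^sup>+y. hB y * indicator C y \<partial>\<beta>)"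
      unfolding hB_def
    proof (rule nn_integral_cong)
      fix y assume y: "y \<in> space \<beta>"
      have "(\<integral>\<^sup>+x. h (x, y) * indicator (space SA \<times> C) (x, y) \<partial>\<alpha>) = (\<integral>\<^sup>+x. h (x, y) * indicator C y \<partial>\<alpha>)"
        using sets_eq_imp_space_eq[OF s(1)] by (intro nn_integral_cong) (auto simp: indicator_def)
      then show "(\<integral>\<^sup>+x. h (x, y) * indicator (space SA \<times> C) (x, y) \<partial>\<alpha>) = (\<integral>\<^sup>+x. h (x, y) \<partial>\<alpha>) * indicator C y"
        using y by (simp add: nn_integral_multc)
    qed
    finally show "emeasure (distr M SB B) C = emeasure (density \<beta> hB) C" by (simp add: emeasure_density)
  qed (simp add: s)
  interpret dA: prob_space "distr M SA A" by (rule M.prob_space_distr) (rule A)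
  interpret dB: prob_space "distr M SB B" by (rule M.prob_space_distr) (rule B)
  have pair: "distr M SA A \<Otimes>\<^sub>M distr M SB B = density (\<alpha> \<Otimes>\<^sub>M \<beta>) (\<lambda>(x, y). hA x * hB y)"
    unfolding dA dB
    by (rule pair_measure_density) (use dA.sigma_finite_measure_axioms dB.sigma_finite_measure_axioms in \<open>auto simp: dA dB b.sigma_finite_measure_axioms\<close>)
  have posA: "AE z in ?J. hA (fst z) > 0"
  proof -
    have "AE x in distr M SA A. hA x > 0" unfolding dA by (subst AE_density) auto
    then have "AE \<omega> in M. hA (A \<omega>) > 0" by (rule AE_distrD[OF A])
    then show ?thesis by (subst AE_distr_iff) auto
  qed
  have posB: "AE z in ?J. hB (snd z) > 0"
  proof -
    have "AE x in distr M SB B. hB x > 0" unfolding dB by (subst AE_density) auto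
    then have "AE \<omega> in M. hB (B \<omega>) > 0" by (rule AE_distrD[OF B])
    then show ?thesis by (subst AE_distr_iff) auto
  qed
  show ?thesis
  proof (unfold absolutely_continuous_def, safe)
    fix N assume N: "N \<in> null_sets (distr M SA A \<Otimes>\<^sub>M distr M SB B)"
    then have Nm[measurable]: "N \<in> sets (SA \<Otimes>\<^sub>M SB)" by (auto simp: null_sets_def cong: sets_pair_measure_cong)
    have "AE z in density (\<alpha> \<Otimes>\<^sub>M \<beta>) (\<lambda>(x, y). hA x * hB y). z \<notin> N" using AE_not_in[OF N] unfolding pair .
    then have "AE z in \<alpha> \<Otimes>\<^sub>M \<beta>. hA (fst z) * hB (snd z) > 0 \<longrightarrow> z \<notin> N"
      by (subst (asm) AE_density) (auto simp: case_prod_beta')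
    then have "AE z in ?J. hA (fst z) * hB (snd z) > 0 \<longrightarrow> z \<notin> N"
      using absolutely_continuous_AE[OF sJ ac] by blast
    with posA posB have "AE z in ?J. z \<notin> N" by eventually_elim (auto simp: ennreal_zero_less_mult_iff)
    then show "N \<in> null_sets ?J"
      using AE_iff_null[of ?J "\<lambda>z. z \<notin> N"] sets.sets_into_space[OF Nm] 
      by (simp add: AE_iff_null_sets)
  qed
qed

section \<open>Information densities\<close>

text \<open>The summand \<open>- x + 1\<close> integrates to 0 for a probability density, but it
  makes the integrand of the divergence nonnegative.\<close>

definition kl_fun :: "real \<Rightarrow> real" where "kl_fun x = x * ln x - x + 1"

lemma kl_fun_nonneg: "x \<ge> 0 \<Longrightarrow> kl_fun x \<ge> 0"
proof (cases "x = 0")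
  case False
  assume "x \<ge> 0" with False have x: "x > 0" by simp
  have "ln (1/x) \<le> 1/x - 1" using x by (intro ln_le_minus_one) simp
  then have "x * (- ln x) \<le> x * (1/x - 1)" using x by (intro mult_left_mono) (auto simp: ln_div)
  then show ?thesis using x by (simp add: kl_fun_def right_diff_distrib)
qed (simp add: kl_fun_def)

text \<open>Collects what random coding asks of an information density. With finite mutual
  information, \<open>f * ln f\<close> differs from the integrable \<open>kl_fun f\<close> by a
  function of integral 0. In general the logarithm is truncated from above, and monotone convergence
  brings the means arbitrarily close to the mutual information.\<close>

lemma mutual_info_density:
  assumes M: "prob_space M" and A[measurable]: "A \<in> measurable M SA" and B[measurable]: "B \<in> measurable M SB"
    and ac: "absolutely_continuous (distr M SA A \<Otimes>\<^sub>M distr M SB B) (distr M (SA \<Otimes>\<^sub>M SB) (\<lambda>\<omega>. (A \<omega>, B \<omega>)))"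
  shows "\<exists>f. f \<in> borel_measurable (SA \<Otimes>\<^sub>M SB) \<and> (\<forall>z. f z \<ge> (0::real)) \<and>
    distr M (SA \<Otimes>\<^sub>M SB) (\<lambda>\<omega>. (A \<omega>, B \<omega>)) = density (distr M SA A \<Otimes>\<^sub>M distr M SB B) (\<lambda>z. ennreal (f z)) \<and>
    (\<forall>b\<in>space SB. (\<integral>\<^sup>+a. ennreal (f (a, b)) \<partial>distr M SA A) \<le> 1) \<and>
    (\<forall>a\<in>space SA. (\<integral>\<^sup>+b. ennreal (f (a, b)) \<partial>distr M SB B) \<le> 1) \<and>
    (AE \<omega> in M. f (A \<omega>, B \<omega>) > 0) \<and>
    (mutual_info M SA SB A B < \<infinity> \<longrightarrow> integrable M (\<lambda>\<omega>. ln (f (A \<omega>, B \<omega>))) \<and>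
       ereal (\<integral>\<omega>. ln (f (A \<omega>, B \<omega>)) \<partial>M) = mutual_info M SA SB A B) \<and>
    (\<forall>c. ereal c < mutual_info M SA SB A B \<longrightarrow> (\<exists>L. integrable M (\<lambda>\<omega>. min (ln (f (A \<omega>, B \<omega>))) L) \<and>
       c \<le> (\<integral>\<omega>. min (ln (f (A \<omega>, B \<omega>))) L \<partial>M)))"
proof -
  interpret M: prob_space M by fact
  let ?A = "distr M SA A" and ?B = "distr M SB B" and ?J = "distr M (SA \<Otimes>\<^sub>M SB) (\<lambda>\<omega>. (A \<omega>, B \<omega>))"
  interpret a: prob_space ?A by (rule M.prob_space_distr) (rule A)
  interpret b: prob_space ?B by (rule M.prob_space_distr) (rule B)
  interpret ab: pair_prob_space ?A ?B ..
  interpret J: prob_space ?J by (rule M.prob_space_distr) measurable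
  let ?Q = "?A \<Otimes>\<^sub>M ?B"
  have sQ[measurable_cong]: "sets ?Q = sets (SA \<Otimes>\<^sub>M SB)" by (simp cong: sets_pair_measure_cong)
  have sJ: "sets ?J = sets ?Q" using sQ by simp
  define f0 where "f0 z = enn2real (RN_deriv ?Q ?J z)" for z
  have f0m[measurable]: "f0 \<in> borel_measurable (SA \<Otimes>\<^sub>M SB)"
  proof -
    have "f0 \<in> borel_measurable ?Q" unfolding f0_def by measurable
    then show ?thesis by (simp cong: measurable_cong_sets add: measurable_cong_sets[OF sQ refl])
  qed
  have f00: "f0 z \<ge> 0" for z by (simp add: f0_def)
  have fin: "AE z in ?Q. RN_deriv ?Q ?J z \<noteq> \<infinity>"
    by (rule ab.RN_deriv_finite[OF J.sigma_finite_measure_axioms ac sJ])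
  have f0AE: "AE z in ?Q. RN_deriv ?Q ?J z = ennreal (f0 z)"
    using fin by eventually_elim (auto simp: f0_def ennreal_enn2real_if)
  have J0: "?J = density ?Q (\<lambda>z. ennreal (f0 z))"
  proof -
    have "density ?Q (RN_deriv ?Q ?J) = density ?Q (\<lambda>z. ennreal (f0 z))"
      by (rule density_cong) (use f0AE in auto)
    then show ?thesis using ab.density_RN_deriv[OF ac sJ] by simp
  qed
  define kA where "kA y = (\<integral>\<^sup>+x. ennreal (f0 (x, y)) \<partial>?A)" for y
  define kB where "kB x = (\<integral>\<^sup>+y. ennreal (f0 (x, y)) \<partial>?B)" for x
  have [measurable]: "kA \<in> borel_measurable SB" "kB \<in> borel_measurable SA"
    unfolding kA_def kB_def by measurable
  have kA1: "AE y in ?B. kA y = 1"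
  proof -
    have "density ?B kA = density ?B (\<lambda>_. 1)"
    proof (rule measure_eqI)
      fix C assume "C \<in> sets (density ?B kA)"
      then have [measurable]: "C \<in> sets SB" by simp
      have "emeasure ?B C = emeasure ?J (space SA \<times> C)"
        using measurable_space[OF A] by (subst (1 2) emeasure_distr) (auto intro!: arg_cong[where f="emeasure M"])
      also have "\<dots> = (\<integral>\<^sup>+z. ennreal (f0 z) * indicator (space SA \<times> C) z \<partial>?Q)"
        by (subst J0, rule emeasure_density) measurable
      also have "\<dots> = (\<integral>\<^sup>+y. \<integral>\<^sup>+x. ennreal (f0 (x, y)) * indicator (space SA \<times> C) (x, y) \<partial>?A \<partial>?B)"
        by (rule ab.nn_integral_snd[symmetric]) measurable
      also have "\<dots> = (\<integral>\<^sup>+y. kA y * indicator C y \<partial>?B)"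
        unfolding kA_def
      proof (rule nn_integral_cong)
        fix y assume y: "y \<in> space ?B"
        then have [measurable]: "(\<lambda>x. f0 (x, y)) \<in> borel_measurable ?A" by simp
        have "(\<integral>\<^sup>+x. ennreal (f0 (x, y)) * indicator (space SA \<times> C) (x, y) \<partial>?A) = (\<integral>\<^sup>+x. ennreal (f0 (x, y)) * indicator C y \<partial>?A)"
          by (intro nn_integral_cong) (auto simp: indicator_def)
        then show "(\<integral>\<^sup>+x. ennreal (f0 (x, y)) * indicator (space SA \<times> C) (x, y) \<partial>?A) = (\<integral>\<^sup>+x. ennreal (f0 (x, y)) \<partial>?A) * indicator C y"
          by (simp add: nn_integral_multc)
      qed
      finally show "emeasure (density ?B kA) C = emeasure (density ?B (\<lambda>_. 1)) C" by (simp add: emeasure_density)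
    qed simp
    then show ?thesis by (subst (asm) b.density_unique_iff) auto
  qed
  have kB1: "AE x in ?A. kB x = 1"
  proof -
    have "density ?A kB = density ?A (\<lambda>_. 1)"
    proof (rule measure_eqI)
      fix C assume "C \<in> sets (density ?A kB)"
      then have [measurable]: "C \<in> sets SA" by simp
      have "emeasure ?A C = emeasure ?J (C \<times> space SB)"
        using measurable_space[OF B] by (subst (1 2) emeasure_distr) (auto intro!: arg_cong[where f="emeasure M"])
      also have "\<dots> = (\<integral>\<^sup>+z. ennreal (f0 z) * indicator (C \<times> space SB) z \<partial>?Q)"
        by (subst J0, rule emeasure_density) measurable
      also have "\<dots> = (\<integral>\<^sup>+x. \<integral>\<^sup>+y. ennreal (f0 (x, y)) * indicator (C \<times> space SB) (x, y) \<partial>?B \<partial>?A)"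
        by (rule b.nn_integral_fst[symmetric]) measurable
      also have "\<dots> = (\<integral>\<^sup>+x. kB x * indicator C x \<partial>?A)"
        unfolding kB_def
      proof (rule nn_integral_cong)
        fix x assume x: "x \<in> space ?A"
        then have [measurable]: "(\<lambda>y. f0 (x, y)) \<in> borel_measurable ?B" by simp
        have "(\<integral>\<^sup>+y. ennreal (f0 (x, y)) * indicator (C \<times> space SB) (x, y) \<partial>?B) = (\<integral>\<^sup>+y. ennreal (f0 (x, y)) * indicator C x \<partial>?B)"
          by (intro nn_integral_cong) (auto simp: indicator_def)
        then show "(\<integral>\<^sup>+y. ennreal (f0 (x, y)) * indicator (C \<times> space SB) (x, y) \<partial>?B) = (\<integral>\<^sup>+y. ennreal (f0 (x, y)) \<partial>?B) * indicator C x"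
          by (simp add: nn_integral_multc)
      qed
      finally show "emeasure (density ?A kB) C = emeasure (density ?A (\<lambda>_. 1)) C" by (simp add: emeasure_density)
    qed simp
    then show ?thesis by (subst (asm) a.density_unique_iff) auto
  qed
  \<comment> \<open>The marginal integrals \<open>kA\<close> and \<open>kB\<close> of the derivative
    are 1 almost everywhere only. Erasing the exceptional points changes \<open>f0\<close> on a null
    set and makes both integrals at most 1 everywhere, which matters since codewords are integrated
    with the other arguments fixed.\<close>
  define f where "f z = (if kA (snd z) \<le> 1 \<and> kB (fst z) \<le> 1 then f0 z else 0)" for z
  have fm[measurable]: "f \<in> borel_measurable (SA \<Otimes>\<^sub>M SB)" unfolding f_def by measurable
  have f_nn: "f z \<ge> 0" for z by (simp add: f_def f00)
  have ff0: "AE z in ?Q. f z = f0 z"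
  proof -
    have mB: "{z\<in>space ?Q. kB (fst z) = 1} \<in> sets ?Q" by measurable
    have mA: "{z\<in>space ?Q. kA (snd z) = 1} \<in> sets ?Q" by measurable
    have "AE z in ?Q. kB (fst z) = 1"
      by (rule ab.AE_pair_measure[OF mB]) (use kB1 in simp)
    moreover have "AE z in ?Q. kA (snd z) = 1"
      by (rule ab.AE_pair_measure[OF mA]) (use kA1 in simp)
    ultimately show ?thesis by eventually_elim (auto simp: f_def)
  qed
  have Jf: "?J = density ?Q (\<lambda>z. ennreal (f z))"
    by (subst J0, rule density_cong) (use ff0 in auto)
  have intA: "(\<integral>\<^sup>+x. ennreal (f (x, y)) \<partial>?A) \<le> 1" if "y \<in> space SB" for y
  proof (cases "kA y \<le> 1")
    case True
    have "(\<integral>\<^sup>+x. ennreal (f (x, y)) \<partial>?A) \<le> kA y"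
      unfolding kA_def by (intro nn_integral_mono) (auto simp: f_def f00)
    then show ?thesis using True by simp
  qed (simp add: f_def)
  have intB: "(\<integral>\<^sup>+y. ennreal (f (x, y)) \<partial>?B) \<le> 1" if "x \<in> space SA" for x
  proof (cases "kB x \<le> 1")
    case True
    have "(\<integral>\<^sup>+y. ennreal (f (x, y)) \<partial>?B) \<le> kB x"
      unfolding kB_def by (intro nn_integral_mono) (auto simp: f_def f00)
    then show ?thesis using True by simp
  qed (simp add: f_def)
  have pos: "AE \<omega> in M. f (A \<omega>, B \<omega>) > 0"
  proof -
    have "AE z in ?J. f z > 0" by (subst Jf, subst AE_density) auto
    then show ?thesis by (subst (asm) AE_distr_iff) auto
  qed
  have MI: "mutual_info M SA SB A B = enn2ereal (\<integral>\<^sup>+z. ennreal (kl_fun (f z)) \<partial>?Q)"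
  proof -
    have "(\<integral>\<^sup>+z. ennreal (kl_fun (f0 z)) \<partial>?Q) = (\<integral>\<^sup>+z. ennreal (kl_fun (f z)) \<partial>?Q)"
      by (rule nn_integral_cong_AE) (use ff0 in auto)
    then show ?thesis using ac by (simp add: mutual_info_def Let_def f0_def kl_fun_def)
  qed
  have f_int1: "(\<integral>\<^sup>+z. ennreal (f z) \<partial>?Q) = 1"
  proof -
    have "emeasure ?J (space ?J) = (\<integral>\<^sup>+z. ennreal (f z) * indicator (space ?Q) z \<partial>?Q)"
      by (subst (1) Jf, subst emeasure_density) (auto simp: space_pair_measure)
    also have "\<dots> = (\<integral>\<^sup>+z. ennreal (f z) \<partial>?Q)" by (intro nn_integral_cong) simp
    finally show ?thesis using J.emeasure_space_1 by simp
  qed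
  have f_int: "integrable ?Q f" and f_integral: "integral\<^sup>L ?Q f = 1"
    using f_int1 f_nn by (auto intro!: integrableI_nonneg simp: integral_eq_nn_integral)
  have transfer: "integrable M (\<lambda>\<omega>. F (A \<omega>, B \<omega>)) \<longleftrightarrow> integrable ?Q (\<lambda>z. f z * F z)"
      "(\<integral>\<omega>. F (A \<omega>, B \<omega>) \<partial>M) = (\<integral>z. f z * F z \<partial>?Q)"
    if [measurable]: "F \<in> borel_measurable (SA \<Otimes>\<^sub>M SB)" for F :: "_ \<Rightarrow> real"
  proof -
    have "integrable M (\<lambda>\<omega>. F (A \<omega>, B \<omega>)) \<longleftrightarrow> integrable ?J F" by (rule integrable_distr_eq[symmetric]) measurable
    also have "\<dots> \<longleftrightarrow> integrable ?Q (\<lambda>z. f z * F z)"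
      by (subst Jf, rule integrable_real_density) (auto simp: f_nn)
    finally show "integrable M (\<lambda>\<omega>. F (A \<omega>, B \<omega>)) \<longleftrightarrow> integrable ?Q (\<lambda>z. f z * F z)" .
    have "(\<integral>\<omega>. F (A \<omega>, B \<omega>) \<partial>M) = integral\<^sup>L ?J F" by (rule integral_distr[symmetric]) measurable
    also have "\<dots> = (\<integral>z. f z * F z \<partial>?Q)"
      by (subst Jf, rule integral_real_density) (auto simp: f_nn)
    finally show "(\<integral>\<omega>. F (A \<omega>, B \<omega>) \<partial>M) = (\<integral>z. f z * F z \<partial>?Q)" .
  qed
  have klm[measurable]: "(\<lambda>z. kl_fun (f z)) \<in> borel_measurable (SA \<Otimes>\<^sub>M SB)" unfolding kl_fun_def by measurable
  have fin_case: "integrable M (\<lambda>\<omega>. ln (f (A \<omega>, B \<omega>))) \<and> ereal (\<integral>\<omega>. ln (f (A \<omega>, B \<omega>)) \<partial>M) = mutual_info M SA SB A B"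
    if "mutual_info M SA SB A B < \<infinity>"
  proof -
    have lt: "(\<integral>\<^sup>+z. ennreal (kl_fun (f z)) \<partial>?Q) < \<infinity>" using that unfolding MI
      by (cases "\<integral>\<^sup>+z. ennreal (kl_fun (f z)) \<partial>?Q") auto
    have ki: "integrable ?Q (\<lambda>z. kl_fun (f z))"
      by (rule integrableI_nonneg) (use lt kl_fun_nonneg f_nn in auto)
    have eq: "(\<lambda>z. f z * ln (f z)) = (\<lambda>z. kl_fun (f z) + f z - 1)" by (auto simp: kl_fun_def)
    have i1: "integrable ?Q (\<lambda>z. f z * ln (f z))" unfolding eq using ki f_int by auto
    have i2: "(\<integral>z. f z * ln (f z) \<partial>?Q) = (\<integral>z. kl_fun (f z) \<partial>?Q)"
      unfolding eq using ki f_int f_integral by (simp add: ab.prob_space)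
    have "mutual_info M SA SB A B = enn2ereal (ennreal (\<integral>z. kl_fun (f z) \<partial>?Q))"
      unfolding MI using ki by (subst nn_integral_eq_integral) (auto simp: kl_fun_nonneg f_nn)
    also have "\<dots> = ereal (\<integral>z. kl_fun (f z) \<partial>?Q)"
      by (intro enn2ereal_ennreal integral_nonneg_AE AE_I2 kl_fun_nonneg f_nn)
    finally show ?thesis using transfer[of "\<lambda>z. ln (f z)"] i1 i2 by simp
  qed
  have inf_case: "\<exists>L. integrable M (\<lambda>\<omega>. min (ln (f (A \<omega>, B \<omega>))) L) \<and> c \<le> (\<integral>\<omega>. min (ln (f (A \<omega>, B \<omega>))) L \<partial>M)"
    if c: "ereal c < mutual_info M SA SB A B" for c
  proof -
    \<comment> \<open>The truncation level is \<open>Suc n\<close>: being at least 1, it keeps the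
      truncated integrand nonnegative, with value \<open>x * real n + 1\<close> above the level.
      Nonnegativity is needed for monotone convergence.\<close>
    define \<phi> where "\<phi> n x = x * min (ln x) (real (Suc n)) - x + 1" for n :: nat and x :: real
    have \<phi>0: "\<phi> n x \<ge> 0" if "x \<ge> 0" for n x
    proof (cases "ln x \<le> real (Suc n)")
      case True then show ?thesis using kl_fun_nonneg[OF that] by (simp add: \<phi>_def kl_fun_def min_def)
    next
      case False
      then have "\<phi> n x = x * real n + 1" by (simp add: \<phi>_def min_def algebra_simps)
      then show ?thesis using that by simp
    qed
    have \<phi>m[measurable]: "(\<lambda>z. \<phi> n (f z)) \<in> borel_measurable (SA \<Otimes>\<^sub>M SB)" for n unfolding \<phi>_def by measurable
    have \<phi>i: "integrable ?Q (\<lambda>z. \<phi> n (f z))" for n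
    proof (rule Bochner_Integration.integrable_bound[where f="\<lambda>z. f z * real (Suc n) + 1"])
      show "integrable ?Q (\<lambda>z. f z * real (Suc n) + 1)" using f_int by auto
      show "AE z in ?Q. norm (\<phi> n (f z)) \<le> norm (f z * real (Suc n) + 1)"
      proof (rule AE_I2)
        fix z
        have "\<phi> n (f z) \<le> f z * real (Suc n) - 0 + 1"
          unfolding \<phi>_def using f_nn[of z] by (intro add_mono diff_mono mult_left_mono) auto
        then show "norm (\<phi> n (f z)) \<le> norm (f z * real (Suc n) + 1)" using \<phi>0[OF f_nn[of z], of n] f_nn[of z] by simp
      qed
    qed simp
    have \<phi>int: "(\<integral>\<omega>. min (ln (f (A \<omega>, B \<omega>))) (real (Suc n)) \<partial>M) = (\<integral>z. \<phi> n (f z) \<partial>?Q)"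
      and \<phi>int': "integrable M (\<lambda>\<omega>. min (ln (f (A \<omega>, B \<omega>))) (real (Suc n)))" for n
    proof -
      have eq: "(\<lambda>z. f z * min (ln (f z)) (real (Suc n))) = (\<lambda>z. \<phi> n (f z) + f z - 1)" by (auto simp: \<phi>_def)
      show "integrable M (\<lambda>\<omega>. min (ln (f (A \<omega>, B \<omega>))) (real (Suc n)))"
        using transfer(1)[of "\<lambda>z. min (ln (f z)) (real (Suc n))"] \<phi>i[of n] f_int unfolding eq by auto
      show "(\<integral>\<omega>. min (ln (f (A \<omega>, B \<omega>))) (real (Suc n)) \<partial>M) = (\<integral>z. \<phi> n (f z) \<partial>?Q)"
        using transfer(2)[of "\<lambda>z. min (ln (f z)) (real (Suc n))"] \<phi>i[of n] f_int f_integral unfolding eq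
        by (simp add: ab.prob_space)
    qed
    have "\<exists>n. c \<le> (\<integral>z. \<phi> n (f z) \<partial>?Q)"
    \<comment> \<open>A negative \<open>c\<close> would be lost in \<open>ennreal c\<close>; for it
      nonnegativity of the integrand is enough.\<close>
    proof (cases "c < 0")
      case True
      moreover have "(\<integral>z. \<phi> 0 (f z) \<partial>?Q) \<ge> 0" by (intro integral_nonneg_AE AE_I2 \<phi>0 f_nn)
      ultimately show ?thesis by (intro exI[of _ 0]) auto
    next
      case False
      have "(\<integral>\<^sup>+z. ennreal (kl_fun (f z)) \<partial>?Q) = (\<integral>\<^sup>+z. (SUP n. ennreal (\<phi> n (f z))) \<partial>?Q)"
      proof (rule nn_integral_cong)
        fix z
        obtain N :: nat where N: "ln (f z) \<le> real N" using real_arch_simple by blast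
        show "ennreal (kl_fun (f z)) = (SUP n. ennreal (\<phi> n (f z)))"
        proof (rule antisym)
          have "kl_fun (f z) = \<phi> N (f z)" using N by (simp add: kl_fun_def \<phi>_def min_def)
          then show "ennreal (kl_fun (f z)) \<le> (SUP n. ennreal (\<phi> n (f z)))" by (auto intro: SUP_upper2[of N])
          show "(SUP n. ennreal (\<phi> n (f z))) \<le> ennreal (kl_fun (f z))"
            unfolding \<phi>_def kl_fun_def using f_nn[of z]
            by (intro SUP_least ennreal_leI add_right_mono diff_right_mono mult_left_mono) auto
        qed
      qed
      also have "\<dots> = (SUP n. \<integral>\<^sup>+z. ennreal (\<phi> n (f z)) \<partial>?Q)"
      proof (rule nn_integral_monotone_convergence_SUP)
        show "incseq (\<lambda>n z. ennreal (\<phi> n (f z)))"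
          unfolding incseq_def le_fun_def \<phi>_def using f_nn
          by (auto intro!: ennreal_leI diff_right_mono mult_left_mono)
      qed simp
      finally have "ennreal c < (SUP n. \<integral>\<^sup>+z. ennreal (\<phi> n (f z)) \<partial>?Q)"
        using c False unfolding MI by (simp add: less_ennreal.rep_eq enn2ereal_ennreal)
      then obtain n where "ennreal c < (\<integral>\<^sup>+z. ennreal (\<phi> n (f z)) \<partial>?Q)" by (auto simp: less_SUP_iff)
      also have "\<dots> = ennreal (\<integral>z. \<phi> n (f z) \<partial>?Q)"
        by (rule nn_integral_eq_integral[OF \<phi>i]) (auto simp: \<phi>0 f_nn)
      finally show ?thesis using False by (auto simp: ennreal_less_iff intro: less_imp_le)
    qed
    then show ?thesis using \<phi>int \<phi>int' by metis
  qed
  show ?thesis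
    by (intro exI[of _ f] conjI fm Jf pos) (use f_nn intA intB fin_case inf_case in auto)
qed

section \<open>Density of the joint law of the source and the auxiliary variables\<close>

text \<open>Given \<open>X\<close> and the earlier variables, the last one has density
  \<open>f S\<close> against \<open>q S\<close>. Integrating it out turns \<open>F\<close> into a
  function \<open>G\<close> of the earlier variables, which is why the induction is over arbitrary
  \<open>F\<close>.\<close>

lemma chain_density:
  fixes U :: "'s \<Rightarrow> 'a \<Rightarrow> 'u" and SX :: "'x measure" and f :: "'s \<Rightarrow> ('x \<times> ('s \<Rightarrow> 'u)) \<times> 'u \<Rightarrow> real"
  assumes M: "prob_space M" and X[measurable]: "X \<in> measurable M SX"
    and q: "\<And>S. prob_space (q S)" and sq: "\<And>S. S \<in> set ws \<Longrightarrow> sets (q S) = sets (SU S)"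
    and ws: "distinct ws" and U: "\<And>S. S \<in> set ws \<Longrightarrow> U S \<in> measurable M (SU S)"
    and fm: "\<And>S. S \<in> set ws \<Longrightarrow> f S \<in> borel_measurable ((SX \<Otimes>\<^sub>M PiM (bef S) SU) \<Otimes>\<^sub>M SU S)"
    and bef: "\<And>ys S zs. ws = ys @ S # zs \<Longrightarrow> bef S = set ys"
    and law: "\<And>S. S \<in> set ws \<Longrightarrow>
      distr M ((SX \<Otimes>\<^sub>M PiM (bef S) SU) \<Otimes>\<^sub>M SU S) (\<lambda>\<omega>. ((X \<omega>, \<lambda>S'\<in>bef S. U S' \<omega>), U S \<omega>)) =
      density (distr M (SX \<Otimes>\<^sub>M PiM (bef S) SU) (\<lambda>\<omega>. (X \<omega>, \<lambda>S'\<in>bef S. U S' \<omega>)) \<Otimes>\<^sub>M q S) (\<lambda>z. ennreal (f S z))"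
    and F: "F \<in> borel_measurable (SX \<Otimes>\<^sub>M PiM (set ws) SU)"
  shows "(\<integral>\<^sup>+\<omega>. F (X \<omega>, \<lambda>S\<in>set ws. U S \<omega>) \<partial>M) =
    (\<integral>\<^sup>+x. \<integral>\<^sup>+u. F (x, u) * (\<Prod>S\<in>set ws. ennreal (f S ((x, restrict u (bef S)), u S))) \<partial>PiM (set ws) q \<partial>distr M SX X)"
  using sq ws U fm bef law F
proof (induction ws arbitrary: F rule: rev_induct)
  case Nil
  interpret q: product_prob_space q by (rule product_prob_spaceI) (rule q)
  have "(\<lambda>x. F (x, \<lambda>_. undefined)) \<in> borel_measurable SX" using Nil.prems(7) by simp
  then have "(\<integral>\<^sup>+x. F (x, \<lambda>_. undefined) \<partial>distr M SX X) = (\<integral>\<^sup>+\<omega>. F (X \<omega>, \<lambda>_. undefined) \<partial>M)"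
    by (intro nn_integral_distr) auto
  then show ?case by (simp add: q.nn_integral_empty restrict_def)
next
  case (snoc S ws)
  interpret q: product_prob_space q by (rule product_prob_spaceI) (rule q)
  interpret M: prob_space M by fact
  have qS: "sigma_finite_measure (q S)" using q by (simp add: prob_space_imp_sigma_finite)
  let ?W = "set ws"
  have S: "S \<notin> ?W" using snoc.prems(2) by auto
  have befS: "bef S = ?W" using snoc.prems(5)[of ws S "[]"] by simp
  have befsub: "bef T \<subseteq> ?W - {T}" if T: "T \<in> ?W" for T
  proof -
    obtain ys zs where e: "ws = ys @ T # zs" using split_list[OF T] by auto
    then have "bef T = set ys" using snoc.prems(5)[of ys T "zs @ [S]"] by simp
    then show ?thesis using e snoc.prems(2) by auto
  qed
  have sqS[measurable_cong]: "sets (q S) = sets (SU S)" using snoc.prems(1) by simp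
  have [measurable]: "U S \<in> measurable M (SU S)" using snoc.prems(3) by simp
  have UW[measurable]: "(\<lambda>\<omega>. \<lambda>S'\<in>?W. U S' \<omega>) \<in> measurable M (PiM ?W SU)"
    by (rule measurable_restrict) (use snoc.prems(3) in auto)
  have fS[measurable]: "f S \<in> borel_measurable ((SX \<Otimes>\<^sub>M PiM ?W SU) \<Otimes>\<^sub>M SU S)"
    using snoc.prems(4)[of S] by (simp add: befS)
  have sPq: "sets (PiM ?W q) = sets (PiM ?W SU)" by (rule sets_PiM_cong) (use snoc.prems(1) in auto)
  have setS: "set (ws @ [S]) = insert S ?W" by simp
  have sPq': "sets (PiM (insert S ?W) q) = sets (PiM (insert S ?W) SU)" by (rule sets_PiM_cong) (use snoc.prems(1) in auto)
  have Fm[measurable]: "F \<in> borel_measurable (SX \<Otimes>\<^sub>M PiM (insert S ?W) SU)" using snoc.prems(7) by simp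
  have upd[measurable]: "(\<lambda>z. (fst (fst z), (snd (fst z))(S := snd z))) \<in> measurable ((SX \<Otimes>\<^sub>M PiM ?W SU) \<Otimes>\<^sub>M SU S) (SX \<Otimes>\<^sub>M PiM (insert S ?W) SU)"
  proof (rule measurable_Pair)
    have "(\<lambda>z. (snd (fst z), snd z)) \<in> measurable ((SX \<Otimes>\<^sub>M PiM ?W SU) \<Otimes>\<^sub>M SU S) (PiM ?W SU \<Otimes>\<^sub>M SU S)" by measurable
    from measurable_compose[OF this measurable_add_dim]
    show "(\<lambda>z. (snd (fst z))(S := snd z)) \<in> measurable ((SX \<Otimes>\<^sub>M PiM ?W SU) \<Otimes>\<^sub>M SU S) (PiM (insert S ?W) SU)"
      by (simp add: case_prod_beta')
  qed measurable
  define F' where "F' z = F (fst (fst z), (snd (fst z))(S := snd z))" for z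
  have F'm[measurable]: "F' \<in> borel_measurable ((SX \<Otimes>\<^sub>M PiM ?W SU) \<Otimes>\<^sub>M SU S)"
    unfolding F'_def by (rule measurable_compose[OF upd Fm])
  define G where "G z = (\<integral>\<^sup>+v. ennreal (f S (z, v)) * F' (z, v) \<partial>q S)" for z
  have Gm[measurable]: "G \<in> borel_measurable (SX \<Otimes>\<^sub>M PiM ?W SU)" unfolding G_def by measurable
  let ?L = "distr M (SX \<Otimes>\<^sub>M PiM ?W SU) (\<lambda>\<omega>. (X \<omega>, \<lambda>S'\<in>?W. U S' \<omega>))"
  have "(\<integral>\<^sup>+\<omega>. F (X \<omega>, \<lambda>S\<in>set (ws @ [S]). U S \<omega>) \<partial>M) = (\<integral>\<^sup>+\<omega>. F' ((X \<omega>, \<lambda>S'\<in>?W. U S' \<omega>), U S \<omega>) \<partial>M)"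
  proof (rule nn_integral_cong)
    fix \<omega>
    have "(\<lambda>S\<in>set (ws @ [S]). U S \<omega>) = (\<lambda>S'\<in>?W. U S' \<omega>)(S := U S \<omega>)" by (auto simp: fun_eq_iff)
    then show "F (X \<omega>, \<lambda>S\<in>set (ws @ [S]). U S \<omega>) = F' ((X \<omega>, \<lambda>S'\<in>?W. U S' \<omega>), U S \<omega>)" by (simp add: F'_def)
  qed
  also have "\<dots> = (\<integral>\<^sup>+z. F' z \<partial>distr M ((SX \<Otimes>\<^sub>M PiM ?W SU) \<Otimes>\<^sub>M SU S) (\<lambda>\<omega>. ((X \<omega>, \<lambda>S'\<in>?W. U S' \<omega>), U S \<omega>)))"
    by (rule nn_integral_distr[symmetric]) measurable
  also have "\<dots> = (\<integral>\<^sup>+z. F' z \<partial>density (?L \<Otimes>\<^sub>M q S) (\<lambda>z. ennreal (f S z)))"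
  proof -
    have "distr M ((SX \<Otimes>\<^sub>M PiM ?W SU) \<Otimes>\<^sub>M SU S) (\<lambda>\<omega>. ((X \<omega>, \<lambda>S'\<in>?W. U S' \<omega>), U S \<omega>))
      = density (?L \<Otimes>\<^sub>M q S) (\<lambda>z. ennreal (f S z))"
      by (rule snoc.prems(6)[of S, unfolded befS]) simp
    then show ?thesis by (simp only:)
  qed
  also have "\<dots> = (\<integral>\<^sup>+z. ennreal (f S z) * F' z \<partial>(?L \<Otimes>\<^sub>M q S))"
    by (rule nn_integral_density) measurable
  also have "\<dots> = (\<integral>\<^sup>+z. G z \<partial>?L)"
    unfolding G_def by (rule sigma_finite_measure.nn_integral_fst[OF qS, symmetric]) measurable
  also have "\<dots> = (\<integral>\<^sup>+\<omega>. G (X \<omega>, \<lambda>S'\<in>?W. U S' \<omega>) \<partial>M)"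
    by (rule nn_integral_distr) measurable
  also have "\<dots> = (\<integral>\<^sup>+x. \<integral>\<^sup>+u. G (x, u) * (\<Prod>S\<in>?W. ennreal (f S ((x, restrict u (bef S)), u S))) \<partial>PiM ?W q \<partial>distr M SX X)"
  proof (rule snoc.IH)
    show "bef T = set ys" if "ws = ys @ T # zs" for ys T zs
      using snoc.prems(5)[of ys T "zs @ [S]"] that by simp
  qed (use snoc.prems Gm in auto)
  also have "\<dots> = (\<integral>\<^sup>+x. \<integral>\<^sup>+u. F (x, u) * (\<Prod>S\<in>insert S ?W. ennreal (f S ((x, restrict u (bef S)), u S))) \<partial>PiM (insert S ?W) q \<partial>distr M SX X)"
  proof (rule nn_integral_cong)
    fix x assume "x \<in> space (distr M SX X)"
    then have x: "x \<in> space SX" by simp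
    let ?p = "\<lambda>T u. ennreal (f T ((x, restrict u (bef T)), u T))"
    have pm: "?p T \<in> borel_measurable (PiM (insert S ?W) q)" if T: "T \<in> insert S ?W" for T
    proof -
      have sub: "bef T \<subseteq> insert S ?W" using befsub[of T] befS T by auto
      have [measurable]: "f T \<in> borel_measurable ((SX \<Otimes>\<^sub>M PiM (bef T) SU) \<Otimes>\<^sub>M SU T)" using snoc.prems(4)[of T] T by auto
      have [measurable]: "(\<lambda>u. restrict u (bef T)) \<in> measurable (PiM (insert S ?W) SU) (PiM (bef T) SU)"
        by (rule measurable_restrict_subset[OF sub])
      have [measurable]: "(\<lambda>u. u T) \<in> measurable (PiM (insert S ?W) SU) (SU T)" using T by (rule measurable_component_singleton)
      have "?p T \<in> borel_measurable (PiM (insert S ?W) SU)" using x by measurable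
      then show ?thesis by (simp only: measurable_cong_sets[OF sPq' refl])
    qed
    have Fx: "(\<lambda>u. F (x, u)) \<in> borel_measurable (PiM (insert S ?W) q)"
      using x measurable_Pair2[OF Fm, of x] by (simp add: measurable_cong_sets[OF sPq' refl])
    have "(\<integral>\<^sup>+u. F (x, u) * (\<Prod>T\<in>insert S ?W. ?p T u) \<partial>PiM (insert S ?W) q)
      = (\<integral>\<^sup>+u. \<integral>\<^sup>+v. F (x, u(S := v)) * (\<Prod>T\<in>insert S ?W. ?p T (u(S := v))) \<partial>q S \<partial>PiM ?W q)"
      by (rule q.product_nn_integral_insert[OF _ S]) (auto intro!: borel_measurable_times_ennreal borel_measurable_prod_ennreal Fx pm)
    also have "\<dots> = (\<integral>\<^sup>+u. G (x, u) * (\<Prod>T\<in>?W. ?p T u) \<partial>PiM ?W q)"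
    proof (rule nn_integral_cong)
      fix u assume u: "u \<in> space (PiM ?W q)"
      then have u': "u \<in> space (PiM ?W SU)" using sets_eq_imp_space_eq[OF sPq] by simp
      have ext: "u \<in> extensional ?W" using u by (auto simp: space_PiM PiE_iff)
      have pT: "?p T (u(S := v)) = ?p T u" if T: "T \<in> ?W" for T v
      proof -
        have "restrict (u(S := v)) (bef T) = restrict u (bef T)" using befsub[OF T] S by (auto simp: restrict_def fun_eq_iff)
        moreover have "(u(S := v)) T = u T" using T S by auto
        ultimately show ?thesis by (simp only:)
      qed
      have pS: "?p S (u(S := v)) = ennreal (f S ((x, u), v))" for v
      proof -
        have "restrict (u(S := v)) (bef S) = u" using ext S by (auto simp: befS restrict_def fun_eq_iff extensional_def)
        then show ?thesis by simp
      qed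
      have "F (x, u(S := v)) * (\<Prod>T\<in>insert S ?W. ?p T (u(S := v))) = (ennreal (f S ((x, u), v)) * F' ((x, u), v)) * (\<Prod>T\<in>?W. ?p T u)" for v
      proof -
        have "(\<Prod>T\<in>insert S ?W. ?p T (u(S := v))) = ?p S (u(S := v)) * (\<Prod>T\<in>?W. ?p T (u(S := v)))"
          using S by (rule prod.insert[OF finite_set])
        also have "(\<Prod>T\<in>?W. ?p T (u(S := v))) = (\<Prod>T\<in>?W. ?p T u)" by (rule prod.cong[OF refl pT])
        finally show ?thesis by (simp only: pS) (simp add: F'_def mult_ac)
      qed
      then have "(\<integral>\<^sup>+v. F (x, u(S := v)) * (\<Prod>T\<in>insert S ?W. ?p T (u(S := v))) \<partial>q S)
        = (\<integral>\<^sup>+v. (ennreal (f S ((x, u), v)) * F' ((x, u), v)) * (\<Prod>T\<in>?W. ?p T u) \<partial>q S)" by (simp only:)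
      also have "\<dots> = G (x, u) * (\<Prod>T\<in>?W. ?p T u)"
        unfolding G_def by (rule nn_integral_multc) (use x u' in measurable)
      finally show "(\<integral>\<^sup>+v. F (x, u(S := v)) * (\<Prod>T\<in>insert S ?W. ?p T (u(S := v))) \<partial>q S) = G (x, u) * (\<Prod>T\<in>?W. ?p T u)" .
    qed
    finally show "(\<integral>\<^sup>+u. G (x, u) * (\<Prod>T\<in>?W. ?p T u) \<partial>PiM ?W q) = (\<integral>\<^sup>+u. F (x, u) * (\<Prod>T\<in>insert S ?W. ?p T u) \<partial>PiM (insert S ?W) q)" ..
  qed
  finally show ?case unfolding setS .
qed

text \<open>Given \<open>X\<close>, the event that \<open>V\<close> lies in \<open>A\<close> has as
  conditional probability the integral of \<open>w\<close> over \<open>A\<close>. Conditional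
  independence lets this factor multiply the law of \<open>(X, Y)\<close>, so the density found for
  \<open>(X, V)\<close> serves for \<open>((X, Y), V)\<close> as well.\<close>

lemma markov_density:
  assumes M: "prob_space M" and X[measurable]: "X \<in> measurable M SX" and Y[measurable]: "Y \<in> measurable M SY"
    and V[measurable]: "V \<in> measurable M SV" and mk: "markov_chain M SV V SX X SY Y"
    and Q: "prob_space Q" and sQ[measurable_cong]: "sets Q = sets SV" and w[measurable]: "w \<in> borel_measurable (SX \<Otimes>\<^sub>M SV)"
    and law: "\<And>F. F \<in> borel_measurable (SX \<Otimes>\<^sub>M SV) \<Longrightarrow>
      (\<integral>\<^sup>+\<omega>. F (X \<omega>, V \<omega>) \<partial>M) = (\<integral>\<^sup>+x. \<integral>\<^sup>+v. F (x, v) * w (x, v) \<partial>Q \<partial>distr M SX X)"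
  shows "distr M ((SX \<Otimes>\<^sub>M SY) \<Otimes>\<^sub>M SV) (\<lambda>\<omega>. ((X \<omega>, Y \<omega>), V \<omega>))
    = density (distr M (SX \<Otimes>\<^sub>M SY) (\<lambda>\<omega>. (X \<omega>, Y \<omega>)) \<Otimes>\<^sub>M Q) (\<lambda>z. w (fst (fst z), snd z))"
proof -
  interpret M: prob_space M by fact
  interpret Q: prob_space Q by fact
  let ?F = "vimage_algebra (space M) X SX"
  have XF: "X \<in> measurable ?F SX" by (rule measurable_vimage_algebra1) (use measurable_space[OF X] in auto)
  have sub: "subalgebra M ?F"
    unfolding subalgebra_def using measurable_sets[OF X] measurable_space[OF X]
    by (auto simp: sets_vimage_algebra2)
  interpret finite_measure_subalgebra M ?F by unfold_locales (rule sub)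
  have key: "emeasure M {\<omega>\<in>space M. X \<omega> \<in> C \<and> Y \<omega> \<in> B \<and> V \<omega> \<in> A} =
      (\<integral>\<^sup>+\<omega>. indicator C (X \<omega>) * indicator B (Y \<omega>) * (\<integral>\<^sup>+v. indicator A v * w (X \<omega>, v) \<partial>Q) \<partial>M)"
    if A[measurable]: "A \<in> sets SV" and B[measurable]: "B \<in> sets SY" and C[measurable]: "C \<in> sets SX" for A B C
  proof -
    define h where "h x = (\<integral>\<^sup>+v. indicator A v * w (x, v) \<partial>Q)" for x
    have hm[measurable]: "h \<in> borel_measurable SX" unfolding h_def by measurable
    have hlaw: "(\<integral>\<^sup>+\<omega>. indicator D (X \<omega>) * indicator A (V \<omega>) \<partial>M) = (\<integral>\<^sup>+\<omega>. indicator D (X \<omega>) * h (X \<omega>) \<partial>M)"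
      if D[measurable]: "D \<in> sets SX" for D
    proof -
      have "(\<integral>\<^sup>+\<omega>. indicator D (X \<omega>) * indicator A (V \<omega>) \<partial>M) = (\<integral>\<^sup>+x. \<integral>\<^sup>+v. (indicator D x * indicator A v) * w (x, v) \<partial>Q \<partial>distr M SX X)"
        using law[of "\<lambda>z. indicator D (fst z) * indicator A (snd z)"] by simp
      also have "\<dots> = (\<integral>\<^sup>+x. indicator D x * h x \<partial>distr M SX X)"
        unfolding h_def by (intro nn_integral_cong) (auto simp: mult.assoc intro!: nn_integral_cmult)
      also have "\<dots> = (\<integral>\<^sup>+\<omega>. indicator D (X \<omega>) * h (X \<omega>) \<partial>M)" by (rule nn_integral_distr) measurable
      finally show ?thesis .
    qed
    have "(\<integral>\<^sup>+\<omega>. h (X \<omega>) \<partial>M) = (\<integral>\<^sup>+\<omega>. indicator (space SX) (X \<omega>) * h (X \<omega>) \<partial>M)"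
      using measurable_space[OF X] by (intro nn_integral_cong) auto
    also have "\<dots> = (\<integral>\<^sup>+\<omega>. indicator (space SX) (X \<omega>) * indicator A (V \<omega>) \<partial>M)" by (rule hlaw[symmetric]) simp
    also have "\<dots> \<le> (\<integral>\<^sup>+\<omega>. 1 \<partial>M)" by (intro nn_integral_mono) (auto simp: indicator_def)
    also have "\<dots> = 1" by (simp add: M.emeasure_space_1)
    finally have hle: "(\<integral>\<^sup>+\<omega>. h (X \<omega>) \<partial>M) \<le> 1" .
    then have hfin: "AE \<omega> in M. h (X \<omega>) \<noteq> \<infinity>"
      by (intro nn_integral_noteq_infinite) (auto simp: top_unique)
    \<comment> \<open>Conditional expectations are real-valued, so the almost surely finite
      \<open>h (X \<omega>)\<close> is made real before \<open>c1\<close> identifies it as a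
      conditional probability.\<close>
    define hr where "hr \<omega> = enn2real (h (X \<omega>))" for \<omega>
    have hrAE: "AE \<omega> in M. ennreal (hr \<omega>) = h (X \<omega>)"
      using hfin by eventually_elim (auto simp: hr_def ennreal_enn2real_if)
    have hrF: "hr \<in> borel_measurable ?F" unfolding hr_def using XF by measurable
    have hrm[measurable]: "hr \<in> borel_measurable M" unfolding hr_def by measurable
    have hr0: "hr \<omega> \<ge> 0" for \<omega> by (simp add: hr_def)
    have hri: "integrable M hr"
    proof (rule integrableI_nonneg)
      have "(\<integral>\<^sup>+\<omega>. ennreal (hr \<omega>) \<partial>M) = (\<integral>\<^sup>+\<omega>. h (X \<omega>) \<partial>M)" by (rule nn_integral_cong_AE[OF hrAE])
      then show "(\<integral>\<^sup>+\<omega>. ennreal (hr \<omega>) \<partial>M) < \<infinity>" using hle by (simp add: le_less_trans)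
    qed (auto simp: hr0)
    let ?VA = "{\<omega>\<in>space M. V \<omega> \<in> A}" and ?YB = "{\<omega>\<in>space M. Y \<omega> \<in> B}" and ?VY = "{\<omega>\<in>space M. V \<omega> \<in> A \<and> Y \<omega> \<in> B}"
    have c1: "AE \<omega> in M. real_cond_exp M ?F (indicator ?VA) \<omega> = hr \<omega>"
    proof (rule real_cond_exp_charact[OF _ _ hri hrF])
      show "integrable M (indicator ?VA :: _ \<Rightarrow> real)"
        by (rule M.integrable_const_bound[where B=1]) (auto simp: indicator_def)
      fix E assume "E \<in> sets ?F"
      then obtain D where D[measurable]: "D \<in> sets SX" and E: "E = X -` D \<inter> space M"
        using measurable_space[OF X] by (auto simp: sets_vimage_algebra2)
      have "E \<in> sets M" unfolding E by measurable
      have "ennreal (\<integral>\<omega>. indicator E \<omega> * indicator ?VA \<omega> \<partial>M) = (\<integral>\<^sup>+\<omega>. ennreal (indicator E \<omega> * indicator ?VA \<omega>) \<partial>M)"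
        by (rule nn_integral_eq_integral[symmetric])
           (use \<open>E \<in> sets M\<close> in \<open>auto intro!: M.integrable_const_bound[where B=1] simp: indicator_def\<close>)
      also have "\<dots> = (\<integral>\<^sup>+\<omega>. indicator D (X \<omega>) * indicator A (V \<omega>) \<partial>M)"
        by (intro nn_integral_cong) (auto simp: E indicator_def)
      also have "\<dots> = (\<integral>\<^sup>+\<omega>. indicator D (X \<omega>) * h (X \<omega>) \<partial>M)" by (rule hlaw) simp
      also have "\<dots> = (\<integral>\<^sup>+\<omega>. ennreal (indicator E \<omega> * hr \<omega>) \<partial>M)"
      proof (rule nn_integral_cong_AE)
        show "AE \<omega> in M. indicator D (X \<omega>) * h (X \<omega>) = ennreal (indicator E \<omega> * hr \<omega>)"
          using hrAE AE_space by eventually_elim (auto simp: E indicator_def)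
      qed
      also have "\<dots> = ennreal (\<integral>\<omega>. indicator E \<omega> * hr \<omega> \<partial>M)"
        by (rule nn_integral_eq_integral)
           (use \<open>E \<in> sets M\<close> hri hr0 in \<open>auto intro!: integrable_real_mult_indicator simp: mult.commute[of "indicator E _"]\<close>)
      finally have "(\<integral>\<omega>. indicator E \<omega> * indicator ?VA \<omega> \<partial>M) = (\<integral>\<omega>. indicator E \<omega> * hr \<omega> \<partial>M)"
        by (subst (asm) ennreal_inj) (auto intro!: integral_nonneg_AE simp: hr0)
      then show "(\<integral>\<omega>\<in>E. indicator ?VA \<omega> \<partial>M) = (\<integral>\<omega>\<in>E. hr \<omega> \<partial>M)"
        by (simp add: set_lebesgue_integral_def)
    qed
    \<comment> \<open>The Markov property brings in \<open>hr\<close> as a factor. Being measurable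
      with respect to \<open>X\<close>, it can be moved inside, and integrating removes the
      conditional expectation of the event for \<open>Y\<close>.\<close>
    have mkAE: "AE \<omega> in M. real_cond_exp M ?F (indicator ?VY) \<omega> =
        real_cond_exp M ?F (indicator ?VA) \<omega> * real_cond_exp M ?F (indicator ?YB) \<omega>"
      using mk A B unfolding markov_chain_def by blast
    let ?c = "\<lambda>\<omega>. indicator C (X \<omega>) :: real"
    have cF: "?c \<in> borel_measurable ?F" using XF by measurable
    have ci: "integrable M (\<lambda>\<omega>. ?c \<omega> * indicator ?VY \<omega>)"
      by (rule M.integrable_const_bound[where B=1]) (auto simp: indicator_def)
    have chi: "integrable M (\<lambda>\<omega>. ?c \<omega> * hr \<omega> * indicator ?YB \<omega>)"
      by (rule Bochner_Integration.integrable_bound[OF hri]) (auto simp: indicator_def hr0)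
    have "(\<integral>\<omega>. ?c \<omega> * indicator ?VY \<omega> \<partial>M) = (\<integral>\<omega>. ?c \<omega> * real_cond_exp M ?F (indicator ?VY) \<omega> \<partial>M)"
      by (rule real_cond_exp_intg(2)[symmetric, OF ci cF]) measurable
    also have "\<dots> = (\<integral>\<omega>. (?c \<omega> * hr \<omega>) * real_cond_exp M ?F (indicator ?YB) \<omega> \<partial>M)"
    proof (rule integral_cong_AE)
      show "AE \<omega> in M. ?c \<omega> * real_cond_exp M ?F (indicator ?VY) \<omega> = (?c \<omega> * hr \<omega>) * real_cond_exp M ?F (indicator ?YB) \<omega>"
        using mkAE c1 by eventually_elim simp
    qed measurable
    also have "\<dots> = (\<integral>\<omega>. (?c \<omega> * hr \<omega>) * indicator ?YB \<omega> \<partial>M)"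
      by (rule real_cond_exp_intg(2)[OF chi]) (use cF hrF in measurable)
    finally have eq: "(\<integral>\<omega>. ?c \<omega> * indicator ?VY \<omega> \<partial>M) = (\<integral>\<omega>. (?c \<omega> * hr \<omega>) * indicator ?YB \<omega> \<partial>M)" .
    have "emeasure M {\<omega>\<in>space M. X \<omega> \<in> C \<and> Y \<omega> \<in> B \<and> V \<omega> \<in> A} = (\<integral>\<^sup>+\<omega>. indicator {\<omega>\<in>space M. X \<omega> \<in> C \<and> Y \<omega> \<in> B \<and> V \<omega> \<in> A} \<omega> \<partial>M)"
      by (rule nn_integral_indicator[symmetric]) measurable
    also have "\<dots> = (\<integral>\<^sup>+\<omega>. ennreal (?c \<omega> * indicator ?VY \<omega>) \<partial>M)"
      by (intro nn_integral_cong) (auto simp: indicator_def)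
    also have "\<dots> = ennreal (\<integral>\<omega>. ?c \<omega> * indicator ?VY \<omega> \<partial>M)"
      by (rule nn_integral_eq_integral[OF ci]) auto
    also have "\<dots> = ennreal (\<integral>\<omega>. (?c \<omega> * hr \<omega>) * indicator ?YB \<omega> \<partial>M)" by (simp only: eq)
    also have "\<dots> = (\<integral>\<^sup>+\<omega>. ennreal ((?c \<omega> * hr \<omega>) * indicator ?YB \<omega>) \<partial>M)"
      by (rule nn_integral_eq_integral[OF chi, symmetric]) (auto simp: hr0)
    also have "\<dots> = (\<integral>\<^sup>+\<omega>. indicator C (X \<omega>) * indicator B (Y \<omega>) * h (X \<omega>) \<partial>M)"
    proof (rule nn_integral_cong_AE)
      show "AE \<omega> in M. ennreal ((?c \<omega> * hr \<omega>) * indicator ?YB \<omega>) = indicator C (X \<omega>) * indicator B (Y \<omega>) * h (X \<omega>)"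
        using hrAE AE_space by eventually_elim (auto simp: indicator_def)
    qed
    finally show ?thesis by (simp add: h_def)
  qed
  let ?P = "distr M (SX \<Otimes>\<^sub>M SY) (\<lambda>\<omega>. (X \<omega>, Y \<omega>))"
  let ?L = "distr M ((SX \<Otimes>\<^sub>M SY) \<Otimes>\<^sub>M SV) (\<lambda>\<omega>. ((X \<omega>, Y \<omega>), V \<omega>))"
  let ?D = "density (?P \<Otimes>\<^sub>M Q) (\<lambda>z. w (fst (fst z), snd z))"
  interpret L: prob_space ?L by (rule M.prob_space_distr) measurable
  show ?thesis
  proof (rule measure_eqI_rectangles[where S="SX \<Otimes>\<^sub>M SY" and T=SV])
    show "sets ?L = sets ((SX \<Otimes>\<^sub>M SY) \<Otimes>\<^sub>M SV)" by simp
    show sD: "sets ?D = sets ((SX \<Otimes>\<^sub>M SY) \<Otimes>\<^sub>M SV)" using sQ by (simp cong: sets_pair_measure_cong)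
    show "finite_measure ?L" by unfold_locales
    fix Z A assume Z: "Z \<in> sets (SX \<Otimes>\<^sub>M SY)" and A[measurable]: "A \<in> sets SV"
    define h where "h x = (\<integral>\<^sup>+v. indicator A v * w (x, v) \<partial>Q)" for x
    have hm[measurable]: "h \<in> borel_measurable SX" unfolding h_def by measurable
    have emD: "emeasure ?D (Z \<times> A) = (\<integral>\<^sup>+\<omega>. indicator Z (X \<omega>, Y \<omega>) * h (X \<omega>) \<partial>M)"
      if Z[measurable]: "Z \<in> sets (SX \<Otimes>\<^sub>M SY)" for Z
    proof -
      have "emeasure ?D (Z \<times> A) = (\<integral>\<^sup>+z. w (fst (fst z), snd z) * indicator (Z \<times> A) z \<partial>(?P \<Otimes>\<^sub>M Q))"
        by (rule emeasure_density) measurable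
      also have "\<dots> = (\<integral>\<^sup>+p. \<integral>\<^sup>+v. w (fst p, v) * indicator (Z \<times> A) (p, v) \<partial>Q \<partial>?P)"
      proof -
        have "(\<lambda>z. w (fst (fst z), snd z) * indicator (Z \<times> A) z) \<in> borel_measurable (?P \<Otimes>\<^sub>M Q)" by measurable
        from Q.nn_integral_fst[OF this] show ?thesis by simp
      qed
      also have "\<dots> = (\<integral>\<^sup>+p. indicator Z p * h (fst p) \<partial>?P)"
        unfolding h_def
      proof (intro nn_integral_cong)
        fix p assume "p \<in> space ?P"
        then have [measurable]: "fst p \<in> space SX" by (auto simp: space_pair_measure)
        have "(\<integral>\<^sup>+v. w (fst p, v) * indicator (Z \<times> A) (p, v) \<partial>Q) = (\<integral>\<^sup>+v. indicator Z p * (indicator A v * w (fst p, v)) \<partial>Q)"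
          by (intro nn_integral_cong) (auto simp: indicator_def)
        also have "\<dots> = indicator Z p * (\<integral>\<^sup>+v. indicator A v * w (fst p, v) \<partial>Q)" by (rule nn_integral_cmult) measurable
        finally show "(\<integral>\<^sup>+v. w (fst p, v) * indicator (Z \<times> A) (p, v) \<partial>Q) = indicator Z p * (\<integral>\<^sup>+v. indicator A v * w (fst p, v) \<partial>Q)" .
      qed
      also have "\<dots> = (\<integral>\<^sup>+\<omega>. indicator Z (X \<omega>, Y \<omega>) * h (X \<omega>) \<partial>M)"
        by (subst nn_integral_distr) auto
      finally show ?thesis .
    qed
    \<comment> \<open>The identity \<open>key\<close> for triple rectangles is extended in two
      stages: here to all \<open>Z\<close> for fixed \<open>A\<close>, then by the enclosing
      argument to all sets of the outer product.\<close>
    have "distr (density M (indicator {\<omega>\<in>space M. V \<omega> \<in> A})) (SX \<Otimes>\<^sub>M SY) (\<lambda>\<omega>. (X \<omega>, Y \<omega>))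
       = distr (density M (\<lambda>\<omega>. h (X \<omega>))) (SX \<Otimes>\<^sub>M SY) (\<lambda>\<omega>. (X \<omega>, Y \<omega>))" (is "?m1 = ?m2")
    proof (rule measure_eqI_rectangles[where S=SX and T=SY])
      show "sets ?m1 = sets (SX \<Otimes>\<^sub>M SY)" "sets ?m2 = sets (SX \<Otimes>\<^sub>M SY)" by simp_all
      show "finite_measure ?m1"
      proof
        have "emeasure ?m1 (space ?m1) = (\<integral>\<^sup>+\<omega>. indicator {\<omega>\<in>space M. V \<omega> \<in> A} \<omega> * indicator ((\<lambda>\<omega>. (X \<omega>, Y \<omega>)) -` space (SX \<Otimes>\<^sub>M SY) \<inter> space M) \<omega> \<partial>M)"
          by (subst emeasure_distr, measurable, simp, subst emeasure_density) auto
        also have "\<dots> \<le> (\<integral>\<^sup>+\<omega>. 1 \<partial>M)"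
          by (rule nn_integral_mono) (simp add: indicator_def)
        finally have "emeasure ?m1 (space ?m1) \<le> (\<integral>\<^sup>+\<omega>. 1 \<partial>M)" .
        then show "emeasure ?m1 (space ?m1) \<noteq> \<infinity>" by (auto simp: M.emeasure_space_1 top_unique)
      qed
      fix C B assume [measurable]: "C \<in> sets SX" "B \<in> sets SY"
      have "emeasure ?m1 (C \<times> B) = (\<integral>\<^sup>+\<omega>. indicator {\<omega>\<in>space M. V \<omega> \<in> A} \<omega> * indicator ((\<lambda>\<omega>. (X \<omega>, Y \<omega>)) -` (C \<times> B) \<inter> space M) \<omega> \<partial>M)"
        by (subst emeasure_distr, measurable, simp, subst emeasure_density) auto
      also have "\<dots> = (\<integral>\<^sup>+\<omega>. indicator {\<omega>\<in>space M. X \<omega> \<in> C \<and> Y \<omega> \<in> B \<and> V \<omega> \<in> A} \<omega> \<partial>M)"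
        by (intro nn_integral_cong) (auto simp: indicator_def)
      also have "\<dots> = emeasure M {\<omega>\<in>space M. X \<omega> \<in> C \<and> Y \<omega> \<in> B \<and> V \<omega> \<in> A}" by (rule nn_integral_indicator) measurable
      also have "\<dots> = (\<integral>\<^sup>+\<omega>. indicator C (X \<omega>) * indicator B (Y \<omega>) * h (X \<omega>) \<partial>M)"
        unfolding h_def by (rule key) measurable
      also have "\<dots> = (\<integral>\<^sup>+\<omega>. h (X \<omega>) * indicator ((\<lambda>\<omega>. (X \<omega>, Y \<omega>)) -` (C \<times> B) \<inter> space M) \<omega> \<partial>M)"
        by (intro nn_integral_cong) (auto simp: indicator_def)
      also have "\<dots> = emeasure ?m2 (C \<times> B)"
        by (subst emeasure_distr, measurable, simp, subst emeasure_density) auto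
      finally show "emeasure ?m1 (C \<times> B) = emeasure ?m2 (C \<times> B)" .
    qed
    then have "emeasure ?m1 Z = emeasure ?m2 Z" by simp
    moreover have "emeasure ?m1 Z = emeasure ?L (Z \<times> A)"
    proof -
      have pm: "(\<lambda>\<omega>. ((X \<omega>, Y \<omega>), V \<omega>)) \<in> measurable M ((SX \<Otimes>\<^sub>M SY) \<Otimes>\<^sub>M SV)" by measurable
      have ZA: "Z \<times> A \<in> sets ((SX \<Otimes>\<^sub>M SY) \<Otimes>\<^sub>M SV)" using Z A by (rule pair_measureI)
      have "emeasure ?m1 Z = (\<integral>\<^sup>+\<omega>. indicator {\<omega>\<in>space M. V \<omega> \<in> A} \<omega> * indicator ((\<lambda>\<omega>. (X \<omega>, Y \<omega>)) -` Z \<inter> space M) \<omega> \<partial>M)"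
        using Z by (subst emeasure_distr, measurable, simp, subst emeasure_density) auto
      also have "\<dots> = (\<integral>\<^sup>+\<omega>. indicator ((\<lambda>\<omega>. ((X \<omega>, Y \<omega>), V \<omega>)) -` (Z \<times> A) \<inter> space M) \<omega> \<partial>M)"
        by (intro nn_integral_cong) (auto simp: indicator_def)
      also have "\<dots> = emeasure M ((\<lambda>\<omega>. ((X \<omega>, Y \<omega>), V \<omega>)) -` (Z \<times> A) \<inter> space M)"
        by (rule nn_integral_indicator) (rule measurable_sets[OF pm ZA])
      also have "\<dots> = emeasure ?L (Z \<times> A)" by (rule emeasure_distr[OF pm ZA, symmetric])
      finally show ?thesis .
    qed
    moreover have "emeasure ?m2 Z = emeasure ?D (Z \<times> A)"
    proof -
      have "emeasure ?m2 Z = (\<integral>\<^sup>+\<omega>. h (X \<omega>) * indicator ((\<lambda>\<omega>. (X \<omega>, Y \<omega>)) -` Z \<inter> space M) \<omega> \<partial>M)"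
        using Z by (subst emeasure_distr, measurable, simp, subst emeasure_density) auto
      also have "\<dots> = (\<integral>\<^sup>+\<omega>. indicator Z (X \<omega>, Y \<omega>) * h (X \<omega>) \<partial>M)"
        by (intro nn_integral_cong) (auto simp: indicator_def)
      finally show ?thesis using emD[OF Z] by simp
    qed
    ultimately show "emeasure ?L (Z \<times> A) = emeasure ?D (Z \<times> A)" by simp
  qed
qed

section \<open>Absolute continuity for the decoders\<close>

text \<open>Resampling coordinate \<open>S\<close> leaves \<open>B\<close> unchanged and replaces
  the old coordinate by a fresh draw, which makes the two independent.\<close>

lemma coordinate_indep:
  assumes P: "prob_space P" and q: "\<And>S. prob_space (q S)" and I: "finite I" "S \<in> I"
    and B[measurable]: "B \<in> measurable (P \<Otimes>\<^sub>M PiM I q) SB" and inv: "\<And>a u v. B (a, u(S := v)) = B (a, u)"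
  shows "distr (P \<Otimes>\<^sub>M PiM I q) (q S \<Otimes>\<^sub>M SB) (\<lambda>z. (snd z S, B z)) = q S \<Otimes>\<^sub>M distr (P \<Otimes>\<^sub>M PiM I q) SB B"
proof -
  interpret P: prob_space P by fact
  interpret qq: prob_space "PiM I q" by (rule prob_space_PiM) (rule q)
  interpret pq: pair_prob_space P "PiM I q" ..
  interpret qS: prob_space "q S" by (rule q)
  interpret b: prob_space "distr (P \<Otimes>\<^sub>M PiM I q) SB B" by (rule pq.prob_space_distr) (rule B)
  have [measurable]: "(\<lambda>u. u S) \<in> measurable (PiM I q) (q S)" using I by simp
  show ?thesis
  proof (rule pair_measure_eqI[symmetric])
    fix C E assume C[measurable]: "C \<in> sets (q S)" and "E \<in> sets (distr (P \<Otimes>\<^sub>M PiM I q) SB B)"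
    then have E[measurable]: "E \<in> sets SB" by simp
    have "emeasure (distr (P \<Otimes>\<^sub>M PiM I q) (q S \<Otimes>\<^sub>M SB) (\<lambda>z. (snd z S, B z))) (C \<times> E)
      = (\<integral>\<^sup>+z. indicator ((\<lambda>z. (snd z S, B z)) -` (C \<times> E) \<inter> space (P \<Otimes>\<^sub>M PiM I q)) z \<partial>(P \<Otimes>\<^sub>M PiM I q))"
    proof -
      have pm: "(\<lambda>z. (snd z S, B z)) \<in> measurable (P \<Otimes>\<^sub>M PiM I q) (q S \<Otimes>\<^sub>M SB)" by measurable
      have CE: "C \<times> E \<in> sets (q S \<Otimes>\<^sub>M SB)" by measurable
      show ?thesis using measurable_sets[OF pm CE] by (simp add: emeasure_distr[OF pm CE])
    qed
    also have "\<dots> = (\<integral>\<^sup>+z. indicator C (snd z S) * indicator E (B z) \<partial>(P \<Otimes>\<^sub>M PiM I q))"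
      by (intro nn_integral_cong) (auto simp: indicator_def)
    also have "\<dots> = (\<integral>\<^sup>+a. \<integral>\<^sup>+u. indicator C (u S) * indicator E (B (a, u)) \<partial>PiM I q \<partial>P)"
    proof -
      have pm: "(\<lambda>z. (snd z S, B z)) \<in> measurable (P \<Otimes>\<^sub>M PiM I q) (q S \<Otimes>\<^sub>M SB)" by measurable
      have "(\<lambda>p. indicator C (fst p) * indicator E (snd p) :: ennreal) \<in> borel_measurable (q S \<Otimes>\<^sub>M SB)" by measurable
      from measurable_compose[OF pm this]
      have "(\<lambda>z. indicator C (snd z S) * indicator E (B z) :: ennreal) \<in> borel_measurable (P \<Otimes>\<^sub>M PiM I q)" by simp
      from qq.nn_integral_fst[OF this] show ?thesis by simp
    qed
    also have "\<dots> = (\<integral>\<^sup>+a. emeasure (q S) C * (\<integral>\<^sup>+u. indicator E (B (a, u)) \<partial>PiM I q) \<partial>P)"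
    proof (rule nn_integral_cong)
      fix a assume a: "a \<in> space P"
      then have [measurable]: "(\<lambda>u. B (a, u)) \<in> measurable (PiM I q) SB" by simp
      have "(\<integral>\<^sup>+u. indicator C (u S) * indicator E (B (a, u)) \<partial>PiM I q)
         = (\<integral>\<^sup>+u. \<integral>\<^sup>+v. indicator C ((u(S := v)) S) * indicator E (B (a, u(S := v))) \<partial>q S \<partial>PiM I q)"
        by (rule nn_integral_PiM_resample[OF q I]) measurable
      also have "\<dots> = (\<integral>\<^sup>+u. \<integral>\<^sup>+v. indicator C v * indicator E (B (a, u)) \<partial>q S \<partial>PiM I q)"
        by (simp only: inv) simp
      also have "\<dots> = (\<integral>\<^sup>+u. emeasure (q S) C * indicator E (B (a, u)) \<partial>PiM I q)"
        by (simp add: nn_integral_multc)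
      also have "\<dots> = emeasure (q S) C * (\<integral>\<^sup>+u. indicator E (B (a, u)) \<partial>PiM I q)"
        by (rule nn_integral_cmult) measurable
      finally show "(\<integral>\<^sup>+u. indicator C (u S) * indicator E (B (a, u)) \<partial>PiM I q) = emeasure (q S) C * (\<integral>\<^sup>+u. indicator E (B (a, u)) \<partial>PiM I q)" .
    qed
    also have "\<dots> = emeasure (q S) C * (\<integral>\<^sup>+a. \<integral>\<^sup>+u. indicator E (B (a, u)) \<partial>PiM I q \<partial>P)"
      by (rule nn_integral_cmult) measurable
    also have "(\<integral>\<^sup>+a. \<integral>\<^sup>+u. indicator E (B (a, u)) \<partial>PiM I q \<partial>P) = (\<integral>\<^sup>+z. indicator E (B z) \<partial>(P \<Otimes>\<^sub>M PiM I q))"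
      by (rule qq.nn_integral_fst) measurable
    also have "\<dots> = emeasure (distr (P \<Otimes>\<^sub>M PiM I q) SB B) E"
      by (subst nn_integral_indicator[symmetric], simp, subst nn_integral_distr) auto
    finally show "emeasure (q S) C * emeasure (distr (P \<Otimes>\<^sub>M PiM I q) SB B) E
      = emeasure (distr (P \<Otimes>\<^sub>M PiM I q) (q S \<Otimes>\<^sub>M SB) (\<lambda>z. (snd z S, B z))) (C \<times> E)" ..
  qed (auto simp: qS.sigma_finite_measure_axioms b.sigma_finite_measure_axioms cong: sets_pair_measure_cong)
qed

text \<open>Under the independent law, \<open>U S\<close> is independent of any \<open>B\<close>
  that does not read it. A global density of the true law therefore passes to the pair, relative to
  \<open>q S\<close> and the independent law of \<open>B\<close>;
  \<open>absolutely_continuous_marginals\<close> then exchanges these for the true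
  marginals.\<close>

lemma absolutely_continuous_coordinate:
  assumes P: "prob_space P" and q: "\<And>S. prob_space (q S)" and I: "finite I" "S \<in> I"
    and B[measurable]: "B \<in> measurable (P \<Otimes>\<^sub>M PiM I q) SB" and inv: "\<And>a u v. B (a, u(S := v)) = B (a, u)"
    and sS: "sets (q S) = sets SA" and M: "prob_space M" and Z[measurable]: "Z \<in> measurable M (P \<Otimes>\<^sub>M PiM I q)"
    and ac: "absolutely_continuous (P \<Otimes>\<^sub>M PiM I q) (distr M (P \<Otimes>\<^sub>M PiM I q) Z)"
  shows "absolutely_continuous (distr M SA (\<lambda>\<omega>. snd (Z \<omega>) S) \<Otimes>\<^sub>M distr M SB (\<lambda>\<omega>. B (Z \<omega>)))
     (distr M (SA \<Otimes>\<^sub>M SB) (\<lambda>\<omega>. (snd (Z \<omega>) S, B (Z \<omega>))))"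
proof -
  interpret P: prob_space P by fact
  interpret qq: prob_space "PiM I q" by (rule prob_space_PiM) (rule q)
  interpret pq: pair_prob_space P "PiM I q" ..
  have [measurable]: "(\<lambda>u. u S) \<in> measurable (PiM I q) SA"
    using measurable_component_singleton[OF I(2), of q] by (simp only: measurable_cong_sets[OF refl sS])
  let ?R = "P \<Otimes>\<^sub>M PiM I q"
  have s: "sets (q S \<Otimes>\<^sub>M SB) = sets (SA \<Otimes>\<^sub>M SB)" using sS by (simp cong: sets_pair_measure_cong)
  have pm: "(\<lambda>z. (snd z S, B z)) \<in> measurable ?R (SA \<Otimes>\<^sub>M SB)" by measurable
  show ?thesis
  proof (rule absolutely_continuous_marginals[where \<alpha>="q S" and \<beta>="distr ?R SB B"])
    show "prob_space (distr ?R SB B)" by (rule pq.prob_space_distr) (rule B)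
    show "absolutely_continuous (q S \<Otimes>\<^sub>M distr ?R SB B) (distr M (SA \<Otimes>\<^sub>M SB) (\<lambda>\<omega>. (snd (Z \<omega>) S, B (Z \<omega>))))"
    proof (unfold absolutely_continuous_def, safe)
      fix N assume "N \<in> null_sets (q S \<Otimes>\<^sub>M distr ?R SB B)"
      then have N: "N \<in> null_sets (distr ?R (q S \<Otimes>\<^sub>M SB) (\<lambda>z. (snd z S, B z)))"
        using coordinate_indep[OF P q I B inv] by simp
      then have Nm[measurable]: "N \<in> sets (SA \<Otimes>\<^sub>M SB)" using s by (auto simp: null_sets_def)
      have "(\<lambda>z. (snd z S, B z)) -` N \<inter> space ?R \<in> null_sets ?R"
        using N pm s by (subst (asm) null_sets_distr_iff) (auto simp: measurable_cong_sets[OF refl s])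
      then have "(\<lambda>z. (snd z S, B z)) -` N \<inter> space ?R \<in> null_sets (distr M ?R Z)"
        using ac by (auto simp: absolutely_continuous_def)
      then have "Z -` ((\<lambda>z. (snd z S, B z)) -` N \<inter> space ?R) \<inter> space M \<in> null_sets M"
        by (subst (asm) null_sets_distr_iff[OF Z]) auto
      also have "Z -` ((\<lambda>z. (snd z S, B z)) -` N \<inter> space ?R) \<inter> space M = (\<lambda>\<omega>. (snd (Z \<omega>) S, B (Z \<omega>))) -` N \<inter> space M"
        using measurable_space[OF Z] by auto
      finally show "N \<in> null_sets (distr M (SA \<Otimes>\<^sub>M SB) (\<lambda>\<omega>. (snd (Z \<omega>) S, B (Z \<omega>))))"
        by (subst null_sets_distr_iff) auto
    qed
  qed (use q M sS in auto)
qed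

section \<open>Codes from codebooks\<close>

text \<open>\<open>d\<close> is the distortion granted by \<open>G\<close> off the failure event,
  \<open>\<eta>\<close> bounds the probability of failure and \<open>\<beta>\<close> every
  reconstruction. \<open>C\<close> and \<open>\<kappa>\<close> express uniform integrability: the
  part of a squared source component above \<open>C\<close> has mean at most
  \<open>\<kappa>\<close>.\<close>

locale block_code = multi_codebook_n P "vecM k" fst q vs \<rho> m DS "\<lambda>l. vecM (kY l)" "\<lambda>l z. snd z l" g R R' n A B \<theta> G
  for P :: "((nat \<Rightarrow> real) \<times> (nat \<Rightarrow> nat \<Rightarrow> real)) measure" and k :: nat
    and q :: "'s \<Rightarrow> 'u measure" and vs :: "'s list"
    and \<rho> :: "'s \<Rightarrow> (nat \<Rightarrow> real) \<Rightarrow> ('s \<Rightarrow> 'u) \<Rightarrow> real"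
    and m :: nat and DS :: "nat \<Rightarrow> 's set" and kY :: "nat \<Rightarrow> nat"
    and g :: "nat \<Rightarrow> 's set \<Rightarrow> 's \<Rightarrow> (nat \<Rightarrow> real) \<Rightarrow> ('s \<Rightarrow> 'u) \<Rightarrow> real"
    and R R' :: "'s \<Rightarrow> real"
    and n :: nat and A B :: "'s \<Rightarrow> nat" and \<theta> :: real and G +
  fixes \<phi> :: "nat \<Rightarrow> nat \<Rightarrow> ('s \<Rightarrow> 'u) \<times> (nat \<Rightarrow> real) \<Rightarrow> real" and \<beta> :: real and d :: "nat \<Rightarrow> nat \<Rightarrow> real"
    and cb :: "nat \<Rightarrow> 's \<times> nat \<times> nat \<Rightarrow> 'u" and enc :: "(nat \<Rightarrow> nat \<Rightarrow> real) \<Rightarrow> 's \<Rightarrow> nat \<times> nat"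
    and C \<kappa> \<eta> :: real
  assumes sP: "sets P = sets (XYM m k kY)" and n: "n > 0"
    and phi_meas: "\<And>i c. i < m \<Longrightarrow> c < k \<Longrightarrow> \<phi> i c \<in> borel_measurable (PiM (DS i) q \<Otimes>\<^sub>M vecM (kY i))"
    and phi_bound: "\<And>i c z. \<bar>\<phi> i c z\<bar> \<le> \<beta>"
    and G_eq: "\<And>z. G z \<longleftrightarrow> (\<forall>i<m. \<forall>c<k.
      (\<Sum>t<n. (fst (fst (z t)) c - \<phi> i c (restrict (snd (z t)) (DS i), snd (fst (z t)) i))\<^sup>2) \<le> real n * d i c)"
    and cb: "cb \<in> space (PiM {..<n} (\<lambda>_. QC))"
    and enc: "enc \<in> measurable (PiM {..<n} (\<lambda>_. vecM k)) (count_space UNIV)" "\<And>xs. enc xs \<in> tuples"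
    and fail_sets: "{a\<in>space (PiM {..<n} (\<lambda>_. P)). bad (enc (\<lambda>t\<in>{..<n}. fst (a t))) (\<lambda>t\<in>{..<n}. (a t, cb t))} \<in> sets (PiM {..<n} (\<lambda>_. P))"
    and fail_prob: "measure (PiM {..<n} (\<lambda>_. P)) {a\<in>space (PiM {..<n} (\<lambda>_. P)).
        bad (enc (\<lambda>t\<in>{..<n}. fst (a t))) (\<lambda>t\<in>{..<n}. (a t, cb t))} \<le> \<eta>"
    and C0: "C \<ge> 0" and kappa0: "\<kappa> \<ge> 0" and d0: "\<And>i c. i < m \<Longrightarrow> c < k \<Longrightarrow> d i c \<ge> 0"
    and kappa: "\<And>c. c < k \<Longrightarrow> (\<integral>\<^sup>+z. ennreal ((fst z c)\<^sup>2) * indicator {z. (fst z c)\<^sup>2 > C} z \<partial>P) \<le> ennreal \<kappa>"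
begin

lemma beta0: "\<beta> \<ge> 0" using phi_bound[of undefined undefined undefined] by linarith

lemma dpick_space:
  assumes "a \<in> PiE (set vs) (\<lambda>S. {..<A S})" "i < m" "b \<in> PiE (DS i) (\<lambda>S. {..<B S})" "t < n"
  shows "dpick i a b (cb t) \<in> space (PiM (DS i) q)"
proof -
  have ct: "cb t \<in> space QC" using cb assms(4) by (auto simp: space_PiM PiE_iff)
  have "cb t (S, a S, b S) \<in> space (q S)" if S: "S \<in> DS i" for S
  proof -
    have "(S, a S, b S) \<in> keys" using S DS[OF assms(2)] assms(1,3) by (auto simp: keys_def idx_def PiE_iff)
    then show ?thesis using ct by (auto simp: QC_def space_PiM PiE_iff)
  qed
  then show ?thesis by (auto simp: dpick_def space_PiM)
qed

text \<open>Off the failure event every decoder finds the right words, and \<open>G\<close> bounds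
  the distortion by \<open>d\<close>. On it, (x - h)^2 is at most 2 \<open>\<beta>\<close>^2 + 2
  x^2, and x^2 is at most \<open>C\<close> plus its part above \<open>C\<close>. Averaging yields
  the terms with \<open>\<eta>\<close> and \<open>\<kappa>\<close>.\<close>

lemma is_code_exists:
  "\<exists>f h. is_code m k kY P n (card (PiE (set vs) (\<lambda>S. {..<A S}))) (\<lambda>i c. d i c + (2 * \<beta>\<^sup>2 + 2 * C) * \<eta> + 2 * \<kappa>) f h"
proof -
  let ?PP = "PiM {..<n} (\<lambda>_. P)" and ?TA = "PiE (set vs) (\<lambda>S. {..<A S})" and ?TB = "\<lambda>i. PiE (DS i) (\<lambda>S. {..<B S})"
  interpret PP: prob_space P by (rule P)
  interpret Pn: prob_space ?PP by (rule prob_space_PiM) (rule P)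
  define E where "E = {a\<in>space ?PP. bad (enc (\<lambda>t\<in>{..<n}. fst (a t))) (\<lambda>t\<in>{..<n}. (a t, cb t))}"
  have Em[measurable]: "E \<in> sets ?PP" using fail_sets by (simp add: E_def)
  have Ep: "emeasure ?PP E \<le> ennreal \<eta>" using fail_prob by (auto simp: E_def Pn.emeasure_eq_measure intro: ennreal_leI)
  define Mn where "Mn = card ?TA"
  have finA: "finite ?TA" by (auto intro!: finite_PiE)
  obtain e where e: "bij_betw e {0..<Mn} ?TA" using ex_bij_betw_nat_finite[OF finA] by (auto simp: Mn_def)
  have "(\<lambda>S\<in>set vs. 0) \<in> ?TA" using A by auto
  then have "?TA \<noteq> {}" by blast
  then have Mn: "Mn > 0" using finA unfolding Mn_def card_gt_0_iff by blast
  \<comment> \<open>Messages start at 1, positions in the enumeration at 0. The default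
    \<open>e 0\<close> keeps the decoders defined with valid bins for every natural number.\<close>
  define dmsg where "dmsg w = (if w \<in> {1..Mn} then e (w - 1) else e 0)" for w
  have dmsgT: "dmsg w \<in> ?TA" for w using e Mn by (auto simp: dmsg_def bij_betw_def)
  define msg where "msg a = Suc (the_inv_into {0..<Mn} e a)" for a
  have inj: "inj_on e {0..<Mn}" and img: "e ` {0..<Mn} = ?TA" using e by (auto simp: bij_betw_def)
  have msg_range: "msg a \<in> {1..Mn}" if "a \<in> ?TA" for a
    using the_inv_into_into[OF inj, of a "{0..<Mn}"] that img by (auto simp: msg_def)
  have dmsg_msg: "dmsg (msg a) = a" if "a \<in> ?TA" for a
    using msg_range[OF that] f_the_inv_into_f[OF inj, of a] that img by (auto simp: dmsg_def msg_def)
  have "\<exists>hb. bij_betw hb {0..<card (?TB i)} (?TB i)" if "i < m" for i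
    using finite_DS[OF that] by (intro ex_bij_betw_nat_finite finite_PiE) auto
  then obtain hb where hb: "\<And>i. i < m \<Longrightarrow> bij_betw (hb i) {0..<card (?TB i)} (?TB i)" by metis
  have hbT: "hb i r \<in> ?TB i" if "i < m" "r < card (?TB i)" for i r using hb[OF that(1)] that(2) by (auto simp: bij_betw_def)
  \<comment> \<open>The first typical candidate is taken, which is measurable. Uniqueness matters on
    the good event only, where this is the true tuple.\<close>
  define sel where "sel i w ys = (LEAST r. r < card (?TB i) \<and> jtyp n \<theta> i ys (\<lambda>t. dpick i (dmsg w) (hb i r) (cb t)))" for i w ys
  \<comment> \<open>If no candidate is typical, \<open>LEAST\<close> may leave the range; the value
    0 keeps reconstructions bounded by \<open>\<beta>\<close> in any case.\<close>
  define out where "out i w ys t c r = (if r < card (?TB i) then \<phi> i c (dpick i (dmsg w) (hb i r) (cb t), ys t) else 0)" for i w ys t c r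
  define h where "h i w ys t c = out i w ys t c (sel i w ys)" for i w ys t c
  define f where "f xs = msg (\<lambda>S\<in>set vs. fst (enc xs S))" for xs
  have encA: "(\<lambda>S\<in>set vs. fst (enc xs S)) \<in> ?TA" for xs
    using enc(2)[of xs] by (auto simp: tuples_def idx_def PiE_iff mem_Times_iff)
  have f_meas: "f \<in> measurable (PiM {..<n} (\<lambda>_. vecM k)) (count_space UNIV)"
    unfolding f_def by (rule measurable_compose[OF enc(1)]) simp
  have f_range: "f xs \<in> {1..Mn}" for xs unfolding f_def by (rule msg_range[OF encA])
  have h_meas: "(\<lambda>p. h i (fst p) (snd p) t c) \<in> borel_measurable (count_space UNIV \<Otimes>\<^sub>M PiM {..<n} (\<lambda>_. vecM (kY i)))"
    if i: "i < m" and t: "t < n" and c: "c < k" for i t c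
  proof (rule measurable_pair_measure_countable1)
    fix w :: nat
    let ?N = "PiM {..<n} (\<lambda>_. vecM (kY i))"
    have ym: "(\<lambda>ys. ys s) \<in> measurable ?N (vecM (kY i))" if "s < n" for s using that by simp
    have jm: "Measurable.pred ?N (\<lambda>ys. r < card (?TB i) \<and> jtyp n \<theta> i ys (\<lambda>t. dpick i (dmsg w) (hb i r) (cb t)))" for r
    proof (cases "r < card (?TB i)")
      case True
      have "Measurable.pred ?N (\<lambda>ys. jtyp n \<theta> i (\<lambda>s. ys s) (\<lambda>s. dpick i (dmsg w) (hb i r) (cb s)))"
        by (rule jtyp_pred[OF i, where Y="\<lambda>s ys. ys s" and U="\<lambda>s ys. dpick i (dmsg w) (hb i r) (cb s)"])
           (use ym dpick_space[OF dmsgT i hbT[OF i True]] in auto)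
      then show ?thesis using True by simp
    qed simp
    have [measurable]: "sel i w \<in> measurable ?N (count_space UNIV)"
      unfolding sel_def by (rule measurable_Least) (rule jm)
    have om: "(\<lambda>ys. out i w ys t c r) \<in> borel_measurable ?N" for r
    proof (cases "r < card (?TB i)")
      case True
      have "(\<lambda>ys. (dpick i (dmsg w) (hb i r) (cb t), ys t)) \<in> measurable ?N (PiM (DS i) q \<Otimes>\<^sub>M vecM (kY i))"
        using dpick_space[OF dmsgT i hbT[OF i True] t] ym[OF t] by (intro measurable_Pair) auto
      from measurable_compose[OF this phi_meas[OF i c]] show ?thesis using True by (simp add: out_def)
    qed (simp add: out_def)
    have "(\<lambda>ys. out i w ys t c (sel i w ys)) \<in> borel_measurable ?N"
      by (rule measurable_compose_countable[OF om]) measurable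
    then show "(\<lambda>y. h i (fst (w, y)) (snd (w, y)) t c) \<in> borel_measurable ?N" by (simp add: h_def)
  qed simp
  have h_bound: "\<bar>h i w ys t c\<bar> \<le> \<beta>" for i w ys t c
    using phi_bound beta0 by (auto simp: h_def out_def)
  have decode: "h i (f (\<lambda>s\<in>{..<n}. fst (a s))) (\<lambda>s\<in>{..<n}. snd (a s) i) t c
      = \<phi> i c (restrict (pick (enc (\<lambda>s\<in>{..<n}. fst (a s))) (cb t)) (DS i), snd (a t) i)"
    and good: "(\<Sum>t<n. (fst (a t) c - \<phi> i c (restrict (pick (enc (\<lambda>s\<in>{..<n}. fst (a s))) (cb t)) (DS i), snd (a t) i))\<^sup>2) \<le> real n * d i c"
    if i: "i < m" and c: "c < k" and t: "t < n" and a: "a \<in> space ?PP" and nE: "a \<notin> E" for i c t a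
  proof -
    let ?xs = "\<lambda>s\<in>{..<n}. fst (a s)" and ?ys = "\<lambda>s\<in>{..<n}. snd (a s) i" and ?z = "\<lambda>t\<in>{..<n}. (a t, cb t)"
    let ?j = "enc ?xs"
    let ?b0 = "\<lambda>S\<in>DS i. snd (?j S)"
    have nb: "\<not> bad ?j ?z" using nE a by (auto simp: E_def)
    then have ok: "okZ (zmap ?j ?z)" by (auto simp: bad_def)
    have zt: "zmap ?j ?z s = (a s, pick ?j (cb s))" if "s < n" for s using that by (simp add: zmap_nth)
    have b0: "?b0 \<in> ?TB i" using enc(2)[of ?xs] DS[OF i] by (auto simp: tuples_def idx_def PiE_iff mem_Times_iff)
    have dp: "dpick i (dmsg (f ?xs)) b cc = dpick i (\<lambda>S. fst (?j S)) b cc" for b cc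
      unfolding f_def dmsg_msg[OF encA] dpick_def using DS[OF i] by (auto simp: restrict_def fun_eq_iff)
    have rp: "restrict (pick ?j cc) (DS i) = dpick i (\<lambda>S. fst (?j S)) ?b0 cc" for cc
      using DS[OF i] by (auto simp: pick_def dpick_def restrict_def fun_eq_iff)
    have "jtyp n \<theta> i (\<lambda>t. snd (fst (zmap ?j ?z t)) i) (\<lambda>t. restrict (snd (zmap ?j ?z t)) (DS i))"
      using ok i by (auto simp: okZ_def)
    also have "?this \<longleftrightarrow> jtyp n \<theta> i ?ys (\<lambda>t. dpick i (dmsg (f ?xs)) ?b0 (cb t))"
      by (rule jtyp_cong) (simp_all add: zt dp rp)
    finally have t0: "jtyp n \<theta> i ?ys (\<lambda>t. dpick i (dmsg (f ?xs)) ?b0 (cb t))" .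
    have "?b0 \<in> hb i ` {0..<card (?TB i)}" unfolding bij_betw_imp_surj_on[OF hb[OF i]] by (rule b0)
    then obtain r0 where r0: "?b0 = hb i r0" "r0 \<in> {0..<card (?TB i)}" by (rule imageE)
    have sel: "sel i (f ?xs) ?ys < card (?TB i) \<and> jtyp n \<theta> i ?ys (\<lambda>t. dpick i (dmsg (f ?xs)) (hb i (sel i (f ?xs) ?ys)) (cb t))"
      unfolding sel_def by (rule LeastI[of _ r0]) (use r0(2) t0[unfolded r0(1)] in \<open>simp only: atLeastLessThan_iff simp_thms\<close>)
    \<comment> \<open>Any other typical candidate in the same bins would be one of the competitors
      that make the pair \<open>bad\<close>.\<close>
    have hbeq: "hb i (sel i (f ?xs) ?ys) = ?b0"
    proof (rule ccontr)
      assume ne: "hb i (sel i (f ?xs) ?ys) \<noteq> ?b0"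
      have "jtyp n \<theta> i ?ys (\<lambda>t. dpick i (dmsg (f ?xs)) (hb i (sel i (f ?xs) ?ys)) (cb t))" using sel by simp
      also have "?this \<longleftrightarrow> jtyp n \<theta> i (\<lambda>t. snd (fst (?z t)) i) (\<lambda>t. dpick i (\<lambda>S. fst (?j S)) (hb i (sel i (f ?xs) ?ys)) (snd (?z t)))"
        by (rule jtyp_cong) (simp_all add: dp)
      finally have "bad ?j ?z" unfolding bad_def using i ne hbT[OF i] sel by blast
      then show False using nb by simp
    qed
    have selK: "sel i (f ?xs) ?ys < card (?TB i)" using sel by blast
    have yst: "?ys t = snd (a t) i" using t by simp
    have "h i (f ?xs) ?ys t c = \<phi> i c (dpick i (dmsg (f ?xs)) (hb i (sel i (f ?xs) ?ys)) (cb t), ?ys t)"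
      unfolding h_def out_def by (simp only: selK if_True)
    also have "\<dots> = \<phi> i c (restrict (pick ?j (cb t)) (DS i), snd (a t) i)"
      by (simp only: hbeq dp rp yst)
    finally show "h i (f ?xs) ?ys t c = \<phi> i c (restrict (pick ?j (cb t)) (DS i), snd (a t) i)" .
    have "(\<Sum>t<n. (fst (fst (zmap ?j ?z t)) c - \<phi> i c (restrict (snd (zmap ?j ?z t)) (DS i), snd (fst (zmap ?j ?z t)) i))\<^sup>2) \<le> real n * d i c"
      using ok i c unfolding okZ_def G_eq by blast
    then show "(\<Sum>t<n. (fst (a t) c - \<phi> i c (restrict (pick ?j (cb t)) (DS i), snd (a t) i))\<^sup>2) \<le> real n * d i c"
      by (simp add: zt)
  qed
  have dist: "ennreal (1 / real n) *
          (\<Sum>t<n. \<integral>\<^sup>+\<omega>. ennreal ((fst (\<omega> t) c -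
              h i (f (\<lambda>s\<in>{..<n}. fst (\<omega> s))) (\<lambda>s\<in>{..<n}. snd (\<omega> s) i) t c)\<^sup>2) \<partial>?PP)
        \<le> ennreal (d i c + (2 * \<beta>\<^sup>2 + 2 * C) * \<eta> + 2 * \<kappa>)"
    if i: "i < m" and c: "c < k" for i c
  proof -
    define er where "er \<omega> t = fst (\<omega> t) c - h i (f (\<lambda>s\<in>{..<n}. fst (\<omega> s))) (\<lambda>s\<in>{..<n}. snd (\<omega> s) i) t c" for \<omega> t
    define kf where "kf z = ennreal ((fst z c)\<^sup>2) * indicator {z. (fst z c)\<^sup>2 > C} z" for z :: "(nat \<Rightarrow> real) \<times> (nat \<Rightarrow> nat \<Rightarrow> real)"
    have fc: "(\<lambda>z. fst z c) \<in> borel_measurable P"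
    proof -
      have "(\<lambda>z. fst z c) \<in> borel_measurable (XYM m k kY)"
        unfolding XYM_def vecM_def
        by (rule measurable_compose[OF measurable_fst measurable_component_singleton]) (use c in simp)
      then show ?thesis by (simp only: measurable_cong_sets[OF sP refl])
    qed
    have kfm: "kf \<in> borel_measurable P"
    proof -
      note [measurable] = fc
      have "(\<lambda>z. ennreal ((fst z c)\<^sup>2) * (if (fst z c)\<^sup>2 > C then 1 else 0)) \<in> borel_measurable P" by measurable
      also have "(\<lambda>z. ennreal ((fst z c)\<^sup>2) * (if (fst z c)\<^sup>2 > C then 1 else 0)) = kf" by (auto simp: kf_def)
      finally show ?thesis .
    qed
    have em: "(\<lambda>\<omega>. er \<omega> t) \<in> borel_measurable ?PP" if t: "t < n" for t
    proof -
      have zt: "(\<lambda>\<omega>. \<omega> s) \<in> measurable ?PP P" if "s < n" for s using that by simp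
      have 1: "(\<lambda>\<omega>. fst (\<omega> t) c) \<in> borel_measurable ?PP" by (rule measurable_compose[OF zt[OF t] fc])
      have "(\<lambda>\<omega>. \<lambda>s\<in>{..<n}. fst (\<omega> s)) \<in> measurable ?PP (PiM {..<n} (\<lambda>_. vecM k))"
        by (rule measurable_restrict, rule measurable_compose[OF zt px]) simp
      from measurable_compose[OF this f_meas] have 2: "(\<lambda>\<omega>. f (\<lambda>s\<in>{..<n}. fst (\<omega> s))) \<in> measurable ?PP (count_space UNIV)" .
      have 3: "(\<lambda>\<omega>. \<lambda>s\<in>{..<n}. snd (\<omega> s) i) \<in> measurable ?PP (PiM {..<n} (\<lambda>_. vecM (kY i)))"
        by (rule measurable_restrict, rule measurable_compose[OF zt py[OF i]]) simp
      from measurable_compose[OF measurable_Pair[OF 2 3] h_meas[OF i t c]]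
      have "(\<lambda>\<omega>. h i (f (\<lambda>s\<in>{..<n}. fst (\<omega> s))) (\<lambda>s\<in>{..<n}. snd (\<omega> s) i) t c) \<in> borel_measurable ?PP" by simp
      with 1 show ?thesis unfolding er_def by (rule borel_measurable_diff)
    qed
    have point: "(\<Sum>t<n. ennreal ((er \<omega> t)\<^sup>2)) \<le> ennreal (real n * d i c) + ennreal (real n * (2 * \<beta>\<^sup>2 + 2 * C)) * indicator E \<omega> + (\<Sum>t<n. 2 * kf (\<omega> t))"
      if \<omega>: "\<omega> \<in> space ?PP" for \<omega>
    proof (cases "\<omega> \<in> E")
      case False
      have "(\<Sum>t<n. ennreal ((er \<omega> t)\<^sup>2)) = ennreal (\<Sum>t<n. (er \<omega> t)\<^sup>2)" by (rule sum_ennreal) simp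
      also have "(\<Sum>t<n. (er \<omega> t)\<^sup>2) = (\<Sum>t<n. (fst (\<omega> t) c - \<phi> i c (restrict (pick (enc (\<lambda>s\<in>{..<n}. fst (\<omega> s))) (cb t)) (DS i), snd (\<omega> t) i))\<^sup>2)"
        unfolding er_def by (intro sum.cong refl) (simp add: decode[OF i c _ \<omega> False])
      also have "ennreal \<dots> \<le> ennreal (real n * d i c)" by (rule ennreal_leI, rule good[OF i c n \<omega> False])
      also have "\<dots> \<le> ennreal (real n * d i c) + ennreal (real n * (2 * \<beta>\<^sup>2 + 2 * C)) * indicator E \<omega> + (\<Sum>t<n. 2 * kf (\<omega> t))"
        by (simp add: add.assoc)
      finally show ?thesis .
    next
      case True
      have "ennreal ((er \<omega> t)\<^sup>2) \<le> ennreal (2 * \<beta>\<^sup>2 + 2 * C) + 2 * kf (\<omega> t)" for t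
      proof -
        let ?x = "fst (\<omega> t) c" and ?h = "h i (f (\<lambda>s\<in>{..<n}. fst (\<omega> s))) (\<lambda>s\<in>{..<n}. snd (\<omega> s) i) t c"
        have "?h\<^sup>2 \<le> \<beta>\<^sup>2" using h_bound[of i _ _ t c] beta0 by (intro abs_le_square_iff[THEN iffD1]) auto
        moreover have "(?x - ?h)\<^sup>2 \<le> 2 * ?x\<^sup>2 + 2 * ?h\<^sup>2"
        proof -
          have "0 \<le> (?x + ?h)\<^sup>2" by simp
          then show ?thesis by (simp add: power2_eq_square algebra_simps)
        qed
        ultimately have "(er \<omega> t)\<^sup>2 \<le> 2 * \<beta>\<^sup>2 + 2 * ?x\<^sup>2" by (simp add: er_def)
        also have "\<dots> \<le> (2 * \<beta>\<^sup>2 + 2 * C) + 2 * (?x\<^sup>2 * of_bool (?x\<^sup>2 > C))" using C0 by auto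
        finally have "ennreal ((er \<omega> t)\<^sup>2) \<le> ennreal ((2 * \<beta>\<^sup>2 + 2 * C) + 2 * (?x\<^sup>2 * of_bool (?x\<^sup>2 > C)))" by (rule ennreal_leI)
        also have "\<dots> = ennreal (2 * \<beta>\<^sup>2 + 2 * C) + ennreal (2 * (?x\<^sup>2 * of_bool (?x\<^sup>2 > C)))"
          using C0 by (intro ennreal_plus) auto
        also have "ennreal (2 * (?x\<^sup>2 * of_bool (?x\<^sup>2 > C))) = 2 * kf (\<omega> t)"
          by (auto simp: kf_def ennreal_mult' indicator_def)
        finally show ?thesis .
      qed
      then have "(\<Sum>t<n. ennreal ((er \<omega> t)\<^sup>2)) \<le> (\<Sum>t<n. ennreal (2 * \<beta>\<^sup>2 + 2 * C) + 2 * kf (\<omega> t))" by (intro sum_mono)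
      also have "\<dots> = ennreal (real n * (2 * \<beta>\<^sup>2 + 2 * C)) + (\<Sum>t<n. 2 * kf (\<omega> t))"
        using C0 by (simp add: sum.distrib ennreal_mult' ennreal_of_nat_eq_real_of_nat)
      also have "\<dots> \<le> ennreal (real n * d i c) + ennreal (real n * (2 * \<beta>\<^sup>2 + 2 * C)) * indicator E \<omega> + (\<Sum>t<n. 2 * kf (\<omega> t))"
        using True by (intro add_right_mono) simp
      finally show ?thesis .
    qed
    have kfi: "(\<integral>\<^sup>+\<omega>. kf (\<omega> t) \<partial>?PP) \<le> ennreal \<kappa>" if t: "t < n" for t
    proof -
      have "distr ?PP P (\<lambda>z. z t) = P" using t by (subst distr_PiM_component) (auto intro: P)
      then have "(\<integral>\<^sup>+z. kf z \<partial>P) = (\<integral>\<^sup>+z. kf z \<partial>distr ?PP P (\<lambda>z. z t))" by simp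
      also have "\<dots> = (\<integral>\<^sup>+\<omega>. kf (\<omega> t) \<partial>?PP)" using t kfm by (intro nn_integral_distr) auto
      finally show ?thesis using kappa[OF c] by (simp add: kf_def)
    qed
    have kfm': "(\<lambda>\<omega>. kf (\<omega> t)) \<in> borel_measurable ?PP" if "t < n" for t
      using that by (intro measurable_compose[OF _ kfm]) simp
    have "(\<Sum>t<n. \<integral>\<^sup>+\<omega>. ennreal ((er \<omega> t)\<^sup>2) \<partial>?PP) = (\<integral>\<^sup>+\<omega>. (\<Sum>t<n. ennreal ((er \<omega> t)\<^sup>2)) \<partial>?PP)"
      by (rule nn_integral_sum[symmetric]) (auto intro!: measurable_compose[OF _ measurable_ennreal] borel_measurable_power em)
    also have "\<dots> \<le> (\<integral>\<^sup>+\<omega>. ennreal (real n * d i c) + ennreal (real n * (2 * \<beta>\<^sup>2 + 2 * C)) * indicator E \<omega> + (\<Sum>t<n. 2 * kf (\<omega> t)) \<partial>?PP)"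
      by (rule nn_integral_mono) (rule point)
    also have "\<dots> = (\<integral>\<^sup>+\<omega>. ennreal (real n * d i c) + ennreal (real n * (2 * \<beta>\<^sup>2 + 2 * C)) * indicator E \<omega> \<partial>?PP) + (\<integral>\<^sup>+\<omega>. (\<Sum>t<n. 2 * kf (\<omega> t)) \<partial>?PP)"
      by (rule nn_integral_add) (auto intro!: borel_measurable_sum borel_measurable_times_ennreal kfm' borel_measurable_indicator Em)
    also have "(\<integral>\<^sup>+\<omega>. ennreal (real n * d i c) + ennreal (real n * (2 * \<beta>\<^sup>2 + 2 * C)) * indicator E \<omega> \<partial>?PP)
      = ennreal (real n * d i c) + ennreal (real n * (2 * \<beta>\<^sup>2 + 2 * C)) * emeasure ?PP E"
      by (subst nn_integral_add) (auto simp: nn_integral_cmult_indicator Pn.emeasure_space_1)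
    also have "(\<integral>\<^sup>+\<omega>. (\<Sum>t<n. 2 * kf (\<omega> t)) \<partial>?PP) = (\<Sum>t<n. 2 * (\<integral>\<^sup>+\<omega>. kf (\<omega> t) \<partial>?PP))"
      by (subst nn_integral_sum) (auto intro!: borel_measurable_times_ennreal kfm' sum.cong nn_integral_cmult)
    also have "\<dots> \<le> (\<Sum>t<n. 2 * ennreal \<kappa>)" using kfi by (intro sum_mono mult_left_mono) auto
    also have "(\<Sum>t<n. 2 * ennreal \<kappa>) = ennreal (real n * (2 * \<kappa>))"
      using kappa0 by (simp add: ennreal_mult' ennreal_of_nat_eq_real_of_nat)
    finally have "(\<Sum>t<n. \<integral>\<^sup>+\<omega>. ennreal ((er \<omega> t)\<^sup>2) \<partial>?PP)
       \<le> ennreal (real n * d i c) + ennreal (real n * (2 * \<beta>\<^sup>2 + 2 * C)) * emeasure ?PP E + ennreal (real n * (2 * \<kappa>))"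
      by (simp add: add_left_mono)
    also have "\<dots> \<le> ennreal (real n * d i c) + ennreal (real n * (2 * \<beta>\<^sup>2 + 2 * C)) * ennreal \<eta> + ennreal (real n * (2 * \<kappa>))"
      by (intro add_mono mult_left_mono Ep) auto
    also have "\<dots> = ennreal (real n * (d i c + (2 * \<beta>\<^sup>2 + 2 * C) * \<eta> + 2 * \<kappa>))"
    proof -
      have eta0: "\<eta> \<ge> 0" using fail_prob measure_nonneg order_trans by blast
      have 0: "0 \<le> real n * d i c" "0 \<le> real n * (2 * \<beta>\<^sup>2 + 2 * C)" "0 \<le> real n * (2 * \<kappa>)" "0 \<le> real n * (2 * \<beta>\<^sup>2 + 2 * C) * \<eta>"
        using d0[OF i c] C0 kappa0 eta0 by auto
      have "ennreal (real n * d i c) + ennreal (real n * (2 * \<beta>\<^sup>2 + 2 * C)) * ennreal \<eta> + ennreal (real n * (2 * \<kappa>))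
        = ennreal (real n * d i c + real n * (2 * \<beta>\<^sup>2 + 2 * C) * \<eta> + real n * (2 * \<kappa>))"
        using 0 eta0 by (simp add: ennreal_mult[symmetric] ennreal_plus[symmetric] del: ennreal_plus)
      then show ?thesis by (simp add: algebra_simps)
    qed
    finally have "ennreal (1 / real n) * (\<Sum>t<n. \<integral>\<^sup>+\<omega>. ennreal ((er \<omega> t)\<^sup>2) \<partial>?PP)
       \<le> ennreal (1 / real n) * ennreal (real n * (d i c + (2 * \<beta>\<^sup>2 + 2 * C) * \<eta> + 2 * \<kappa>))" by (rule mult_left_mono) simp
    also have "\<dots> = ennreal (d i c + (2 * \<beta>\<^sup>2 + 2 * C) * \<eta> + 2 * \<kappa>)"
      using n by (subst ennreal_mult'[symmetric]) auto
    finally show ?thesis by (simp add: er_def)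
  qed
  have "is_code m k kY P n Mn (\<lambda>i c. d i c + (2 * \<beta>\<^sup>2 + 2 * C) * \<eta> + 2 * \<kappa>) f h"
    unfolding is_code_def using f_meas f_range h_meas dist by blast
  then show ?thesis unfolding Mn_def by blast
qed

end

section \<open>Codes for all large block lengths\<close>

lemma is_code_mono:
  assumes "is_code m k kY P n M D f h" and "\<And>i c. i < m \<Longrightarrow> c < k \<Longrightarrow> D i c \<le> D' i c"
  shows "is_code m k kY P n M D' f h"
proof -
  note * = assms(1)[unfolded is_code_def]
  show ?thesis
    unfolding is_code_def using * assms(2) by (intro conjI) (blast, blast, blast, meson ennreal_leI order_trans)
qed

text \<open>Dominated convergence in the truncation level. The bound is stated for all larger levels
  as well, because one common level has to serve every component of the source.\<close>

lemma integrable_tail_small: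
  fixes f :: "'a \<Rightarrow> real"
  assumes f: "integrable M f" and f0: "\<And>z. f z \<ge> 0" and \<kappa>: "\<kappa> > 0"
  shows "\<exists>C\<ge>0. \<forall>C'\<ge>C. (\<integral>\<^sup>+z. ennreal (f z) * indicator {z. f z > C'} z \<partial>M) \<le> ennreal \<kappa>"
proof -
  have [measurable]: "f \<in> borel_measurable M" using f by auto
  let ?g = "\<lambda>C z. f z * of_bool (f z > C)"
  have "(\<lambda>n. \<integral>z. ?g (real n) z \<partial>M) \<longlonglongrightarrow> (\<integral>z. 0 \<partial>M)"
  proof (rule integral_dominated_convergence[where w=f])
    show "AE z in M. (\<lambda>n. ?g (real n) z) \<longlonglongrightarrow> 0"
    proof (rule AE_I2)
      fix z
      obtain N :: nat where N: "f z \<le> real N" using real_arch_simple by blast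
      have "eventually (\<lambda>n. ?g (real n) z = 0) sequentially"
        using eventually_ge_at_top[of N] by eventually_elim (use N in auto)
      then show "(\<lambda>n. ?g (real n) z) \<longlonglongrightarrow> 0" by (rule tendsto_eventually)
    qed
  qed (use f f0 in auto)
  then have "(\<lambda>n. \<integral>z. ?g (real n) z \<partial>M) \<longlonglongrightarrow> 0" by simp
  from order_tendstoD(2)[OF this \<kappa>] obtain N where N: "(\<integral>z. ?g (real N) z \<partial>M) < \<kappa>"
    by (auto simp: eventually_sequentially)
  show ?thesis
  proof (intro exI[of _ "real N"] conjI allI impI)
    fix C' assume C': "C' \<ge> real N"
    have i: "integrable M (?g (real N))"
      by (rule Bochner_Integration.integrable_bound[OF f]) (use f0 in auto)
    have "(\<integral>\<^sup>+z. ennreal (f z) * indicator {z. f z > C'} z \<partial>M) \<le> (\<integral>\<^sup>+z. ennreal (?g (real N) z) \<partial>M)"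
      using C' by (intro nn_integral_mono) (auto simp: indicator_def)
    also have "\<dots> = ennreal (\<integral>z. ?g (real N) z \<partial>M)" by (rule nn_integral_eq_integral[OF i]) (use f0 in auto)
    also have "\<dots> \<le> ennreal \<kappa>" using N by (intro ennreal_leI) simp
    finally show "(\<integral>\<^sup>+z. ennreal (f z) * indicator {z. f z > C'} z \<partial>M) \<le> ennreal \<kappa>" .
  qed simp
qed

text \<open>The single-letter facts from which codes follow. No block length occurs, and the
  estimators \<open>\<phi>\<close> are already bounded, so that a failure costs a controlled
  distortion.\<close>

locale block_source = multi_codebook P "vecM k" fst q vs \<rho> m DS "\<lambda>l. vecM (kY l)" "\<lambda>l z. snd z l" g R R'
  for P :: "((nat \<Rightarrow> real) \<times> (nat \<Rightarrow> nat \<Rightarrow> real)) measure" and k :: nat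
    and q :: "'s \<Rightarrow> 'u measure" and vs :: "'s list"
    and \<rho> :: "'s \<Rightarrow> (nat \<Rightarrow> real) \<Rightarrow> ('s \<Rightarrow> 'u) \<Rightarrow> real"
    and m :: nat and DS :: "nat \<Rightarrow> 's set" and kY :: "nat \<Rightarrow> nat"
    and g :: "nat \<Rightarrow> 's set \<Rightarrow> 's \<Rightarrow> (nat \<Rightarrow> real) \<Rightarrow> ('s \<Rightarrow> 'u) \<Rightarrow> real"
    and R R' :: "'s \<Rightarrow> real" +
  fixes \<phi> :: "nat \<Rightarrow> nat \<Rightarrow> ('s \<Rightarrow> 'u) \<times> (nat \<Rightarrow> real) \<Rightarrow> real" and \<beta> :: real and d :: "nat \<Rightarrow> nat \<Rightarrow> real"
  assumes sP: "sets P = sets (XYM m k kY)"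
    and JM: "prob_space JM"
    and R0: "\<And>S. S \<in> set vs \<Longrightarrow> R S \<ge> 0"
    and rho_ln: "\<And>S. S \<in> set vs \<Longrightarrow> integrable JM (\<lambda>z. ln (\<rho> S (fst (fst z)) (snd z)))"
    and rho_ln_le: "\<And>S. S \<in> set vs \<Longrightarrow> (\<integral>z. ln (\<rho> S (fst (fst z)) (snd z)) \<partial>JM) \<le> R S + R' S"
    and g_ln: "\<And>l D e. l < m \<Longrightarrow> D \<subseteq> DS l \<Longrightarrow> D \<noteq> {} \<Longrightarrow> e > 0 \<Longrightarrow> \<exists>h. integrable JM h \<and>
      (AE z in JM. (\<forall>S\<in>D. g l D S (snd (fst z) l) (restrict (snd z) (DS l)) > 0) \<and>
         h z \<le> (\<Sum>S\<in>D. ln (g l D S (snd (fst z) l) (restrict (snd z) (DS l))))) \<and>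
      (\<Sum>S\<in>D. R' S) - e \<le> integral\<^sup>L JM h"
    and phi_meas: "\<And>i c. i < m \<Longrightarrow> c < k \<Longrightarrow> \<phi> i c \<in> borel_measurable (PiM (DS i) q \<Otimes>\<^sub>M vecM (kY i))"
    and phi_bound: "\<And>i c z. \<bar>\<phi> i c z\<bar> \<le> \<beta>"
    and dist_int: "\<And>i c. i < m \<Longrightarrow> c < k \<Longrightarrow>
      integrable JM (\<lambda>z. (fst (fst z) c - \<phi> i c (restrict (snd z) (DS i), snd (fst z) i))\<^sup>2)"
    and dist_le: "\<And>i c. i < m \<Longrightarrow> c < k \<Longrightarrow>
      (\<integral>z. (fst (fst z) c - \<phi> i c (restrict (snd z) (DS i), snd (fst z) i))\<^sup>2 \<partial>JM) \<le> d i c"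
    and X2: "\<And>c. c < k \<Longrightarrow> integrable P (\<lambda>z. (fst z c)\<^sup>2)"
    and d0: "\<And>i c. i < m \<Longrightarrow> c < k \<Longrightarrow> d i c \<ge> 0"
begin

lemma codes_eventually:
  assumes \<epsilon>: "\<epsilon> > 0"
  shows "\<exists>N. \<forall>n\<ge>N. \<exists>M f h. n > 0 \<and> is_code m k kY P n M (\<lambda>i c. d i c + \<epsilon>) f h \<and>
    ln (real M) / real n \<le> (\<Sum>S\<in>set vs. R S) + \<epsilon>"
proof -
  define s where "s = real (card (set vs))"
  \<comment> \<open>Each of the \<open>s\<close> codebooks exceeds its rate by the
    \<open>4 * \<theta>\<close> of \<open>Abin\<close>, and all together may cost
    \<open>\<epsilon> / 2\<close>. The 1 keeps the denominator positive when there is no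
    codebook.\<close>
  define \<theta> where "\<theta> = \<epsilon> / (8 * (s + 1))"
  have s0: "s \<ge> 0" by (simp add: s_def)
  have \<theta>: "\<theta> > 0" using \<epsilon> s0 by (simp add: \<theta>_def)
  have s\<theta>: "s * (4 * \<theta>) \<le> \<epsilon> / 2"
  proof -
    have "s * (4 * \<theta>) = (s / (s + 1)) * (\<epsilon> / 2)" using s0 by (simp add: \<theta>_def field_simps)
    also have "\<dots> \<le> 1 * (\<epsilon> / 2)" using s0 \<epsilon> by (intro mult_right_mono) auto
    finally show ?thesis by simp
  qed
  have beta0: "\<beta> \<ge> 0" using phi_bound[of undefined undefined undefined] by linarith
  have "\<forall>c. \<exists>C. c < k \<longrightarrow> C \<ge> 0 \<and> (\<forall>C'\<ge>C. (\<integral>\<^sup>+z. ennreal ((fst z c)\<^sup>2) * indicator {z. (fst z c)\<^sup>2 > C'} z \<partial>P) \<le> ennreal (\<epsilon>/8))"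
  proof
    fix c
    show "\<exists>C. c < k \<longrightarrow> C \<ge> 0 \<and> (\<forall>C'\<ge>C. (\<integral>\<^sup>+z. ennreal ((fst z c)\<^sup>2) * indicator {z. (fst z c)\<^sup>2 > C'} z \<partial>P) \<le> ennreal (\<epsilon>/8))"
      using integrable_tail_small[OF X2, of c "\<epsilon>/8"] \<epsilon> by (cases "c < k") auto
  qed
  from choice[OF this] obtain Cc where Cc': "\<forall>c. c < k \<longrightarrow> Cc c \<ge> 0 \<and>
      (\<forall>C'\<ge>Cc c. (\<integral>\<^sup>+z. ennreal ((fst z c)\<^sup>2) * indicator {z. (fst z c)\<^sup>2 > C'} z \<partial>P) \<le> ennreal (\<epsilon>/8))" ..
  have Cc: "\<And>c. c < k \<Longrightarrow> Cc c \<ge> 0"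
    "\<And>c C'. c < k \<Longrightarrow> C' \<ge> Cc c \<Longrightarrow> (\<integral>\<^sup>+z. ennreal ((fst z c)\<^sup>2) * indicator {z. (fst z c)\<^sup>2 > C'} z \<partial>P) \<le> ennreal (\<epsilon>/8)"
    using Cc' by simp_all
  \<comment> \<open>The sum of nonnegative levels dominates each of them.\<close>
  define C where "C = (\<Sum>c<k. Cc c)"
  have C0: "C \<ge> 0" unfolding C_def by (intro sum_nonneg) (auto intro: Cc)
  have CC: "C \<ge> Cc c" if "c < k" for c
    unfolding C_def using that Cc(1) by (intro member_le_sum[where f=Cc]) auto
  \<comment> \<open>Makes the contribution of failures in \<open>is_code_exists\<close> at most
    \<open>\<epsilon> / 4\<close>; the 1 again keeps the denominator positive.\<close>
  define \<eta> where "\<eta> = \<epsilon> / (4 * (2 * \<beta>\<^sup>2 + 2 * C + 1))"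
  have pos: "2 * \<beta>\<^sup>2 + 2 * C + 1 > 0" using C0 by (intro add_nonneg_pos) auto
  have \<eta>: "\<eta> > 0" using \<epsilon> pos unfolding \<eta>_def by (intro divide_pos_pos) auto
  have \<eta>le: "(2 * \<beta>\<^sup>2 + 2 * C) * \<eta> \<le> \<epsilon> / 4"
  proof -
    have "(2 * \<beta>\<^sup>2 + 2 * C) * \<eta> \<le> (2 * \<beta>\<^sup>2 + 2 * C + 1) * \<eta>" using \<eta> by (intro mult_right_mono) auto
    also have "\<dots> = \<epsilon> / 4"
    proof -
      have "b * (\<epsilon> / (4 * b)) = \<epsilon> / 4" if "b > 0" for b :: real using that by simp
      from this[OF pos] show ?thesis by (simp only: \<eta>_def)
    qed
    finally show ?thesis .
  qed
  define H where "H i c z = (fst (fst z) c - \<phi> i c (restrict (snd z) (DS i), snd (fst z) i))\<^sup>2"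
    for i c and z :: "((nat \<Rightarrow> real) \<times> (nat \<Rightarrow> nat \<Rightarrow> real)) \<times> ('s \<Rightarrow> 'u)"
  define G where "G n z \<longleftrightarrow> (\<forall>i<m. \<forall>c<k. (\<Sum>t<n. H i c (z t)) \<le> real n * (d i c + \<epsilon>/4))" for n :: nat and z
  let ?J = "\<lambda>n. PiM {..<n::nat} (\<lambda>_. JM)"
  have Hm: "H i c \<in> borel_measurable RM" if "i < m" "c < k" for i c
  proof -
    have "H i c \<in> borel_measurable JM" unfolding H_def using dist_int[OF that] by auto
    then show ?thesis by (simp add: JM_def)
  qed
  have HmP: "(\<lambda>z. \<Sum>t<n. H i c (z t)) \<in> borel_measurable (PiM {..<n} (\<lambda>_. RM))" if "i < m" "c < k" for i c n
    by (intro borel_measurable_sum measurable_compose[OF _ Hm[OF that]]) simp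
  have Gm: "Measurable.pred (PiM {..<n} (\<lambda>_. RM)) (G n)" for n
  proof -
    have [measurable]: "Measurable.pred (PiM {..<n} (\<lambda>_. RM)) (\<lambda>z. (\<Sum>t<n. H i c (z t)) \<le> real n * (d i c + \<epsilon>/4))" if "i < m" "c < k" for i c
      using HmP[OF that, of n] by measurable
    show ?thesis unfolding G_def by measurable
  qed
  have sJ: "sets (?J n) = sets (PiM {..<n} (\<lambda>_. RM))" for n by (rule PiM_JM_sets)
  define T where "T i c n = {z\<in>space (?J n). \<not> (\<Sum>t<n. H i c (z t)) \<le> real n * ((\<integral>z. H i c z \<partial>JM) + \<epsilon>/4)}" for i c n
  have Tlim: "(\<lambda>n. measure (?J n) (T i c n)) \<longlonglongrightarrow> 0" if "i < m" "c < k" for i c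
    unfolding T_def H_def by (rule weak_law_upper[OF JM dist_int[OF that]]) (use \<epsilon> in simp)
  have Tlim': "(\<lambda>n. \<Sum>i<m. \<Sum>c<k. measure (?J n) (T i c n)) \<longlonglongrightarrow> 0"
    using tendsto_sum[of "{..<m}" "\<lambda>i n. \<Sum>c<k. measure (?J n) (T i c n)" "\<lambda>_. \<Sum>c<k. 0" sequentially]
      tendsto_sum[of "{..<k}" "\<lambda>c n. measure (?J n) (T _ c n)" "\<lambda>_. 0" sequentially] Tlim by simp
  define covf where "covf n = measure (?J n) {z\<in>space (?J n). \<not> cov n \<theta> (\<lambda>t. fst (fst (z t))) (\<lambda>t. snd (z t))}" for n
  define typf where "typf n = measure (?J n) {z\<in>space (?J n). \<not> (\<forall>l<m. jtyp n \<theta> l (\<lambda>t. snd (fst (z t)) l) (\<lambda>t. restrict (snd (z t)) (DS l)))}" for n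
  define cE where "cE n = (\<Prod>S\<in>set vs. 1 + exp (real n * (R S + R' S + \<theta>)) / real (Abin \<theta> n S * Bbin \<theta> n S)) - 1" for n
  define dE where "dE n = (\<Sum>l<m. exp (real n * \<theta>) * ((\<Prod>S\<in>DS l. 1 + real (Bbin \<theta> n S - 1) * exp (- real n * R' S)) - 1))" for n
  have l1: "covf \<longlonglongrightarrow> 0" unfolding covf_def by (rule cov_fail_tendsto_0[OF JM \<theta> rho_ln rho_ln_le])
  have l2: "typf \<longlonglongrightarrow> 0" unfolding typf_def by (rule typ_fail_tendsto_0[OF JM \<theta> g_ln])
  have l3: "cE \<longlonglongrightarrow> 0" unfolding cE_def by (rule covering_error_tendsto_0[OF \<theta>])
  have l4: "dE \<longlonglongrightarrow> 0" unfolding dE_def by (rule packing_error_tendsto_0[OF \<theta>])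
  have "(\<lambda>n. 8 * covf n + 4 * cE n + 2 * (((\<Sum>i<m. \<Sum>c<k. measure (?J n) (T i c n)) + typf n) + dE n)) \<longlonglongrightarrow> 8 * 0 + 4 * 0 + 2 * ((0 + 0) + 0)"
    by (rule tendsto_add[OF tendsto_add[OF tendsto_mult_left[OF l1] tendsto_mult_left[OF l3]]
          tendsto_mult_left[OF tendsto_add[OF tendsto_add[OF Tlim' l2] l4]]])
  then have "eventually (\<lambda>n. 8 * covf n + 4 * cE n + 2 * (((\<Sum>i<m. \<Sum>c<k. measure (?J n) (T i c n)) + typf n) + dE n) < \<eta>) sequentially"
    using \<eta> by (intro order_tendstoD(2)) auto
  moreover have "eventually (\<lambda>n. s * (ln 2 / real n) \<le> \<epsilon> / 2) sequentially"
  proof -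
    have "(\<lambda>n. s * (ln 2 / real n)) \<longlonglongrightarrow> 0" by real_asymp
    then have "eventually (\<lambda>n. s * (ln 2 / real n) < \<epsilon> / 2) sequentially" using \<epsilon> by (intro order_tendstoD(2)) auto
    then show ?thesis by eventually_elim simp
  qed
  moreover have "eventually (\<lambda>n. n > (0::nat)) sequentially" by (rule eventually_gt_at_top)
  ultimately have "eventually (\<lambda>n. \<exists>M f h. n > 0 \<and> is_code m k kY P n M (\<lambda>i c. d i c + \<epsilon>) f h \<and>
    ln (real M) / real n \<le> (\<Sum>S\<in>set vs. R S) + \<epsilon>) sequentially"
  proof eventually_elim
    case (elim n)
    have n: "n > 0" using elim by simp
    interpret mcn: multi_codebook_n P "vecM k" fst q vs \<rho> m DS "\<lambda>l. vecM (kY l)" "\<lambda>l z. snd z l" g R R' n "Abin \<theta> n" "Bbin \<theta> n" \<theta> "G n"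
      by (intro multi_codebook_n.intro multi_codebook_n_axioms.intro multi_codebook_axioms JM Abin_pos Bbin_pos Gm)
    interpret Jn: prob_space "?J n" by (rule prob_space_PiM) (rule JM)
    have okf: "measure (?J n) {z\<in>space (?J n). \<not> mcn.okZ z} \<le> (\<Sum>i<m. \<Sum>c<k. measure (?J n) (T i c n)) + typf n"
    proof -
      let ?Ty = "{z\<in>space (?J n). \<not> (\<forall>l<m. jtyp n \<theta> l (\<lambda>t. snd (fst (z t)) l) (\<lambda>t. restrict (snd (z t)) (DS l)))}"
      have Tm: "T i c n \<in> sets (?J n)" if "i < m" "c < k" for i c
      proof -
        have [measurable]: "(\<lambda>z. \<Sum>t<n. H i c (z t)) \<in> borel_measurable (?J n)"
          using HmP[OF that, of n] by (simp only: measurable_cong_sets[OF sJ refl])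
        show ?thesis unfolding T_def by measurable
      qed
      have Tym: "?Ty \<in> sets (?J n)"
      proof -
        have 1: "{z\<in>space (PiM {..<n} (\<lambda>_. RM)). \<not> (\<forall>l<m. jtyp n \<theta> l (\<lambda>t. snd (fst (z t)) l) (\<lambda>t. restrict (snd (z t)) (DS l)))} \<in> sets (PiM {..<n} (\<lambda>_. RM))"
        proof -
          have [measurable]: "Measurable.pred (PiM {..<n} (\<lambda>_. RM)) (\<lambda>z. jtyp n \<theta> l (\<lambda>t. snd (fst (z t)) l) (\<lambda>t. restrict (snd (z t)) (DS l)))" if l: "l < m" for l
          proof (rule jtyp_pred[OF l])
            fix t assume "t < n"
            then have zt: "(\<lambda>z. z t) \<in> measurable (PiM {..<n} (\<lambda>_. RM)) (P \<Otimes>\<^sub>M PiM (set vs) q)" by (simp add: RM_def)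
            show "(\<lambda>z. snd (fst (z t)) l) \<in> measurable (PiM {..<n} (\<lambda>_. RM)) (vecM (kY l))"
              by (rule measurable_compose[OF zt measurable_compose[OF measurable_fst py[OF l]]])
            show "(\<lambda>z. restrict (snd (z t)) (DS l)) \<in> measurable (PiM {..<n} (\<lambda>_. RM)) (PiM (DS l) q)"
              by (rule measurable_compose[OF zt measurable_compose[OF measurable_snd measurable_restrict_subset[OF DS[OF l]]]])
          qed
          show ?thesis by measurable
        qed
        then show ?thesis by (simp only: sJ sets_eq_imp_space_eq[OF sJ])
      qed
      have U: "(\<Union>i<m. \<Union>c<k. T i c n) \<in> sets (?J n)" by (intro sets.finite_UN Tm) auto
      have "{z\<in>space (?J n). \<not> mcn.okZ z} \<subseteq> (\<Union>i<m. \<Union>c<k. T i c n) \<union> ?Ty"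
      proof
        fix z assume "z \<in> {z\<in>space (?J n). \<not> mcn.okZ z}"
        then have z: "z \<in> space (?J n)" and "\<not> G n z \<or> z \<in> ?Ty" by (auto simp: mcn.okZ_def)
        then show "z \<in> (\<Union>i<m. \<Union>c<k. T i c n) \<union> ?Ty"
        proof (elim disjE)
          assume "\<not> G n z"
          then obtain i c where ic: "i < m" "c < k" "(\<Sum>t<n. H i c (z t)) > real n * (d i c + \<epsilon>/4)"
            unfolding G_def by (auto simp: not_le)
          have "real n * ((\<integral>z. H i c z \<partial>JM) + \<epsilon>/4) \<le> real n * (d i c + \<epsilon>/4)"
            using dist_le[OF ic(1,2)] by (intro mult_left_mono) (auto simp: H_def)
          then have "z \<in> T i c n" using ic z by (auto simp: T_def)
          then show ?thesis using ic by auto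
        qed simp
      qed
      then have a1: "measure (?J n) {z\<in>space (?J n). \<not> mcn.okZ z} \<le> measure (?J n) ((\<Union>i<m. \<Union>c<k. T i c n) \<union> ?Ty)"
        by (rule Jn.finite_measure_mono) (rule sets.Un[OF U Tym])
      have a2: "measure (?J n) ((\<Union>i<m. \<Union>c<k. T i c n) \<union> ?Ty) \<le> measure (?J n) (\<Union>i<m. \<Union>c<k. T i c n) + measure (?J n) ?Ty"
        by (rule measure_Un_le[OF U Tym])
      have a3: "measure (?J n) (\<Union>i<m. \<Union>c<k. T i c n) \<le> (\<Sum>i<m. measure (?J n) (\<Union>c<k. T i c n))"
        by (rule Jn.finite_measure_subadditive_finite) (auto intro!: Tm sets.finite_UN)
      have a4: "(\<Sum>i<m. measure (?J n) (\<Union>c<k. T i c n)) \<le> (\<Sum>i<m. \<Sum>c<k. measure (?J n) (T i c n))"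
        by (intro sum_mono Jn.finite_measure_subadditive_finite) (auto intro!: Tm)
      show ?thesis unfolding typf_def by (rule order_trans[OF order_trans[OF a1 a2] add_right_mono[OF order_trans[OF a3 a4]]])
    qed
    have err: "8 * measure (?J n) {z\<in>space (?J n). \<not> mcn.covZ z}
      + 4 * ((\<Prod>S\<in>set vs. 1 + mcn.E S / real (Abin \<theta> n S * Bbin \<theta> n S)) - 1)
      + 2 * (measure (?J n) {z\<in>space (?J n). \<not> mcn.okZ z} + mcn.dE) < \<eta>"
    proof -
      have "measure (?J n) {z\<in>space (?J n). \<not> mcn.covZ z} = covf n" by (simp add: mcn.covZ_def covf_def)
      moreover have "(\<Prod>S\<in>set vs. 1 + mcn.E S / real (Abin \<theta> n S * Bbin \<theta> n S)) - 1 = cE n" by (simp add: mcn.E_def cE_def)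
      moreover have "mcn.dE = dE n" by (simp add: mcn.dE_def dE_def)
      ultimately show ?thesis using elim(1) okf by simp
    qed
    from mcn.codebook_exists[OF err] obtain cb enc where
      cb: "cb \<in> space (PiM {..<n} (\<lambda>_. mcn.QC))" and
      enc: "enc \<in> measurable (PiM {..<n} (\<lambda>_. vecM k)) (count_space UNIV)" "\<And>xs. enc xs \<in> mcn.tuples"
        "{a\<in>space (PiM {..<n} (\<lambda>_. P)). mcn.bad (enc (\<lambda>t\<in>{..<n}. fst (a t))) (\<lambda>t\<in>{..<n}. (a t, cb t))} \<in> sets (PiM {..<n} (\<lambda>_. P))"
        "measure (PiM {..<n} (\<lambda>_. P)) {a\<in>space (PiM {..<n} (\<lambda>_. P)). mcn.bad (enc (\<lambda>t\<in>{..<n}. fst (a t))) (\<lambda>t\<in>{..<n}. (a t, cb t))} < \<eta>"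
      by blast
    \<comment> \<open>The distortion budget: \<open>\<epsilon> / 4\<close> for the law of large
      numbers, at most \<open>\<epsilon> / 4\<close> for failures, and twice
      \<open>\<epsilon> / 8\<close> for the tail of the source.\<close>
    interpret bc: block_code P k q vs \<rho> m DS kY g R R' n "Abin \<theta> n" "Bbin \<theta> n" \<theta> "G n" \<phi> \<beta> "\<lambda>i c. d i c + \<epsilon>/4" cb enc C "\<epsilon>/8" \<eta>
    proof (intro block_code.intro block_code_axioms.intro mcn.multi_codebook_n_axioms)
      show "G n z \<longleftrightarrow> (\<forall>i<m. \<forall>c<k.
         (\<Sum>t<n. (fst (fst (z t)) c - \<phi> i c (restrict (snd (z t)) (DS i), snd (fst (z t)) i))\<^sup>2) \<le> real n * (d i c + \<epsilon>/4))" for z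
        by (simp add: G_def H_def)
      show "0 \<le> d i c + \<epsilon>/4" if "i < m" "c < k" for i c using d0[OF that] \<epsilon> by simp
      show "(\<integral>\<^sup>+z. ennreal ((fst z c)\<^sup>2) * indicator {z. (fst z c)\<^sup>2 > C} z \<partial>P) \<le> ennreal (\<epsilon>/8)" if "c < k" for c
        by (rule Cc(2)[OF that CC[OF that]])
      show "measure (PiM {..<n} (\<lambda>_. P)) {a\<in>space (PiM {..<n} (\<lambda>_. P)). mcn.bad (enc (\<lambda>t\<in>{..<n}. fst (a t))) (\<lambda>t\<in>{..<n}. (a t, cb t))} \<le> \<eta>"
        using enc(4) by (rule less_imp_le)
      show "0 \<le> \<epsilon>/8" using \<epsilon> by simp
    qed (fact sP n phi_meas phi_bound cb enc(1) enc(2) enc(3) C0)+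
    obtain f h where "is_code m k kY P n (card (PiE (set vs) (\<lambda>S. {..<Abin \<theta> n S}))) (\<lambda>i c. (d i c + \<epsilon>/4) + (2 * \<beta>\<^sup>2 + 2 * C) * \<eta> + 2 * (\<epsilon>/8)) f h"
      using bc.is_code_exists by blast
    then have "is_code m k kY P n (card (PiE (set vs) (\<lambda>S. {..<Abin \<theta> n S}))) (\<lambda>i c. d i c + \<epsilon>) f h"
      by (rule is_code_mono) (use \<eta>le \<epsilon> in simp)
    moreover have "ln (real (card (PiE (set vs) (\<lambda>S. {..<Abin \<theta> n S})))) / real n \<le> (\<Sum>S\<in>set vs. R S) + \<epsilon>"
    proof -
      have "ln (real (card (PiE (set vs) (\<lambda>S. {..<Abin \<theta> n S})))) / real n \<le> (\<Sum>S\<in>set vs. R S) + s * (4 * \<theta> + ln 2 / real n)"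
        unfolding s_def by (rule rate_bound[OF \<theta> R0 n])
      also have "s * (4 * \<theta> + ln 2 / real n) = s * (4 * \<theta>) + s * (ln 2 / real n)" by (rule distrib_left)
      also have "\<dots> \<le> \<epsilon> / 2 + \<epsilon> / 2" using s\<theta> elim(2) by (rule add_mono)
      finally show ?thesis by simp
    qed
    ultimately show ?case using n by blast
  qed
  then show ?thesis by (simp add: eventually_sequentially)
qed

end

section \<open>Gaussian sources and test channels\<close>

lemma before_split:
  assumes d: "distinct vs" and vs: "vs = ys @ S # zs"
  shows "before vs S = set ys"
proof
  show "before vs S \<subseteq> set ys"
  proof
    fix S' assume "S' \<in> before vs S"
    then obtain i j where ij: "i < j" "j < length vs" "vs ! i = S'" "vs ! j = S" by (auto simp: before_def)
    have "vs ! length ys = S" "length ys < length vs" using vs by auto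
    then have "j = length ys" using d ij nth_eq_iff_index_eq[OF d, of j "length ys"] by auto
    then show "S' \<in> set ys" using ij vs by (auto simp: nth_append)
  qed
  show "set ys \<subseteq> before vs S"
  proof
    fix S' assume "S' \<in> set ys"
    then obtain i where "i < length ys" "ys ! i = S'" by (auto simp: in_set_conv_nth)
    then show "S' \<in> before vs S" unfolding before_def using vs
      by (intro CollectI exI[of _ i] exI[of _ "length ys"]) (auto simp: nth_append)
  qed
qed

lemma before_props:
  assumes d: "distinct vs" and S: "S \<in> set vs"
  shows "before vs S \<subseteq> set vs" "S \<notin> before vs S"
proof -
  obtain ys zs where e: "vs = ys @ S # zs" using split_list[OF S] by auto
  show "before vs S \<subseteq> set vs" "S \<notin> before vs S" using before_split[OF d e] e d by auto
qed

text \<open>Gives the dependency order of the integration argument: a factor for \<open>S\<close>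
  reads \<open>S\<close> and what precedes it, never a later coordinate.\<close>

lemma sorted_wrt_before:
  assumes d: "distinct vs"
  shows "sorted_wrt (\<lambda>S S'. S' \<notin> before vs S \<and> S' \<noteq> S) vs"
  unfolding sorted_wrt_iff_nth_less
proof (intro allI impI)
  fix i j assume ij: "i < j" "j < length vs"
  then have e: "vs = take i vs @ vs ! i # drop (Suc i) vs" by (simp add: id_take_nth_drop)
  have "before vs (vs ! i) = set (take i vs)" by (rule before_split[OF d e])
  moreover have "vs ! j \<notin> set (take i vs)" using d ij
    by (auto simp: in_set_conv_nth nth_eq_iff_index_eq)
  moreover have "vs ! j \<noteq> vs ! i" using d ij by (simp add: nth_eq_iff_index_eq)
  ultimately show "vs ! j \<notin> before vs (vs ! i) \<and> vs ! j \<noteq> vs ! i" by simp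
qed

lemma gauss_rv_square_integrable:
  assumes M: "prob_space M" and W: "gauss_rv M W"
  shows "integrable M (\<lambda>\<omega>. (W \<omega>)\<^sup>2)"
proof -
  interpret prob_space M by fact
  have Wm[measurable]: "W \<in> borel_measurable M" using W by (simp add: gauss_rv_def)
  obtain \<mu> where "(AE \<omega> in M. W \<omega> = \<mu>) \<or> (\<exists>\<sigma>>0. distributed M lborel W (normal_density \<mu> \<sigma>))"
    using W by (auto simp: gauss_rv_def)
  then show ?thesis
  proof (elim disjE exE conjE)
    assume "AE \<omega> in M. W \<omega> = \<mu>"
    then have "AE \<omega> in M. norm ((W \<omega>)\<^sup>2) \<le> \<mu>\<^sup>2" by eventually_elim simp
    then show ?thesis by (intro integrable_const_bound) auto
  next
    fix \<sigma> :: real assume \<sigma>: "\<sigma> > 0" and D: "distributed M lborel W (normal_density \<mu> \<sigma>)"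
    \<comment> \<open>Expanding around \<open>\<mu>\<close> reduces the second moment to central
      moments.\<close>
    have e: "(\<lambda>x. normal_density \<mu> \<sigma> x * x\<^sup>2) = (\<lambda>x. normal_density \<mu> \<sigma> x * (x - \<mu>)^2 + 2 * \<mu> * (normal_density \<mu> \<sigma> x * (x - \<mu>)^1) + \<mu>\<^sup>2 * normal_density \<mu> \<sigma> x)"
      by (auto simp: power2_eq_square algebra_simps)
    have "integrable lborel (\<lambda>x. normal_density \<mu> \<sigma> x * x\<^sup>2)"
      unfolding e
      by (intro Bochner_Integration.integrable_add integrable_mult_right integrable_normal_moment[OF \<sigma>] integrable_normal_density[OF \<sigma>])
    then show ?thesis
      using distributed_integrable[OF D, of "\<lambda>x. x\<^sup>2"] by simp
  qed
qed

lemma gaussian_source_square_integrable: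
  assumes g: "gaussian_source m k kY P" and c: "c < k"
  shows "integrable P (\<lambda>z. (fst z c)\<^sup>2)"
proof -
  have P: "prob_space P" and J: "jgauss P (source_coords m k kY) source_val" using g by (auto simp: gaussian_source_def)
  have fin: "finite (source_coords m k kY)" using J by (simp add: jgauss_def)
  have mem: "XC c \<in> source_coords m k kY" using c by (auto simp: source_coords_def)
  have "gauss_rv P (\<lambda>\<omega>. \<Sum>i\<in>source_coords m k kY. (of_bool (i = XC c)) * source_val i \<omega>)"
    using J unfolding jgauss_def by (elim conjE) (erule allE[of _ "\<lambda>i. of_bool (i = XC c)"])
  also have "(\<lambda>\<omega>. \<Sum>i\<in>source_coords m k kY. (of_bool (i = XC c)) * source_val i \<omega>) = (\<lambda>\<omega>. fst \<omega> c)"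
  proof
    fix \<omega> :: "(nat \<Rightarrow> real) \<times> (nat \<Rightarrow> nat \<Rightarrow> real)"
    have "(\<Sum>i\<in>source_coords m k kY. (of_bool (i = XC c)) * source_val i \<omega>) = (\<Sum>i\<in>source_coords m k kY. if i = XC c then source_val (XC c) \<omega> else 0)"
      by (intro sum.cong) auto
    also have "\<dots> = source_val (XC c) \<omega>" using fin mem by (simp add: sum.delta)
    finally show "(\<Sum>i\<in>source_coords m k kY. (of_bool (i = XC c)) * source_val i \<omega>) = fst \<omega> c" by simp
  qed
  finally show ?thesis by (rule gauss_rv_square_integrable[OF P])
qed

lemma Uval_measurable:
  assumes T: "T \<in> measurable M (count_space UNIV)" "\<And>\<omega>. \<omega> \<in> space M \<Longrightarrow> T \<omega> \<in> {1..\<tau>}"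
    and U: "\<And>t. t \<in> {1..\<tau>} \<Longrightarrow> Uf S t \<in> measurable M (vecM d)"
  shows "Uval Uf T S \<in> measurable M (UM d)"
proof -
  \<comment> \<open>\<open>Uf S t\<close> is known to be measurable only for \<open>t\<close> in
    \<open>{1..\<tau>}\<close>. A constant stands in elsewhere, and along \<open>T\<close> the two
    agree.\<close>
  define F where "F t = (if t \<in> {1..\<tau>} then Uf S t else (\<lambda>_. \<lambda>c\<in>{..<d}. 0))" for t
  have "F t \<in> measurable M (vecM d)" for t
    using U[of t] by (auto simp: F_def vecM_def space_PiM)
  then have "(\<lambda>\<omega>. F (T \<omega>) \<omega>) \<in> measurable M (vecM d)"
    by (rule measurable_compose_countable) (rule T(1))
  then have "(\<lambda>\<omega>. (F (T \<omega>) \<omega>, T \<omega>)) \<in> measurable M (UM d)"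
    unfolding UM_def using T(1) by (rule measurable_Pair)
  also have "?this \<longleftrightarrow> Uval Uf T S \<in> measurable M (UM d)"
    by (rule measurable_cong) (use T(2) in \<open>auto simp: Uval_def F_def\<close>)
  finally show ?thesis .
qed

text \<open>Dominated convergence as the clipping level grows. The conclusion holds eventually, so
  that one level can be chosen for finitely many components and decoders.\<close>

lemma clipped_estimator:
  fixes X \<psi> :: "'a \<Rightarrow> real"
  assumes [measurable]: "\<psi> \<in> borel_measurable M" and X2: "integrable M (\<lambda>\<omega>. (X \<omega>)\<^sup>2)" and Xm[measurable]: "X \<in> borel_measurable M"
    and e2: "(\<integral>\<^sup>+\<omega>. ennreal ((X \<omega> - \<psi> \<omega>)\<^sup>2) \<partial>M) \<le> ennreal D" and D: "D \<ge> 0" and \<epsilon>: "\<epsilon> > 0"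
  shows "eventually (\<lambda>B::nat. integrable M (\<lambda>\<omega>. (X \<omega> - max (- real B) (min (real B) (\<psi> \<omega>)))\<^sup>2) \<and>
    (\<integral>\<omega>. (X \<omega> - max (- real B) (min (real B) (\<psi> \<omega>)))\<^sup>2 \<partial>M) \<le> D + \<epsilon>) sequentially"
proof -
  have ei: "integrable M (\<lambda>\<omega>. (X \<omega> - \<psi> \<omega>)\<^sup>2)"
    by (rule integrableI_nonneg) (use e2 in \<open>auto intro: le_less_trans\<close>)
  have eD: "(\<integral>\<omega>. (X \<omega> - \<psi> \<omega>)\<^sup>2 \<partial>M) \<le> D"
    using e2 D by (subst (asm) nn_integral_eq_integral[OF ei]) auto
  let ?c = "\<lambda>(B::nat) \<omega>. max (- real B) (min (real B) (\<psi> \<omega>))"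
  \<comment> \<open>Square integrability of \<open>\<psi>\<close> is not given, so clipping is
    dominated through the error: (X - c)^2 is at most 2 X^2 + 2 \<open>\<psi>\<close>^2, and
    \<open>\<psi>\<close>^2 is at most 2 X^2 + 2 (X - \<open>\<psi>\<close>)^2, which produces 6 and
    4.\<close>
  let ?w = "\<lambda>\<omega>. 6 * (X \<omega>)\<^sup>2 + 4 * (X \<omega> - \<psi> \<omega>)\<^sup>2"
  have wi: "integrable M ?w" using X2 ei by auto
  have dom: "(X \<omega> - ?c B \<omega>)\<^sup>2 \<le> ?w \<omega>" for B \<omega>
  proof -
    have "(?c B \<omega>)\<^sup>2 \<le> (\<psi> \<omega>)\<^sup>2" by (intro abs_le_square_iff[THEN iffD1]) auto
    moreover have "(X \<omega> - ?c B \<omega>)\<^sup>2 \<le> 2 * (X \<omega>)\<^sup>2 + 2 * (?c B \<omega>)\<^sup>2"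
    proof -
      have "0 \<le> (X \<omega> + ?c B \<omega>)\<^sup>2" by (rule zero_le_power2)
      then show ?thesis by (simp only: power2_sum power2_diff)
    qed
    moreover have "(\<psi> \<omega>)\<^sup>2 \<le> 2 * (X \<omega>)\<^sup>2 + 2 * (X \<omega> - \<psi> \<omega>)\<^sup>2"
    proof -
      have "0 \<le> (2 * X \<omega> - \<psi> \<omega>)\<^sup>2" by simp
      then show ?thesis by (simp add: power2_eq_square algebra_simps)
    qed
    ultimately show ?thesis by linarith
  qed
  have int: "integrable M (\<lambda>\<omega>. (X \<omega> - ?c B \<omega>)\<^sup>2)" for B
    by (rule Bochner_Integration.integrable_bound[OF wi]) (use dom[of _ B] in \<open>auto intro: order_trans[OF _ abs_ge_self]\<close>)
  have "(\<lambda>B. \<integral>\<omega>. (X \<omega> - ?c B \<omega>)\<^sup>2 \<partial>M) \<longlonglongrightarrow> (\<integral>\<omega>. (X \<omega> - \<psi> \<omega>)\<^sup>2 \<partial>M)"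
  proof (rule integral_dominated_convergence[where w="?w"])
    show "AE \<omega> in M. (\<lambda>B. (X \<omega> - ?c B \<omega>)\<^sup>2) \<longlonglongrightarrow> (X \<omega> - \<psi> \<omega>)\<^sup>2"
    proof (rule AE_I2)
      fix \<omega>
      obtain N :: nat where N: "\<bar>\<psi> \<omega>\<bar> \<le> real N" using real_arch_simple by blast
      have "eventually (\<lambda>B. (X \<omega> - ?c B \<omega>)\<^sup>2 = (X \<omega> - \<psi> \<omega>)\<^sup>2) sequentially"
        using eventually_ge_at_top[of N]
      proof eventually_elim
        case (elim B)
        then have "?c B \<omega> = \<psi> \<omega>" using N by auto
        then show ?case by simp
      qed
      then show "(\<lambda>B. (X \<omega> - ?c B \<omega>)\<^sup>2) \<longlonglongrightarrow> (X \<omega> - \<psi> \<omega>)\<^sup>2" by (rule tendsto_eventually)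
    qed
    show "AE \<omega> in M. norm ((X \<omega> - ?c B \<omega>)\<^sup>2) \<le> ?w \<omega>" for B
      by (rule AE_I2) (use dom[of _ B] in simp)
  qed (use wi in auto)
  then have "eventually (\<lambda>B. (\<integral>\<omega>. (X \<omega> - ?c B \<omega>)\<^sup>2 \<partial>M) < D + \<epsilon>) sequentially"
    using eD \<epsilon> by (intro order_tendstoD(2)) auto
  then show ?thesis by eventually_elim (use int in auto)
qed

lemma mutual_info_nonneg: "mutual_info M SA SB A B \<ge> 0"
  by (simp add: mutual_info_def Let_def)

lemma mutual_info_finite_imp_ac:
  "mutual_info M SA SB A B < \<infinity> \<Longrightarrow>
    absolutely_continuous (distr M SA A \<Otimes>\<^sub>M distr M SB B) (distr M (SA \<Otimes>\<^sub>M SB) (\<lambda>\<omega>. (A \<omega>, B \<omega>)))"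
  by (auto simp: mutual_info_def Let_def split: if_splits)

text \<open>Truncated logarithms reach only real numbers strictly below a mutual information. This
  distributes a bound on the sum over strict real bounds for the summands, even when some of them
  are infinite.\<close>

lemma ereal_sum_lower_approx:
  fixes \<mu> :: "'s \<Rightarrow> ereal"
  assumes D: "finite D" "D \<noteq> {}" and \<mu>: "\<And>S. S \<in> D \<Longrightarrow> \<mu> S \<ge> 0" and le: "ereal r \<le> (\<Sum>S\<in>D. \<mu> S)" and e: "e > 0"
  shows "\<exists>c. (\<forall>S\<in>D. ereal (c S) < \<mu> S) \<and> r - e \<le> (\<Sum>S\<in>D. c S)"
proof (cases "\<forall>S\<in>D. \<mu> S < \<infinity>")
  case True
  have n: "real (card D) > 0" using D by (simp add: card_gt_0_iff)
  have fin: "\<mu> S = ereal (real_of_ereal (\<mu> S))" if "S \<in> D" for S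
    using True \<mu>[OF that] that by (cases "\<mu> S") auto
  have "(\<Sum>S\<in>D. \<mu> S) = (\<Sum>S\<in>D. ereal (real_of_ereal (\<mu> S)))" by (rule sum.cong[OF refl fin])
  then have r: "r \<le> (\<Sum>S\<in>D. real_of_ereal (\<mu> S))" using le by simp
  show ?thesis
  proof (intro exI[of _ "\<lambda>S. real_of_ereal (\<mu> S) - e / real (card D)"] conjI ballI)
    fix S assume S: "S \<in> D"
    have "ereal (real_of_ereal (\<mu> S) - e / real (card D)) < ereal (real_of_ereal (\<mu> S))" using e n by simp
    then show "ereal (real_of_ereal (\<mu> S) - e / real (card D)) < \<mu> S" using fin[OF S] by simp
  next
    show "r - e \<le> (\<Sum>S\<in>D. real_of_ereal (\<mu> S) - e / real (card D))" using r n by (simp add: sum_subtractf)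
  qed
next
  case False
  then obtain S0 where S0: "S0 \<in> D" "\<mu> S0 = \<infinity>" by auto
  \<comment> \<open>One infinite summand carries everything: the others only have to exceed -1, and
    \<open>real (card D)\<close> compensates for these terms.\<close>
  define c where "c S = (if S = S0 then r + real (card D) else - 1)" for S
  have "(\<Sum>S\<in>D. c S) = (r + real (card D)) + (\<Sum>S\<in>D - {S0}. - 1)"
    using sum.remove[OF D(1) S0(1), of c] by (simp add: c_def)
  also have "\<dots> \<ge> r - e" using e S0 D by (simp add: of_nat_diff card_gt_0_iff)
  finally have "r - e \<le> (\<Sum>S\<in>D. c S)" .
  moreover have "ereal (c S) < \<mu> S" if "S \<in> D" for S
    using \<mu>[OF that] S0 by (auto simp: c_def intro: less_le_trans[of _ "0::ereal"])
  ultimately show ?thesis by blast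
qed

section \<open>From a test channel to an achievable rate\<close>

text \<open>Translates the single-letter conditions into \<open>block_source\<close>: the encoder
  inequalities give integrable log-densities, the chain rule and the Markov condition the density of
  the joint law, the decoder inequalities integrable minorants, and the error covariances bounded
  estimators.\<close>

lemma sum_rate_achievable:
  assumes gs: "gaussian_source m k kY P" and D0: "\<forall>i<m. \<forall>c<k. D i c > 0" and ord: "vs \<in> orderings m"
    and cg: "CG m k kY P D M X Y T \<tau> dU Uf" and lp: "LP m k kY vs M X Y T dU Uf R R'"
  shows "mse_achievable m k kY P D (\<Sum>S\<in>subsets m. R S)"
proof -
  have d: "distinct vs" and sv: "set vs = subsets m" using ord by (auto simp: orderings_def)
  note c1 = cg[unfolded CG_def]
  note c2 = conjunct2[OF c1]
  note c3 = conjunct2[OF c2]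
  note c4 = conjunct2[OF c3]
  note c5 = conjunct2[OF c4]
  note c6 = conjunct2[OF c5]
  note c7 = conjunct2[OF c6]
  note c8 = conjunct2[OF c7]
  note c9 = conjunct2[OF c8]
  note c10 = conjunct2[OF c9]
  note c11 = conjunct2[OF c10]
  note M = conjunct1[OF c1] and X[measurable] = conjunct1[OF c2] and Y[measurable] = conjunct1[OF c3]
    and PXY = conjunct1[OF c4] and T = conjunct1[OF c6] conjunct1[OF c7, rule_format]
    and Uf = conjunct1[OF c9, rule_format] and mk = conjunct1[OF c10] and mmse = conjunct1[OF c11, rule_format]
  interpret M: prob_space M by fact
  have P: "prob_space P" and sP: "sets P = sets (XYM m k kY)" using gs by (auto simp: gaussian_source_def)
  interpret P: prob_space P by fact
  \<comment> \<open>The time-sharing variable is a component of every \<open>U S\<close>, so each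
    letter of a codeword carries its own value of it.\<close>
  define U where "U = Uval Uf T"
  define SU where "SU S = UM (dU S)" for S
  define bef where "bef = before vs"
  have Um: "U S \<in> measurable M (SU S)" if "S \<in> set vs" for S
    unfolding U_def SU_def using that Uf by (intro Uval_measurable[OF T]) (auto simp: sv)
  have Ucoll: "Ucoll Uf T A = (\<lambda>\<omega>. \<lambda>S\<in>A. U S \<omega>)" for A by (simp add: Ucoll_def U_def fun_eq_iff)
  have UcollM: "UcollM dU A = PiM A SU" for A by (simp add: UcollM_def SU_def[abs_def])
  have Ucm: "(\<lambda>\<omega>. \<lambda>S\<in>A. U S \<omega>) \<in> measurable M (PiM A SU)" if "A \<subseteq> set vs" for A
    by (rule measurable_restrict) (use that Um in auto)
  have Ym: "(\<lambda>\<omega>. Y \<omega> l) \<in> measurable M (vecM (kY l))" if "l < m" for l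
    using that Y unfolding YM_def by simp
  have bef_sub: "bef S \<subseteq> set vs" and bef_irr: "S \<notin> bef S" if "S \<in> set vs" for S
    unfolding bef_def using before_props[OF d that] by auto
  have Dl_sub: "Dl m l \<subseteq> set vs" for l by (auto simp: Dl_def sv)
  \<comment> \<open>The codebook locales ask for a probability measure at every index; outside
    \<open>set vs\<close> a point mass is put there.\<close>
  define q where "q S = (if S \<in> set vs then distr M (SU S) (U S) else return (count_space UNIV) undefined)" for S
  have q: "prob_space (q S)" for S
    unfolding q_def by (auto intro!: M.prob_space_distr prob_space_return Um)
  have qS: "q S = distr M (SU S) (U S)" if "S \<in> set vs" for S using that by (simp add: q_def)
  have sq: "sets (q S) = sets (SU S)" if "S \<in> set vs" for S using that by (simp add: qS)
  have sPq: "sets (PiM A q) = sets (PiM A SU)" if "A \<subseteq> set vs" for A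
    by (rule sets_PiM_cong) (use that sq in auto)
  have R0: "R S \<ge> 0" if "S \<in> set vs" for S using lp that by (auto simp: LP_def sv)

  define aenc where "aenc S \<omega> = (X \<omega>, \<lambda>S'\<in>bef S. U S' \<omega>)" for S \<omega>
  define SA where "SA S = vecM k \<Otimes>\<^sub>M PiM (bef S) SU" for S
  have aencm: "aenc S \<in> measurable M (SA S)" if "S \<in> set vs" for S
    unfolding aenc_def SA_def using Ucm[OF bef_sub[OF that]] by measurable
  have "\<forall>S\<in>set vs. \<exists>f. f \<in> borel_measurable (SA S \<Otimes>\<^sub>M SU S) \<and> (\<forall>z. f z \<ge> (0::real)) \<and>
      distr M (SA S \<Otimes>\<^sub>M SU S) (\<lambda>\<omega>. (aenc S \<omega>, U S \<omega>)) = density (distr M (SA S) (aenc S) \<Otimes>\<^sub>M q S) (\<lambda>z. ennreal (f z)) \<and>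
      (\<forall>a\<in>space (SA S). (\<integral>\<^sup>+v. ennreal (f (a, v)) \<partial>q S) \<le> 1) \<and>
      integrable M (\<lambda>\<omega>. ln (f (aenc S \<omega>, U S \<omega>))) \<and> (\<integral>\<omega>. ln (f (aenc S \<omega>, U S \<omega>)) \<partial>M) \<le> R S + R' S"
  proof
    fix S assume S: "S \<in> set vs"
    have "mutual_info M (vecM k \<Otimes>\<^sub>M UcollM dU (before vs S)) (UM (dU S))
          (\<lambda>\<omega>. (X \<omega>, Ucoll Uf T (before vs S) \<omega>)) (Uval Uf T S) - ereal (R' S) \<le> ereal (R S)"
      using lp S unfolding LP_def sv by blast
    then have le: "mutual_info M (SA S) (SU S) (aenc S) (U S) - ereal (R' S) \<le> ereal (R S)"
      unfolding Ucoll UcollM U_def[symmetric] SU_def[symmetric] SA_def aenc_def[abs_def] bef_def .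
    \<comment> \<open>\<open>R S\<close> and \<open>R' S\<close> are real numbers, so the encoder
      inequality forces finite mutual information, and with it absolute continuity.\<close>
    have mi: "mutual_info M (SA S) (SU S) (aenc S) (U S) < \<infinity>" "mutual_info M (SA S) (SU S) (aenc S) (U S) \<le> ereal (R S + R' S)"
      using le by (cases "mutual_info M (SA S) (SU S) (aenc S) (U S)"; simp)+
    from mutual_info_density[OF M aencm[OF S] Um[OF S] mutual_info_finite_imp_ac[OF mi(1)]]
    obtain f where f: "f \<in> borel_measurable (SA S \<Otimes>\<^sub>M SU S)" "\<forall>z. f z \<ge> (0::real)"
      "distr M (SA S \<Otimes>\<^sub>M SU S) (\<lambda>\<omega>. (aenc S \<omega>, U S \<omega>)) = density (distr M (SA S) (aenc S) \<Otimes>\<^sub>M distr M (SU S) (U S)) (\<lambda>z. ennreal (f z))"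
      "\<forall>a\<in>space (SA S). (\<integral>\<^sup>+v. ennreal (f (a, v)) \<partial>distr M (SU S) (U S)) \<le> 1"
      "integrable M (\<lambda>\<omega>. ln (f (aenc S \<omega>, U S \<omega>)))"
      "ereal (\<integral>\<omega>. ln (f (aenc S \<omega>, U S \<omega>)) \<partial>M) = mutual_info M (SA S) (SU S) (aenc S) (U S)"
      using mi(1) by blast
    have "(\<integral>\<omega>. ln (f (aenc S \<omega>, U S \<omega>)) \<partial>M) \<le> R S + R' S" using mi(2) f(6)[symmetric] by simp
    with f(1-5) show "\<exists>f. f \<in> borel_measurable (SA S \<Otimes>\<^sub>M SU S) \<and> (\<forall>z. f z \<ge> (0::real)) \<and>
      distr M (SA S \<Otimes>\<^sub>M SU S) (\<lambda>\<omega>. (aenc S \<omega>, U S \<omega>)) = density (distr M (SA S) (aenc S) \<Otimes>\<^sub>M q S) (\<lambda>z. ennreal (f z)) \<and>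
      (\<forall>a\<in>space (SA S). (\<integral>\<^sup>+v. ennreal (f (a, v)) \<partial>q S) \<le> 1) \<and>
      integrable M (\<lambda>\<omega>. ln (f (aenc S \<omega>, U S \<omega>))) \<and> (\<integral>\<omega>. ln (f (aenc S \<omega>, U S \<omega>)) \<partial>M) \<le> R S + R' S"
      unfolding qS[OF S] by blast
  qed
  from bchoice[OF this] obtain f0 where f0: "\<forall>S\<in>set vs. f0 S \<in> borel_measurable (SA S \<Otimes>\<^sub>M SU S) \<and> (\<forall>z. f0 S z \<ge> (0::real)) \<and>
      distr M (SA S \<Otimes>\<^sub>M SU S) (\<lambda>\<omega>. (aenc S \<omega>, U S \<omega>)) = density (distr M (SA S) (aenc S) \<Otimes>\<^sub>M q S) (\<lambda>z. ennreal (f0 S z)) \<and>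
      (\<forall>a\<in>space (SA S). (\<integral>\<^sup>+v. ennreal (f0 S (a, v)) \<partial>q S) \<le> 1) \<and>
      integrable M (\<lambda>\<omega>. ln (f0 S (aenc S \<omega>, U S \<omega>))) \<and> (\<integral>\<omega>. ln (f0 S (aenc S \<omega>, U S \<omega>)) \<partial>M) \<le> R S + R' S" ..
  \<comment> \<open>Set to zero outside \<open>set vs\<close>, because nonnegativity is required at
    every index.\<close>
  define f where "f S z = (if S \<in> set vs then f0 S z else 0)" for S z
  have ff0: "f S = f0 S" if "S \<in> set vs" for S using that by (simp add: f_def fun_eq_iff)
  have fm: "f S \<in> borel_measurable (SA S \<Otimes>\<^sub>M SU S)"
    and flaw: "distr M (SA S \<Otimes>\<^sub>M SU S) (\<lambda>\<omega>. (aenc S \<omega>, U S \<omega>)) = density (distr M (SA S) (aenc S) \<Otimes>\<^sub>M q S) (\<lambda>z. ennreal (f S z))"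
    and fint: "\<And>a. a \<in> space (SA S) \<Longrightarrow> (\<integral>\<^sup>+v. ennreal (f S (a, v)) \<partial>q S) \<le> 1"
    and fln: "integrable M (\<lambda>\<omega>. ln (f S (aenc S \<omega>, U S \<omega>)))" "(\<integral>\<omega>. ln (f S (aenc S \<omega>, U S \<omega>)) \<partial>M) \<le> R S + R' S"
    if "S \<in> set vs" for S
    using f0 that unfolding ff0[OF that] by blast+
  have fnn: "f S z \<ge> 0" for S z
  proof (cases "S \<in> set vs")
    case True
    then have "\<forall>z. f0 S z \<ge> 0" using f0 by blast
    then show ?thesis using True by (simp only: f_def if_True)
  qed (simp add: f_def)

  define \<rho> where "\<rho> S x u = f S ((x, restrict u (bef S)), u S)" for S x u
  define V where "V \<omega> = (\<lambda>S\<in>set vs. U S \<omega>)" for \<omega>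
  have Vm[measurable]: "V \<in> measurable M (PiM (set vs) SU)" unfolding V_def by (rule Ucm) simp
  have rhom: "(\<lambda>z. \<rho> S (fst z) (snd z)) \<in> borel_measurable (vecM k \<Otimes>\<^sub>M PiM (set vs) SU)" if S: "S \<in> set vs" for S
  proof -
    have [measurable]: "(\<lambda>u. restrict u (bef S)) \<in> measurable (PiM (set vs) SU) (PiM (bef S) SU)"
      by (rule measurable_restrict_subset[OF bef_sub[OF S]])
    have [measurable]: "(\<lambda>u. u S) \<in> measurable (PiM (set vs) SU) (SU S)" using S by (rule measurable_component_singleton)
    have "(\<lambda>z. ((fst z, restrict (snd z) (bef S)), snd z S)) \<in> measurable (vecM k \<Otimes>\<^sub>M PiM (set vs) SU) (SA S \<Otimes>\<^sub>M SU S)"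
      unfolding SA_def by measurable
    from measurable_compose[OF this fm[OF S]] show ?thesis by (simp add: \<rho>_def)
  qed
  define w' where "w' z = (\<Prod>S\<in>set vs. ennreal (\<rho> S (fst z) (snd z)))" for z
  have w'm: "w' \<in> borel_measurable (vecM k \<Otimes>\<^sub>M PiM (set vs) SU)"
    unfolding w'_def by (intro borel_measurable_prod_ennreal measurable_compose[OF rhom measurable_ennreal])
  have law: "(\<integral>\<^sup>+\<omega>. F (X \<omega>, V \<omega>) \<partial>M) = (\<integral>\<^sup>+x. \<integral>\<^sup>+u. F (x, u) * w' (x, u) \<partial>PiM (set vs) q \<partial>distr M (vecM k) X)"
    if F: "F \<in> borel_measurable (vecM k \<Otimes>\<^sub>M PiM (set vs) SU)" for F
  proof -
    have "(\<integral>\<^sup>+\<omega>. F (X \<omega>, \<lambda>S\<in>set vs. U S \<omega>) \<partial>M) =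
      (\<integral>\<^sup>+x. \<integral>\<^sup>+u. F (x, u) * (\<Prod>S\<in>set vs. ennreal (f S ((x, restrict u (bef S)), u S))) \<partial>PiM (set vs) q \<partial>distr M (vecM k) X)"
    proof (rule chain_density[OF M X q sq d Um _ _ _ F])
      show "f S \<in> borel_measurable ((vecM k \<Otimes>\<^sub>M PiM (bef S) SU) \<Otimes>\<^sub>M SU S)" if "S \<in> set vs" for S
        using fm[OF that] by (simp add: SA_def)
      show "bef S = set ys" if "vs = ys @ S # zs" for ys S zs
        unfolding bef_def by (rule before_split[OF d that])
      show "distr M ((vecM k \<Otimes>\<^sub>M PiM (bef S) SU) \<Otimes>\<^sub>M SU S) (\<lambda>\<omega>. ((X \<omega>, \<lambda>S'\<in>bef S. U S' \<omega>), U S \<omega>)) =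
        density (distr M (vecM k \<Otimes>\<^sub>M PiM (bef S) SU) (\<lambda>\<omega>. (X \<omega>, \<lambda>S'\<in>bef S. U S' \<omega>)) \<Otimes>\<^sub>M q S) (\<lambda>z. ennreal (f S z))"
        if "S \<in> set vs" for S using flaw[OF that] unfolding SA_def aenc_def[abs_def] .
    qed
    then show ?thesis unfolding V_def w'_def \<rho>_def by simp
  qed
  define RM where "RM = P \<Otimes>\<^sub>M PiM (set vs) q"
  define Z where "Z \<omega> = ((X \<omega>, Y \<omega>), V \<omega>)" for \<omega>
  have sRM: "sets RM = sets ((vecM k \<Otimes>\<^sub>M YM m kY) \<Otimes>\<^sub>M PiM (set vs) SU)"
    unfolding RM_def using sP sPq[OF subset_refl] by (intro sets_pair_measure_cong) (auto simp: XYM_def)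
  have Zm: "Z \<in> measurable M RM"
    unfolding measurable_cong_sets[OF refl sRM] Z_def by measurable
  have ZRM: "distr M RM Z = density RM (\<lambda>z. w' (fst (fst z), snd z))"
  proof -
    have "distr M ((vecM k \<Otimes>\<^sub>M YM m kY) \<Otimes>\<^sub>M PiM (set vs) SU) (\<lambda>\<omega>. ((X \<omega>, Y \<omega>), V \<omega>))
      = density (distr M (vecM k \<Otimes>\<^sub>M YM m kY) (\<lambda>\<omega>. (X \<omega>, Y \<omega>)) \<Otimes>\<^sub>M PiM (set vs) q) (\<lambda>z. w' (fst (fst z), snd z))"
    proof (rule markov_density[OF M X Y Vm _ _ _ w'm law])
      show "markov_chain M (PiM (set vs) SU) V (vecM k) X (YM m kY) Y"
        using mk unfolding Ucoll UcollM sv[symmetric] V_def[abs_def] .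
      show "prob_space (PiM (set vs) q)" by (rule prob_space_PiM) (rule q)
      show "sets (PiM (set vs) q) = sets (PiM (set vs) SU)" by (rule sPq) simp
    qed
    also have "distr M (vecM k \<Otimes>\<^sub>M YM m kY) (\<lambda>\<omega>. (X \<omega>, Y \<omega>)) = P" using PXY by (simp add: XYM_def)
    also have "distr M ((vecM k \<Otimes>\<^sub>M YM m kY) \<Otimes>\<^sub>M PiM (set vs) SU) (\<lambda>\<omega>. ((X \<omega>, Y \<omega>), V \<omega>)) = distr M RM Z"
      by (rule distr_cong) (auto simp: sRM Z_def)
    finally show ?thesis by (simp add: RM_def)
  qed

  \<comment> \<open>What decoder \<open>l\<close> compares \<open>U S\<close> with when the words in
    \<open>D'\<close> are in doubt: the earlier words within \<open>D'\<close>, the words outside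
    \<open>D'\<close>, and its side information.\<close>
  define bdec where "bdec l D' S \<omega> = ((\<lambda>S'\<in>bef S \<inter> D'. U S' \<omega>), (\<lambda>S'\<in>Dl m l - D'. U S' \<omega>), Y \<omega> l)" for l D' S \<omega>
  define SB where "SB l D' S = PiM (bef S \<inter> D') SU \<Otimes>\<^sub>M PiM (Dl m l - D') SU \<Otimes>\<^sub>M vecM (kY l)" for l D' S
  define mi where "mi l D' S = mutual_info M (SU S) (SB l D' S) (U S) (bdec l D' S)" for l D' S
  define QQ where "QQ = {(l, D', S). l < m \<and> D' \<subseteq> Dl m l \<and> S \<in> D'}"
  have bdecm: "bdec l D' S \<in> measurable M (SB l D' S)" if "l < m" "D' \<subseteq> Dl m l" "S \<in> D'" for l D' S
  proof -
    have "bef S \<inter> D' \<subseteq> set vs" "Dl m l - D' \<subseteq> set vs" using that Dl_sub[of l] by auto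
    from Ucm[OF this(1)] Ucm[OF this(2)] Ym[OF that(1)] show ?thesis unfolding bdec_def SB_def by measurable
  qed
  have "\<forall>p\<in>QQ. \<exists>h. case p of (l, D', S) \<Rightarrow> h \<in> borel_measurable (SU S \<Otimes>\<^sub>M SB l D' S) \<and> (\<forall>z. h z \<ge> (0::real)) \<and>
      (\<forall>b\<in>space (SB l D' S). (\<integral>\<^sup>+v. ennreal (h (v, b)) \<partial>q S) \<le> 1) \<and>
      (AE \<omega> in M. h (U S \<omega>, bdec l D' S \<omega>) > 0) \<and>
      (\<forall>c. ereal c < mi l D' S \<longrightarrow> (\<exists>L. integrable M (\<lambda>\<omega>. min (ln (h (U S \<omega>, bdec l D' S \<omega>))) L) \<and>
         c \<le> (\<integral>\<omega>. min (ln (h (U S \<omega>, bdec l D' S \<omega>))) L \<partial>M)))"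
  proof
    fix p assume "p \<in> QQ"
    then obtain l D' S where p: "p = (l, D', S)" and l: "l < m" and D': "D' \<subseteq> Dl m l" and S: "S \<in> D'" by (auto simp: QQ_def)
    have Sv: "S \<in> set vs" using S D' Dl_sub[of l] by auto
    \<comment> \<open>Reads \<open>bdec\<close> off the product space without touching coordinate
      \<open>S\<close>: this lies in \<open>D'\<close> and does not precede itself.\<close>
    define B where "B z = (restrict (snd z) (bef S \<inter> D'), restrict (snd z) (Dl m l - D'), snd (fst z) l)"
      for z :: "((nat \<Rightarrow> real) \<times> (nat \<Rightarrow> nat \<Rightarrow> real)) \<times> (nat set \<Rightarrow> (nat \<Rightarrow> real) \<times> nat)"
    have sub: "bef S \<inter> D' \<subseteq> set vs" "Dl m l - D' \<subseteq> set vs" using D' Dl_sub[of l] by auto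
    have Bm: "B \<in> measurable RM (SB l D' S)"
    proof -
      have [measurable]: "(\<lambda>u. restrict u (bef S \<inter> D')) \<in> measurable (PiM (set vs) SU) (PiM (bef S \<inter> D') SU)"
        "(\<lambda>u. restrict u (Dl m l - D')) \<in> measurable (PiM (set vs) SU) (PiM (Dl m l - D') SU)"
        by (rule measurable_restrict_subset, rule sub)+
      have [measurable]: "(\<lambda>y. y l) \<in> measurable (YM m kY) (vecM (kY l))" unfolding YM_def using l by simp
      show ?thesis unfolding measurable_cong_sets[OF sRM refl] B_def SB_def by measurable
    qed
    have VS: "snd (Z \<omega>) S = U S \<omega>" for \<omega> using Sv by (simp add: Z_def V_def)
    have BZ: "B (Z \<omega>) = bdec l D' S \<omega>" for \<omega>
      using sub by (auto simp: B_def Z_def V_def bdec_def restrict_def fun_eq_iff)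
    \<comment> \<open>The mutual information of a decoder is not known to be finite; absolute
      continuity is inherited from the density of the whole joint law.\<close>
    have "absolutely_continuous (distr M (SU S) (\<lambda>\<omega>. snd (Z \<omega>) S) \<Otimes>\<^sub>M distr M (SB l D' S) (\<lambda>\<omega>. B (Z \<omega>)))
     (distr M (SU S \<Otimes>\<^sub>M SB l D' S) (\<lambda>\<omega>. (snd (Z \<omega>) S, B (Z \<omega>))))"
    proof (rule absolutely_continuous_coordinate[OF P q, where I="set vs" and S=S])
      show "B \<in> measurable (P \<Otimes>\<^sub>M PiM (set vs) q) (SB l D' S)" using Bm by (simp add: RM_def)
      show "B (a, u(S := v)) = B (a, u)" for a u v
        using bef_irr[OF Sv] S by (auto simp: B_def restrict_def fun_eq_iff)
      show "Z \<in> measurable M (P \<Otimes>\<^sub>M PiM (set vs) q)" using Zm by (simp add: RM_def)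
      have "absolutely_continuous RM (density RM (\<lambda>z. w' (fst (fst z), snd z)))"
      proof (rule absolutely_continuousI_density)
        have "(\<lambda>z. (fst (fst z), snd z)) \<in> measurable RM (vecM k \<Otimes>\<^sub>M PiM (set vs) SU)"
          unfolding measurable_cong_sets[OF sRM refl] by measurable
        from measurable_compose[OF this w'm] show "(\<lambda>z. w' (fst (fst z), snd z)) \<in> borel_measurable RM" .
      qed
      then show "absolutely_continuous (P \<Otimes>\<^sub>M PiM (set vs) q) (distr M (P \<Otimes>\<^sub>M PiM (set vs) q) Z)"
        unfolding ZRM[symmetric] by (simp add: RM_def)
    qed (use Sv sq[OF Sv] M in auto)
    then have ac: "absolutely_continuous (distr M (SU S) (U S) \<Otimes>\<^sub>M distr M (SB l D' S) (bdec l D' S))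
       (distr M (SU S \<Otimes>\<^sub>M SB l D' S) (\<lambda>\<omega>. (U S \<omega>, bdec l D' S \<omega>)))"
      unfolding VS BZ .
    from mutual_info_density[OF M Um[OF Sv] bdecm[OF l D' S] ac]
    show "\<exists>h. case p of (l, D', S) \<Rightarrow> h \<in> borel_measurable (SU S \<Otimes>\<^sub>M SB l D' S) \<and> (\<forall>z. h z \<ge> (0::real)) \<and>
      (\<forall>b\<in>space (SB l D' S). (\<integral>\<^sup>+v. ennreal (h (v, b)) \<partial>q S) \<le> 1) \<and>
      (AE \<omega> in M. h (U S \<omega>, bdec l D' S \<omega>) > 0) \<and>
      (\<forall>c. ereal c < mi l D' S \<longrightarrow> (\<exists>L. integrable M (\<lambda>\<omega>. min (ln (h (U S \<omega>, bdec l D' S \<omega>))) L) \<and>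
         c \<le> (\<integral>\<omega>. min (ln (h (U S \<omega>, bdec l D' S \<omega>))) L \<partial>M)))"
      unfolding p prod.case mi_def qS[OF Sv] by blast
  qed
  from bchoice[OF this] obtain h0 where h0: "\<forall>p\<in>QQ. case p of (l, D', S) \<Rightarrow> h0 p \<in> borel_measurable (SU S \<Otimes>\<^sub>M SB l D' S) \<and> (\<forall>z. h0 p z \<ge> (0::real)) \<and>
      (\<forall>b\<in>space (SB l D' S). (\<integral>\<^sup>+v. ennreal (h0 p (v, b)) \<partial>q S) \<le> 1) \<and>
      (AE \<omega> in M. h0 p (U S \<omega>, bdec l D' S \<omega>) > 0) \<and>
      (\<forall>c. ereal c < mi l D' S \<longrightarrow> (\<exists>L. integrable M (\<lambda>\<omega>. min (ln (h0 p (U S \<omega>, bdec l D' S \<omega>))) L) \<and>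
         c \<le> (\<integral>\<omega>. min (ln (h0 p (U S \<omega>, bdec l D' S \<omega>))) L \<partial>M)))" ..
  define h where "h l D' S z = (if (l, D', S) \<in> QQ then h0 (l, D', S) z else 0)" for l D' S z
  have hm: "h l D' S \<in> borel_measurable (SU S \<Otimes>\<^sub>M SB l D' S)"
    and hint: "\<And>b. b \<in> space (SB l D' S) \<Longrightarrow> (\<integral>\<^sup>+v. ennreal (h l D' S (v, b)) \<partial>q S) \<le> 1"
    and hpos: "AE \<omega> in M. h l D' S (U S \<omega>, bdec l D' S \<omega>) > 0"
    and hmi: "\<And>c. ereal c < mi l D' S \<Longrightarrow> \<exists>L. integrable M (\<lambda>\<omega>. min (ln (h l D' S (U S \<omega>, bdec l D' S \<omega>))) L) \<and>
         c \<le> (\<integral>\<omega>. min (ln (h l D' S (U S \<omega>, bdec l D' S \<omega>))) L \<partial>M)"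
    if "l < m" "D' \<subseteq> Dl m l" "S \<in> D'" for l D' S
  proof -
    have mem: "(l, D', S) \<in> QQ" using that by (simp add: QQ_def)
    then have eq: "h l D' S = h0 (l, D', S)" by (simp add: h_def fun_eq_iff)
    note * = bspec[OF h0 mem, unfolded prod.case]
    show "h l D' S \<in> borel_measurable (SU S \<Otimes>\<^sub>M SB l D' S)"
      "\<And>b. b \<in> space (SB l D' S) \<Longrightarrow> (\<integral>\<^sup>+v. ennreal (h l D' S (v, b)) \<partial>q S) \<le> 1"
      "AE \<omega> in M. h l D' S (U S \<omega>, bdec l D' S \<omega>) > 0"
      "\<And>c. ereal c < mi l D' S \<Longrightarrow> \<exists>L. integrable M (\<lambda>\<omega>. min (ln (h l D' S (U S \<omega>, bdec l D' S \<omega>))) L) \<and>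
         c \<le> (\<integral>\<omega>. min (ln (h l D' S (U S \<omega>, bdec l D' S \<omega>))) L \<partial>M)"
      unfolding eq using * by blast+
  qed
  have hnn: "h l D' S z \<ge> 0" for l D' S z
  proof (cases "(l, D', S) \<in> QQ")
    case True
    have "\<forall>z. h0 (l, D', S) z \<ge> 0" using bspec[OF h0 True, unfolded prod.case] by blast
    then show ?thesis using True by (simp only: h_def if_True)
  qed (simp add: h_def)

  define g where "g l D' S y u = h l D' S (u S, restrict u (bef S \<inter> D'), restrict u (Dl m l - D'), y)" for l D' S y u
  have gm: "(\<lambda>z. g l D' S (fst z) (snd z)) \<in> borel_measurable (vecM (kY l) \<Otimes>\<^sub>M PiM (Dl m l) q)"
    if l: "l < m" and D': "D' \<subseteq> Dl m l" and S: "S \<in> D'" for l D' S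
  proof -
    have sub: "bef S \<inter> D' \<subseteq> Dl m l" "Dl m l - D' \<subseteq> Dl m l" using D' by auto
    have [measurable]: "(\<lambda>u. restrict u (bef S \<inter> D')) \<in> measurable (PiM (Dl m l) SU) (PiM (bef S \<inter> D') SU)"
      "(\<lambda>u. restrict u (Dl m l - D')) \<in> measurable (PiM (Dl m l) SU) (PiM (Dl m l - D') SU)"
      by (rule measurable_restrict_subset, rule sub)+
    have [measurable]: "(\<lambda>u. u S) \<in> measurable (PiM (Dl m l) SU) (SU S)" using S D' by (intro measurable_component_singleton) auto
    have "(\<lambda>z. (snd z S, restrict (snd z) (bef S \<inter> D'), restrict (snd z) (Dl m l - D'), fst z))
       \<in> measurable (vecM (kY l) \<Otimes>\<^sub>M PiM (Dl m l) SU) (SU S \<Otimes>\<^sub>M SB l D' S)" unfolding SB_def by measurable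
    from measurable_compose[OF this hm[OF l D' S]]
    have "(\<lambda>z. g l D' S (fst z) (snd z)) \<in> borel_measurable (vecM (kY l) \<Otimes>\<^sub>M PiM (Dl m l) SU)" by (simp add: g_def)
    then show ?thesis
      by (subst measurable_cong_sets[OF sets_pair_measure_cong[OF refl sPq[OF Dl_sub]] refl])
  qed
  interpret mc: multi_codebook P "vecM k" fst q vs \<rho> m "Dl m" "\<lambda>l. vecM (kY l)" "\<lambda>l z. snd z l" g R R'
  proof (rule multi_codebook.intro)
    show "\<rho> S x u \<ge> 0" for S x u unfolding \<rho>_def by (rule fnn)
    show "g l D' S y u \<ge> 0" for l D' S y u unfolding g_def by (rule hnn)
    show "fst \<in> measurable P (vecM k)" unfolding measurable_cong_sets[OF sP refl] XYM_def by simp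
    show "(\<lambda>z. snd z l) \<in> measurable P (vecM (kY l))" if "l < m" for l
      unfolding measurable_cong_sets[OF sP refl] XYM_def YM_def
      by (rule measurable_compose[OF measurable_snd measurable_component_singleton]) (use that in simp)
    show "(\<lambda>z. \<rho> S (fst z) (snd z)) \<in> borel_measurable (vecM k \<Otimes>\<^sub>M PiM (set vs) q)" if "S \<in> set vs" for S
      using rhom[OF that] by (subst measurable_cong_sets[OF sets_pair_measure_cong[OF refl sPq[OF subset_refl]] refl])
    show "sorted_wrt (\<lambda>S S'. \<forall>x u v. \<rho> S x (u(S' := v)) = \<rho> S x u) vs"
    proof (rule sorted_wrt_mono_rel[OF _ sorted_wrt_before[OF d]], intro allI)
      fix S S' x and u :: "nat set \<Rightarrow> (nat \<Rightarrow> real) \<times> nat" and v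
      assume "S' \<notin> before vs S \<and> S' \<noteq> S"
      then have "restrict (u(S' := v)) (bef S) = restrict u (bef S)" "(u(S' := v)) S = u S"
        by (auto simp: bef_def restrict_def fun_eq_iff)
      then show "\<rho> S x (u(S' := v)) = \<rho> S x u" unfolding \<rho>_def by (simp only:)
    qed
    show "(\<integral>\<^sup>+v. ennreal (\<rho> S x (u(S := v))) \<partial>q S) \<le> 1"
      if S: "S \<in> set vs" and x: "x \<in> space (vecM k)" and u: "u \<in> space (PiM (set vs) q)" for S x u
    proof -
      have "restrict (u(S := v)) (bef S) = restrict u (bef S)" for v
        using bef_irr[OF S] by (auto simp: restrict_def fun_eq_iff)
      then have "\<rho> S x (u(S := v)) = f S ((x, restrict u (bef S)), v)" for v by (simp add: \<rho>_def del: restrict_apply)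
      moreover have "(x, restrict u (bef S)) \<in> space (SA S)"
      proof -
        have "u \<in> space (PiM (set vs) SU)" using u sets_eq_imp_space_eq[OF sPq[OF subset_refl]] by simp
        then have "restrict u (bef S) \<in> space (PiM (bef S) SU)"
          by (rule measurable_space[OF measurable_restrict_subset[OF bef_sub[OF S]]])
        then show ?thesis using x by (simp add: SA_def space_pair_measure)
      qed
      ultimately show ?thesis using fint[OF S] by simp
    qed
    show "(\<lambda>z. g l D' S (fst z) (snd z)) \<in> borel_measurable (vecM (kY l) \<Otimes>\<^sub>M PiM (Dl m l) q)"
      if "l < m" "D' \<subseteq> Dl m l" "S \<in> D'" for l D' S by (rule gm[OF that])
    show "sorted_wrt (\<lambda>S S'. \<forall>y u v. g l D' S y (u(S' := v)) = g l D' S y u) (filter (\<lambda>S. S \<in> D') vs)"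
      if "l < m" "D' \<subseteq> Dl m l" for l D'
    proof (rule sorted_wrt_mono_rel[OF _ sorted_wrt_filter[OF sorted_wrt_before[OF d]]], intro allI)
      fix S S' y and u :: "nat set \<Rightarrow> (nat \<Rightarrow> real) \<times> nat" and v
      assume "S' \<in> set (filter (\<lambda>S. S \<in> D') vs)" "S' \<notin> before vs S \<and> S' \<noteq> S"
      then have "restrict (u(S' := v)) (bef S \<inter> D') = restrict u (bef S \<inter> D')" "(u(S' := v)) S = u S"
        "restrict (u(S' := v)) (Dl m l - D') = restrict u (Dl m l - D')"
        by (auto simp: bef_def restrict_def fun_eq_iff)
      then show "g l D' S y (u(S' := v)) = g l D' S y u" unfolding g_def by (simp only:)
    qed
    show "(\<integral>\<^sup>+v. ennreal (g l D' S y (u(S := v))) \<partial>q S) \<le> 1"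
      if l: "l < m" and D': "D' \<subseteq> Dl m l" and S: "S \<in> D'" and y: "y \<in> space (vecM (kY l))" and u: "u \<in> space (PiM (Dl m l) q)" for l D' S y u
    proof -
      have Sv: "S \<in> set vs" using S D' Dl_sub[of l] by auto
      have "restrict (u(S := v)) (bef S \<inter> D') = restrict u (bef S \<inter> D')"
        "restrict (u(S := v)) (Dl m l - D') = restrict u (Dl m l - D')" for v
        using bef_irr[OF Sv] S by (auto simp: restrict_def fun_eq_iff)
      then have "g l D' S y (u(S := v)) = h l D' S (v, restrict u (bef S \<inter> D'), restrict u (Dl m l - D'), y)" for v
        by (simp add: g_def del: restrict_apply)
      moreover have "(restrict u (bef S \<inter> D'), restrict u (Dl m l - D'), y) \<in> space (SB l D' S)"
      proof -
        have u': "u \<in> space (PiM (Dl m l) SU)" using u sets_eq_imp_space_eq[OF sPq[OF Dl_sub]] by simp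
        have "bef S \<inter> D' \<subseteq> Dl m l" "Dl m l - D' \<subseteq> Dl m l" using D' by auto
        from measurable_space[OF measurable_restrict_subset[OF this(1)] u'] measurable_space[OF measurable_restrict_subset[OF this(2)] u']
        show ?thesis using y by (simp add: SB_def space_pair_measure)
      qed
      ultimately show ?thesis using hint[OF l D' S] by simp
    qed
  qed (rule P q d Dl_sub)+

  have mcRM: "mc.RM = RM" by (simp add: mc.RM_def RM_def)
  have JM: "mc.JM = distr M RM Z"
  proof -
    have "ennreal (mc.w z) = w' (fst (fst z), snd z)" for z
      unfolding mc.w_def w'_def by (simp add: prod_ennreal fnn \<rho>_def)
    then show ?thesis unfolding ZRM mc.JM_def mcRM by simp
  qed
  have pJM: "prob_space mc.JM" unfolding JM by (rule M.prob_space_distr[OF Zm])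
  have tr1: "integrable mc.JM F \<longleftrightarrow> integrable M (\<lambda>\<omega>. F (Z \<omega>))" and tr2: "(\<integral>z. F z \<partial>mc.JM) = (\<integral>\<omega>. F (Z \<omega>) \<partial>M)"
    if "F \<in> borel_measurable RM" for F :: "_ \<Rightarrow> real"
    unfolding JM using that by (auto intro!: integrable_distr_eq[OF Zm] integral_distr[OF Zm])
  have Zrho: "\<rho> S (fst (fst (Z \<omega>))) (snd (Z \<omega>)) = f S (aenc S \<omega>, U S \<omega>)" if S: "S \<in> set vs" for S \<omega>
  proof -
    have "restrict (V \<omega>) (bef S) = (\<lambda>S'\<in>bef S. U S' \<omega>)" using bef_sub[OF S] by (auto simp: V_def restrict_def fun_eq_iff)
    then show ?thesis using S by (simp add: \<rho>_def Z_def aenc_def V_def del: restrict_apply) (simp add: V_def)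
  qed
  have Zg: "g l D' S (snd (fst (Z \<omega>)) l) (restrict (snd (Z \<omega>)) (Dl m l)) = h l D' S (U S \<omega>, bdec l D' S \<omega>)"
    if "D' \<subseteq> Dl m l" "S \<in> D'" for l D' S \<omega>
  proof -
    have "restrict (restrict (V \<omega>) (Dl m l)) (bef S \<inter> D') = (\<lambda>S'\<in>bef S \<inter> D'. U S' \<omega>)"
      "restrict (restrict (V \<omega>) (Dl m l)) (Dl m l - D') = (\<lambda>S'\<in>Dl m l - D'. U S' \<omega>)"
      "restrict (V \<omega>) (Dl m l) S = U S \<omega>"
      using that Dl_sub[of l] by (auto simp: V_def restrict_def fun_eq_iff)
    then show ?thesis unfolding g_def Z_def bdec_def fst_conv snd_conv by (simp only:)
  qed
  have rhoRM: "(\<lambda>z. \<rho> S (fst (fst z)) (snd z)) \<in> borel_measurable RM" if "S \<in> set vs" for S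
    using mc.rho_meas_RM[OF that] by (simp add: mcRM)
  have gRM: "(\<lambda>z. g l D' S (snd (fst z) l) (restrict (snd z) (Dl m l))) \<in> borel_measurable RM"
    if l: "l < m" and D': "D' \<subseteq> Dl m l" and S: "S \<in> D'" for l D' S
  proof -
    have "(\<lambda>z. (snd (fst z) l, restrict (snd z) (Dl m l))) \<in> measurable RM (vecM (kY l) \<Otimes>\<^sub>M PiM (Dl m l) q)"
      unfolding RM_def
      by (intro measurable_Pair measurable_compose[OF measurable_fst mc.py[OF l]]
          measurable_compose[OF measurable_snd measurable_restrict_subset[OF Dl_sub]])
    from measurable_compose[OF this gm[OF l D' S]] show ?thesis by simp
  qed
  have g_ln: "\<exists>hh. integrable mc.JM hh \<and>
      (AE z in mc.JM. (\<forall>S\<in>D'. g l D' S (snd (fst z) l) (restrict (snd z) (Dl m l)) > 0) \<and>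
         hh z \<le> (\<Sum>S\<in>D'. ln (g l D' S (snd (fst z) l) (restrict (snd z) (Dl m l))))) \<and>
      (\<Sum>S\<in>D'. R' S) - e \<le> integral\<^sup>L mc.JM hh"
    if l: "l < m" and D': "D' \<subseteq> Dl m l" and ne: "D' \<noteq> {}" and e: "e > 0" for l D' e
  proof -
    have fin: "finite D'" using D' Dl_sub[of l] by (meson List.finite_set finite_subset)
    have "ereal (\<Sum>S\<in>D'. R' S) \<le> (\<Sum>S\<in>D'. mutual_info M (UM (dU S))
            (UcollM dU (before vs S \<inter> D') \<Otimes>\<^sub>M UcollM dU (Dl m l - D') \<Otimes>\<^sub>M vecM (kY l)) (Uval Uf T S)
            (\<lambda>\<omega>. (Ucoll Uf T (before vs S \<inter> D') \<omega>, Ucoll Uf T (Dl m l - D') \<omega>, Y \<omega> l)))"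
      using lp l D' ne unfolding LP_def by blast
    then have "ereal (\<Sum>S\<in>D'. R' S) \<le> (\<Sum>S\<in>D'. mi l D' S)"
      unfolding Ucoll UcollM U_def[symmetric] SU_def[symmetric] mi_def SB_def bdec_def[abs_def] bef_def .
    from ereal_sum_lower_approx[OF fin ne _ this e] obtain c where
      c: "\<forall>S\<in>D'. ereal (c S) < mi l D' S" and csum: "(\<Sum>S\<in>D'. R' S) - e \<le> (\<Sum>S\<in>D'. c S)"
      unfolding mi_def using mutual_info_nonneg by blast
    have "\<forall>S\<in>D'. \<exists>L. integrable M (\<lambda>\<omega>. min (ln (h l D' S (U S \<omega>, bdec l D' S \<omega>))) L) \<and>
         c S \<le> (\<integral>\<omega>. min (ln (h l D' S (U S \<omega>, bdec l D' S \<omega>))) L \<partial>M)"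
      using hmi[OF l D'] c by blast
    from bchoice[OF this] obtain L where L: "\<forall>S\<in>D'. integrable M (\<lambda>\<omega>. min (ln (h l D' S (U S \<omega>, bdec l D' S \<omega>))) (L S)) \<and>
         c S \<le> (\<integral>\<omega>. min (ln (h l D' S (U S \<omega>, bdec l D' S \<omega>))) (L S) \<partial>M)" ..
    define G where "G S z = g l D' S (snd (fst z) l) (restrict (snd z) (Dl m l))"
      for S and z :: "((nat \<Rightarrow> real) \<times> (nat \<Rightarrow> nat \<Rightarrow> real)) \<times> (nat set \<Rightarrow> (nat \<Rightarrow> real) \<times> nat)"
    have Gm: "G S \<in> borel_measurable RM" if "S \<in> D'" for S unfolding G_def by (rule gRM[OF l D' that])
    have GZ: "G S (Z \<omega>) = h l D' S (U S \<omega>, bdec l D' S \<omega>)" if "S \<in> D'" for S \<omega> unfolding G_def by (rule Zg[OF D' that])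
    \<comment> \<open>The minorant required by \<open>typ_fail_tendsto_0\<close>: the truncated
      logarithms are integrable even when a mutual information is infinite, and their means add up
      to within \<open>e\<close> of the sum of the \<open>R' S\<close>.\<close>
    define hh where "hh z = (\<Sum>S\<in>D'. min (ln (G S z)) (L S))" for z
    have hhm: "hh \<in> borel_measurable RM" unfolding hh_def
      by (intro borel_measurable_sum borel_measurable_min borel_measurable_ln Gm) auto
    have hhZ: "hh (Z \<omega>) = (\<Sum>S\<in>D'. min (ln (h l D' S (U S \<omega>, bdec l D' S \<omega>))) (L S))" for \<omega>
      unfolding hh_def by (intro sum.cong refl) (simp add: GZ)
    have i: "integrable mc.JM hh"
      unfolding tr1[OF hhm] hhZ using L by (intro Bochner_Integration.integrable_sum) auto
    have "(\<Sum>S\<in>D'. c S) \<le> (\<Sum>S\<in>D'. \<integral>\<omega>. min (ln (h l D' S (U S \<omega>, bdec l D' S \<omega>))) (L S) \<partial>M)"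
      using L by (intro sum_mono) auto
    also have "\<dots> = integral\<^sup>L mc.JM hh"
      unfolding tr2[OF hhm] hhZ using L by (intro Bochner_Integration.integral_sum[symmetric]) auto
    finally have int: "(\<Sum>S\<in>D'. R' S) - e \<le> integral\<^sup>L mc.JM hh" using csum by simp
    have "AE \<omega> in M. G S (Z \<omega>) > 0" if "S \<in> D'" for S
      using hpos[OF l D' that] by (simp add: GZ[OF that])
    then have "AE z in mc.JM. G S z > 0" if "S \<in> D'" for S
    proof -
      have "{z\<in>space RM. G S z > 0} \<in> sets RM" using Gm[OF that] by measurable
      then show ?thesis unfolding JM using \<open>\<And>S. S \<in> D' \<Longrightarrow> AE \<omega> in M. G S (Z \<omega>) > 0\<close>[OF that]
        by (subst AE_distr_iff[OF Zm]) auto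
    qed
    then have "AE z in mc.JM. \<forall>S\<in>D'. G S z > 0" using fin by (simp add: AE_finite_all)
    then have "AE z in mc.JM. (\<forall>S\<in>D'. G S z > 0) \<and> hh z \<le> (\<Sum>S\<in>D'. ln (G S z))"
      by eventually_elim (auto simp: hh_def intro!: sum_mono)
    then show ?thesis using i int unfolding G_def by blast
  qed
  have X2: "integrable P (\<lambda>z. (fst z c)\<^sup>2)" if "c < k" for c by (rule gaussian_source_square_integrable[OF gs that])
  have Xcm: "(\<lambda>\<omega>. X \<omega> c) \<in> borel_measurable M" if "c < k" for c
    by (rule measurable_compose[OF X]) (use that in \<open>simp add: vecM_def\<close>)
  have X2M: "integrable M (\<lambda>\<omega>. (X \<omega> c)\<^sup>2)" if "c < k" for c
  proof -
    have pm: "(\<lambda>\<omega>. (X \<omega>, Y \<omega>)) \<in> measurable M (XYM m k kY)" unfolding XYM_def by measurable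
    have "(\<lambda>z. (fst z c)\<^sup>2) \<in> borel_measurable (XYM m k kY)"
      using X2[OF that] by (subst measurable_cong_sets[OF sP[symmetric] refl]) auto
    from integrable_distr_eq[OF pm this] show ?thesis using X2[OF that] unfolding PXY by simp
  qed
  have "\<exists>\<psi>. i < m \<and> c < k \<longrightarrow> \<psi> \<in> borel_measurable (PiM (Dl m i) SU \<Otimes>\<^sub>M vecM (kY i)) \<and>
      (\<integral>\<^sup>+\<omega>. ennreal ((X \<omega> c - \<psi> (\<lambda>S\<in>Dl m i. U S \<omega>, Y \<omega> i))\<^sup>2) \<partial>M) \<le> ennreal (D i c)" for i c
  proof (cases "i < m \<and> c < k")
    case True
    \<comment> \<open>The observation of decoder \<open>i\<close>. By \<open>doob_dynkin\<close> the
      conditional expectation of a source component is a function \<open>\<psi>\<close> of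
      it.\<close>
    let ?B = "\<lambda>\<omega>. (\<lambda>S\<in>Dl m i. U S \<omega>, Y \<omega> i)" and ?N = "PiM (Dl m i) SU \<Otimes>\<^sub>M vecM (kY i)"
    let ?F = "vimage_algebra (space M) ?B ?N"
    have Bm: "?B \<in> measurable M ?N" using Ucm[OF Dl_sub[of i]] Ym[of i] True by (intro measurable_Pair) auto
    have "real_cond_exp M ?F (\<lambda>\<omega>. X \<omega> c) \<in> borel_measurable ?F" by (rule borel_measurable_cond_exp)
    from doob_dynkin[OF this] measurable_space[OF Bm]
    obtain \<psi> where \<psi>: "\<psi> \<in> borel_measurable ?N" "\<And>\<omega>. \<omega> \<in> space M \<Longrightarrow> real_cond_exp M ?F (\<lambda>\<omega>. X \<omega> c) \<omega> = \<psi> (?B \<omega>)" by blast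
    have "(\<integral>\<^sup>+\<omega>. ennreal ((X \<omega> c - real_cond_exp M ?F (\<lambda>\<omega>. X \<omega> c) \<omega>)\<^sup>2) \<partial>M) \<le> ennreal (D i c)"
      using mmse[of i c] True unfolding Ucoll UcollM by blast
    also have "(\<integral>\<^sup>+\<omega>. ennreal ((X \<omega> c - real_cond_exp M ?F (\<lambda>\<omega>. X \<omega> c) \<omega>)\<^sup>2) \<partial>M) = (\<integral>\<^sup>+\<omega>. ennreal ((X \<omega> c - \<psi> (?B \<omega>))\<^sup>2) \<partial>M)"
      by (rule nn_integral_cong) (simp only: \<psi>(2))
    finally show ?thesis using \<psi>(1) by blast
  qed blast
  then have "\<forall>i. \<exists>\<psi>. \<forall>c. i < m \<and> c < k \<longrightarrow> \<psi> c \<in> borel_measurable (PiM (Dl m i) SU \<Otimes>\<^sub>M vecM (kY i)) \<and>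
      (\<integral>\<^sup>+\<omega>. ennreal ((X \<omega> c - \<psi> c (\<lambda>S\<in>Dl m i. U S \<omega>, Y \<omega> i))\<^sup>2) \<partial>M) \<le> ennreal (D i c)"
    by (intro allI choice)
  from choice[OF this] obtain \<psi> where \<psi>0: "\<forall>i c. i < m \<and> c < k \<longrightarrow> \<psi> i c \<in> borel_measurable (PiM (Dl m i) SU \<Otimes>\<^sub>M vecM (kY i)) \<and>
      (\<integral>\<^sup>+\<omega>. ennreal ((X \<omega> c - \<psi> i c (\<lambda>S\<in>Dl m i. U S \<omega>, Y \<omega> i))\<^sup>2) \<partial>M) \<le> ennreal (D i c)" ..
  have \<psi>m: "\<psi> i c \<in> borel_measurable (PiM (Dl m i) SU \<Otimes>\<^sub>M vecM (kY i))"
    and \<psi>D: "(\<integral>\<^sup>+\<omega>. ennreal ((X \<omega> c - \<psi> i c (\<lambda>S\<in>Dl m i. U S \<omega>, Y \<omega> i))\<^sup>2) \<partial>M) \<le> ennreal (D i c)"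
    if "i < m" "c < k" for i c using \<psi>0 that by blast+
  show ?thesis
    unfolding mse_achievable_def
  proof (intro allI impI)
    fix \<epsilon> :: real assume \<epsilon>: "\<epsilon> > 0"
    have \<psi>Z: "(\<lambda>\<omega>. \<psi> i c (\<lambda>S\<in>Dl m i. U S \<omega>, Y \<omega> i)) \<in> borel_measurable M" if "i < m" "c < k" for i c
      by (rule measurable_compose[OF measurable_Pair[OF Ucm[OF Dl_sub] Ym[OF that(1)]] \<psi>m[OF that]])
    have "\<forall>\<^sub>F B in sequentially. \<forall>i\<in>{..<m}. \<forall>c\<in>{..<k}.
        integrable M (\<lambda>\<omega>. (X \<omega> c - max (- real B) (min (real B) (\<psi> i c (\<lambda>S\<in>Dl m i. U S \<omega>, Y \<omega> i))))\<^sup>2) \<and>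
        (\<integral>\<omega>. (X \<omega> c - max (- real B) (min (real B) (\<psi> i c (\<lambda>S\<in>Dl m i. U S \<omega>, Y \<omega> i))))\<^sup>2 \<partial>M) \<le> D i c + \<epsilon>/2"
      using D0 \<epsilon> by (intro eventually_ball_finite ballI clipped_estimator \<psi>Z X2M Xcm \<psi>D) (auto intro: less_imp_le)
    \<comment> \<open>One clipping level for all finitely many pairs \<open>(i, c)\<close>.\<close>
    then obtain B :: nat where B: "\<And>i c. i < m \<Longrightarrow> c < k \<Longrightarrow>
        integrable M (\<lambda>\<omega>. (X \<omega> c - max (- real B) (min (real B) (\<psi> i c (\<lambda>S\<in>Dl m i. U S \<omega>, Y \<omega> i))))\<^sup>2) \<and>
        (\<integral>\<omega>. (X \<omega> c - max (- real B) (min (real B) (\<psi> i c (\<lambda>S\<in>Dl m i. U S \<omega>, Y \<omega> i))))\<^sup>2 \<partial>M) \<le> D i c + \<epsilon>/2"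
      unfolding eventually_sequentially by auto
    define \<phi> where "\<phi> i c z = max (- real B) (min (real B) (\<psi> i c z))" for i c z
    have \<phi>m: "\<phi> i c \<in> borel_measurable (PiM (Dl m i) q \<Otimes>\<^sub>M vecM (kY i))" if "i < m" "c < k" for i c
    proof -
      note [measurable] = \<psi>m[OF that]
      have "\<phi> i c \<in> borel_measurable (PiM (Dl m i) SU \<Otimes>\<^sub>M vecM (kY i))" unfolding \<phi>_def by measurable
      then show ?thesis
        by (subst measurable_cong_sets[OF sets_pair_measure_cong[OF sPq[OF Dl_sub] refl] refl])
    qed
    define H where "H i c z = (fst (fst z) c - \<phi> i c (restrict (snd z) (Dl m i), snd (fst z) i))\<^sup>2"
      for i c and z :: "((nat \<Rightarrow> real) \<times> (nat \<Rightarrow> nat \<Rightarrow> real)) \<times> (nat set \<Rightarrow> (nat \<Rightarrow> real) \<times> nat)"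
    have Hm: "H i c \<in> borel_measurable RM" if i: "i < m" and c: "c < k" for i c
    proof -
      have "(\<lambda>z. (restrict (snd z) (Dl m i), snd (fst z) i)) \<in> measurable RM (PiM (Dl m i) q \<Otimes>\<^sub>M vecM (kY i))"
        unfolding RM_def
        by (intro measurable_Pair measurable_compose[OF measurable_fst mc.py[OF i]]
            measurable_compose[OF measurable_snd measurable_restrict_subset[OF Dl_sub]])
      note 1 = measurable_compose[OF this \<phi>m[OF i c]]
      have 2: "(\<lambda>z. fst (fst z) c) \<in> borel_measurable RM"
        unfolding RM_def
        by (rule measurable_compose[OF measurable_fst measurable_compose[OF mc.px]]) (use c in \<open>simp add: vecM_def\<close>)
      show ?thesis unfolding H_def by (intro borel_measurable_power borel_measurable_diff 1 2)
    qed
    have HZ: "H i c (Z \<omega>) = (X \<omega> c - max (- real B) (min (real B) (\<psi> i c (\<lambda>S\<in>Dl m i. U S \<omega>, Y \<omega> i))))\<^sup>2" for i c \<omega>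
    proof -
      have "restrict (V \<omega>) (Dl m i) = (\<lambda>S\<in>Dl m i. U S \<omega>)" using Dl_sub[of i] by (auto simp: V_def restrict_def fun_eq_iff)
      then show ?thesis unfolding H_def \<phi>_def Z_def fst_conv snd_conv by (simp only:)
    qed
    \<comment> \<open>Clipping has spent the first half of \<open>\<epsilon>\<close>; the block
      construction gets the second.\<close>
    interpret bs: block_source P k q vs \<rho> m "Dl m" kY g R R' \<phi> "real B" "\<lambda>i c. D i c + \<epsilon>/2"
    proof (intro block_source.intro block_source_axioms.intro mc.multi_codebook_axioms)
      show "integrable mc.JM (\<lambda>z. ln (\<rho> S (fst (fst z)) (snd z)))" if "S \<in> set vs" for S
        using fln(1)[OF that] rhoRM[OF that] by (subst tr1) (auto simp: Zrho[OF that])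
      show "(\<integral>z. ln (\<rho> S (fst (fst z)) (snd z)) \<partial>mc.JM) \<le> R S + R' S" if "S \<in> set vs" for S
        using fln(2)[OF that] rhoRM[OF that] by (subst tr2) (auto simp: Zrho[OF that])
      show "\<bar>\<phi> i c z\<bar> \<le> real B" for i c z by (auto simp: \<phi>_def)
      show "integrable mc.JM (\<lambda>z. (fst (fst z) c - \<phi> i c (restrict (snd z) (Dl m i), snd (fst z) i))\<^sup>2)" if "i < m" "c < k" for i c
      proof -
        have "integrable mc.JM (H i c)" unfolding tr1[OF Hm[OF that]] HZ using B[OF that] by blast
        then show ?thesis unfolding H_def[abs_def] .
      qed
      show "(\<integral>z. (fst (fst z) c - \<phi> i c (restrict (snd z) (Dl m i), snd (fst z) i))\<^sup>2 \<partial>mc.JM) \<le> D i c + \<epsilon>/2" if "i < m" "c < k" for i c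
      proof -
        have "(\<integral>z. H i c z \<partial>mc.JM) \<le> D i c + \<epsilon>/2" unfolding tr2[OF Hm[OF that]] HZ using B[OF that] by blast
        then show ?thesis unfolding H_def .
      qed
      show "0 \<le> D i c + \<epsilon>/2" if "i < m" "c < k" for i c using D0 \<epsilon> that by (simp add: less_imp_le)
    qed (fact sP pJM R0 g_ln \<phi>m X2)+
    have e2: "\<epsilon>/2 > 0" using \<epsilon> by simp
    obtain N where N: "\<forall>n\<ge>N. \<exists>M f h. n > 0 \<and> is_code m k kY P n M (\<lambda>i c. D i c + \<epsilon>/2 + \<epsilon>/2) f h \<and>
        ln (real M) / real n \<le> (\<Sum>S\<in>set vs. R S) + \<epsilon>/2"
      using bs.codes_eventually[OF e2] by blast
    show "\<exists>N. \<forall>n\<ge>N. \<exists>M f g. n > 0 \<and> is_code m k kY P n M (\<lambda>i c. D i c + \<epsilon>) f g \<and>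
        ln (real M) / real n \<le> (\<Sum>S\<in>subsets m. R S) + \<epsilon>"
    proof (rule exI[of _ N], intro allI impI)
      fix n assume "n \<ge> N"
      with N obtain K e h where n: "n > 0" and code: "is_code m k kY P n K (\<lambda>i c. D i c + \<epsilon>/2 + \<epsilon>/2) e h"
        and rate: "ln (real K) / real n \<le> (\<Sum>S\<in>set vs. R S) + \<epsilon>/2" by blast
      have "is_code m k kY P n K (\<lambda>i c. D i c + \<epsilon>) e h" by (rule is_code_mono[OF code]) simp
      moreover have "ln (real K) / real n \<le> (\<Sum>S\<in>subsets m. R S) + \<epsilon>" using rate \<epsilon> by (simp add: sv)
      ultimately show "\<exists>M f g. n > 0 \<and> is_code m k kY P n M (\<lambda>i c. D i c + \<epsilon>) f g \<and>
        ln (real M) / real n \<le> (\<Sum>S\<in>subsets m. R S) + \<epsilon>" using n by blast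
    qed
  qed
qed

theorem theorem2:
  fixes m k :: nat and kY :: "nat \<Rightarrow> nat"
    and P :: "((nat \<Rightarrow> real) \<times> (nat \<Rightarrow> nat \<Rightarrow> real)) measure"
    and D :: "nat \<Rightarrow> nat \<Rightarrow> real"
  assumes "m \<ge> 1" and "k \<ge> 1" and "\<forall>i<m. kY i \<ge> 1"
    and "gaussian_source m k kY P"
    and "\<forall>i<m. \<forall>c<k. D i c > 0"
  shows "R_MSE m k kY P D \<le> R_G_ach m k kY P D"
  unfolding R_G_ach_def
proof (intro INF_greatest Inf_greatest)
  fix vs a
  assume vs: "vs \<in> orderings m"
    and "a \<in> {\<Sqinter> {ereal (\<Sum>S\<in>subsets m. R S) | R R'. LP m k kY vs M X Y T dU Uf R R'}
           | M X Y T \<tau> dU Uf. CG m k kY P D M X Y T \<tau> dU Uf}"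
  then obtain M X Y T \<tau> dU Uf where cg: "CG m k kY P D M X Y T \<tau> dU Uf"
    and a: "a = \<Sqinter> {ereal (\<Sum>S\<in>subsets m. R S) | R R'. LP m k kY vs M X Y T dU Uf R R'}" by blast
  show "R_MSE m k kY P D \<le> a"
    unfolding a
  proof (rule Inf_greatest)
    fix b assume "b \<in> {ereal (\<Sum>S\<in>subsets m. R S) | R R'. LP m k kY vs M X Y T dU Uf R R'}"
    then obtain R R' where lp: "LP m k kY vs M X Y T dU Uf R R'" and b: "b = ereal (\<Sum>S\<in>subsets m. R S)" by blast
    have "mse_achievable m k kY P D (\<Sum>S\<in>subsets m. R S)"
      by (rule sum_rate_achievable[OF assms(4,5) vs cg lp])
    then show "R_MSE m k kY P D \<le> b" unfolding b R_MSE_def by (intro Inf_lower) blast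
  qed
qed

end
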